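(* Let $d,n\ge 1$. The limit Hilbert–Kunz multiplicity of the hypersurface $x_0^{n+1}+x_1^2+\dots+x_d^2$, i.e. of $R=\mathbb{C}[[x_0,\dots,x_d]]/(x_0^{n+1}+x_1^2+\dots+x_d^2)$, equals $$1+\frac{n+1}{2}\cdot\frac{N_d(2,n+1)}{(n+1)^d\,d!},$$ where $N_d(2,n+1)$ is the number of alternating augmented $(2,n+1)$-signed $d$-permutations.
   Context: For a local ring $(S,\mathfrak m)$ of characteristic $p>0$ and dimension $d$, $e_{\mathrm{HK}}(S)=\lim_{e\to\infty}p^{-ed}\ell(S/\mathfrak m^{[p^e]})$. For $f\in\mathbb{Z}[x_0,\dots,x_d]$, the limit Hilbert–Kunz multiplicity of $\mathbb{C}[[x_0,\dots,x_d]]/(f)$ is $\lim_{p\to\infty}e_{\mathrm{HK}}(\mathbb{F}_p[[x_0,\dots,x_d]]/(f))$, when the limit exists. Signed permutations. Let $1\le p\le r$ be integers (here $p$ is not a characteristic) and $\zeta=e^{2\pi i/r}$. Consider the set $S=\{0\}\cup\{a\zeta^k: a\ge1 \text{ an integer},\ 0\le k\le r-1\}$ with the linear order $\prec$ (denoted $\Lambda(p,r)$): $$\zeta^{r-1}\prec2\zeta^{r-1}\prec3\zeta^{r-1}\prec\cdots\prec\zeta^{r-2}\prec2\zeta^{r-2}\prec\cdots\prec\zeta^{p}\prec2\zeta^{p}\prec\cdots\prec0\prec\zeta^{p-1}\prec2\zeta^{p-1}\prec\cdots\prec1\prec2\prec3\prec\cdots,$$ that is: $a\zeta^k\prec b\zeta^l$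 if $k>l$, or $k=l$ and $a<b$; and $0$ lies above all $a\zeta^k$ with $k\ge p$ and below all $a\zeta^k$ with $k\le p-1$. An augmented $r$-signed $d$-permutation is a list $(a_1\zeta^{k_1},\dots,a_d\zeta^{k_d})$ with $0\le k_i\le r-1$ such that $(a_1,\dots,a_d)$ is a permutation of $\{1,\dots,d\}$. It is alternating (for $\Lambda(p,r)$) if, writing $x_i=a_i\zeta^{k_i}$, one has $0\prec x_1\succ x_2\prec x_3\succ\cdots x_d$. $N_d(p,r)$ denotes the number of alternating augmented $(p,r)$-signed $d$-permutations, i.e. of $\Lambda(p,r)$-alternating augmented $r$-signed $d$-permutations. *)

theory Defs
  imports
    "HOL-Analysis.Analysis"
    "HOL-Library.Poly_Mapping"
    "HOL-Number_Theory.Residues"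
    "HOL-Algebra.Module"
    "HOL-Algebra.QuotRing"
begin

section \<open>Lengths, dimension and Hilbert--Kunz multiplicity\<close>

definition module_length ::
    "('a, 'm) ring_scheme \<Rightarrow> ('a, 'b, 'k) module_scheme \<Rightarrow> enat" where
  "module_length R M = Sup {enat n | n. \<exists>N.
     (\<forall>i\<le>n. submodule (N i) R M) \<and> (\<forall>i<n. N i \<subset> N (Suc i))}"

text \<open>The quotient R/I as an R-module: \<open>r \<in> R\<close> acts as multiplication by its residue class.
  The fields \<open>mult\<close> and \<open>one\<close> are irrelevant for the module structure.\<close>
definition quotient_module ::
    "('a, 'm) ring_scheme \<Rightarrow> 'a set \<Rightarrow> ('a, 'a set) module" where
  "quotient_module R I =
     \<lparr>carrier = carrier (R Quot I),
      monoid.mult = monoid.mult (R Quot I),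
      one = one (R Quot I),
      zero = zero (R Quot I),
      add = add (R Quot I),
      smult = (\<lambda>r X. (I +>\<^bsub>R\<^esub> r) \<otimes>\<^bsub>R Quot I\<^esub> X)\<rparr>"

definition krull_dim :: "('a, 'm) ring_scheme \<Rightarrow> enat" where
  "krull_dim R = Sup {enat n | n. \<exists>P.
     (\<forall>i\<le>n. primeideal (P i) R) \<and> (\<forall>i<n. P i \<subset> P (Suc i))}"

definition local_ring :: "('a, 'm) ring_scheme \<Rightarrow> bool" where
  "local_ring R \<longleftrightarrow> cring R \<and> (\<exists>!M. maximalideal M R)"

definition max_ideal :: "('a, 'm) ring_scheme \<Rightarrow> 'a set" where
  "max_ideal R = (THE M. maximalideal M R)"

definition has_prime_char :: "('a, 'm) ring_scheme \<Rightarrow> nat \<Rightarrow> bool" where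
  "has_prime_char R p \<longleftrightarrow> Factorial_Ring.prime p \<and> \<one>\<^bsub>R\<^esub> \<noteq> \<zero>\<^bsub>R\<^esub> \<and> [p] \<cdot>\<^bsub>R\<^esub> \<one>\<^bsub>R\<^esub> = \<zero>\<^bsub>R\<^esub>"

text \<open>The ideal \<open>I\<^sup>[\<^sup>q\<^sup>]\<close> generated by the q-th powers of all elements of I.\<close>
definition bracket_power :: "('a, 'm) ring_scheme \<Rightarrow> 'a set \<Rightarrow> nat \<Rightarrow> 'a set" where
  "bracket_power R I q = Idl\<^bsub>R\<^esub> ((\<lambda>x. x [^]\<^bsub>R\<^esub> q) ` I)"

text \<open>Stated as a relation, so that the existence of the limit is part of the assertion.\<close>
definition has_hk_multiplicity :: "('a, 'm) ring_scheme \<Rightarrow> real \<Rightarrow> bool" where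
  "has_hk_multiplicity S h \<longleftrightarrow> local_ring S \<and>
     (\<exists>p d. has_prime_char S p \<and> krull_dim S = enat d \<and>
        (\<lambda>e. ereal_of_enat
                (module_length S (quotient_module S (bracket_power S (max_ideal S) (p ^ e))))
              / ereal (real p ^ (e * d))) \<longlonglongrightarrow> ereal h)"


section \<open>Power series rings in finitely many variables\<close>

text \<open>\<open>K[[x\<^sub>i : i \<in> V]]\<close>: a series is its coefficient function on exponents \<open>m\<close> (standing for the
  monomial with \<open>x\<^sub>i\<close> to the power \<open>lookup m i\<close>), zero on exponents involving indices outside \<open>V\<close>.\<close>
definition power_series_ring ::
    "('a, 'm) ring_scheme \<Rightarrow> nat set \<Rightarrow> ((nat \<Rightarrow>\<^sub>0 nat) \<Rightarrow> 'a) ring" where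
  "power_series_ring K V =
     \<lparr>carrier = {g. (\<forall>m. g m \<in> carrier K) \<and>
                     (\<forall>m. \<not> Poly_Mapping.keys m \<subseteq> V \<longrightarrow> g m = \<zero>\<^bsub>K\<^esub>)},
      monoid.mult = (\<lambda>g h m.
        finsum K (\<lambda>(a, b). g a \<otimes>\<^bsub>K\<^esub> h b) {(a, b). a + b = m}),
      one = (\<lambda>m. if m = 0 then \<one>\<^bsub>K\<^esub> else \<zero>\<^bsub>K\<^esub>),
      zero = (\<lambda>m. \<zero>\<^bsub>K\<^esub>),
      add = (\<lambda>g h m. g m \<oplus>\<^bsub>K\<^esub> h m)\<rparr>"

text \<open>Integer polynomials are finitely supported coefficient functions with the convolution product
  of \<open>Poly_Mapping\<close>.\<close>
type_synonym int_mpoly = "(nat \<Rightarrow>\<^sub>0 nat) \<Rightarrow>\<^sub>0 int"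

definition X :: "nat \<Rightarrow> int_mpoly" where
  "X i = Poly_Mapping.single (Poly_Mapping.single i 1) 1"

definition reduce_mod :: "nat \<Rightarrow> int_mpoly \<Rightarrow> (nat \<Rightarrow>\<^sub>0 nat) \<Rightarrow> int" where
  "reduce_mod p f = (\<lambda>m. Poly_Mapping.lookup f m mod int p)"

text \<open>\<open>F\<^sub>p[[x\<^sub>0, \<dots>, x\<^sub>d]]/(f)\<close>, for \<open>f\<close> involving only \<open>x\<^sub>0, \<dots>, x\<^sub>d\<close>.\<close>
definition hypersurface_mod ::
    "nat \<Rightarrow> nat \<Rightarrow> int_mpoly \<Rightarrow> ((nat \<Rightarrow>\<^sub>0 nat) \<Rightarrow> int) set ring" where
  "hypersurface_mod p d f =
     (let A = power_series_ring (residue_ring (int p)) {..d}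
      in A Quot (Idl\<^bsub>A\<^esub> {reduce_mod p f}))"

text \<open>The limit runs over primes only. For finitely many primes \<open>e\<^sub>H\<^sub>K\<close> may be undefined (for
  instance if \<open>f\<close> becomes a unit), which does not affect the limit.\<close>
definition has_limit_hk_multiplicity :: "nat \<Rightarrow> int_mpoly \<Rightarrow> real \<Rightarrow> bool" where
  "has_limit_hk_multiplicity d f L \<longleftrightarrow>
     (let F = inf at_top (principal {p::nat. Factorial_Ring.prime p})
      in \<exists>h. (\<forall>\<^sub>F p in F. has_hk_multiplicity (hypersurface_mod p d f) (h p)) \<and>
             (h \<longlongrightarrow> L) F)"


section \<open>Alternating augmented signed permutations\<close>

text \<open>\<open>Signed a k\<close> stands for \<open>a \<zeta>\<^sup>k\<close> with \<open>\<zeta> = exp (2 \<pi> \<i> / r)\<close>. Since \<open>a \<ge> 1\<close> and \<open>0 \<le> k < r\<close>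
  throughout, distinct pairs stand for distinct complex numbers.\<close>
datatype signed = Zero | Signed nat nat

text \<open>The order \<open>\<Lambda>(p,r)\<close>; the parameter \<open>r\<close> enters only through the bound \<open>k < r\<close> on the underlying
  set.\<close>
fun prec :: "nat \<Rightarrow> signed \<Rightarrow> signed \<Rightarrow> bool" where
  "prec p (Signed a k) (Signed b l) \<longleftrightarrow> k > l \<or> (k = l \<and> a < b)"
| "prec p (Signed a k) Zero \<longleftrightarrow> p \<le> k"
| "prec p Zero (Signed a k) \<longleftrightarrow> k < p"
| "prec p Zero Zero \<longleftrightarrow> False"

definition signed_permutations :: "nat \<Rightarrow> nat \<Rightarrow> signed list set" where
  "signed_permutations r d =
     {map2 Signed as ks | as ks. distinct as \<and> set as = {1..d} \<and>
        length ks = d \<and> (\<forall>k\<in>set ks. k < r)}"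

text \<open>\<open>0 \<prec> x\<^sub>1 \<succ> x\<^sub>2 \<prec> x\<^sub>3 \<succ> \<dots>\<close>\<close>
definition alternating :: "nat \<Rightarrow> signed list \<Rightarrow> bool" where
  "alternating p xs \<longleftrightarrow>
     (let ys = Zero # xs in \<forall>i<length xs.
        if even i then prec p (ys ! i) (ys ! Suc i) else prec p (ys ! Suc i) (ys ! i))"

definition N_alt :: "nat \<Rightarrow> nat \<Rightarrow> nat \<Rightarrow> nat" where
  "N_alt d p r = card {xs \<in> signed_permutations r d. alternating p xs}"

end

theory Submission
  imports Defs "HOL-Library.Function_Algebras"
begin

text \<open>Put \<open>r = n + 1\<close>, \<open>q = p\<^sup>e\<close> and \<open>B = F\<^sub>p[x\<^sub>0, \<dots>, x\<^sub>d]/(x\<^sub>i\<^sup>q)\<close>. The length of \<open>S/m\<^sup>[\<^sup>q\<^sup>]\<close> is the dimension of the kernel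
  of multiplication by \<open>f = x\<^sub>0\<^sup>r + g\<close> on \<open>B\<close>, where \<open>g = x\<^sub>1\<^sup>2 + \<dots> + x\<^sub>d\<^sup>2\<close>; splitting off \<open>x\<^sub>0\<close>, it is a
  sum of \<open>r\<close> values, at arguments within one of \<open>q/r\<close>, of \<open>C\<^sub>q(j) = dim ker g\<^sup>j\<close>. Frobenius gives
  \<open>C\<^sub>p\<^sub>q(pj) = p\<^sup>d C\<^sub>q(j)\<close>, whence the limit over \<open>e\<close> exists and differs by \<open>O(1/p)\<close> from
  \<open>r C\<^sub>p(p div r) / p\<^sup>d\<close>.

  For an operator \<open>T\<close> on a module \<open>M\<close> with \<open>T\<^sup>p = 0\<close>, the logarithmic kernel sizes \<open>G(j, a)\<close> of
  \<open>(T + x)\<^sup>j\<close> on \<open>M[x]/(x\<^sup>a)\<close> are symmetric and satisfy a discrete wave equation, so they are determined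
  by the boundary values \<open>G(1, a) = log |ker T\<^sup>a|\<close>. This turns the passage from \<open>d\<close> to \<open>d + 1\<close>
  variables into a recursion for \<open>C\<^sub>p\<close>, which is also the recursion that counts alternating words over
  an ordered alphabet by their first letter. Words of length \<open>d\<close> in the \<open>rm\<close> letters \<open>a \<zeta>\<^sup>k\<close> with
  \<open>1 \<le> a \<le> m\<close> have distinct \<open>a\<close>'s asymptotically always, and those alternate with frequency
  \<open>N\<^sub>d(2, r) / (r\<^sup>d d!)\<close>.

  That \<open>S\<close> has dimension \<open>d\<close> is proved directly: chains of primes in the power series ring are bounded by
  counting residues modulo powers of the maximal ideal with the Artin--Rees lemma, and a chain through
  \<open>(f)\<close> is found by Zorn's lemma, avoiding boundary monoids.\<close>

section \<open>Nilpotent operators on finite elementary groups\<close>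

text \<open>The wave equation comes from one extra variable \<open>z\<close> with
  \<open>z^2 = 0\<close>. If \<open>j\<close> is a unit modulo \<open>p\<close>, then
  \<open>ker (U + z)^j\<close> is as large as \<open>ker U^(j-1)\<close> times
  \<open>ker U^(j+1)\<close>. An exponent and a truncation order are interchangeable, so the kernel
  with both \<open>x\<close> and \<open>z\<close> adjoined can be evaluated in two ways.
  Divisibility of \<open>j\<close> by \<open>p\<close> is the obstacle: it confines the equation to
  indices below \<open>p\<close>, which is why exact values are available at \<open>q = p\<close>
  alone.

  The variables enter through squares, which yields sums over a window of exponents centred at
  \<open>p/2\<close>. Beyond the middle the values follow by reflection, because
  \<open>T^p = 0\<close> makes the top boundary linear. Folding the window leaves a constant per
  pair plus twice the values below the middle, listed downwards. The constants become the summand 1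
  of the limit; the downward listing reverses the alphabet at each new variable, which is
  alternation.

  Dimensions are recorded as base-\<open>p\<close> logarithms of cardinalities, so kernels, residues
  and lengths are all compared by counting.\<close>

definition pgroup :: "nat \<Rightarrow> 'g::comm_ring_1 set \<Rightarrow> bool" where
  "pgroup p M \<longleftrightarrow> finite M \<and> 0 \<in> M \<and> (\<forall>x\<in>M. \<forall>y\<in>M. x + y \<in> M) \<and> (\<forall>x\<in>M. - x \<in> M) \<and>
     (\<forall>x\<in>M. of_nat p * x = 0)"

text \<open>Additivity is required on the whole type, membership only on \<open>M\<close>. The
  ambient ring supplies the scalars \<open>of_nat n\<close>; functions into it form such a ring
  again, so \<open>xt\<close> and \<open>xop\<close> stay in the framework and can be
  iterated.\<close>

definition endo :: "'g::comm_ring_1 set \<Rightarrow> ('g \<Rightarrow> 'g) \<Rightarrow> bool" where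
  "endo M T \<longleftrightarrow> (\<forall>x y. T (x + y) = T x + T y) \<and> (\<forall>x\<in>M. T x \<in> M)"

definition ker_card :: "'g::zero set \<Rightarrow> ('g \<Rightarrow> 'g) \<Rightarrow> nat \<Rightarrow> nat" where
  "ker_card M T j = card {m \<in> M. (T ^^ j) m = 0}"

text \<open>The module \<open>M[x]/(x\<^sup>Q)\<close> with coefficients listed from the top degree, so that multiplication by
  \<open>x\<^sup>s\<close> is the shift \<open>v t \<mapsto> v (t + s)\<close> and \<open>xop T s\<close> is \<open>T + x\<^sup>s\<close>.\<close>
definition xt :: "nat \<Rightarrow> 'g::zero set \<Rightarrow> (nat \<Rightarrow> 'g) set" where
  "xt Q M = {v. (\<forall>t. v t \<in> M) \<and> (\<forall>t\<ge>Q. v t = 0)}"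

definition xop :: "('g \<Rightarrow> 'g) \<Rightarrow> nat \<Rightarrow> (nat \<Rightarrow> 'g::plus) \<Rightarrow> nat \<Rightarrow> 'g" where
  "xop T s v = (\<lambda>t. T (v t) + v (t + s))"

lemma pgroupD:
  assumes "pgroup p M"
  shows "finite M" "0 \<in> M" "x \<in> M \<Longrightarrow> y \<in> M \<Longrightarrow> x + y \<in> M" "x \<in> M \<Longrightarrow> - x \<in> M"
    "x \<in> M \<Longrightarrow> y \<in> M \<Longrightarrow> x - y \<in> M" "x \<in> M \<Longrightarrow> of_nat p * x = 0"
  using assms unfolding pgroup_def by (auto simp flip: add_uminus_conv_diff)

lemma pgroup_of_nat: "pgroup p M \<Longrightarrow> x \<in> M \<Longrightarrow> of_nat n * x \<in> M"
  by (induction n) (auto simp: pgroupD algebra_simps)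

lemma endoD:
  assumes "endo M T"
  shows "T (x + y) = T x + T y" "x \<in> M \<Longrightarrow> T x \<in> M"
  using assms by (auto simp: endo_def)

lemma endo_zero: "endo M T \<Longrightarrow> T 0 = 0"
  using endoD(1)[of M T 0 0] by simp

lemma endo_minus: "endo M T \<Longrightarrow> T (- x) = - T x"
  using endoD(1)[of M T x "- x"] endo_zero[of M T] by (simp add: eq_neg_iff_add_eq_0 add.commute)

lemma endo_diff: "endo M T \<Longrightarrow> T (x - y) = T x - T y"
  using endoD(1)[of M T x "- y"] by (simp add: endo_minus)

lemma endo_of_nat: "endo M T \<Longrightarrow> T (of_nat n * x) = of_nat n * T x"
  by (induction n) (auto simp: endoD endo_zero algebra_simps)

lemma endo_sign: "endo M T \<Longrightarrow> T ((-1) ^ k * x) = (-1) ^ k * T x"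
  by (cases "even k") (auto simp: endo_minus)

lemma endo_funpow: "endo M T \<Longrightarrow> endo M (T ^^ k)"
  by (induction k) (auto simp: endo_def)

lemma endo_add: "pgroup p M \<Longrightarrow> endo M T \<Longrightarrow> endo M U \<Longrightarrow> endo M (\<lambda>x. T x + U x)"
  by (auto simp: endo_def pgroupD algebra_simps)

lemma funpow_zero_mono:
  assumes "endo M T" "(T ^^ k) x = 0" "k \<le> l"
  shows "(T ^^ l) x = 0"
proof -
  have "(T ^^ l) x = (T ^^ (l - k)) ((T ^^ k) x)"
    using assms(3) by (metis comp_apply funpow_add le_add_diff_inverse2)
  then show ?thesis using endo_zero[OF endo_funpow[OF assms(1)]] assms(2) by simp
qed

lemma ker_card_0: "endo M T \<Longrightarrow> 0 \<in> M \<Longrightarrow> ker_card M T 0 = 1"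
proof -
  assume "0 \<in> M"
  then have "{m \<in> M. (T ^^ 0) m = 0} = {0}" by auto
  then show ?thesis unfolding ker_card_def by simp
qed

lemma ker_card_pos: "pgroup p M \<Longrightarrow> endo M T \<Longrightarrow> 0 < ker_card M T j"
  unfolding ker_card_def using endo_zero[OF endo_funpow, of M T j]
  by (auto simp: card_gt_0_iff pgroupD intro!: exI[of _ 0])

lemma ker_card_mono: "pgroup p M \<Longrightarrow> endo M T \<Longrightarrow> i \<le> j \<Longrightarrow> ker_card M T i \<le> ker_card M T j"
  unfolding ker_card_def by (rule card_mono) (auto simp: pgroupD dest: funpow_zero_mono)

lemma ker_card_funpow: "ker_card M (T ^^ k) j = ker_card M T (k * j)"
  by (simp add: ker_card_def funpow_mult)

lemma ker_card_nilpotent: "(\<And>m. m \<in> M \<Longrightarrow> (T ^^ j) m = 0) \<Longrightarrow> ker_card M T j = card M"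
  unfolding ker_card_def by (rule arg_cong[where f = card]) auto

lemma ker_card_cong_bij:
  assumes "bij_betw f M M'" "\<And>m. m \<in> M \<Longrightarrow> T m \<in> M" "\<And>m. m \<in> M \<Longrightarrow> f (T m) = T' (f m)"
    "\<And>m. m \<in> M \<Longrightarrow> f m = 0 \<longleftrightarrow> m = 0"
  shows "ker_card M T j = ker_card M' T' j"
proof -
  have *: "(T ^^ j) m \<in> M \<and> f ((T ^^ j) m) = (T' ^^ j) (f m)" if "m \<in> M" for m
    using that assms(2,3) by (induction j) auto
  have "bij_betw f {m \<in> M. (T ^^ j) m = 0} {m \<in> M'. (T' ^^ j) m = 0}"
    unfolding bij_betw_def
  proof
    show "inj_on f {m \<in> M. (T ^^ j) m = 0}"
      using assms(1) by (auto simp: bij_betw_def inj_on_def)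
    show "f ` {m \<in> M. (T ^^ j) m = 0} = {m \<in> M'. (T' ^^ j) m = 0}"
      using assms(1) * assms(4) by (auto simp: bij_betw_def image_iff) metis+
  qed
  then show ?thesis unfolding ker_card_def by (rule bij_betw_same_card)
qed

text \<open>Every fibre of \<open>h\<close> is a translate of \<open>K\<close>. Only the fibre
  condition is assumed, so \<open>h\<close> may be a truncated product, a single coefficient or an
  iterate of an operator.\<close>

lemma card_eq_card_image_mult_card_kernel:
  fixes V :: "'g::ab_group_add set"
  assumes "finite V" "K \<subseteq> V" "\<And>x y. x \<in> V \<Longrightarrow> y \<in> K \<Longrightarrow> x + y \<in> V"
    and "\<And>x y. x \<in> V \<Longrightarrow> y \<in> V \<Longrightarrow> h x = h y \<longleftrightarrow> y - x \<in> K"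
  shows "card V = card (h ` V) * card K"
proof -
  have "card V = (\<Sum>b\<in>h ` V. card {x \<in> V. h x = b})"
    using sum.image_gen[OF assms(1), of "\<lambda>_. 1::nat" h] by simp
  also have "\<dots> = (\<Sum>b\<in>h ` V. card K)"
  proof (rule sum.cong[OF refl])
    fix b assume "b \<in> h ` V"
    then obtain x where x: "x \<in> V" "b = h x" by auto
    have "{y \<in> V. h y = b} = (\<lambda>k. x + k) ` K"
    proof (intro equalityI subsetI)
      fix y assume "y \<in> {y \<in> V. h y = b}"
      then have "y - x \<in> K" using assms(4)[of x y] x by auto
      then show "y \<in> (\<lambda>k. x + k) ` K" by (intro image_eqI[of _ _ "y - x"]) auto
    next
      fix y assume "y \<in> (\<lambda>k. x + k) ` K"
      then obtain k where k: "k \<in> K" "y = x + k" by auto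
      then have "y \<in> V" using assms(3) x by auto
      moreover have "h x = h y" using assms(4)[of x y] x k \<open>y \<in> V\<close> by auto
      ultimately show "y \<in> {y \<in> V. h y = b}" using x by auto
    qed
    then show "card {y \<in> V. h y = b} = card K" by (simp add: card_image)
  qed
  finally show ?thesis by simp
qed

section \<open>Adjoining one truncated variable\<close>

lemma pgroup_xt:
  assumes "pgroup p M" shows "pgroup p (xt Q M)"
proof -
  have "finite (xt Q M)"
  proof (rule finite_subset)
    show "xt Q M \<subseteq> (\<lambda>f t. if t < Q then f t else 0) ` ({..<Q} \<rightarrow>\<^sub>E M)"
    proof
      fix v assume v: "v \<in> xt Q M"
      show "v \<in> (\<lambda>f t. if t < Q then f t else 0) ` ({..<Q} \<rightarrow>\<^sub>E M)"
        by (rule image_eqI[of _ _ "restrict v {..<Q}"]) (use v in \<open>auto simp: xt_def fun_eq_iff\<close>)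
    qed
  qed (use assms in \<open>auto intro!: finite_PiE simp: pgroupD\<close>)
  then show ?thesis
    using assms unfolding pgroup_def xt_def by (auto simp: fun_eq_iff)
qed

lemma card_xt:
  assumes "pgroup p M" shows "card (xt Q M) = card M ^ Q"
proof -
  have "bij_betw (\<lambda>v. restrict v {..<Q}) (xt Q M) ({..<Q} \<rightarrow>\<^sub>E M)"
    by (rule bij_betw_byWitness[where f' = "\<lambda>f t. if t < Q then f t else 0"])
       (use pgroupD(2)[OF assms] in \<open>auto simp: xt_def fun_eq_iff PiE_def Pi_def extensional_def\<close>)
  then show ?thesis by (auto dest!: bij_betw_same_card simp: card_PiE)
qed

lemma endo_xop:
  assumes "pgroup p M" "endo M T" shows "endo (xt Q M) (xop T s)"
  using assms unfolding endo_def xop_def xt_def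
  by (auto simp: fun_eq_iff algebra_simps pgroupD endo_zero[OF assms(2)])

text \<open>The quotient is the ceiling of \<open>(Q - u) / s\<close>, the number of exponents
  \<open>u, u + s, u + 2 s, ...\<close> below \<open>Q\<close>; truncated subtraction makes it 0
  once \<open>u\<close> reaches \<open>Q\<close>.\<close>

lemma ceil_div_le_iff:
  assumes "0 < (s::nat)" shows "(Q - u + s - 1) div s \<le> k \<longleftrightarrow> Q \<le> u + k * s"
proof -
  have "(Q - u + s - 1) div s \<le> k \<longleftrightarrow> Q - u + s - 1 < Suc k * s"
    using assms by (metis less_Suc_eq_le div_less_iff_less_mult)
  then show ?thesis using assms by auto
qed

text \<open>A kernel element satisfies \<open>v (t + s) = - T (v t)\<close>, so its first
  \<open>s\<close> entries determine it. Vanishing from index \<open>Q\<close> on is the remaining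
  constraint: entry \<open>u\<close> must be killed by \<open>T\<close> iterated as often as its
  string of exponents is long.\<close>

lemma card_ker_xop:
  assumes M: "pgroup p M" and T: "endo M T" and s: "s > 0"
  shows "card {v \<in> xt Q M. xop T s v = 0} = (\<Prod>u<s. ker_card M T ((Q - u + s - 1) div s))"
proof -
  define k where "k = (\<lambda>u. (Q - u + s - 1) div s)"
  define B where "B = (\<lambda>u. {m \<in> M. (T ^^ k u) m = 0})"
  define g where "g = (\<lambda>w t. (-1) ^ (t div s) * (T ^^ (t div s)) (w (t mod s :: nat) :: 'a))"
  have rec: "v t = (-1) ^ (t div s) * (T ^^ (t div s)) (v (t mod s))"
    if "xop T s v = 0" for v t
  proof (induction t rule: less_induct)
    case (less t)
    show ?case
    proof (cases "t < s")
      case False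
      then have t: "t - s < t" "(t - s) mod s = t mod s" "t div s = Suc ((t - s) div s)" "t - s + s = t"
        using s by (auto simp: le_mod_geq le_div_geq)
      have "T (v (t - s)) + v t = 0"
        using that t(4) by (auto simp: xop_def fun_eq_iff) metis
      then have "v t = - T (v (t - s))" by (simp add: eq_neg_iff_add_eq_0 add.commute)
      then show ?thesis using less[OF t(1)] t by (simp add: endo_sign[OF T])
    qed simp
  qed
  have "bij_betw (\<lambda>v. restrict v {..<s}) {v \<in> xt Q M. xop T s v = 0} (PiE {..<s} B)"
  proof (rule bij_betw_byWitness[where f' = g])
    show "\<forall>v\<in>{v \<in> xt Q M. xop T s v = 0}. g (restrict v {..<s}) = v"
      using rec s by (auto simp: g_def fun_eq_iff)
    show "\<forall>w\<in>PiE {..<s} B. restrict (g w) {..<s} = w"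
      by (auto simp: g_def fun_eq_iff PiE_def extensional_def)
    show "(\<lambda>v. restrict v {..<s}) ` {v \<in> xt Q M. xop T s v = 0} \<subseteq> PiE {..<s} B"
    proof (clarsimp simp: B_def)
      fix v u assume v: "v \<in> xt Q M" "xop T s v = 0" and u: "u < s"
      have "Q \<le> u + k u * s" using ceil_div_le_iff[OF s, of Q u "k u"] by (simp add: k_def)
      then have "v (u + k u * s) = 0" using v by (auto simp: xt_def)
      moreover have "(u + k u * s) div s = k u" "(u + k u * s) mod s = u" using u s by auto
      ultimately have "(-1) ^ k u * (T ^^ k u) (v u) = 0"
        using rec[OF v(2), of "u + k u * s"] by metis
      then have "(T ^^ k u) (v u) = 0"
        by (cases "even (k u)") auto
      then show "v u \<in> M \<and> (T ^^ k u) (v u) = 0" using v by (auto simp: xt_def)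
    qed
    show "g ` PiE {..<s} B \<subseteq> {v \<in> xt Q M. xop T s v = 0}"
    proof safe
      fix w assume w: "w \<in> PiE {..<s} B"
      have wB: "w (t mod s) \<in> M" "(T ^^ k (t mod s)) (w (t mod s)) = 0" for t
        using w s by (auto simp: B_def PiE_def Pi_def)
      have "(-1) ^ l * (x::'a) \<in> M" if "x \<in> M" for l x
        using that M by (cases "even l") (auto simp: pgroupD)
      then have "g w t \<in> M" for t
        unfolding g_def using endoD(2)[OF endo_funpow[OF T]] wB by blast
      moreover have "g w t = 0" if "t \<ge> Q" for t
      proof -
        have "k (t mod s) \<le> t div s"
          unfolding k_def ceil_div_le_iff[OF s] using that by (simp add: add.commute)
        then show ?thesis unfolding g_def
          using funpow_zero_mono[OF T wB(2)] by simp
      qed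
      ultimately show "g w \<in> xt Q M" by (auto simp: xt_def)
      show "xop T s (g w) = 0"
        using s by (auto simp: xop_def g_def fun_eq_iff endo_sign[OF T])
    qed
  qed
  then have "card {v \<in> xt Q M. xop T s v = 0} = card (PiE {..<s} B)" by (rule bij_betw_same_card)
  also have "\<dots> = (\<Prod>u<s. ker_card M T (k u))" by (simp add: card_PiE B_def ker_card_def)
  finally show ?thesis by (simp add: k_def)
qed

text \<open>Trades an exponent for a truncation order: \<open>T ^^ Q\<close> on \<open>M\<close>
  becomes \<open>T + x\<close> with \<open>x^Q = 0\<close>. This is the source of the symmetry
  between \<open>j\<close> and \<open>a\<close>.\<close>

lemma card_ker_xop1:
  assumes "pgroup p M" "endo M T"
  shows "card {v \<in> xt Q M. xop T 1 v = 0} = ker_card M T Q"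
  using card_ker_xop[OF assms, of 1 Q] by simp

lemma xop_apply: "xop T s v t = T (v t) + v (t + s)"
  by (simp add: xop_def)

lemma funpow_xop_Suc:
  "(xop T s ^^ Suc j) v t = T ((xop T s ^^ j) v t) + (xop T s ^^ j) v (t + s)"
  unfolding funpow.simps comp_apply by (rule xop_apply)

lemma ker_card_cong:
  assumes "\<And>m. m \<in> M \<Longrightarrow> T m \<in> M" "\<And>m. m \<in> M \<Longrightarrow> T m = T' m"
  shows "ker_card M T j = ker_card M T' j"
  by (rule ker_card_cong_bij[of id]) (use assms in auto)

lemma of_nat_mult_cong:
  assumes "pgroup p M" "x \<in> M" "[a = b] (mod p)"
  shows "of_nat a * x = of_nat b * x"
proof -
  have *: "of_nat c * x = of_nat (c mod p) * x" for c
  proof -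
    have "of_nat c * x = of_nat (p * (c div p) + c mod p) * x" by simp
    also have "\<dots> = of_nat (c div p) * (of_nat p * x) + of_nat (c mod p) * x"
      by (simp only: of_nat_add of_nat_mult algebra_simps)
    finally show ?thesis using pgroupD(6)[OF assms(1,2)] by simp
  qed
  show ?thesis using *[of a] *[of b] assms(3) by (simp add: cong_def)
qed

text \<open>Since \<open>x^2 = 0\<close>, \<open>(T + x)^j = T^j + j T^(j-1) x\<close>. The
  substitution \<open>a = j v 1 + T (v 0)\<close>, \<open>b = v 0\<close> decouples the two kernel
  equations into \<open>T^(j-1) a = 0\<close> and \<open>T^(j+1) b = 0\<close>; it is invertible
  because \<open>j\<close> is a unit modulo \<open>p\<close>.\<close>

lemma ker_card_xt2:
  assumes M: "pgroup p M" and T: "endo M T" and j: "j \<ge> 1" "coprime j p"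
  shows "ker_card (xt 2 M) (xop T 1) j = ker_card M T (j - 1) * ker_card M T (j + 1)"
proof -
  obtain j' where "[j * j' = Suc 0] (mod p)" using cong_solve_coprime_nat[OF j(2)] by blast
  then have inv: "of_nat j * (of_nat j' * x) = x" "of_nat j' * (of_nat j * x) = x" if "x \<in> M" for x
    using of_nat_mult_cong[OF M that, of "j * j'" 1] by (simp_all add: algebra_simps)
  have pow: "(xop T 1 ^^ k) v = (\<lambda>t. if t = 0 then (T ^^ k) (v 0) + of_nat k * (T ^^ (k - 1)) (v 1)
      else if t = 1 then (T ^^ k) (v 1) else 0)" if "v \<in> xt 2 M" for k v
  proof (induction k)
    case 0
    show ?case using that by (auto simp: xt_def fun_eq_iff)
  next
    case (Suc k)
    \<comment> \<open>For \<open>k = 0\<close> the truncated exponent \<open>k - 1\<close> does no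
      harm because the factor \<open>of_nat k\<close> vanishes.\<close>
    have "T (of_nat k * (T ^^ (k - 1)) (v 1)) = of_nat k * (T ^^ k) (v 1)"
      by (cases k) (auto simp: endo_of_nat[OF T] endo_zero[OF T] simp del: of_nat_Suc)
    then show ?case
      unfolding fun_eq_iff funpow_xop_Suc Suc.IH
      by (auto simp: endoD(1)[OF T] endo_zero[OF T] algebra_simps)
  qed
  have Tj: "(T ^^ j) x = (T ^^ (j - 1)) (T x)" "(T ^^ (j + 1)) x = (T ^^ j) (T x)" for x
    using j(1) by (cases j; simp add: funpow_swap1)+
  note e1 = endo_funpow[OF T, of "j - 1"] and e2 = endo_funpow[OF T, of j]
  define f where "f = (\<lambda>v::nat \<Rightarrow> 'a. (of_nat j * v 1 + T (v 0), v 0))"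
  define g where "g = (\<lambda>(a, b) t. if t = (0::nat) then b
      else if t = 1 then of_nat j' * (a - T b) else 0)"
  have "bij_betw f {v \<in> xt 2 M. (xop T 1 ^^ j) v = 0}
      ({m \<in> M. (T ^^ (j - 1)) m = 0} \<times> {m \<in> M. (T ^^ (j + 1)) m = 0})"
  proof (rule bij_betw_byWitness[where f' = g])
    show "\<forall>v\<in>{v \<in> xt 2 M. (xop T 1 ^^ j) v = 0}. g (f v) = v"
      by (auto simp: f_def g_def fun_eq_iff xt_def inv)
    show "\<forall>w\<in>{m \<in> M. (T ^^ (j - 1)) m = 0} \<times> {m \<in> M. (T ^^ (j + 1)) m = 0}. f (g w) = w"
      using inv endoD(2)[OF T] pgroupD(5)[OF M] by (auto simp: f_def g_def)
    show "f ` {v \<in> xt 2 M. (xop T 1 ^^ j) v = 0} \<subseteq>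
        {m \<in> M. (T ^^ (j - 1)) m = 0} \<times> {m \<in> M. (T ^^ (j + 1)) m = 0}"
    proof (rule image_subsetI)
      fix v assume "v \<in> {v \<in> xt 2 M. (xop T 1 ^^ j) v = 0}"
      then have v: "v \<in> xt 2 M" "(xop T 1 ^^ j) v = 0" by auto
      have vM: "v 0 \<in> M" "v 1 \<in> M" using v(1) by (auto simp: xt_def)
      have 0: "(T ^^ j) (v 0) + of_nat j * (T ^^ (j - 1)) (v 1) = 0" "(T ^^ j) (v 1) = 0"
        using fun_cong[OF v(2), of 0] fun_cong[OF v(2), of 1] by (auto simp: pow[OF v(1)] simp del: One_nat_def)
      have a: "(T ^^ (j - 1)) (of_nat j * v 1 + T (v 0)) = 0"
        using 0(1) by (simp only: endoD(1)[OF e1] endo_of_nat[OF e1] Tj(1) add.commute)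
      have "(T ^^ j) (of_nat j * v 1 + T (v 0)) = 0"
        using funpow_zero_mono[OF T a, of j] by simp
      then have "(T ^^ (j + 1)) (v 0) = 0"
        using 0(2) by (simp only: endoD(1)[OF e2] endo_of_nat[OF e2] Tj(2)) simp
      moreover have "of_nat j * v 1 + T (v 0) \<in> M"
        using pgroupD(3)[OF M pgroup_of_nat[OF M vM(2)] endoD(2)[OF T vM(1)]] .
      ultimately show "f v \<in> {m \<in> M. (T ^^ (j - 1)) m = 0} \<times> {m \<in> M. (T ^^ (j + 1)) m = 0}"
        using a vM by (simp add: f_def)
    qed
    show "g ` ({m \<in> M. (T ^^ (j - 1)) m = 0} \<times> {m \<in> M. (T ^^ (j + 1)) m = 0}) \<subseteq>
        {v \<in> xt 2 M. (xop T 1 ^^ j) v = 0}"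
    proof (rule image_subsetI)
      fix w assume "w \<in> {m \<in> M. (T ^^ (j - 1)) m = 0} \<times> {m \<in> M. (T ^^ (j + 1)) m = 0}"
      then obtain a b where w: "w = (a, b)" and a: "a \<in> M" "(T ^^ (j - 1)) a = 0"
        and b: "b \<in> M" "(T ^^ (j + 1)) b = 0" by blast
      let ?c = "of_nat j' * (a - T b)"
      have d: "a - T b \<in> M" using pgroupD(5)[OF M a(1) endoD(2)[OF T b(1)]] .
      have G: "g (a, b) \<in> xt 2 M"
        using b pgroup_of_nat[OF M d] pgroupD(2)[OF M] by (auto simp: g_def xt_def)
      have "(T ^^ j) (T b) = 0" using b(2) unfolding Tj(2) .
      then have "(T ^^ j) (a - T b) = 0"
        using funpow_zero_mono[OF T a(2), of j] by (simp add: endo_diff[OF e2])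
      then have 1: "(T ^^ j) ?c = 0" by (simp add: endo_of_nat[OF e2])
      have "of_nat j * (T ^^ (j - 1)) ?c = (T ^^ (j - 1)) (of_nat j * ?c)"
        by (simp only: endo_of_nat[OF e1])
      also have "\<dots> = (T ^^ (j - 1)) (a - T b)" using inv[OF d] by simp
      also have "\<dots> = - (T ^^ j) b" by (simp only: endo_diff[OF e1] Tj(1) a(2)) simp
      finally have 2: "(T ^^ j) b + of_nat j * (T ^^ (j - 1)) ?c = 0" by simp
      have "(xop T 1 ^^ j) (g (a, b)) = 0"
        unfolding pow[OF G] using 1 2 by (auto simp: g_def fun_eq_iff)
      with G show "g w \<in> {v \<in> xt 2 M. (xop T 1 ^^ j) v = 0}" unfolding w by blast
    qed
  qed
  then show ?thesis unfolding ker_card_def by (auto dest!: bij_betw_same_card simp: card_cartesian_product)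
qed

lemma ker_card_xt_swap:
  assumes "pgroup p M" "endo M T"
  shows "ker_card (xt b (xt a M)) (xop (xop T s) s') j = ker_card (xt a (xt b M)) (xop (xop T s') s) j"
proof (rule ker_card_cong_bij)
  show "bij_betw (\<lambda>w y z. w z y) (xt b (xt a M)) (xt a (xt b M))"
    by (rule bij_betw_byWitness[where f' = "\<lambda>w y z. w z y"])
       (use pgroupD(2)[OF assms(1)] in \<open>auto simp: xt_def fun_eq_iff\<close>)
  show "xop (xop T s) s' m \<in> xt b (xt a M)" if "m \<in> xt b (xt a M)" for m
    using endoD(2)[OF endo_xop[OF pgroup_xt[OF assms(1)] endo_xop[OF assms]] that] .
qed (auto simp: xop_def fun_eq_iff algebra_simps)

lemma ker_card_one: "ker_card M T (Suc 0) = card {m \<in> M. T m = 0}"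
  by (simp add: ker_card_def)

text \<open>Both sides count the kernel of \<open>T + x + y\<close> on
  \<open>M[x, y]/(x^a, y^j)\<close>.\<close>

lemma ker_card_xt1_sym:
  assumes "pgroup p M" "endo M T"
  shows "ker_card (xt a M) (xop T 1) j = ker_card (xt j M) (xop T 1) a"
  using card_ker_xop1[OF pgroup_xt[OF assms(1)] endo_xop[OF assms], of j a 1]
    card_ker_xop1[OF pgroup_xt[OF assms(1)] endo_xop[OF assms], of a j 1]
    ker_card_xt_swap[OF assms, of j a 1 1 1]
  by (simp add: ker_card_one)

text \<open>Exponents modulo \<open>s\<close> split the module into \<open>s\<close> strings, on
  each of which \<open>x^s\<close> acts as a single variable. Replacing the exponent
  \<open>j\<close> by a second truncated variable reduces this to the kernel count
  \<open>card_ker_xop\<close>.\<close>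

lemma ker_card_xt_prod:
  assumes "pgroup p M" "endo M T" "s > 0"
  shows "ker_card (xt Q M) (xop T s) j = (\<Prod>u<s. ker_card (xt ((Q - u + s - 1) div s) M) (xop T 1) j)"
proof -
  have "ker_card (xt Q M) (xop T s) j = ker_card (xt j (xt Q M)) (xop (xop T s) 1) 1"
    using card_ker_xop1[OF pgroup_xt[OF assms(1)] endo_xop[OF assms(1,2)], of j Q s]
    by (simp add: ker_card_one)
  also have "\<dots> = ker_card (xt Q (xt j M)) (xop (xop T 1) s) 1"
    by (rule ker_card_xt_swap[OF assms(1,2)])
  also have "\<dots> = (\<Prod>u<s. ker_card (xt j M) (xop T 1) ((Q - u + s - 1) div s))"
    using card_ker_xop[OF pgroup_xt[OF assms(1)] endo_xop[OF assms(1,2)] assms(3), of Q j 1]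
    by (simp add: ker_card_one)
  finally show ?thesis by (simp only: ker_card_xt1_sym[OF assms(1,2), of j])
qed

text \<open>A variable of order 2 is adjoined to \<open>M[x]/(x^a)\<close> and split off at exponent
  \<open>j\<close>, which gives the left side. Exchanging the exponent \<open>j\<close> with the
  order \<open>a\<close> first, it is split off at exponent \<open>a\<close> instead; hence both
  indices must be prime to \<open>p\<close>.\<close>

lemma ker_card_wave:
  assumes "pgroup p M" "endo M T" "j \<ge> 1" "coprime j p" "a \<ge> 1" "coprime a p"
  shows "ker_card (xt a M) (xop T 1) (j - 1) * ker_card (xt a M) (xop T 1) (j + 1) =
    ker_card (xt j M) (xop T 1) (a - 1) * ker_card (xt j M) (xop T 1) (a + 1)"
proof -
  note X = pgroup_xt[OF assms(1)] endo_xop[OF assms(1,2)]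
  have "ker_card (xt a M) (xop T 1) (j - 1) * ker_card (xt a M) (xop T 1) (j + 1) =
      ker_card (xt 2 (xt a M)) (xop (xop T 1) 1) j"
    by (rule ker_card_xt2[OF X assms(3,4), symmetric])
  also have "\<dots> = ker_card (xt a (xt 2 M)) (xop (xop T 1) 1) j"
    by (rule ker_card_xt_swap[OF assms(1,2)])
  also have "\<dots> = ker_card (xt j (xt 2 M)) (xop (xop T 1) 1) a"
    by (rule ker_card_xt1_sym[OF X])
  also have "\<dots> = ker_card (xt 2 (xt j M)) (xop (xop T 1) 1) a"
    by (rule ker_card_xt_swap[OF assms(1,2)])
  also have "\<dots> = ker_card (xt j M) (xop T 1) (a - 1) * ker_card (xt j M) (xop T 1) (a + 1)"
    by (rule ker_card_xt2[OF X assms(5,6)])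
  finally show ?thesis .
qed

section \<open>Frobenius for sums of commuting operators\<close>

lemma endo_sum: "endo M T \<Longrightarrow> T (sum f A) = (\<Sum>i\<in>A. T (f i))"
  by (induction A rule: infinite_finite_induct) (auto simp: endoD endo_zero)

lemma funpow_add_commuting:
  fixes A B :: "'g::comm_ring_1 \<Rightarrow> 'g"
  assumes A: "endo M A" and B: "endo M B" and AB: "\<And>x. A (B x) = B (A x)"
  shows "((\<lambda>x. A x + B x) ^^ n) x = (\<Sum>k\<le>n. of_nat (n choose k) * (A ^^ k) ((B ^^ (n - k)) x))"
proof (induction n)
  case (Suc n)
  have comm: "B ((A ^^ k) y) = (A ^^ k) (B y)" for k y
    by (induction k) (auto simp flip: AB)
  have 1: "(\<Sum>k\<le>n. of_nat (n choose k) * (A ^^ k) ((B ^^ (Suc n - k)) x)) =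
      (B ^^ Suc n) x + (\<Sum>k\<le>n. of_nat (n choose Suc k) * (A ^^ Suc k) ((B ^^ (n - k)) x))"
  proof -
    have "(\<Sum>k\<le>n. of_nat (n choose k) * (A ^^ k) ((B ^^ (Suc n - k)) x)) =
        (\<Sum>k\<le>Suc n. of_nat (n choose k) * (A ^^ k) ((B ^^ (Suc n - k)) x))"
      by (simp add: binomial_eq_0)
    also have "\<dots> = (B ^^ Suc n) x + (\<Sum>k\<le>n. of_nat (n choose Suc k) * (A ^^ Suc k) ((B ^^ (n - k)) x))"
      by (subst sum.atMost_Suc_shift) simp
    finally show ?thesis .
  qed
  have "((\<lambda>x. A x + B x) ^^ Suc n) x =
      (\<Sum>k\<le>n. of_nat (n choose k) * (A ^^ Suc k) ((B ^^ (n - k)) x)) +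
      (\<Sum>k\<le>n. of_nat (n choose k) * (A ^^ k) ((B ^^ (Suc n - k)) x))"
    by (simp add: Suc endo_sum[OF A] endo_sum[OF B] endo_of_nat[OF A] endo_of_nat[OF B] comm Suc_diff_le)
  also have "\<dots> = (B ^^ Suc n) x +
      (\<Sum>k\<le>n. of_nat (Suc n choose Suc k) * (A ^^ Suc k) ((B ^^ (n - k)) x))"
    unfolding 1 by (simp add: sum.distrib algebra_simps del: funpow.simps)
  also have "\<dots> = (\<Sum>k\<le>Suc n. of_nat (Suc n choose k) * (A ^^ k) ((B ^^ (Suc n - k)) x))"
    by (subst sum.atMost_Suc_shift) simp
  finally show ?case .
qed simp

text \<open>The inner binomial coefficients are divisible by \<open>p\<close>, and \<open>p\<close>
  kills \<open>M\<close>. The identity is therefore claimed on \<open>M\<close> only, not on the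
  ambient type.\<close>

lemma funpow_prime_add_commuting:
  assumes M: "pgroup p M" and p: "prime p" and A: "endo M A" and B: "endo M B"
    and AB: "\<And>x. A (B x) = B (A x)" and x: "(x::'g::comm_ring_1) \<in> M"
  shows "((\<lambda>x. A x + B x) ^^ p) x = (A ^^ p) x + (B ^^ p) x"
proof -
  have p0: "p > 0" using p prime_gt_0_nat by auto
  have "of_nat (p choose k) * (A ^^ k) ((B ^^ (p - k)) x) = 0" if "k \<in> {1..<p}" for k
  proof -
    have "p dvd (p choose k)" using that p by (intro dvd_choose_prime) auto
    then obtain c where "p choose k = p * c" by (auto simp: dvd_def)
    moreover have "(A ^^ k) ((B ^^ (p - k)) x) \<in> M"
      using endoD(2)[OF endo_funpow[OF A] endoD(2)[OF endo_funpow[OF B] x]] .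
    moreover have "of_nat (p * c) * y = of_nat c * (of_nat p * y)" for y :: 'g
      by (simp add: ac_simps)
    ultimately show ?thesis using pgroupD(6)[OF M] by (simp del: of_nat_mult)
  qed
  then have "(\<Sum>k\<in>{1..<p}. of_nat (p choose k) * (A ^^ k) ((B ^^ (p - k)) x)) = 0" by simp
  moreover have "{..p} = insert 0 (insert p {1..<p})" using p0 by auto
  ultimately show ?thesis
    using p0 by (simp add: funpow_add_commuting[OF A B AB] add.commute)
qed

lemma funpow_prime_xop:
  assumes M: "pgroup p M" and p: "prime p" and T: "endo M T" and v: "v \<in> xt Q M"
  shows "(xop T s ^^ p) v = xop (T ^^ p) (p * s) v"
proof -
  let ?A = "\<lambda>v t. T (v t :: 'a)" and ?B = "\<lambda>v t. v (t + s) :: 'a"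
  have A: "endo (xt Q M) ?A" and B: "endo (xt Q M) ?B"
    using T by (auto simp: endo_def xt_def fun_eq_iff endo_zero[OF T])
  have AB: "?A (?B w) = ?B (?A w)" for w ..
  have "(?A ^^ k) v = (\<lambda>t. (T ^^ k) (v t))" for k by (induction k) auto
  moreover have "(?B ^^ k) v = (\<lambda>t. v (t + k * s))" for k
    by (induction k) (auto simp: fun_eq_iff algebra_simps)
  moreover have "xop T s = (\<lambda>v. ?A v + ?B v)" by (auto simp: xop_def fun_eq_iff)
  ultimately show ?thesis
    using funpow_prime_add_commuting[OF pgroup_xt[OF M] p A B AB v]
    by (simp add: xop_def plus_fun_def)
qed

text \<open>Sorting exponents modulo \<open>c\<close> splits the larger module into \<open>c\<close>
  copies of the smaller one, and \<open>x^(c s)\<close> acts on each copy as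
  \<open>x^s\<close>.\<close>

lemma ker_card_xt_dilate:
  assumes "pgroup p M" "endo M T" "c > 0"
  shows "ker_card (xt (c * Q) M) (xop T (c * s)) j = ker_card (xt Q M) (xop T s) j ^ c"
proof -
  define K where "K = {w \<in> xt Q M. (xop T s ^^ j) w = 0}"
  have tw: "(xop T (c * s) ^^ j) v (u + c * t) = (xop T s ^^ j) (\<lambda>t. v (u + c * t)) t" for v u t
  proof (induction j arbitrary: t)
    case (Suc j)
    have "u + c * t + c * s = u + c * (t + s)" by (simp add: algebra_simps)
    show ?case unfolding funpow_xop_Suc Suc.IH \<open>u + c * t + c * s = _\<close> ..
  qed simp
  have m: "t mod c < c" "t mod c + c * (t div c) = t" for t using assms(3) by auto
  have d: "Q \<le> t div c" if "c * Q \<le> t" for t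
    using that assms(3) by (simp add: less_eq_div_iff_mult_less_eq mult.commute)
  have "bij_betw (\<lambda>v. \<lambda>u\<in>{..<c}. \<lambda>t. v (u + c * t)) {v \<in> xt (c * Q) M. (xop T (c * s) ^^ j) v = 0}
      (PiE {..<c} (\<lambda>_. K))"
  proof (rule bij_betw_byWitness[where f' = "\<lambda>w t. w (t mod c) (t div c)"])
    show "\<forall>v\<in>{v \<in> xt (c * Q) M. (xop T (c * s) ^^ j) v = 0}.
       (\<lambda>t. (\<lambda>u\<in>{..<c}. \<lambda>t. v (u + c * t)) (t mod c) (t div c)) = v"
      using m by (auto simp: fun_eq_iff)
    show "\<forall>w\<in>PiE {..<c} (\<lambda>_. K). (\<lambda>u\<in>{..<c}. \<lambda>t. w ((u + c * t) mod c) ((u + c * t) div c)) = w"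
      by (auto simp: fun_eq_iff PiE_def extensional_def)
    show "(\<lambda>v. \<lambda>u\<in>{..<c}. \<lambda>t. v (u + c * t)) ` {v \<in> xt (c * Q) M. (xop T (c * s) ^^ j) v = 0}
        \<subseteq> PiE {..<c} (\<lambda>_. K)"
    proof (clarsimp simp: K_def)
      fix v u assume v: "v \<in> xt (c * Q) M" "(xop T (c * s) ^^ j) v = 0" "u < c"
      have "v (u + c * t) = 0" if "t \<ge> Q" for t
        using v(1) trans_le_add2[OF mult_le_mono2[OF that, of c], of u] unfolding xt_def by blast
      then show "(\<lambda>t. v (u + c * t)) \<in> xt Q M \<and> (xop T s ^^ j) (\<lambda>t. v (u + c * t)) = 0"
        using v tw[of v u] by (auto simp: xt_def fun_eq_iff)
    qed
    show "(\<lambda>w t. w (t mod c) (t div c)) ` PiE {..<c} (\<lambda>_. K)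
        \<subseteq> {v \<in> xt (c * Q) M. (xop T (c * s) ^^ j) v = 0}"
    proof safe
      fix w assume w: "w \<in> PiE {..<c} (\<lambda>_. K)"
      have wK: "w (t mod c) \<in> K" for t using w m(1) by (auto simp: PiE_def Pi_def)
      then show "(\<lambda>t. w (t mod c) (t div c)) \<in> xt (c * Q) M"
        using d by (auto simp: K_def xt_def)
      have "(xop T (c * s) ^^ j) (\<lambda>t. w (t mod c) (t div c)) t = 0" for t
      proof -
        have "(\<lambda>t'. w ((t mod c + c * t') mod c) ((t mod c + c * t') div c)) = w (t mod c)"
          using m(1)[of t] by (auto simp: fun_eq_iff)
        then show ?thesis
          using tw[of "\<lambda>t. w (t mod c) (t div c)" "t mod c" "t div c"] wK[of t]
          by (simp add: m(2) K_def)
      qed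
      then show "(xop T (c * s) ^^ j) (\<lambda>t. w (t mod c) (t div c)) = 0" by auto
    qed
  qed
  then show ?thesis
    by (auto dest!: bij_betw_same_card simp: card_PiE K_def ker_card_def)
qed

section \<open>The discrete wave equation\<close>

locale wave =
  fixes g :: "nat \<Rightarrow> nat \<Rightarrow> real" and p :: nat
  assumes sym: "g j a = g a j"
    and zero: "g 0 a = 0"
    and wave: "\<lbrakk>1 \<le> j; j < p; 1 \<le> a; a < p\<rbrakk> \<Longrightarrow> g (j + 1) a + g (j - 1) a = g j (a + 1) + g j (a - 1)"
begin

text \<open>Discrete d'Alembert formula: the boundary points form the base of the backward cone of
  \<open>(j, a)\<close>, at every second place because the equation couples points of equal parity
  of \<open>j + a\<close>. The bound \<open>j + a \<le> p\<close> keeps the cone inside the region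
  where the equation holds.\<close>

lemma eq_sum_boundary:
  assumes "j \<le> a" "j + a \<le> p" shows "g j a = (\<Sum>t<j. g 1 (a - j + 1 + 2 * t))"
  using assms
proof (induction j arbitrary: a rule: less_induct)
  case (less j)
  consider "j = 0" | "j = 1" | i where "j = Suc (Suc i)"
    by (metis One_nat_def not0_implies_Suc)
  then show ?case
  proof cases
    case 3
    define b where "b = a - Suc (Suc i)"
    have a: "a = b + Suc (Suc i)" using less.prems 3 by (simp add: b_def)
    have "g (Suc i + 1) a + g (Suc i - 1) a = g (Suc i) (a + 1) + g (Suc i) (a - 1)"
      using less.prems 3 by (intro wave) auto
    then have "g j a = g (Suc i) (a + 1) + g (Suc i) (a - 1) - g i a"
      using 3 by simp
    also have "g (Suc i) (a + 1) = (\<Sum>t<Suc i. g 1 (a + 1 - Suc i + 1 + 2 * t))"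
      using less.prems 3 by (intro less.IH) auto
    also have "g (Suc i) (a - 1) = (\<Sum>t<Suc i. g 1 (a - 1 - Suc i + 1 + 2 * t))"
      using less.prems 3 by (intro less.IH) auto
    also have "g i a = (\<Sum>t<i. g 1 (a - i + 1 + 2 * t))"
      using less.prems 3 by (intro less.IH) auto
    finally show ?thesis
      by (simp add: a 3 algebra_simps numeral_2_eq_2)
  qed (use less.prems in \<open>auto simp: zero\<close>)
qed

context
  fixes m :: real
  assumes full: "a \<le> p \<Longrightarrow> g p a = real a * m"
begin

text \<open>The defect \<open>D\<close> is symmetric, odd under the point reflection
  \<open>(j, a) -> (p - j, p - a)\<close>, and again a solution of the wave equation. Induction on
  the excess \<open>s = j + a - p\<close> shows that it is constant along each antidiagonal beyond
  the middle one; at the end \<open>j = p\<close> it vanishes by \<open>full\<close>.\<close>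

lemma reflection:
  assumes "j \<le> p" "a \<le> p" "p \<le> j + a"
  shows "g j a = g (p - j) (p - a) + (real j + real a - real p) * m"
proof -
  define D where "D = (\<lambda>j a. g j a - g (p - j) (p - a) - (real j + real a - real p) * m)"
  have Dsym: "D j a = D a j" for j a using sym by (simp add: D_def add.commute)
  have Dneg: "D (p - j) (p - a) = - D j a" if "j \<le> p" "a \<le> p" for j a
    using that by (simp add: D_def of_nat_diff algebra_simps)
  have Dwave: "D (j + 1) a + D (j - 1) a = D j (a + 1) + D j (a - 1)"
    if "1 \<le> j" "j < p" "1 \<le> a" "a < p" for j a
  proof -
    have "g (p - j + 1) (p - a) + g (p - j - 1) (p - a) = g (p - j) (p - a + 1) + g (p - j) (p - a - 1)"
      using that by (intro wave) auto
    moreover have "p - j + 1 = p - (j - 1)" "p - j - 1 = p - (j + 1)"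
        "p - a + 1 = p - (a - 1)" "p - a - 1 = p - (a + 1)" using that by auto
    ultimately show ?thesis using wave[OF that] that
      by (simp add: D_def of_nat_diff algebra_simps)
  qed
  have Dp: "D p a = 0" if "a \<le> p" for a
    using full[OF that] zero by (simp add: D_def)
  have "\<forall>j a. j \<le> p \<longrightarrow> a \<le> p \<longrightarrow> j + a = p + s \<longrightarrow> D j a = 0" for s
  proof (induction s rule: less_induct)
    case (less s)
    show ?case
    proof (cases s)
      case 0
      show ?thesis
      proof (intro allI impI)
        fix j a assume "j \<le> p" "a \<le> p" "j + a = p + s"
        then have "p - j = a" "p - a = j" using 0 by auto
        then show "D j a = 0" using \<open>j + a = p + s\<close> 0 sym[of j a] by (simp add: D_def flip: of_nat_add)
      qed
    next
      case (Suc s')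
      have step: "D (j + 1) a = D j (a + 1)" if ja: "1 \<le> j" "j < p" "1 \<le> a" "a < p" "j + a = p + s'" for j a
      proof (cases "s' = 0")
        case False
        then have "D (j - 1) a = 0" "D j (a - 1) = 0"
          using ja less.IH[of "s' - 1"] Suc by auto
        then show ?thesis using Dwave[OF ja(1-4)] by simp
      next
        case True
        \<comment> \<open>The neighbours below lie on the antidiagonal \<open>j + a = p - 1\<close>,
          the mirror image of the one above, so oddness turns the wave equation into
          \<open>2 D (j + 1) a = 2 D j (a + 1)\<close>.\<close>
        have e: "p - (j - 1) = a + 1" "p - a = j" "p - (a - 1) = j + 1" "p - j = a"
          using ja True by auto
        have "D (a + 1) j = - D (j - 1) a" using Dneg[of "j - 1" a] ja unfolding e by simp
        then have 1: "D (j - 1) a = - D j (a + 1)" using Dsym[of "a + 1" j] by linarith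
        have "D a (j + 1) = - D j (a - 1)" using Dneg[of j "a - 1"] ja unfolding e by simp
        then have 2: "D j (a - 1) = - D (j + 1) a" using Dsym[of "j + 1" a] by linarith
        show ?thesis using Dwave[OF ja(1-4)] 1 2 by simp
      qed
      have "D j a = 0" if "j \<le> p" "a \<le> p" "j + a = p + s" for j a
        using that
      proof (induction "p - j" arbitrary: j a)
        case 0
        then show ?case using Dp by auto
      next
        case (Suc n)
        then have "D (j + 1) (a - 1) = D j (a - 1 + 1)"
          using \<open>s = Suc s'\<close> by (intro step) auto
        moreover have "D (j + 1) (a - 1) = 0" using Suc \<open>s = Suc s'\<close> by (intro Suc(1)) auto
        ultimately show ?case using Suc \<open>s = Suc s'\<close> by auto
      qed
      then show ?thesis by blast
    qed
  qed
  from this[of "j + a - p"] assms have "D j a = 0" by auto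
  then show ?thesis by (simp add: D_def)
qed

end

end

definition log_ker :: "nat \<Rightarrow> 'g::zero set \<Rightarrow> ('g \<Rightarrow> 'g) \<Rightarrow> nat \<Rightarrow> real" where
  "log_ker p M T j = log (real p) (real (ker_card M T j))"

lemma wave_log_ker:
  assumes p: "prime p" and M: "pgroup p M" and T: "endo M T"
  shows "wave (\<lambda>j a. log_ker p (xt a M) (xop T 1) j) p"
proof
  show "log_ker p (xt a M) (xop T 1) j = log_ker p (xt j M) (xop T 1) a" for j a
    by (simp add: log_ker_def ker_card_xt1_sym[OF M T, of a j] del: One_nat_def)
  show "log_ker p (xt a M) (xop T 1) 0 = 0" for a
    using ker_card_0[OF endo_xop[OF M T, of a 1] pgroupD(2)[OF pgroup_xt[OF M]]] by (simp add: log_ker_def)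
  fix j a assume *: "1 \<le> j" "j < p" "1 \<le> a" "a < p"
  have c: "coprime i p" if "1 \<le> i" "i < p" for i
  proof -
    have "\<not> p dvd i" using that by (auto dest: dvd_imp_le)
    then show ?thesis using p prime_imp_coprime_nat[of p i] by (simp add: coprime_commute)
  qed
  have p1: "p > 1" using p prime_gt_1_nat by blast
  have pos: "real (ker_card (xt b M) (xop T 1) i) > 0" for b i
    using ker_card_pos[OF pgroup_xt[OF M] endo_xop[OF M T], of b 1 i] by (simp del: One_nat_def)
  have "log (real p) (real (ker_card (xt a M) (xop T 1) (j - 1)) * real (ker_card (xt a M) (xop T 1) (j + 1))) =
        log (real p) (real (ker_card (xt j M) (xop T 1) (a - 1)) * real (ker_card (xt j M) (xop T 1) (a + 1)))"
    using ker_card_wave[OF M T *(1) c[OF *(1,2)] *(3) c[OF *(3,4)]] by (metis of_nat_mult)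
  then show "log_ker p (xt a M) (xop T 1) (j + 1) + log_ker p (xt a M) (xop T 1) (j - 1) =
     log_ker p (xt (a + 1) M) (xop T 1) j + log_ker p (xt (a - 1) M) (xop T 1) j"
    unfolding log_ker_def log_mult_pos[OF pos pos] ker_card_xt1_sym[OF M T, of "a + 1" j]
      ker_card_xt1_sym[OF M T, of "a - 1" j] by linarith
qed

lemma log_ker_xt1_1:
  assumes M: "pgroup p M" and T: "endo M T"
  shows "log_ker q (xt a M) (xop T 1) 1 = log_ker q M T a"
  using card_ker_xop1[OF M T, of a] by (simp add: log_ker_def ker_card_one)

text \<open>\<open>xt p M\<close> splits into \<open>xt (a + 1) M\<close> and \<open>xt a M\<close> according to parity; adding the two
  Clebsch--Gordan sums turns their steps of length two into steps of length one.\<close>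
lemma
  assumes p: "prime p" and pa: "p = 2 * a + 1" and M: "pgroup p M" and T: "endo M T"
    and nil: "\<And>x. x \<in> M \<Longrightarrow> (T ^^ p) x = 0"
  shows log_ker_xt_square: "j \<le> a \<Longrightarrow> log_ker p (xt p M) (xop T 2) j = (\<Sum>i=a-j+1..a+j. log_ker p M T i)"
    and log_ker_xt_square_reflect: "j \<le> p \<Longrightarrow>
      log_ker p (xt p M) (xop T 2) (p - j) = log_ker p (xt p M) (xop T 2) j + (real p - 2 * real j) * log p (card M)"
proof -
  interpret wave "\<lambda>j a. log_ker p (xt a M) (xop T 1) j" p by (rule wave_log_ker[OF p M T])
  have pos: "real (ker_card (xt b M) (xop T 1) i) > 0" for b i
    using ker_card_pos[OF pgroup_xt[OF M] endo_xop[OF M T], of b 1 i] by (simp del: One_nat_def)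
  have "{..<2::nat} = {0, 1}" by auto
  then have split: "log_ker p (xt p M) (xop T 2) j =
      log_ker p (xt (a + 1) M) (xop T 1) j + log_ker p (xt a M) (xop T 1) j" for j
    using ker_card_xt_prod[OF M T, of 2 p j] pos[of "Suc a" j] pos[of a j] by (simp add: pa log_ker_def log_mult_pos)
  show "log_ker p (xt p M) (xop T 2) j = (\<Sum>i=a-j+1..a+j. log_ker p M T i)" if j: "j \<le> a"
  proof -
    have "log_ker p (xt p M) (xop T 2) j = (\<Sum>t<j. log_ker p M T (a + 1 - j + 1 + 2 * t)) +
        (\<Sum>t<j. log_ker p M T (a - j + 1 + 2 * t))"
      unfolding split using j pa
      by (subst (1 2) eq_sum_boundary) (auto simp: log_ker_xt1_1[OF M T] simp del: One_nat_def)
    also have "\<dots> = (\<Sum>t<j. log_ker p M T (a - j + 1 + 2 * t) + log_ker p M T (a - j + 1 + (2 * t + 1)))"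
      using j by (simp add: sum.distrib Suc_diff_le algebra_simps)
    also have "\<dots> = (\<Sum>i<2 * j. log_ker p M T (a - j + 1 + i))"
    proof -
      have "(\<Sum>t<k. f (b + 2 * t) + f (b + (2 * t + 1))) = (\<Sum>i<2 * k. f (b + i))"
        for f :: "nat \<Rightarrow> real" and b k by (induction k) auto
      then show ?thesis .
    qed
    also have "\<dots> = (\<Sum>i=a-j+1..a+j. log_ker p M T i)"
      by (rule sum.reindex_bij_witness[of _ "\<lambda>i. i - (a - j + 1)" "\<lambda>i. a - j + 1 + i"]) (use j in auto)
    finally show ?thesis .
  qed
  show "log_ker p (xt p M) (xop T 2) (p - j) = log_ker p (xt p M) (xop T 2) j + (real p - 2 * real j) * log p (card M)"
    if j: "j \<le> p"
  proof -
    have p1: "p > 1" using p prime_gt_1_nat by blast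
    \<comment> \<open>\<open>(T + x)^p = T^p + x^p\<close> is zero on \<open>M[x]/(x^b)\<close> for
      \<open>b \<le> p\<close>. This linear top boundary is the hypothesis of
      \<open>reflection\<close>.\<close>
    have full: "log_ker p (xt b M) (xop T 1) p = real b * log p (card M)" if "b \<le> p" for b
    proof -
      have "(xop T 1 ^^ p) v = 0" if v: "v \<in> xt b M" for v
        unfolding funpow_prime_xop[OF M p T v] using v \<open>b \<le> p\<close>
        by (auto simp: xop_def fun_eq_iff xt_def nil)
      then have "ker_card (xt b M) (xop T 1) p = card M ^ b"
        by (subst ker_card_nilpotent) (auto simp: card_xt[OF M])
      moreover have "card M > 0" using pgroupD(1,2)[OF M] by (auto simp: card_gt_0_iff)
      ultimately show ?thesis by (simp add: log_ker_def log_nat_power)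
    qed
    have refl: "log_ker p (xt b M) (xop T 1) i = log_ker p (xt (p - b) M) (xop T 1) (p - i) +
        (real i + real b - real p) * log p (card M)" if "i \<le> p" "b \<le> p" "p \<le> i + b" for i b
      using reflection[OF full that] .
    \<comment> \<open>Reflection exchanges the strings of lengths \<open>a\<close> and
      \<open>a + 1\<close>, whose sum is \<open>p\<close>; the two linear corrections
      \<open>a + 1 - j\<close> and \<open>a - j\<close> add up to \<open>p - 2 j\<close>.\<close>
    have half: "log_ker p (xt p M) (xop T 2) (p - j) = log_ker p (xt p M) (xop T 2) j + (real p - 2 * real j) * log p (card M)"
      if "j \<le> a" for j
      unfolding split using that pa
      by (subst (1 2) refl) (auto simp: of_nat_diff algebra_simps)
    show ?thesis
    proof (cases "j \<le> a")
      case False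
      then have "p - j \<le> a" "p - (p - j) = j" using j pa by auto
      then show ?thesis using half[of "p - j"] j by (simp add: of_nat_diff algebra_simps)
    qed (rule half)
  qed
qed

section \<open>Truncated polynomial rings over prime fields\<close>

abbreviation (input) lookup where "lookup \<equiv> Poly_Mapping.lookup"
abbreviation (input) single where "single \<equiv> Poly_Mapping.single"

text \<open>The product of all rings \<open>\<int>/n\<close>. It contains every \<open>F\<^sub>p\<close> as an ideal with unit element \<open>fpe p 1\<close>, so one
  ring type serves all primes.\<close>
typedef zprod = "{f :: nat \<Rightarrow> int. \<forall>n. f n mod int n = f n}"
  by (rule exI[of _ "\<lambda>_. 0"]) simp

setup_lifting type_definition_zprod

instantiation zprod :: comm_ring_1
begin

lift_definition zero_zprod :: zprod is "\<lambda>_. 0" by simp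
lift_definition one_zprod :: zprod is "\<lambda>n. 1 mod int n" by simp
lift_definition plus_zprod :: "zprod \<Rightarrow> zprod \<Rightarrow> zprod" is "\<lambda>f g n. (f n + g n) mod int n" by simp
lift_definition minus_zprod :: "zprod \<Rightarrow> zprod \<Rightarrow> zprod" is "\<lambda>f g n. (f n - g n) mod int n" by simp
lift_definition uminus_zprod :: "zprod \<Rightarrow> zprod" is "\<lambda>f n. (- f n) mod int n" by simp
lift_definition times_zprod :: "zprod \<Rightarrow> zprod \<Rightarrow> zprod" is "\<lambda>f g n. (f n * g n) mod int n" by simp

instance
proof
  fix a b c :: zprod
  show "a * b * c = a * (b * c)" by transfer (simp add: mod_simps mult.assoc)
  show "a * b = b * a" by transfer (simp add: mult.commute)
  show "1 * a = a" by transfer (simp add: mod_simps)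
  show "a + b + c = a + (b + c)" by transfer (simp add: mod_simps add.assoc)
  show "a + b = b + a" by transfer (simp add: add.commute)
  show "0 + a = a" by transfer simp
  show "- a + a = 0" by transfer (simp add: mod_simps)
  show "a - b = a + - b" by transfer (simp add: mod_simps)
  show "(a + b) * c = a * c + b * c" by transfer (simp add: mod_simps distrib_right)
  \<comment> \<open>Component 0 separates them: reduction modulo 0 is the identity, so that factor
    is the ring of integers.\<close>
  show "(0::zprod) \<noteq> 1" by transfer (auto simp: fun_eq_iff intro!: exI[of _ 0])
qed

end

lift_definition fpe :: "nat \<Rightarrow> int \<Rightarrow> zprod" is "\<lambda>p z n. if n = p then z mod int n else 0" by simp

definition Fp :: "nat \<Rightarrow> zprod set" where "Fp p = range (fpe p)"

lemma fpe_0 [simp]: "fpe p 0 = 0" by transfer auto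
lemma fpe_add: "fpe p (z + w) = fpe p z + fpe p w" by transfer (simp add: fun_eq_iff mod_add_eq)
lemma fpe_mult: "fpe p (z * w) = fpe p z * fpe p w" by transfer (simp add: fun_eq_iff mod_mult_eq)
lemma fpe_minus: "fpe p (- z) = - fpe p z" by transfer (simp add: fun_eq_iff mod_minus_eq)
lemma fpe_mod: "fpe p (z mod int p) = fpe p z" by transfer auto
lemma fpe_eq_iff: "fpe p z = fpe p w \<longleftrightarrow> z mod int p = w mod int p"
  by transfer (auto simp: fun_eq_iff)

lemma fpe_of_nat: "of_nat k * fpe p z = fpe p (int k * z)"
  by (induction k) (simp_all add: distrib_right fpe_add)

lemma fpe_in_Fp [simp]: "fpe p z \<in> Fp p" by (simp add: Fp_def)

lemma zero_in_Fp [simp]: "0 \<in> Fp p" using fpe_in_Fp[of p 0] by simp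

lemma bij_betw_fpe: "p > 0 \<Longrightarrow> bij_betw (fpe p) {0..<int p} (Fp p)"
proof -
  assume p: "p > 0"
  have "fpe p z \<in> fpe p ` {0..<int p}" for z
    using p by (intro image_eqI[of _ _ "z mod int p"]) (auto simp: fpe_mod)
  then show ?thesis by (auto simp: bij_betw_def inj_on_def fpe_eq_iff Fp_def)
qed

lemma card_Fp: "p > 0 \<Longrightarrow> card (Fp p) = p"
  using bij_betw_same_card[OF bij_betw_fpe] by simp

lemma finite_Fp: "p > 0 \<Longrightarrow> finite (Fp p)"
  using bij_betw_finite[OF bij_betw_fpe] by simp

lemma pgroup_Fp: "p > 0 \<Longrightarrow> pgroup p (Fp p)"
proof -
  assume p: "p > 0"
  have "fpe p (int p * z) = 0" for z using fpe_eq_iff[of p "int p * z" 0] by simp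
  then have "of_nat p * x = 0" if "x \<in> Fp p" for x
    using that by (auto simp: Fp_def fpe_of_nat)
  moreover have "x + y \<in> Fp p" "- x \<in> Fp p" if "x \<in> Fp p" "y \<in> Fp p" for x y
    using that by (auto simp: Fp_def simp flip: fpe_add fpe_minus)
  ultimately show ?thesis by (auto simp: pgroup_def finite_Fp[OF p])
qed

lemma Fp_mult: "x \<in> Fp p \<Longrightarrow> y \<in> Fp p \<Longrightarrow> x * y \<in> Fp p"
  by (auto simp: Fp_def simp flip: fpe_mult)

lemma Fp_one_mult: "x \<in> Fp p \<Longrightarrow> fpe p 1 * x = x" "x \<in> Fp p \<Longrightarrow> x * fpe p 1 = x"
  by (auto simp: Fp_def simp flip: fpe_mult)

lemma Fp_inverse:
  assumes "prime p" "x \<in> Fp p" "x \<noteq> 0" shows "\<exists>y\<in>Fp p. x * y = fpe p 1"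
proof -
  obtain z where z: "x = fpe p z" using assms(2) by (auto simp: Fp_def)
  then have "\<not> int p dvd z" using assms(3) fpe_eq_iff[of p z 0] by auto
  then have "coprime z (int p)"
    using assms(1) prime_imp_coprime[of "int p" z] by (simp add: coprime_commute)
  then obtain w where "[z * w = 1] (mod int p)" using cong_solve_coprime_int by blast
  then have "x * fpe p w = fpe p 1"
    by (simp add: z fpe_eq_iff cong_def flip: fpe_mult)
  then show ?thesis using fpe_in_Fp by blast
qed

text \<open>With exponents reversed as for \<open>xt\<close>, \<open>W p I Q\<close> is \<open>F\<^sub>p[x\<^sub>i : i \<in> I]/(x\<^sub>i\<^bsup>Q i\<^esup>)\<close>, and \<open>gop I s\<close> is
  multiplication by the sum of the \<open>x\<^sub>i\<^bsup>s i\<^esup>\<close>.\<close>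
definition W :: "nat \<Rightarrow> nat set \<Rightarrow> (nat \<Rightarrow> nat) \<Rightarrow> ((nat \<Rightarrow>\<^sub>0 nat) \<Rightarrow> zprod) set" where
  "W p I Q = {v. (\<forall>\<alpha>. v \<alpha> \<in> Fp p) \<and>
     (\<forall>\<alpha> i. v \<alpha> \<noteq> 0 \<longrightarrow> (if i \<in> I then lookup \<alpha> i < Q i else lookup \<alpha> i = 0))}"

definition gop :: "nat set \<Rightarrow> (nat \<Rightarrow> nat) \<Rightarrow> ((nat \<Rightarrow>\<^sub>0 nat) \<Rightarrow> zprod) \<Rightarrow> (nat \<Rightarrow>\<^sub>0 nat) \<Rightarrow> zprod" where
  "gop I s v = (\<lambda>\<alpha>. \<Sum>i\<in>I. v (\<alpha> + single i (s i)))"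

lemma WD:
  assumes "v \<in> W p I Q"
  shows "v \<alpha> \<in> Fp p" "v \<alpha> \<noteq> 0 \<Longrightarrow> i \<in> I \<Longrightarrow> lookup \<alpha> i < Q i" "v \<alpha> \<noteq> 0 \<Longrightarrow> i \<notin> I \<Longrightarrow> lookup \<alpha> i = 0"
  using assms by (auto simp: W_def split: if_splits)

lemma W_empty: "W p {} Q = {v. v 0 \<in> Fp p \<and> (\<forall>\<alpha>. \<alpha> \<noteq> 0 \<longrightarrow> v \<alpha> = 0)}"
proof -
  have "\<alpha> \<noteq> 0 \<longleftrightarrow> (\<exists>i. lookup \<alpha> i \<noteq> 0)" for \<alpha> :: "nat \<Rightarrow>\<^sub>0 nat"
    by (metis lookup_zero poly_mapping_eqI)
  then show ?thesis unfolding W_def by (auto split: if_splits) (metis zero_in_Fp)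
qed

lemma gop_insert:
  "finite J \<Longrightarrow> c \<notin> J \<Longrightarrow> gop (insert c J) s v = (\<lambda>\<alpha>. v (\<alpha> + single c (s c))) + gop J s v"
  by (auto simp: gop_def fun_eq_iff)

lemma W_cong: "(\<And>i. i \<in> I \<Longrightarrow> Q i = Q' i) \<Longrightarrow> W p I Q = W p I Q'"
  by (simp add: W_def cong: if_cong)

lemma gop_cong: "(\<And>i. i \<in> I \<Longrightarrow> s i = s' i) \<Longrightarrow> gop I s = gop I s'"
  by (simp add: gop_def fun_eq_iff)

text \<open>Reading a polynomial as one in \<open>x_c\<close> over the remaining variables makes
  \<open>W\<close> an iterated \<open>xt\<close>, so facts on one adjoined variable give inductions
  on the index set. A slice is extended by zero to exponents that involve \<open>c\<close>.\<close>

lemma W_insert_bij: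
  assumes "c \<notin> I"
  shows "bij_betw (\<lambda>v t \<beta>. if lookup \<beta> c = 0 then v (\<beta> + single c t) else 0)
    (W p (insert c I) Q) (xt (Q c) (W p I Q))" (is "bij_betw ?f _ _")
proof -
  let ?g = "\<lambda>w \<alpha>. w (lookup \<alpha> c) (Poly_Mapping.update c 0 \<alpha>) :: zprod"
  have 1: "Poly_Mapping.update c 0 \<alpha> + single c (lookup \<alpha> c) = \<alpha>" for \<alpha> :: "nat \<Rightarrow>\<^sub>0 nat"
    by (rule poly_mapping_eqI) (auto simp: lookup_add lookup_update lookup_single when_def)
  have 2: "Poly_Mapping.update c 0 (\<beta> + single c t) = \<beta>" if "lookup \<beta> c = 0" for \<beta> :: "nat \<Rightarrow>\<^sub>0 nat" and t
    by (rule poly_mapping_eqI) (use that in \<open>auto simp: lookup_add lookup_update lookup_single when_def\<close>)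
  show ?thesis
  proof (rule bij_betw_byWitness[where f' = ?g])
    show "\<forall>v\<in>W p (insert c I) Q. ?g (?f v) = v"
      by (auto simp: fun_eq_iff lookup_update 1)
    show "\<forall>w\<in>xt (Q c) (W p I Q). ?f (?g w) = w"
    proof
      fix w assume w: "w \<in> xt (Q c) (W p I Q)"
      have "w t \<beta> = 0" if "lookup \<beta> c \<noteq> 0" for t \<beta>
      proof -
        have "w t \<in> W p I Q" using w by (simp add: xt_def)
        then show ?thesis using WD(3)[OF _ _ assms, of "w t" p Q \<beta>] that by blast
      qed
      then show "?f (?g w) = w"
        by (auto simp: fun_eq_iff 2 lookup_add)
    qed
    show "?f ` W p (insert c I) Q \<subseteq> xt (Q c) (W p I Q)"
    proof (rule image_subsetI)
      fix v assume v: "v \<in> W p (insert c I) Q"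
      have "?f v t \<beta> = 0" if "t \<ge> Q c" for t \<beta>
      proof (rule ccontr)
        assume "?f v t \<beta> \<noteq> 0"
        then have "lookup (\<beta> + single c t) c < Q c"
          using v unfolding W_def by (auto split: if_splits)
        then show False using that by (simp add: lookup_add)
      qed
      moreover have "?f v t \<in> W p I Q" for t
        unfolding W_def
      proof (clarsimp, intro conjI allI impI)
        show "v (\<beta> + single c t) \<in> Fp p" for \<beta> using v by (auto simp: W_def)
        fix \<beta> i assume 0: "lookup \<beta> c = 0" "v (\<beta> + single c t) \<noteq> 0"
        then have *: "if i \<in> insert c I then lookup (\<beta> + single c t) i < Q i
            else lookup (\<beta> + single c t) i = 0" using v unfolding W_def by blast
        show "i \<in> I \<Longrightarrow> lookup \<beta> i < Q i" using * assms by (auto simp: lookup_add lookup_single when_def split: if_splits)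
        show "i \<notin> I \<Longrightarrow> lookup \<beta> i = 0" using * 0(1) by (cases "i = c") (auto simp: lookup_add lookup_single when_def)
      qed
      ultimately show "?f v \<in> xt (Q c) (W p I Q)" by (auto simp: xt_def fun_eq_iff)
    qed
    show "?g ` xt (Q c) (W p I Q) \<subseteq> W p (insert c I) Q"
    proof (rule image_subsetI)
      fix w assume w: "w \<in> xt (Q c) (W p I Q)"
      have "w t \<in> W p I Q" for t using w by (auto simp: xt_def)
      moreover have "lookup \<alpha> c < Q c" if "?g w \<alpha> \<noteq> 0" for \<alpha>
      proof (rule ccontr)
        assume "\<not> lookup \<alpha> c < Q c"
        then have "w (lookup \<alpha> c) = 0" using w by (auto simp: xt_def)
        then show False using that by simp
      qed
      ultimately show "?g w \<in> W p (insert c I) Q"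
        unfolding W_def by (auto simp: lookup_update split: if_splits) (metis lookup_update)+
    qed
  qed
qed

text \<open>Closure is separated from finiteness because finiteness of \<open>W\<close> is obtained
  through \<open>xt\<close>, and \<open>pgroup_xt\<close> already needs the smaller \<open>W\<close>
  to be a \<open>pgroup\<close>.\<close>

lemma pgroup_W_if_finite:
  assumes "p > 0" "finite (W p I Q)" shows "pgroup p (W p I Q)"
proof -
  note F = pgroupD[OF pgroup_Fp[OF assms(1)]]
  have "v + w \<in> W p I Q" if vw: "v \<in> W p I Q" "w \<in> W p I Q" for v w
  proof -
    have "if i \<in> I then lookup \<alpha> i < Q i else lookup \<alpha> i = 0" if "(v + w) \<alpha> \<noteq> 0" for \<alpha> i
    proof -
      have "v \<alpha> \<noteq> 0 \<or> w \<alpha> \<noteq> 0" using that by auto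
      then show ?thesis using WD(2,3)[OF vw(1), of \<alpha> i] WD(2,3)[OF vw(2), of \<alpha> i] by auto
    qed
    then show ?thesis using WD(1)[OF vw(1)] WD(1)[OF vw(2)] F(3) unfolding W_def by simp
  qed
  moreover have "- v \<in> W p I Q \<and> of_nat p * v = 0" if "v \<in> W p I Q" for v
    using that F(4,6) unfolding W_def by (simp add: fun_eq_iff)
  moreover have "0 \<in> W p I Q" unfolding W_def by simp
  ultimately show ?thesis using assms(2) unfolding pgroup_def by blast
qed

lemma pgroup_W:
  assumes "p > 0" "finite I" shows "pgroup p (W p I Q)"
proof -
  have "finite (W p I Q)"
    using assms(2)
  proof (induction I)
    case empty
    have "W p {} Q \<subseteq> (\<lambda>x \<alpha>. if \<alpha> = 0 then x else 0) ` Fp p"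
    proof
      fix v assume v: "v \<in> W p {} Q"
      show "v \<in> (\<lambda>x \<alpha>. if \<alpha> = 0 then x else 0) ` Fp p"
        by (rule image_eqI[of _ _ "v 0"]) (use v in \<open>auto simp: W_empty\<close>)
    qed
    then show ?case using finite_Fp[OF assms(1)] finite_subset by blast
  next
    case (insert c I)
    then have "pgroup p (W p I Q)" using pgroup_W_if_finite[OF assms(1)] by blast
    then show ?case
      using bij_betw_finite[OF W_insert_bij[OF insert(2)]] pgroupD(1)[OF pgroup_xt] by blast
  qed
  then show ?thesis by (rule pgroup_W_if_finite[OF assms(1)])
qed

lemma card_W:
  assumes "p > 0" "finite I" shows "card (W p I Q) = p ^ (\<Prod>i\<in>I. Q i)"
  using assms(2)
proof (induction I)
  case empty
  have "bij_betw (\<lambda>x \<alpha>. if \<alpha> = 0 then x else 0) (Fp p) (W p {} Q)"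
    by (rule bij_betw_byWitness[where f' = "\<lambda>v. v 0"])
       (auto simp: W_empty)
  then show ?case using card_Fp[OF assms(1)] by (auto dest: bij_betw_same_card)
next
  case (insert c I)
  have "card (W p (insert c I) Q) = (p ^ prod Q I) ^ Q c"
    using bij_betw_same_card[OF W_insert_bij[OF insert(2), of p Q]] card_xt[OF pgroup_W[OF assms(1) insert(1)]]
      insert(3) by simp
  then show ?case using insert by (simp add: mult.commute flip: power_mult)
qed

lemma endo_shift: "endo (W p I Q) (\<lambda>v \<alpha>. v (\<alpha> + \<beta>))"
proof -
  have "(\<lambda>\<alpha>. v (\<alpha> + \<beta>)) \<in> W p I Q" if v: "v \<in> W p I Q" for v
    unfolding W_def
  proof (clarsimp, intro conjI allI impI)
    show "v (\<alpha> + \<beta>) \<in> Fp p" for \<alpha> using v by (auto simp: W_def)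
    fix \<alpha> i assume "v (\<alpha> + \<beta>) \<noteq> 0"
    then have *: "if i \<in> I then lookup (\<alpha> + \<beta>) i < Q i else lookup (\<alpha> + \<beta>) i = 0"
      using v unfolding W_def by blast
    show "i \<in> I \<Longrightarrow> lookup \<alpha> i < Q i" "i \<notin> I \<Longrightarrow> lookup \<alpha> i = 0" using * by (auto simp: lookup_add)
  qed
  then show ?thesis by (auto simp: endo_def fun_eq_iff)
qed

lemma endo_gop:
  assumes "p > 0" "finite I" "finite J" shows "endo (W p I Q) (gop J s)"
  using assms(3)
proof (induction J)
  case empty
  show ?case using pgroupD(2)[OF pgroup_W[OF assms(1,2)]] by (auto simp: endo_def gop_def fun_eq_iff zero_fun_def)
next
  case (insert c J)
  show ?case
    unfolding gop_insert[OF insert(1,2), abs_def]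
    by (rule endo_add[OF pgroup_W[OF assms(1,2)] endo_shift insert(3)])
qed

lemma ker_card_W_insert:
  assumes "p > 0" "finite I" "c \<notin> I"
  shows "ker_card (W p (insert c I) Q) (gop (insert c I) s) j = ker_card (xt (Q c) (W p I Q)) (xop (gop I s) (s c)) j"
proof (rule ker_card_cong_bij[OF W_insert_bij[OF assms(3)]])
  fix v assume v: "v \<in> W p (insert c I) Q"
  show "gop (insert c I) s v \<in> W p (insert c I) Q"
    using endoD(2)[OF endo_gop v] assms by simp
  have "i \<noteq> c" if "i \<in> I" for i using that assms(3) by auto
  then show "(\<lambda>t \<beta>. if lookup \<beta> c = 0 then gop (insert c I) s v (\<beta> + single c t) else 0) =
      xop (gop I s) (s c) (\<lambda>t \<beta>. if lookup \<beta> c = 0 then v (\<beta> + single c t) else 0)"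
    using assms(2,3)
    by (auto simp: fun_eq_iff xop_def gop_def lookup_add lookup_single single_add ac_simps intro!: sum.cong)
  show "(\<lambda>t \<beta>. if lookup \<beta> c = 0 then v (\<beta> + single c t) else 0) = 0 \<longleftrightarrow> v = 0"
  proof
    assume "(\<lambda>t \<beta>. if lookup \<beta> c = 0 then v (\<beta> + single c t) else 0) = 0"
    moreover have "(\<lambda>t \<beta>. if lookup \<beta> c = 0 then (0 :: (nat \<Rightarrow>\<^sub>0 nat) \<Rightarrow> zprod) (\<beta> + single c t) else 0) = 0"
      by (auto simp: fun_eq_iff)
    ultimately show "v = 0"
      using W_insert_bij[OF assms(3), of p Q] v pgroupD(2)[OF pgroup_W[OF assms(1), of "insert c I" Q]] assms(2)
      unfolding bij_betw_def inj_on_def by auto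
  qed (auto simp: fun_eq_iff)
qed

lemma funpow_prime_gop:
  assumes p: "prime p" and I: "finite I" and J: "finite J" and v: "v \<in> W p I Q"
  shows "(gop J s ^^ p) v = gop J (\<lambda>i. p * s i) v"
  using J
proof (induction J)
  case empty
  have "p > 0" using p prime_gt_0_nat by blast
  then obtain n where "p = Suc n" using gr0_implies_Suc by blast
  then show ?case by (simp add: gop_def fun_eq_iff)
next
  case (insert c J)
  have p0: "p > 0" using p prime_gt_0_nat by blast
  let ?A = "\<lambda>v \<alpha>. v (\<alpha> + single c (s c)) :: zprod"
  note 1 = gop_insert[OF insert(1,2), abs_def]
  have A: "(?A ^^ k) v = (\<lambda>\<alpha>. v (\<alpha> + single c (k * s c)))" for k
    by (induction k) (auto simp: fun_eq_iff single_add ac_simps)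
  have AB: "?A (gop J s w) = gop J s (?A w)" for w
    by (auto simp: gop_def fun_eq_iff ac_simps)
  show ?case
    unfolding 1 funpow_prime_add_commuting[OF pgroup_W[OF p0 I] p endo_shift endo_gop[OF p0 I insert(1)] AB v] A insert(3) ..
qed

text \<open>The variables are dilated one at a time, which passes through modules with mixed
  truncation orders; \<open>Q\<close> and \<open>s\<close>, being functions of the index,
  accommodate these.\<close>

lemma ker_card_W_dilate:
  assumes "p > 0" "finite I" "c > 0"
  shows "ker_card (W p I (\<lambda>i. c * Q i)) (gop I (\<lambda>i. c * s i)) j = ker_card (W p I Q) (gop I s) j ^ (c ^ card I)"
proof -
  have "ker_card (W p I (\<lambda>i. if i \<in> J then c * Q i else Q i)) (gop I (\<lambda>i. if i \<in> J then c * s i else s i)) j =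
      ker_card (W p I Q) (gop I s) j ^ (c ^ card J)" if "J \<subseteq> I" for J
    using finite_subset[OF that assms(2)] that
  proof (induction J)
    case (insert a J)
    define K where "K = I - {a}"
    have K: "I = insert a K" "a \<notin> K" "finite K" using insert assms(2) by (auto simp: K_def)
    let ?m = "\<lambda>J f i. if i \<in> J then c * f i else f i :: nat"
    have e: "W p K (?m (insert a J) Q) = W p K (?m J Q)" "gop K (?m (insert a J) s) = gop K (?m J s)"
      using K(2) by (auto intro!: W_cong gop_cong)
    have "ker_card (W p I (?m (insert a J) Q)) (gop I (?m (insert a J) s)) j =
        ker_card (xt (c * Q a) (W p K (?m J Q))) (xop (gop K (?m J s)) (c * s a)) j"
      unfolding K(1) ker_card_W_insert[OF assms(1) K(3,2)] e by simp
    also have "\<dots> = ker_card (xt (Q a) (W p K (?m J Q))) (xop (gop K (?m J s)) (s a)) j ^ c"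
      by (rule ker_card_xt_dilate[OF pgroup_W[OF assms(1) K(3)] endo_gop[OF assms(1) K(3,3)] assms(3)])
    also have "\<dots> = ker_card (W p I (?m J Q)) (gop I (?m J s)) j ^ c"
      unfolding K(1) ker_card_W_insert[OF assms(1) K(3,2)] using insert(2) by simp
    also have "\<dots> = ker_card (W p I Q) (gop I s) j ^ (c ^ card (insert a J))"
      using insert by (simp add: power_mult mult.commute flip: power_mult)
    finally show ?case .
  qed simp
  from this[of I] show ?thesis
    using W_cong[of I "\<lambda>i. if i \<in> I then c * Q i else Q i" "\<lambda>i. c * Q i" p]
      gop_cong[of I "\<lambda>i. if i \<in> I then c * s i else s i" "\<lambda>i. c * s i"] by simp
qed

section \<open>Counting alternating words\<close>

text \<open>A boustrophedon recursion. Over an ordered alphabet of \<open>a + 1\<close> letters it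
  counts alternating words of length \<open>d\<close> whose first letter is among the
  \<open>j\<close> outermost at one end: the letter in place \<open>t\<close> from that end leaves
  \<open>a - t\<close> letters on its far side for the next one.\<close>

fun zigzag :: "nat \<Rightarrow> nat \<Rightarrow> nat \<Rightarrow> nat" where
  "zigzag 0 a j = 1"
| "zigzag (Suc d) a j = (\<Sum>t<j. zigzag d a (a - t))"

lemma zigzag_mono: "a \<le> b \<Longrightarrow> i \<le> j \<Longrightarrow> zigzag d a i \<le> zigzag d b j"
proof (induction d arbitrary: i j)
  case (Suc d)
  have "zigzag (Suc d) a i \<le> (\<Sum>t<i. zigzag d b (b - t))"
    unfolding zigzag.simps by (rule sum_mono, rule Suc.IH) (use Suc.prems in auto)
  also have "\<dots> \<le> zigzag (Suc d) b j"
    unfolding zigzag.simps by (rule sum_mono2) (use Suc.prems in auto)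
  finally show ?case .
qed simp

text \<open>The boolean is the direction of the next comparison. The starting letter is arbitrary
  because the induction on the tail starts from the letter just read.\<close>

fun altl :: "bool \<Rightarrow> signed \<Rightarrow> signed list \<Rightarrow> bool" where
  "altl b y [] = True"
| "altl b y (x # xs) = ((if b then prec 2 y x else prec 2 x y) \<and> altl (\<not> b) x xs)"

lemma altl_iff_nth:
  "altl b y xs \<longleftrightarrow> (\<forall>i<length xs. if even i = b then prec 2 ((y # xs) ! i) ((y # xs) ! Suc i)
     else prec 2 ((y # xs) ! Suc i) ((y # xs) ! i))"
proof (induction xs arbitrary: b y)
  case (Cons x xs)
  show ?case
    unfolding altl.simps Cons.IH[of "\<not> b" x] by (auto simp: All_less_Suc2)
qed simp

lemma alternating_iff_altl: "alternating 2 xs \<longleftrightarrow> altl True Zero xs"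
  by (simp add: alternating_def altl_iff_nth Let_def)

section \<open>Words in letters of bounded magnitude\<close>

definition letters :: "nat \<Rightarrow> nat \<Rightarrow> signed set" where
  "letters r m = {Signed a k | a k. a \<in> {1..m} \<and> k < r}"

definition sgwords :: "nat \<Rightarrow> nat \<Rightarrow> nat \<Rightarrow> signed list set" where
  "sgwords r m d = {xs. length xs = d \<and> set xs \<subseteq> letters r m}"

fun mag :: "signed \<Rightarrow> nat" where "mag (Signed a k) = a" | "mag Zero = 0"
fun lev :: "signed \<Rightarrow> nat" where "lev (Signed a k) = k" | "lev Zero = 0"

lemma card_letters: "card (letters r m) = r * m" and finite_letters: "finite (letters r m)"
proof -
  have "bij_betw (\<lambda>(a, k). Signed a k) ({1..m} \<times> {..<r}) (letters r m)"
    by (auto simp: bij_betw_def inj_on_def letters_def image_iff)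
  note b = this
  show "card (letters r m) = r * m"
    using bij_betw_same_card[OF b] by (simp add: card_cartesian_product mult.commute)
  show "finite (letters r m)" using bij_betw_finite[OF b] by simp
qed

lemma sum_top:
  fixes f :: "nat \<Rightarrow> nat"
  shows "j \<le> K \<Longrightarrow> (\<Sum>t | t < K \<and> K - 1 - t < j. f t) = (\<Sum>t<j. f (K - 1 - t))"
  by (intro sum.reindex_bij_witness[of _ "\<lambda>t. K - 1 - t" "\<lambda>t. K - 1 - t"]) auto

context
  fixes r m :: nat
  assumes m: "m > 0" and r: "r \<ge> 2"
begin

text \<open>Rank of a letter among those of magnitude at most \<open>m\<close>: consecutive blocks
  of \<open>m\<close> letters, one for each exponent of \<open>\<zeta>\<close>, the largest exponent
  lowest.\<close>

definition pos :: "signed \<Rightarrow> nat" where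
  "pos x = (r - 1 - lev x) * m + (mag x - 1)"

lemma bij_pos: "bij_betw pos (letters r m) {..<r * m}"
proof (rule bij_betw_byWitness[where f' = "\<lambda>t. Signed (t mod m + 1) (r - 1 - t div m)"])
  show "\<forall>x\<in>letters r m. Signed (pos x mod m + 1) (r - 1 - pos x div m) = x"
    using m by (auto simp: letters_def pos_def)
  show "\<forall>t\<in>{..<r * m}. pos (Signed (t mod m + 1) (r - 1 - t div m)) = t"
  proof
    fix t assume "t \<in> {..<r * m}"
    then have "t div m < r" by (simp add: less_mult_imp_div_less)
    then have "t div m \<le> r - 1" by simp
    then show "pos (Signed (t mod m + 1) (r - 1 - t div m)) = t"
      using div_mult_mod_eq[of t m] diff_diff_cancel[of "t div m" "r - 1"] by (simp add: pos_def del: diff_diff_left)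
  qed
  show "pos ` letters r m \<subseteq> {..<r * m}"
  proof (rule image_subsetI)
    fix x assume "x \<in> letters r m"
    then obtain a k where *: "x = Signed a k" "1 \<le> a" "a \<le> m" "k < r" by (auto simp: letters_def)
    then have "(r - Suc k) * m + (a - 1) < (r - Suc k) * m + m" by auto
    also have "\<dots> = (r - k) * m" using * by (metis Suc_diff_Suc mult_Suc add.commute)
    also have "\<dots> \<le> r * m" by simp
    finally show "pos x \<in> {..<r * m}" using * by (simp add: pos_def)
  qed
  show "(\<lambda>t. Signed (t mod m + 1) (r - 1 - t div m)) ` {..<r * m} \<subseteq> letters r m"
    using m r by (auto simp: letters_def Suc_leI)
qed

lemma pos_less: "x \<in> letters r m \<Longrightarrow> pos x < r * m"
  using bij_pos by (auto simp: bij_betw_def)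

lemma prec_iff_pos:
  assumes "x \<in> letters r m" "y \<in> letters r m" shows "prec 2 x y \<longleftrightarrow> pos x < pos y"
proof -
  obtain a k b l where x: "x = Signed a k" "1 \<le> a" "a \<le> m" "k < r" and y: "y = Signed b l" "1 \<le> b" "b \<le> m" "l < r"
    using assms by (auto simp: letters_def)
  have *: "u * m + s < v * m + t" if "u < v" "s < m" for u v s t :: nat
  proof -
    have "u * m + s < Suc u * m" using that(2) by simp
    also have "\<dots> \<le> v * m" using that(1) by (intro mult_le_mono1) simp
    finally show ?thesis by simp
  qed
  consider "k < l" | "k = l" | "l < k" by linarith
  then show ?thesis
  proof cases
    case 1
    then have "r - 1 - l < r - 1 - k" "b - 1 < m" using x y by auto
    then have "pos y < pos x" using *[of "r - 1 - l" "r - 1 - k" "b - 1" "a - 1"] x y by (simp add: pos_def)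
    then show ?thesis using 1 x y by simp
  next
    case 2
    then show ?thesis using x y by (auto simp: pos_def)
  next
    case 3
    then have "r - 1 - k < r - 1 - l" "a - 1 < m" using x y by auto
    then have "pos x < pos y" using *[of "r - 1 - k" "r - 1 - l" "a - 1" "b - 1"] x y by (simp add: pos_def)
    then show ?thesis using 3 x y by simp
  qed
qed

text \<open>The letters above 0 have exponent 0 or 1. They fill the two top blocks, hence the bound
  \<open>2 * m\<close> on the distance from the top.\<close>

lemma prec_Zero_iff_pos:
  assumes "x \<in> letters r m" shows "prec 2 Zero x \<longleftrightarrow> r * m - 1 - pos x < 2 * m"
proof -
  obtain a k where x: "x = Signed a k" "1 \<le> a" "a \<le> m" "k < r" using assms by (auto simp: letters_def)
  have 1: "r * m = (r - 1 - k) * m + m + k * m"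
    using x(4) by (metis Suc_diff_Suc add.commute diff_Suc_1 diff_commute diff_diff_left mult_Suc
        add_mult_distrib le_add_diff_inverse less_imp_le_nat plus_1_eq_Suc)
  have "r * m - 1 - pos x = k * m + (m - a)"
    unfolding 1 pos_def using x by simp
  moreover have "k * m + (m - a) < 2 * m \<longleftrightarrow> k < 2"
  proof
    assume *: "k * m + (m - a) < 2 * m"
    show "k < 2"
    proof (rule ccontr)
      assume "\<not> k < 2"
      then have "2 * m \<le> k * m" by (intro mult_le_mono1) simp
      then show False using * by linarith
    qed
  next
    assume "k < 2"
    then have "k * m \<le> 1 * m" by (intro mult_le_mono1) simp
    then show "k * m + (m - a) < 2 * m" using x(2) m by linarith
  qed
  ultimately show ?thesis using x by simp
qed

lemma card_Cons_words:
  assumes "L \<subseteq> letters r m"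
  shows "card {xs \<in> sgwords r m (Suc d). hd xs \<in> L \<and> P (hd xs) (tl xs)} =
    (\<Sum>x\<in>L. card {xs \<in> sgwords r m d. P x xs})"
proof -
  have fin: "finite (sgwords r m d)"
    unfolding sgwords_def using finite_lists_length_eq[OF finite_letters, of r m d]
    by (simp add: conj_commute)
  have "bij_betw (\<lambda>(x, xs). x # xs) (SIGMA x:L. {xs \<in> sgwords r m d. P x xs})
      {xs \<in> sgwords r m (Suc d). hd xs \<in> L \<and> P (hd xs) (tl xs)}"
    using assms
    by (intro bij_betw_byWitness[where f' = "\<lambda>xs. (hd xs, tl xs)"])
       (auto simp: sgwords_def length_Suc_conv)
  then have "card {xs \<in> sgwords r m (Suc d). hd xs \<in> L \<and> P (hd xs) (tl xs)} =
      card (SIGMA x:L. {xs \<in> sgwords r m d. P x xs})"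
    by (simp add: bij_betw_same_card)
  also have "\<dots> = (\<Sum>x\<in>L. card {xs \<in> sgwords r m d. P x xs})"
    using fin finite_subset[OF assms finite_letters] by (intro card_SigmaI) auto
  finally show ?thesis .
qed

lemma sum_letters: "(\<Sum>x\<in>{x \<in> letters r m. Q (pos x)}. f (pos x)) = (\<Sum>t\<in>{t. t < r * m \<and> Q t}. f t)"
proof -
  have "bij_betw pos {x \<in> letters r m. Q (pos x)} {t. t < r * m \<and> Q t}"
    using bij_pos by (auto simp: bij_betw_def inj_on_def image_iff)
  then show ?thesis by (rule sum.reindex_bij_betw)
qed

text \<open>The last argument of \<open>zigzag\<close> is the number of letters on the admissible
  side of \<open>y\<close>. Reversing the ranks exchanges ascents and descents, so a single count
  covers both directions.\<close>

lemma card_altl: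
  assumes "y \<in> letters r m"
  shows "card {xs \<in> sgwords r m d. altl b y xs} =
    zigzag d (r * m - 1) (if b then r * m - 1 - pos y else pos y)"
  using assms
proof (induction d arbitrary: b y)
  case 0
  have "{xs \<in> sgwords r m 0. altl b y xs} = {[]}" by (auto simp: sgwords_def)
  then show ?case by simp
next
  case (Suc d)
  let ?L = "{x \<in> letters r m. if b then pos y < pos x else pos x < pos y}"
  have "{xs \<in> sgwords r m (Suc d). altl b y xs} =
      {xs \<in> sgwords r m (Suc d). hd xs \<in> ?L \<and> altl (\<not> b) (hd xs) (tl xs)}"
    using Suc.prems by (auto simp: sgwords_def length_Suc_conv prec_iff_pos split: if_splits)
  then have "card {xs \<in> sgwords r m (Suc d). altl b y xs} =
      (\<Sum>x\<in>?L. card {xs \<in> sgwords r m d. altl (\<not> b) x xs})"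
    using card_Cons_words[of ?L d "\<lambda>x. altl (\<not> b) x"] by simp
  also have "\<dots> = (\<Sum>x\<in>?L. zigzag d (r * m - 1) (if \<not> b then r * m - 1 - pos x else pos x))"
    by (rule sum.cong[OF refl], rule Suc.IH) auto
  also have "\<dots> = (\<Sum>t\<in>{t. t < r * m \<and> (if b then pos y < t else t < pos y)}.
      zigzag d (r * m - 1) (if \<not> b then r * m - 1 - t else t))"
    by (rule sum_letters)
  also have "\<dots> = zigzag (Suc d) (r * m - 1) (if b then r * m - 1 - pos y else pos y)"
  proof (cases b)
    case True
    show ?thesis using True pos_less[OF Suc.prems]
      by (simp, intro sum.reindex_bij_witness[of _ "\<lambda>t. r * m - 1 - t" "\<lambda>t. r * m - 1 - t"]) auto
  next
    case False
    then have "{t. t < r * m \<and> (if b then pos y < t else t < pos y)} = {..<pos y}"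
      using pos_less[OF Suc.prems] by auto
    then show ?thesis using False by simp
  qed
  finally show ?case .
qed

lemma card_alternating_words:
  assumes "d \<ge> 1"
  shows "card {xs \<in> sgwords r m d. alternating 2 xs} = zigzag d (r * m - 1) (2 * m)"
proof -
  obtain n where d: "d = Suc n" using assms by (cases d) auto
  have K: "2 * m \<le> r * m" using r by (intro mult_le_mono1) simp
  let ?L = "{x \<in> letters r m. r * m - 1 - pos x < 2 * m}"
  have "{xs \<in> sgwords r m d. alternating 2 xs} =
      {xs \<in> sgwords r m (Suc n). hd xs \<in> ?L \<and> altl False (hd xs) (tl xs)}"
    unfolding alternating_iff_altl d by (auto simp: sgwords_def length_Suc_conv prec_Zero_iff_pos)
  then have "card {xs \<in> sgwords r m d. alternating 2 xs} =
      (\<Sum>x\<in>?L. card {xs \<in> sgwords r m n. altl False x xs})"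
    using card_Cons_words[of ?L n "altl False"] by simp
  also have "\<dots> = (\<Sum>x\<in>?L. zigzag n (r * m - 1) (pos x))"
    by (rule sum.cong[OF refl]) (simp add: card_altl)
  also have "\<dots> = (\<Sum>t\<in>{t. t < r * m \<and> r * m - 1 - t < 2 * m}. zigzag n (r * m - 1) t)"
    by (rule sum_letters)
  also have "\<dots> = zigzag d (r * m - 1) (2 * m)"
    unfolding d zigzag.simps by (rule sum_top[OF K])
  finally show ?thesis .
qed

end

section \<open>Signed permutations among the words\<close>

lemma mag_lev_eq: "x \<in> letters r m \<Longrightarrow> Signed (mag x) (lev x) = x"
  by (auto simp: letters_def)

lemma bij_distinct_words:
  "bij_betw (\<lambda>xs. (map mag xs, map lev xs)) {xs \<in> sgwords r m d. distinct (map mag xs)}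
    ({as. length as = d \<and> distinct as \<and> set as \<subseteq> {1..m}} \<times> {ks. set ks \<subseteq> {..<r} \<and> length ks = d})"
proof (rule bij_betw_byWitness[where f' = "\<lambda>(as, ks). map2 Signed as ks"])
  show "\<forall>xs\<in>{xs \<in> sgwords r m d. distinct (map mag xs)}.
      (case (map mag xs, map lev xs) of (as, ks) \<Rightarrow> map2 Signed as ks) = xs"
    by (auto simp: sgwords_def map2_map_map intro!: map_idI mag_lev_eq)
  have l: "map mag (map2 Signed as ks) = as" "map lev (map2 Signed as ks) = ks"
    if "length as = length ks" for as ks
    using that by (induction as ks rule: list_induct2) auto
  show "\<forall>ak\<in>{as. length as = d \<and> distinct as \<and> set as \<subseteq> {1..m}} \<times> {ks. set ks \<subseteq> {..<r} \<and> length ks = d}.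
      (map mag (case ak of (as, ks) \<Rightarrow> map2 Signed as ks), map lev (case ak of (as, ks) \<Rightarrow> map2 Signed as ks)) = ak"
    using l by auto
  show "(\<lambda>xs. (map mag xs, map lev xs)) ` {xs \<in> sgwords r m d. distinct (map mag xs)}
      \<subseteq> {as. length as = d \<and> distinct as \<and> set as \<subseteq> {1..m}} \<times> {ks. set ks \<subseteq> {..<r} \<and> length ks = d}"
    by (force simp: sgwords_def letters_def)
  show "(\<lambda>(as, ks). map2 Signed as ks) ` ({as. length as = d \<and> distinct as \<and> set as \<subseteq> {1..m}} \<times>
      {ks. set ks \<subseteq> {..<r} \<and> length ks = d}) \<subseteq> {xs \<in> sgwords r m d. distinct (map mag xs)}"
  proof (rule image_subsetI, clarify)
    fix as ks assume *: "distinct as" "set as \<subseteq> {1..m}" "set ks \<subseteq> {..<r}" "d = length as" "length ks = length as"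
    have "Signed a k \<in> letters r m" if "(a, k) \<in> set (zip as ks)" for a k
      using set_zip_leftD[OF that] set_zip_rightD[OF that] *(2,3) by (auto simp: letters_def)
    moreover have "distinct (map mag (map2 Signed as ks))" using l(1)[of as ks] * by simp
    ultimately show "map2 Signed as ks \<in> sgwords r m (length as) \<and> distinct (map mag (map2 Signed as ks))"
      using * by (auto simp: sgwords_def)
  qed
qed

lemma signed_permutations_eq:
  "signed_permutations r d = {xs \<in> sgwords r d d. distinct (map mag xs)}"
proof -
  have "signed_permutations r d = (\<lambda>(as, ks). map2 Signed as ks) `
      ({as. length as = d \<and> distinct as \<and> set as \<subseteq> {1..d}} \<times> {ks. set ks \<subseteq> {..<r} \<and> length ks = d})"
  proof -
    have "distinct as \<and> set as = {1..d} \<longleftrightarrow> length as = d \<and> distinct as \<and> set as \<subseteq> {1..d}" for as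
      by (metis card_atLeastAtMost card_subset_eq diff_Suc_1 distinct_card finite_atLeastAtMost order_refl)
    then show ?thesis unfolding signed_permutations_def by (auto simp: image_iff) blast+
  qed
  also have "\<dots> = {xs \<in> sgwords r d d. distinct (map mag xs)}"
  proof -
    have *: "map2 Signed (map mag xs) (map lev xs) = xs" if "xs \<in> sgwords r d d" for xs
      using that by (auto simp: sgwords_def map2_map_map intro!: map_idI mag_lev_eq)
    show ?thesis
      unfolding bij_betw_imp_surj_on[OF bij_distinct_words, symmetric] image_image
      using * by (auto simp: image_iff)
  qed
  finally show ?thesis .
qed

lemma altl_map:
  assumes "\<And>x x'. x \<in> insert y (set xs) \<Longrightarrow> x' \<in> insert y (set xs) \<Longrightarrow> prec 2 (f x) (f x') \<longleftrightarrow> prec 2 x x'"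
  shows "altl b (f y) (map f xs) \<longleftrightarrow> altl b y xs"
  using assms by (induction xs arbitrary: b y) auto

text \<open>Magnitudes are compared only within one exponent, so relabelling them by the increasing
  bijection from \<open>{1..d}\<close> to \<open>B\<close> preserves the order, also relative to
  \<open>Zero\<close>. Each set \<open>B\<close> of magnitudes thus carries one copy of the
  alternating signed permutations.\<close>

lemma card_alternating_words_on:
  assumes B: "B \<subseteq> {1..m}" "card B = d"
  shows "card {xs \<in> sgwords r m d. distinct (map mag xs) \<and> mag ` set xs = B \<and> alternating 2 xs} = N_alt d 2 r"
proof -
  have fB: "finite B" using B(1) finite_subset by blast
  define g where "g = (\<lambda>i. sorted_list_of_set B ! (i - 1))"
  have mono: "g i < g j" if "1 \<le> i" "i < j" "j \<le> d" for i j
    unfolding g_def using that B(2)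
    by (intro sorted_wrt_nth_less[OF strict_sorted_list_of_set]) auto
  have gB: "bij_betw g {1..d} B"
    unfolding bij_betw_def
  proof
    show inj: "inj_on g {1..d}"
      by (rule linorder_inj_onI) (use mono in \<open>auto dest: less_imp_neq\<close>)
    have "g ` {1..d} \<subseteq> B"
      using B(2) fB nth_mem[of _ "sorted_list_of_set B"] by (auto simp: g_def)
    then show "g ` {1..d} = B"
      using card_image[OF inj] B(2) fB by (intro card_subset_eq) auto
  qed
  have iff: "g i < g j \<longleftrightarrow> i < j" "g i = g j \<longleftrightarrow> i = j" if "i \<in> {1..d}" "j \<in> {1..d}" for i j
    using mono[of i j] mono[of j i] that by (cases i j rule: linorder_cases; auto)+
  define f where "f = (\<lambda>x. case x of Signed a k \<Rightarrow> Signed (g a) k | Zero \<Rightarrow> Zero)"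
  define h where "h = (\<lambda>x. case x of Signed a k \<Rightarrow> Signed (inv_into {1..d} g a) k | Zero \<Rightarrow> Zero)"
  have fprec: "prec 2 (f x) (f x') \<longleftrightarrow> prec 2 x x'"
    if "x \<in> insert Zero (letters r d)" "x' \<in> insert Zero (letters r d)" for x x'
    using that iff by (auto simp: f_def letters_def)
  have gB': "g a \<in> B" if "a \<in> {1..d}" for a using gB that by (auto simp: bij_betw_def)
  have gi: "inv_into {1..d} g (g a) = a" if "a \<in> {1..d}" for a
    using gB that by (simp add: bij_betw_inv_into_left)
  have ig: "g (inv_into {1..d} g a) = a" "inv_into {1..d} g a \<in> {1..d}" if "a \<in> B" for a
    using gB that by (auto simp: bij_betw_inv_into_right bij_betw_def inv_into_into)
  have mf: "map mag (map f xs) = map g (map mag xs)" if "set xs \<subseteq> letters r d" for xs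
    using that by (auto simp: f_def letters_def)
  have mag: "mag x \<in> {1..n}" if "x \<in> letters r n" for x n using that by (auto simp: letters_def)
  have "bij_betw (map f) {xs \<in> signed_permutations r d. alternating 2 xs}
     {xs \<in> sgwords r m d. distinct (map mag xs) \<and> mag ` set xs = B \<and> alternating 2 xs}"
  proof (rule bij_betw_byWitness[where f' = "map h"])
    show "\<forall>xs\<in>{xs \<in> signed_permutations r d. alternating 2 xs}. map h (map f xs) = xs"
      using gi by (auto simp: signed_permutations_eq sgwords_def f_def h_def letters_def intro!: map_idI)
    show "\<forall>xs\<in>{xs \<in> sgwords r m d. distinct (map mag xs) \<and> mag ` set xs = B \<and> alternating 2 xs}.
        map f (map h xs) = xs"
      using ig by (auto simp: sgwords_def f_def h_def letters_def intro!: map_idI) force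
    show "map f ` {xs \<in> signed_permutations r d. alternating 2 xs} \<subseteq>
        {xs \<in> sgwords r m d. distinct (map mag xs) \<and> mag ` set xs = B \<and> alternating 2 xs}"
    proof (rule image_subsetI)
      fix xs assume "xs \<in> {xs \<in> signed_permutations r d. alternating 2 xs}"
      then have xs: "length xs = d" "set xs \<subseteq> letters r d" "distinct (map mag xs)" "altl True Zero xs"
        by (auto simp: signed_permutations_eq sgwords_def alternating_iff_altl)
      have sub: "set (map mag xs) \<subseteq> {1..d}" using xs(2) mag by force
      have eq: "set (map mag xs) = {1..d}"
        using sub distinct_card[OF xs(3)] xs(1) by (intro card_subset_eq) auto
      have "inj_on g (set (map mag xs))"
        using gB sub unfolding bij_betw_def by (blast intro: inj_on_subset)
      then have "distinct (map mag (map f xs))"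
        unfolding mf[OF xs(2)] distinct_map[of g] using xs(3) by blast
      moreover have "mag ` set (map f xs) = B"
      proof -
        have "mag ` set (map f xs) = set (map mag (map f xs))" by (simp only: set_map)
        also have "\<dots> = g ` set (map mag xs)" unfolding mf[OF xs(2)] by (simp only: set_map)
        finally show ?thesis unfolding eq using gB by (simp add: bij_betw_def)
      qed
      moreover have "set (map f xs) \<subseteq> letters r m"
        using xs(2) gB' B(1) by (force simp: f_def letters_def)
      moreover have "altl True (f Zero) (map f xs)"
        using xs(2,4) by (subst altl_map) (auto intro!: fprec)
      ultimately show "map f xs \<in> {xs \<in> sgwords r m d. distinct (map mag xs) \<and> mag ` set xs = B \<and> alternating 2 xs}"
        using xs(1) by (auto simp: sgwords_def alternating_iff_altl f_def)
    qed
    show "map h ` {xs \<in> sgwords r m d. distinct (map mag xs) \<and> mag ` set xs = B \<and> alternating 2 xs} \<subseteq>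
        {xs \<in> signed_permutations r d. alternating 2 xs}"
    proof (rule image_subsetI)
      fix xs assume "xs \<in> {xs \<in> sgwords r m d. distinct (map mag xs) \<and> mag ` set xs = B \<and> alternating 2 xs}"
      then have xs: "length xs = d" "set xs \<subseteq> letters r m" "distinct (map mag xs)" "mag ` set xs = B"
          "altl True Zero xs"
        by (auto simp: sgwords_def alternating_iff_altl)
      have L: "set (map h xs) \<subseteq> letters r d"
        using xs(2,4) ig(2) by (force simp: h_def letters_def)
      have fh: "map f (map h xs) = xs"
        using xs(2,4) ig(1) by (auto simp: f_def h_def letters_def intro!: map_idI) force
      have "distinct (map g (map mag (map h xs)))" unfolding mf[OF L, symmetric] fh by (rule xs(3))
      then have "distinct (map mag (map h xs))" by (simp only: distinct_map[of g])
      moreover have "altl True Zero (map h xs)"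
      proof -
        have "altl True (f Zero) (map f (map h xs))" using xs(5) unfolding fh by (simp add: f_def)
        then show ?thesis using L by (subst (asm) altl_map) (auto intro!: fprec)
      qed
      ultimately show "map h xs \<in> {xs \<in> signed_permutations r d. alternating 2 xs}"
        using L xs(1) by (simp add: signed_permutations_eq sgwords_def alternating_iff_altl)
    qed
  qed
  then show ?thesis unfolding N_alt_def by (simp add: bij_betw_same_card)
qed

lemma finite_sgwords: "finite (sgwords r m d)"
  unfolding sgwords_def using finite_lists_length_eq[OF finite_letters, of r m d]
  by (simp add: conj_commute)

lemma card_distinct_alternating_words:
  "card {xs \<in> sgwords r m d. distinct (map mag xs) \<and> alternating 2 xs} = (m choose d) * N_alt d 2 r"
proof -
  let ?S = "{B. B \<subseteq> {1..m} \<and> card B = d}"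
  let ?A = "\<lambda>B. {xs \<in> sgwords r m d. distinct (map mag xs) \<and> mag ` set xs = B \<and> alternating 2 xs}"
  have "mag ` set xs \<in> ?S" if "xs \<in> sgwords r m d" "distinct (map mag xs)" for xs
    using that distinct_card[OF that(2)] by (force simp: sgwords_def letters_def)
  then have "{xs \<in> sgwords r m d. distinct (map mag xs) \<and> alternating 2 xs} = (\<Union>B\<in>?S. ?A B)"
    by auto
  also have "card \<dots> = (\<Sum>B\<in>?S. card (?A B))"
    by (rule card_UN_disjoint) (auto simp: finite_sgwords)
  also have "\<dots> = (\<Sum>B\<in>?S. N_alt d 2 r)"
    by (rule sum.cong[OF refl]) (simp only: mem_Collect_eq card_alternating_words_on)
  also have "\<dots> = (m choose d) * N_alt d 2 r"
    using n_subsets[of "{1..m}" d] by simp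
  finally show ?thesis .
qed

lemma card_sgwords: "card (sgwords r m d) = (r * m) ^ d"
  unfolding sgwords_def using card_lists_length_eq[OF finite_letters, of r m d]
  by (simp add: conj_commute card_letters)

lemma card_distinct_sgwords:
  "card {xs \<in> sgwords r m d. distinct (map mag xs)} = fact d * (m choose d) * r ^ d"
proof -
  have "card {as. length as = d \<and> distinct as \<and> set as \<subseteq> {1..m}} = fact d * (m choose d)"
  proof (cases "d \<le> m")
    case True
    then have "card {as. length as = d \<and> distinct as \<and> set as \<subseteq> {1..m}} = \<Prod>{m - d + 1..m}"
      using card_lists_distinct_length_eq[of "{1..m}" d] by simp
    also have "\<dots> = fact m div fact (m - d)"
      using fact_div_fact[of "m - d" m] by simp
    also have "\<dots> = fact d * (m choose d)"
      using True by (metis binomial_fact_lemma fact_nonzero mult.assoc mult.commute nonzero_mult_div_cancel_right)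
    finally show ?thesis .
  next
    case False
    have E: "{as. length as = d \<and> distinct as \<and> set as \<subseteq> {1..m}} = {}"
    proof (rule equals0I)
      fix as assume "as \<in> {as. length as = d \<and> distinct as \<and> set as \<subseteq> {1..m}}"
      then have "d \<le> card {1..m}" using distinct_card[of as] card_mono[of "{1..m}" "set as"] by auto
      then show False using False by simp
    qed
    show ?thesis unfolding E using False by simp
  qed
  moreover have "card {ks. set ks \<subseteq> {..<r} \<and> length ks = d} = r ^ d"
    using card_lists_length_eq[of "{..<r}" d] by simp
  ultimately show ?thesis
    using bij_betw_same_card[OF bij_distinct_words, of r m d] by (simp add: card_cartesian_product)
qed

lemma binomial_over_power_tendsto: "(\<lambda>m. real (m choose d) / real m ^ d) \<longlonglongrightarrow> 1 / fact d"
proof -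
  have "(\<lambda>m. \<Prod>i<d. (real m - real i) / (real m * real (d - i))) \<longlonglongrightarrow> (\<Prod>i<d. 1 / real (d - i))"
  proof (rule tendsto_prod)
    fix i assume "i \<in> {..<d}"
    have "(\<lambda>m. (1 - real i / real m) / real (d - i)) \<longlonglongrightarrow> (1 - 0) / real (d - i)"
      using \<open>i \<in> {..<d}\<close> by (intro tendsto_intros tendsto_divide_0[OF tendsto_const] filterlim_real_sequentially filterlim_at_top_imp_at_infinity) auto
    moreover have "eventually (\<lambda>m. (1 - real i / real m) / real (d - i) =
        (real m - real i) / (real m * real (d - i))) sequentially"
      using eventually_gt_at_top[of 0] by eventually_elim (auto simp: field_simps)
    ultimately show "(\<lambda>m. (real m - real i) / (real m * real (d - i))) \<longlonglongrightarrow> 1 / real (d - i)"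
      using Lim_transform_eventually by fastforce
  qed
  moreover have "(\<Prod>i<d. 1 / real (d - i)) = 1 / fact d"
  proof -
    have "(\<Prod>i<d. real (d - i)) = fact d"
      unfolding fact_prod_rev by (simp add: atLeast0LessThan)
    then show ?thesis by (simp add: prod_dividef)
  qed
  moreover have "eventually (\<lambda>m. (\<Prod>i<d. (real m - real i) / (real m * real (d - i))) = real (m choose d) / real m ^ d) sequentially"
    using eventually_ge_at_top[of d]
  proof eventually_elim
    case (elim m)
    have "real (m choose d) = (\<Prod>i<d. real (m - i) / real (d - i))"
      using binomial_altdef_of_nat[OF elim, where 'a = real] by (simp add: atLeast0LessThan)
    also have "\<dots> = (\<Prod>i<d. (real m - real i) / real (d - i))"
      using elim by (intro prod.cong) (auto simp: of_nat_diff)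
    finally have "real (m choose d) / real m ^ d = (\<Prod>i<d. (real m - real i) / real (d - i) / real m)"
      by (simp only: prod_dividef prod_constant card_lessThan)
    then show ?case by (simp only: divide_divide_eq_left mult.commute)
  qed
  ultimately show ?thesis by (auto elim: Lim_transform_eventually)
qed

lemma zigzag_over_power_tendsto:
  assumes d: "d \<ge> 1" and r: "r \<ge> 2"
  shows "(\<lambda>m. real (zigzag d (r * m - 1) (2 * m)) / real m ^ d) \<longlonglongrightarrow> real (N_alt d 2 r) / fact d"
proof (rule tendsto_sandwich)
  let ?l = "\<lambda>m. real (m choose d) / real m ^ d"
  \<comment> \<open>The upper bound treats every word with a repeated magnitude as alternating;
    there are only \<open>o(m^d)\<close> of these.\<close>
  have bounds: "real (m choose d) * real (N_alt d 2 r) \<le> real (zigzag d (r * m - 1) (2 * m)) \<and>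
      real (zigzag d (r * m - 1) (2 * m)) \<le> real (m choose d) * real (N_alt d 2 r) +
        real r ^ d * (real m ^ d - fact d * real (m choose d))" if m: "m > 0" for m
  proof -
    let ?D = "{xs \<in> sgwords r m d. distinct (map mag xs)}"
    let ?A = "{xs \<in> sgwords r m d. alternating 2 xs}"
    have 1: "card (?D \<inter> ?A) = (m choose d) * N_alt d 2 r"
    proof -
      have "?D \<inter> ?A = {xs \<in> sgwords r m d. distinct (map mag xs) \<and> alternating 2 xs}" by blast
      then show ?thesis using card_distinct_alternating_words[of r m d] by simp
    qed
    have 2: "card ?A = zigzag d (r * m - 1) (2 * m)" by (rule card_alternating_words[OF m r d])
    have fin: "finite ?A" "finite ?D" by (auto simp: finite_sgwords)
    have "card (?D \<inter> ?A) \<le> card ?A" by (rule card_mono) (auto simp: fin)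
    moreover have "card ?A \<le> card ((?D \<inter> ?A) \<union> (sgwords r m d - ?D))"
      by (rule card_mono) (auto simp: finite_sgwords)
    moreover have "card ((?D \<inter> ?A) \<union> (sgwords r m d - ?D)) \<le> card (?D \<inter> ?A) + card (sgwords r m d - ?D)"
      by (rule card_Un_le)
    moreover have "real (card (sgwords r m d - ?D)) = real (card (sgwords r m d)) - real (card ?D)"
      by (subst card_Diff_subset) (auto simp: finite_sgwords of_nat_diff card_mono)
    moreover have "real (card (sgwords r m d)) - real (card ?D) = real r ^ d * (real m ^ d - fact d * real (m choose d))"
      unfolding card_sgwords card_distinct_sgwords by (simp add: algebra_simps power_mult_distrib)
    ultimately show ?thesis unfolding 1 2 by (simp flip: of_nat_mult)
  qed
  show "\<forall>\<^sub>F m in sequentially. ?l m * real (N_alt d 2 r) \<le> real (zigzag d (r * m - 1) (2 * m)) / real m ^ d"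
    using eventually_gt_at_top[of 0]
  proof eventually_elim
    case (elim m)
    then show ?case using bounds[OF elim] by (simp add: divide_right_mono)
  qed
  show "\<forall>\<^sub>F m in sequentially. real (zigzag d (r * m - 1) (2 * m)) / real m ^ d \<le>
      ?l m * real (N_alt d 2 r) + real r ^ d * (1 - fact d * ?l m)"
    using eventually_gt_at_top[of 0]
  proof eventually_elim
    case (elim m)
    have "real (zigzag d (r * m - 1) (2 * m)) / real m ^ d \<le> (real (m choose d) * real (N_alt d 2 r) +
        real r ^ d * (real m ^ d - fact d * real (m choose d))) / real m ^ d"
      using bounds[OF elim] elim by (intro divide_right_mono) auto
    also have "\<dots> = ?l m * real (N_alt d 2 r) + real r ^ d * (1 - fact d * ?l m)"
      using elim by (simp add: field_simps)
    finally show ?case .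
  qed
  show "(\<lambda>m. ?l m * real (N_alt d 2 r)) \<longlonglongrightarrow> real (N_alt d 2 r) / fact d"
    using tendsto_mult[OF binomial_over_power_tendsto[of d] tendsto_const[of "real (N_alt d 2 r)"]] by simp
  have "(\<lambda>m. ?l m * real (N_alt d 2 r) + real r ^ d * (1 - fact d * ?l m)) \<longlonglongrightarrow>
      1 / fact d * real (N_alt d 2 r) + real r ^ d * (1 - fact d * (1 / fact d))"
    by (intro tendsto_intros binomial_over_power_tendsto)
  then show "(\<lambda>m. ?l m * real (N_alt d 2 r) + real r ^ d * (1 - fact d * ?l m)) \<longlonglongrightarrow>
      real (N_alt d 2 r) / fact d" by simp
qed

section \<open>Limits\<close>

definition quad_log_ker :: "nat \<Rightarrow> nat set \<Rightarrow> nat \<Rightarrow> nat \<Rightarrow> real" where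
  "quad_log_ker p I q j = log_ker p (W p I (\<lambda>_. q)) (gop I (\<lambda>_. 2)) j"

lemma log_card_W:
  assumes "prime p" "finite I" shows "log p (card (W p I (\<lambda>_. q))) = real q ^ card I"
proof -
  have p: "p > 1" using assms(1) prime_gt_1_nat by blast
  then have "log (real p) (real p ^ (q ^ card I)) = real (q ^ card I)"
    by (simp add: log_nat_power)
  then show ?thesis using p by (simp add: card_W assms(2))
qed

lemma quad_log_ker_insert:
  assumes "prime p" "finite I" "c \<notin> I"
  shows "quad_log_ker p (insert c I) q j = log_ker p (xt q (W p I (\<lambda>_. q))) (xop (gop I (\<lambda>_. 2)) 2) j"
  using ker_card_W_insert[OF prime_gt_0_nat[OF assms(1)] assms(2,3), of "\<lambda>_. q" "\<lambda>_. 2" j]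
  by (simp add: quad_log_ker_def log_ker_def)

lemma gop_nilpotent:
  assumes "prime p" "finite I" "v \<in> W p I (\<lambda>_. p)"
  shows "(gop I (\<lambda>_. 2) ^^ p) v = 0"
proof -
  have "v (\<alpha> + single i (p * 2)) = 0" if "i \<in> I" for i \<alpha>
    using WD(2)[OF assms(3) _ that, of "\<alpha> + single i (p * 2)"] by (auto simp: lookup_add)
  then show ?thesis
    unfolding funpow_prime_gop[OF assms(1,2,2,3)] by (simp add: gop_def fun_eq_iff)
qed

text \<open>For \<open>p = 2 * a + 1\<close> the paired indices satisfy
  \<open>a + 1 + t = p - (a - t)\<close>, the form in which reflection applies.\<close>

lemma sum_centered:
  fixes f :: "nat \<Rightarrow> real"
  shows "j \<le> a \<Longrightarrow> (\<Sum>i=a-j+1..a+j. f i) = (\<Sum>t<j. f (a - t) + f (a + 1 + t))"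
proof (induction j)
  case (Suc j)
  have "{a - Suc j + 1..a + Suc j} = insert (a - j) (insert (a + 1 + j) {a - j + 1..a + j})"
    using Suc.prems by auto
  then have "(\<Sum>i=a-Suc j+1..a+Suc j. f i) = f (a - j) + f (a + 1 + j) + (\<Sum>i=a-j+1..a+j. f i)"
    using Suc.prems by simp
  then show ?case using Suc by simp
qed simp

text \<open>Induction on the number of variables. The window sum is folded by reflection, which
  replaces the value at \<open>p - i\<close> by the value at \<open>i\<close> plus
  \<open>(p - 2 i) p^n\<close>. In each pair the terms \<open>2 i p^n\<close> cancel; what remains
  is the constant \<open>p^(n+1)\<close> and twice the value of \<open>zigzag\<close> at
  \<open>i = a - t\<close>, as in the recursion of \<open>zigzag\<close>.\<close>

lemma quad_log_ker_eq_zigzag: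
  assumes "prime p" "p = 2 * a + 1" "finite I" "card I = Suc n" "j \<le> a"
  shows "quad_log_ker p I p j = real j * real p ^ n + 2 ^ n * real (zigzag (Suc n) a j)"
  using assms(3-5)
proof (induction n arbitrary: I j)
  case 0
  then obtain c where c: "I = {c}" by (metis One_nat_def card_1_singletonE)
  have p1: "p > 1" using assms(1) prime_gt_1_nat by blast
  have M: "pgroup p (W p {} (\<lambda>_. p))" using p1 by (intro pgroup_W) auto
  have T: "endo (W p {} (\<lambda>_. p)) (gop {} (\<lambda>_. 2))" using p1 by (intro endo_gop) auto
  \<comment> \<open>Without variables the operator is 0 on \<open>F_p\<close>. The window starts at
    \<open>a - j + 1\<close>, so the exceptional exponent 0 never occurs.\<close>
  have "log_ker p (W p {} (\<lambda>_. p)) (gop {} (\<lambda>_. 2)) i = 1" if "i \<ge> 1" for i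
  proof -
    have "(gop {} (\<lambda>_. 2) ^^ i) v = 0" for v
      using that by (cases i) (auto simp: gop_def fun_eq_iff)
    then have "ker_card (W p {} (\<lambda>_. p)) (gop {} (\<lambda>_. 2)) i = p"
      using p1 by (subst ker_card_nilpotent) (auto simp: card_W)
    then show ?thesis using p1 by (simp add: log_ker_def)
  qed
  then have "quad_log_ker p I p j = (\<Sum>i=a-j+1..a+j. 1)"
    unfolding c quad_log_ker_insert[OF assms(1) finite.emptyI, of c, simplified]
    by (subst log_ker_xt_square[OF assms(1,2) M T gop_nilpotent[OF assms(1) finite.emptyI] 0(3)]) auto
  then show ?case using 0(3) by simp
next
  case (Suc n)
  then obtain c K where K: "I = insert c K" "c \<notin> K" "card K = Suc n" "finite K"
    by (metis card_Suc_eq finite_insert)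
  \<comment> \<open>Reflection for \<open>K\<close> is itself a fact about adjoining one variable,
    so a second variable is split off.\<close>
  then obtain b L where L: "K = insert b L" "b \<notin> L" "card L = n" "finite L"
    by (metis card_Suc_eq finite_insert)
  have p1: "p > 0" using assms(1) prime_gt_0_nat by blast
  note nil = gop_nilpotent[OF assms(1)]
  have rfl: "quad_log_ker p K p (p - i) = quad_log_ker p K p i + (real p - 2 * real i) * real p ^ n" if "i \<le> p" for i
    unfolding L(1) quad_log_ker_insert[OF assms(1) L(4,2)]
    using log_ker_xt_square_reflect[OF assms(1,2) pgroup_W[OF p1 L(4)] endo_gop[OF p1 L(4,4)] nil[OF L(4)] that]
      log_card_W[OF assms(1) L(4), of p] L(3) by simp
  have "quad_log_ker p I p j = (\<Sum>i=a-j+1..a+j. quad_log_ker p K p i)"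
    unfolding K(1) quad_log_ker_insert[OF assms(1) K(4,2)]
    using log_ker_xt_square[OF assms(1,2) pgroup_W[OF p1 K(4)] endo_gop[OF p1 K(4,4)] nil[OF K(4)] Suc.prems(3)]
    by (simp add: quad_log_ker_def)
  also have "\<dots> = (\<Sum>t<j. quad_log_ker p K p (a - t) + quad_log_ker p K p (a + 1 + t))"
    by (rule sum_centered[OF Suc.prems(3)])
  also have "\<dots> = (\<Sum>t<j. real p ^ Suc n + 2 ^ Suc n * real (zigzag (Suc n) a (a - t)))"
  proof (rule sum.cong[OF refl])
    fix t assume "t \<in> {..<j}"
    then have t: "t \<le> a" using Suc.prems(3) by simp
    then have e: "a + 1 + t = p - (a - t)" and le: "a - t \<le> p" using assms(2) by auto
    have "quad_log_ker p K p (a + 1 + t) = quad_log_ker p K p (a - t) + (real p - 2 * real (a - t)) * real p ^ n"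
      unfolding e by (rule rfl[OF le])
    moreover have "quad_log_ker p K p (a - t) = real (a - t) * real p ^ n + 2 ^ n * real (zigzag (Suc n) a (a - t))"
      using K by (intro Suc.IH) auto
    ultimately show "quad_log_ker p K p (a - t) + quad_log_ker p K p (a + 1 + t) =
        real p ^ Suc n + 2 ^ Suc n * real (zigzag (Suc n) a (a - t))"
      by (simp add: algebra_simps)
  qed
  also have "\<dots> = real j * real p ^ Suc n + 2 ^ Suc n * real (zigzag (Suc (Suc n)) a j)"
    by (simp add: sum.distrib sum_distrib_left)
  finally show ?case .
qed

lemma quad_log_ker_dilate:
  assumes "prime p" "finite I"
  shows "quad_log_ker p I (p * q) (p * j) = real p ^ card I * quad_log_ker p I q j"
proof -
  have p0: "p > 0" using assms(1) prime_gt_0_nat by blast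
  let ?M = "W p I (\<lambda>_. p * q)"
  have "ker_card ?M (gop I (\<lambda>_. 2)) (p * j) = ker_card ?M (gop I (\<lambda>_. 2) ^^ p) j"
    by (simp add: ker_card_funpow)
  also have "\<dots> = ker_card ?M (gop I (\<lambda>i. p * 2)) j"
    by (rule ker_card_cong[OF endoD(2)[OF endo_funpow[OF endo_gop[OF p0 assms(2,2)]]]
          funpow_prime_gop[OF assms assms(2)]])
  also have "\<dots> = ker_card (W p I (\<lambda>_. q)) (gop I (\<lambda>_. 2)) j ^ (p ^ card I)"
    by (rule ker_card_W_dilate[OF p0 assms(2) p0])
  finally show ?thesis
    using ker_card_pos[OF pgroup_W[OF p0 assms(2)] endo_gop[OF p0 assms(2,2)], of "\<lambda>_. q" "\<lambda>_. 2" j]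
    by (simp add: quad_log_ker_def log_ker_def log_nat_power)
qed

lemma quad_log_ker_dilate_power:
  assumes "prime p" "finite I"
  shows "quad_log_ker p I (p ^ k * q) (p ^ k * j) = (real p ^ card I) ^ k * quad_log_ker p I q j"
proof (induction k)
  case (Suc k)
  then show ?case using quad_log_ker_dilate[OF assms, of "p ^ k * q" "p ^ k * j"] by (simp add: mult.assoc)
qed simp

lemma quad_log_ker_mono:
  assumes "prime p" "finite I" "i \<le> j" shows "quad_log_ker p I q i \<le> quad_log_ker p I q j"
proof -
  have p: "p > 1" using assms(1) prime_gt_1_nat by blast
  note X = pgroup_W[of p I "\<lambda>_. q"] endo_gop[of p I I "\<lambda>_. q" "\<lambda>_. 2"]
  have "ker_card (W p I (\<lambda>_. q)) (gop I (\<lambda>_. 2)) i \<le> ker_card (W p I (\<lambda>_. q)) (gop I (\<lambda>_. 2)) j"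
    "ker_card (W p I (\<lambda>_. q)) (gop I (\<lambda>_. 2)) i > 0"
    using p assms ker_card_mono[of p] ker_card_pos[of p] X by auto
  then show ?thesis using p by (simp add: quad_log_ker_def log_ker_def)
qed

lemma ker_card_Suc_le:
  assumes M: "pgroup p M" and T: "endo M T"
  shows "ker_card M T (Suc j) \<le> ker_card M T j * ker_card M T 1"
proof -
  let ?V = "{m \<in> M. (T ^^ Suc j) m = 0}" and ?K = "{m \<in> M. (T ^^ j) m = 0}"
  have fin: "finite ?V" "finite {m \<in> M. (T ^^ 1) m = 0}" using pgroupD(1)[OF M] by auto
  note e = endo_funpow[OF T]
  have "card ?V = card ((T ^^ j) ` ?V) * card ?K"
  proof (rule card_eq_card_image_mult_card_kernel[OF fin(1)])
    show "?K \<subseteq> ?V" using funpow_zero_mono[OF T, of j _ "Suc j"] by auto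
    show "x + y \<in> ?V" if "x \<in> ?V" "y \<in> ?K" for x y
      using that funpow_zero_mono[OF T, of j y "Suc j"] pgroupD(3)[OF M]
      by (auto simp: endoD(1)[OF e] endoD(1)[OF T] endo_zero[OF T])
    show "(T ^^ j) x = (T ^^ j) y \<longleftrightarrow> y - x \<in> ?K" if "x \<in> ?V" "y \<in> ?V" for x y
      using that pgroupD(5)[OF M] by (auto simp: endo_diff[OF e])
  qed
  moreover have "card ((T ^^ j) ` ?V) \<le> ker_card M T 1"
    unfolding ker_card_def using endoD(2)[OF e] by (intro card_mono[OF fin(2)]) auto
  ultimately show ?thesis unfolding ker_card_def by (simp add: mult.commute)
qed

text \<open>Each increment is at most the first one. With \<open>x^2\<close> adjoined,
  \<open>ker (T + x^2)\<close> has the size of a product of two kernels in \<open>M\<close>, each at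
  most \<open>card M\<close>, which gives the constant \<open>2 q^n\<close>.\<close>

lemma quad_log_ker_Suc_le:
  assumes "prime p" "finite I" "card I = Suc n"
  shows "quad_log_ker p I q (Suc j) \<le> quad_log_ker p I q j + 2 * real q ^ n"
proof -
  have p: "p > 1" "p > 0" using assms(1) prime_gt_1_nat prime_gt_0_nat by auto
  obtain c K where K: "I = insert c K" "c \<notin> K" "card K = n" "finite K"
    using assms(2,3) by (metis card_Suc_eq finite_insert)
  let ?M = "W p K (\<lambda>_. q)" and ?T = "gop K (\<lambda>_. 2)"
  note M = pgroup_W[OF p(2) K(4), of "\<lambda>_. q"] and T = endo_gop[OF p(2) K(4,4), of "\<lambda>_. q" "\<lambda>_. 2"]
  note N = pgroup_xt[OF M, of q] and U = endo_xop[OF M T, of q 2]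
  have cM: "card ?M > 0" using pgroupD(1,2)[OF M] by (auto simp: card_gt_0_iff)
  have "ker_card (xt q ?M) (xop ?T 2) 1 = (\<Prod>u<2. ker_card ?M ?T ((q - u + 2 - 1) div 2))"
    using card_ker_xop[OF M T, of 2 q] by (simp add: ker_card_one)
  also have "\<dots> \<le> (\<Prod>u<2::nat. card ?M)"
    using pgroupD(1)[OF M] by (intro prod_mono) (auto simp: ker_card_def intro!: card_mono)
  finally have "ker_card (xt q ?M) (xop ?T 2) 1 \<le> card ?M ^ 2" by simp
  then have "ker_card (xt q ?M) (xop ?T 2) (Suc j) \<le> ker_card (xt q ?M) (xop ?T 2) j * card ?M ^ 2"
    by (rule le_trans[OF ker_card_Suc_le[OF N U] mult_le_mono2])
  then have "real (ker_card (xt q ?M) (xop ?T 2) (Suc j)) \<le> real (ker_card (xt q ?M) (xop ?T 2) j) * real (card ?M) ^ 2"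
    by (metis of_nat_le_iff of_nat_mult of_nat_power)
  then have "log p (ker_card (xt q ?M) (xop ?T 2) (Suc j)) \<le> log p (real (ker_card (xt q ?M) (xop ?T 2) j) * real (card ?M) ^ 2)"
    using p ker_card_pos[OF N U] cM by (subst log_le_cancel_iff) auto
  also have "\<dots> = log p (ker_card (xt q ?M) (xop ?T 2) j) + 2 * log p (card ?M)"
    using ker_card_pos[OF N U, of j] cM by (simp add: log_mult_pos log_nat_power)
  finally show ?thesis
    unfolding K(1) quad_log_ker_insert[OF assms(1) K(4,2)] using log_card_W[OF assms(1) K(4), of q] K(3)
    by (simp add: log_ker_def)
qed

definition hk_length :: "nat \<Rightarrow> nat \<Rightarrow> nat \<Rightarrow> nat \<Rightarrow> real" where
  "hk_length p d r q = log p (card {v \<in> W p {..d} (\<lambda>_. q). gop {..d} (\<lambda>i. if i = 0 then r else 2) v = 0})"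

lemma hk_length_bounds:
  assumes "prime p" "r > 0"
  shows "real r * quad_log_ker p {1..d} q (q div r) \<le> hk_length p d r q"
    and "hk_length p d r q \<le> real r * quad_log_ker p {1..d} q (q div r + 1)"
proof -
  have p: "p > 0" "p > 1" using assms(1) prime_gt_1_nat prime_gt_0_nat by auto
  let ?I = "{1..d}" and ?s = "\<lambda>i::nat. if i = 0 then r else 2"
  have I: "{..d} = insert 0 ?I" "0 \<notin> ?I" "finite ?I" by auto
  have g: "gop ?I ?s = gop ?I (\<lambda>_. 2)" by (rule gop_cong) auto
  note M = pgroup_W[OF p(1) I(3), of "\<lambda>_. q"] and T = endo_gop[OF p(1) I(3,3), of "\<lambda>_. q" "\<lambda>_. 2"]
  have "card {v \<in> W p {..d} (\<lambda>_. q). gop {..d} ?s v = 0} =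
      ker_card (W p (insert 0 ?I) (\<lambda>_. q)) (gop (insert 0 ?I) ?s) 1"
    unfolding I(1) by (simp add: ker_card_one)
  also have "\<dots> = ker_card (xt q (W p ?I (\<lambda>_. q))) (xop (gop ?I (\<lambda>_. 2)) r) 1"
    using ker_card_W_insert[OF p(1) I(3,2), of "\<lambda>_. q" ?s 1] unfolding g by simp
  also have "\<dots> = (\<Prod>u<r. ker_card (W p ?I (\<lambda>_. q)) (gop ?I (\<lambda>_. 2)) ((q - u + r - 1) div r))"
    using card_ker_xop[OF M T assms(2), of q] by (simp add: ker_card_one)
  finally have L: "hk_length p d r q = (\<Sum>u<r. quad_log_ker p ?I q ((q - u + r - 1) div r))"
    using p ker_card_pos[OF M T]
    by (simp add: hk_length_def quad_log_ker_def log_ker_def log_def ln_prod sum_divide_distrib)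
  have low: "q div r \<le> (q - u + r - 1) div r" if "u < r" for u
    using that by (intro div_le_mono) auto
  have up: "(q - u + r - 1) div r \<le> q div r + 1" for u
    unfolding ceil_div_le_iff[OF assms(2)] using dividend_less_div_times[OF assms(2), of q]
    by (simp only: add_mult_distrib)
  show "real r * quad_log_ker p ?I q (q div r) \<le> hk_length p d r q"
    unfolding L using sum_mono[of "{..<r}" "\<lambda>_. quad_log_ker p ?I q (q div r)"] quad_log_ker_mono[OF assms(1) I(3) low] by simp
  show "hk_length p d r q \<le> real r * quad_log_ker p ?I q (q div r + 1)"
    unfolding L using sum_mono[of "{..<r}" _ "\<lambda>_. quad_log_ker p ?I q (q div r + 1)"] quad_log_ker_mono[OF assms(1) I(3) up] by simp
qed

text \<open>Level \<open>e\<close> is compared with every level \<open>k \<le> e\<close> by scaling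
  with \<open>p^(e-k)\<close>. The rounding of \<open>p^e / r\<close> costs at most one step of the
  exponent at level \<open>k\<close>, that is \<open>2 r / p^k\<close> after normalisation. As this
  depends on \<open>k\<close> alone, the sequence is Cauchy, and \<open>k = 1\<close> yields the
  bounds for the limit.\<close>

lemma hk_length_tendsto:
  assumes p: "prime p" and d: "d \<ge> 1" and r: "r \<ge> 1"
  obtains h where "(\<lambda>e. hk_length p d r (p ^ e) / real p ^ (e * d)) \<longlonglongrightarrow> h"
    and "real r * quad_log_ker p {1..d} p (p div r) / real p ^ d \<le> h"
    and "h \<le> real r * quad_log_ker p {1..d} p (p div r) / real p ^ d + 2 * real r / real p"
proof -
  have p1: "p > 1" using p prime_gt_1_nat by blast
  define x where "x = (\<lambda>k. real r * quad_log_ker p {1..d} (p ^ k) (p ^ k div r) / real p ^ (k * d))"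
  define a where "a = (\<lambda>e. hk_length p d r (p ^ e) / real p ^ (e * d))"
  have bounds: "x k \<le> a e \<and> a e \<le> x k + 2 * real r / real p ^ k" if "k \<le> e" for k e
  proof -
    obtain l where "e = k + l" using le_Suc_ex[OF \<open>k \<le> e\<close>] by blast
    then have e: "e = l + k" by simp
    have r0: "r > 0" using r by simp
    have scale: "quad_log_ker p {1..d} (p ^ e) (p ^ l * j) = real p ^ (l * d) * quad_log_ker p {1..d} (p ^ k) j" for j
      using quad_log_ker_dilate_power[OF p, of "{1..d}" l "p ^ k" j] by (simp add: e power_add mult.commute flip: power_mult)
    have 1: "p ^ l * (p ^ k div r) \<le> p ^ e div r"
      using r0 by (simp add: e power_add less_eq_div_iff_mult_less_eq mult.assoc)
    have 2: "p ^ e div r + 1 \<le> p ^ l * (p ^ k div r + 1)"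
    proof -
      have "p ^ k < (p ^ k div r + 1) * r" using r0 by (simp add: dividend_less_div_times)
      then have "p ^ l * p ^ k < p ^ l * ((p ^ k div r + 1) * r)"
        using p1 by (intro mult_less_mono2) auto
      then have "p ^ e < p ^ l * (p ^ k div r + 1) * r" by (simp only: e power_add mult.assoc)
      then show ?thesis using r0 by (simp add: div_less_iff_less_mult Suc_leI)
    qed
    have pe: "real p ^ (e * d) = real p ^ (l * d) * real p ^ (k * d)"
      by (simp add: e add_mult_distrib power_add)
    have low: "real r * (real p ^ (l * d) * quad_log_ker p {1..d} (p ^ k) (p ^ k div r)) \<le> hk_length p d r (p ^ e)"
    proof -
      have "quad_log_ker p {1..d} (p ^ e) (p ^ l * (p ^ k div r)) \<le> quad_log_ker p {1..d} (p ^ e) (p ^ e div r)"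
        by (rule quad_log_ker_mono[OF p _ 1]) simp
      then have "real r * quad_log_ker p {1..d} (p ^ e) (p ^ l * (p ^ k div r)) \<le> real r * quad_log_ker p {1..d} (p ^ e) (p ^ e div r)"
        by (rule mult_left_mono) simp
      then show ?thesis using hk_length_bounds(1)[OF p r0, of d "p ^ e"] unfolding scale by linarith
    qed
    have up: "hk_length p d r (p ^ e) \<le> real r * (real p ^ (l * d) * (quad_log_ker p {1..d} (p ^ k) (p ^ k div r) + 2 * real (p ^ k) ^ (d - 1)))"
    proof -
      have "quad_log_ker p {1..d} (p ^ e) (p ^ e div r + 1) \<le> quad_log_ker p {1..d} (p ^ e) (p ^ l * (p ^ k div r + 1))"
        by (rule quad_log_ker_mono[OF p _ 2]) simp
      also have "\<dots> = real p ^ (l * d) * quad_log_ker p {1..d} (p ^ k) (Suc (p ^ k div r))" unfolding scale by simp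
      also have "\<dots> \<le> real p ^ (l * d) * (quad_log_ker p {1..d} (p ^ k) (p ^ k div r) + 2 * real (p ^ k) ^ (d - 1))"
        using d by (intro mult_left_mono quad_log_ker_Suc_le[OF p]) auto
      finally have "real r * quad_log_ker p {1..d} (p ^ e) (p ^ e div r + 1) \<le>
          real r * (real p ^ (l * d) * (quad_log_ker p {1..d} (p ^ k) (p ^ k div r) + 2 * real (p ^ k) ^ (d - 1)))"
        by (rule mult_left_mono) simp
      then show ?thesis using hk_length_bounds(2)[OF p r0, of d "p ^ e"] by linarith
    qed
    have "x k = real r * (real p ^ (l * d) * quad_log_ker p {1..d} (p ^ k) (p ^ k div r)) / real p ^ (e * d)"
      using p1 by (simp add: x_def pe)
    also have "\<dots> \<le> a e" unfolding a_def using low p1 by (intro divide_right_mono) auto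
    finally have lower: "x k \<le> a e" .
    have "a e \<le> real r * (real p ^ (l * d) * (quad_log_ker p {1..d} (p ^ k) (p ^ k div r) + 2 * real (p ^ k) ^ (d - 1))) / real p ^ (e * d)"
      unfolding a_def using up p1 by (intro divide_right_mono) auto
    also have "\<dots> = x k + 2 * real r * (real p ^ (k * (d - 1)) / real p ^ (k * d))"
    proof -
      have gen: "real r * (A * (C + 2 * P)) / (A * B) = real r * C / B + 2 * real r * (P / B)"
        if "A > 0" "B > 0" for A B C P :: real
        using that by (simp add: field_simps)
      show ?thesis
        unfolding pe x_def of_nat_power power_mult[of "real p" k] by (rule gen) (use p1 in auto)
    qed
    also have "real p ^ (k * (d - 1)) / real p ^ (k * d) = 1 / real p ^ k"
    proof -
      have "k * d = k * (d - 1) + k" using d by (cases d) auto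
      then show ?thesis using p1 by (simp add: power_add)
    qed
    finally show ?thesis using lower by simp
  qed
  have "Cauchy a"
  proof (rule metric_CauchyI)
    fix \<epsilon> :: real assume e: "\<epsilon> > 0"
    have "(\<lambda>k. 2 * real r / real p ^ k) \<longlonglongrightarrow> 0"
      using p1 by (intro LIMSEQ_divide_realpow_zero) simp
    then have "eventually (\<lambda>k. 2 * real r / real p ^ k < \<epsilon>) sequentially"
      using e by (rule order_tendstoD(2))
    then obtain k where k: "2 * real r / real p ^ k < \<epsilon>" by (auto simp: eventually_sequentially)
    have "dist (a m) (a n) < \<epsilon>" if "m \<ge> k" "n \<ge> k" for m n
      using bounds[OF that(1)] bounds[OF that(2)] k by (auto simp: dist_real_def)
    then show "\<exists>M. \<forall>m\<ge>M. \<forall>n\<ge>M. dist (a m) (a n) < \<epsilon>" by blast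
  qed
  then obtain h where h: "a \<longlonglongrightarrow> h" using Cauchy_convergent_iff convergent_def by blast
  show thesis
  proof (rule that[of h])
    show "(\<lambda>e. hk_length p d r (p ^ e) / real p ^ (e * d)) \<longlonglongrightarrow> h" using h by (simp add: a_def)
    have x1: "x 1 = real r * quad_log_ker p {1..d} p (p div r) / real p ^ d" by (simp add: x_def)
    show "real r * quad_log_ker p {1..d} p (p div r) / real p ^ d \<le> h"
      unfolding x1[symmetric] using bounds[of 1] by (intro LIMSEQ_le_const[OF h]) auto
    show "h \<le> real r * quad_log_ker p {1..d} p (p div r) / real p ^ d + 2 * real r / real p"
      unfolding x1[symmetric] using bounds[of 1] by (intro LIMSEQ_le_const2[OF h]) auto
  qed
qed

text \<open>Here \<open>2 * a + 1\<close> stands for the prime. As \<open>zigzag\<close> is monotone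
  in both arguments, the pairs \<open>(r m - 1, 2 m)\<close> with \<open>m = a div r\<close> and
  \<open>m = a div r + 1\<close> bracket \<open>(a, (2 a + 1) div r)\<close>.\<close>

lemma zigzag_floor_tendsto:
  assumes d: "d \<ge> 1" and r: "r \<ge> 2"
  shows "(\<lambda>a. real (zigzag d a ((2 * a + 1) div r)) / real a ^ d) \<longlonglongrightarrow> real (N_alt d 2 r) / (real r ^ d * fact d)"
proof -
  let ?Z = "\<lambda>m. real (zigzag d (r * m - 1) (2 * m)) / real m ^ d"
  have r0: "r > 0" using r by simp
  have top: "filterlim (\<lambda>a. a div r) at_top sequentially"
    unfolding filterlim_at_top
  proof
    fix Z
    show "\<forall>\<^sub>F a in sequentially. Z \<le> a div r"
      using eventually_ge_at_top[of "Z * r"] by eventually_elim (simp add: less_eq_div_iff_mult_less_eq r0)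
  qed
  have top1: "filterlim (\<lambda>a. a div r + 1) at_top sequentially"
    by (rule filterlim_at_top_mono[OF top]) simp
  have ratio: "(\<lambda>a. real (a div r) / real a) \<longlonglongrightarrow> 1 / real r"
  proof (rule tendsto_sandwich)
    show "\<forall>\<^sub>F a in sequentially. 1 / real r - 1 / real a \<le> real (a div r) / real a"
      using eventually_gt_at_top[of 0]
    proof eventually_elim
      case (elim a)
      have "real a / real r - 1 \<le> real (a div r)"
      proof -
        have "a < r + a div r * r" by (rule dividend_less_div_times[OF r0])
        then have "real a < real r + real (a div r) * real r"
          by (metis of_nat_add of_nat_less_iff of_nat_mult)
        then show ?thesis using r0 by (simp add: field_simps)
      qed
      then have "(real a / real r - 1) / real a \<le> real (a div r) / real a"
        by (rule divide_right_mono) simp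
      then show ?case using elim by (simp add: diff_divide_distrib)
    qed
    show "\<forall>\<^sub>F a in sequentially. real (a div r) / real a \<le> 1 / real r"
      using eventually_gt_at_top[of 0]
    proof eventually_elim
      case (elim a)
      have "real (a div r) / real a \<le> (real a / real r) / real a"
        by (intro divide_right_mono of_nat_div_le_of_nat) simp
      then show ?case using elim by simp
    qed
    have "(\<lambda>a. 1 / real r - 1 / real a) \<longlonglongrightarrow> 1 / real r - 0"
      by (intro tendsto_intros lim_1_over_n)
    then show "(\<lambda>a. 1 / real r - 1 / real a) \<longlonglongrightarrow> 1 / real r" by simp
  qed simp
  have ratio1: "(\<lambda>a. real (a div r + 1) / real a) \<longlonglongrightarrow> 1 / real r"
    using tendsto_add[OF ratio lim_1_over_n] by (simp add: add_divide_distrib add.commute)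
  note Z = zigzag_over_power_tendsto[OF d r]
  have lim: "real (N_alt d 2 r) / fact d * (1 / real r) ^ d = real (N_alt d 2 r) / (real r ^ d * fact d)"
    by (simp add: power_one_over field_simps)
  show ?thesis
  proof (rule tendsto_sandwich)
    show "(\<lambda>a. ?Z (a div r) * (real (a div r) / real a) ^ d) \<longlonglongrightarrow> real (N_alt d 2 r) / (real r ^ d * fact d)"
      unfolding lim[symmetric] by (intro tendsto_mult tendsto_power ratio filterlim_compose[OF Z top])
    show "(\<lambda>a. ?Z (a div r + 1) * (real (a div r + 1) / real a) ^ d) \<longlonglongrightarrow> real (N_alt d 2 r) / (real r ^ d * fact d)"
      unfolding lim[symmetric] by (intro tendsto_mult tendsto_power ratio1 filterlim_compose[OF Z top1])
    have cancel: "?Z m * (real m / real a) ^ d = real (zigzag d (r * m - 1) (2 * m)) / real a ^ d" if "m > 0" for m a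
      using that by (simp add: power_divide)
    show "\<forall>\<^sub>F a in sequentially. ?Z (a div r) * (real (a div r) / real a) ^ d \<le> real (zigzag d a ((2 * a + 1) div r)) / real a ^ d"
      using eventually_ge_at_top[of r]
    proof eventually_elim
      case (elim a)
      then have pos: "a div r > 0" using r0 by (simp add: div_greater_zero_iff)
      have "zigzag d (r * (a div r) - 1) (2 * (a div r)) \<le> zigzag d a ((2 * a + 1) div r)"
      proof (rule zigzag_mono)
        have *: "r * (a div r) \<le> a" by simp
        then show "r * (a div r) - 1 \<le> a" by linarith
        show "2 * (a div r) \<le> (2 * a + 1) div r"
          unfolding less_eq_div_iff_mult_less_eq[OF r0] using * by (simp only: mult.assoc mult.commute[of _ r])
      qed
      then show ?case unfolding cancel[OF pos] by (intro divide_right_mono) auto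
    qed
    show "\<forall>\<^sub>F a in sequentially. real (zigzag d a ((2 * a + 1) div r)) / real a ^ d \<le> ?Z (a div r + 1) * (real (a div r + 1) / real a) ^ d"
      using eventually_ge_at_top[of r]
    proof eventually_elim
      case (elim a)
      have "zigzag d a ((2 * a + 1) div r) \<le> zigzag d (r * (a div r + 1) - 1) (2 * (a div r + 1))"
      proof (rule zigzag_mono)
        have *: "a < (a div r + 1) * r" using r0 by (simp add: dividend_less_div_times)
        then show "a \<le> r * (a div r + 1) - 1" by (simp add: mult.commute)
        have "(2 * a + 1) div r < 2 * (a div r + 1) + 1"
          using * by (simp add: div_less_iff_less_mult r0 algebra_simps)
        then show "(2 * a + 1) div r \<le> 2 * (a div r + 1)" by simp
      qed
      moreover have pos: "a div r + 1 > 0" by simp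
      ultimately show ?case unfolding cancel[OF pos] by (intro divide_right_mono) auto
    qed
  qed
qed

text \<open>In the exact formula the linear term contributes \<open>r (p div r) / p\<close>, which
  tends to 1. In the other term \<open>2^(d-1) / p^d = (1 - 1/p)^d / (2 a^d)\<close>, because
  \<open>2 a = p - 1\<close>; this is the origin of the factor \<open>r / 2\<close>.\<close>

lemma quad_log_ker_prime_tendsto:
  assumes d: "d \<ge> 1" and r: "r \<ge> 2"
  defines "F \<equiv> inf at_top (principal {p::nat. prime p})"
  shows "((\<lambda>p. real r * quad_log_ker p {1..d} p (p div r) / real p ^ d) \<longlongrightarrow>
    1 + real r / 2 * (real (N_alt d 2 r) / (real r ^ d * fact d))) F"
proof -
  have F: "F \<le> at_top" by (simp add: F_def)
  let ?z = "\<lambda>p. real (zigzag d ((p - 1) div 2) (p div r))"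
  have ev: "eventually (\<lambda>p. prime p \<and> p > 2) F"
    unfolding F_def eventually_inf_principal
    using eventually_gt_at_top[of 2] by eventually_elim simp
  have half: "filterlim (\<lambda>p::nat. (p - 1) div 2) at_top F"
    unfolding filterlim_at_top
  proof
    fix Z
    have "\<forall>\<^sub>F p in at_top. Z \<le> ((p::nat) - 1) div 2"
      using eventually_ge_at_top[of "2 * Z + 1"] by eventually_elim auto
    then show "\<forall>\<^sub>F p in F. Z \<le> (p - 1) div 2" by (rule filter_leD[OF F])
  qed
  have real_top: "filterlim (\<lambda>p::nat. real p) at_top F"
    using filterlim_real_sequentially F by (rule filterlim_mono[OF _ order_refl])
  have inv: "((\<lambda>p. 1 / real p) \<longlongrightarrow> 0) F"
    using lim_1_over_n F by (rule tendsto_mono[rotated])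
  have 1: "((\<lambda>p. real r * real (p div r) / real p) \<longlongrightarrow> 1) F"
  proof (rule tendsto_sandwich)
    show "\<forall>\<^sub>F p in F. 1 - real r * (1 / real p) \<le> real r * real (p div r) / real p"
      using ev
    proof eventually_elim
      case (elim p)
      have "p < (p div r + 1) * r" using r by (simp add: dividend_less_div_times)
      then have "real p < (real (p div r) + 1) * real r" by (metis of_nat_1 of_nat_add of_nat_less_iff of_nat_mult)
      then have "(real p - real r) / real p \<le> real r * real (p div r) / real p"
        by (intro divide_right_mono) (auto simp: algebra_simps)
      then show ?case using elim by (simp add: diff_divide_distrib)
    qed
    show "\<forall>\<^sub>F p in F. real r * real (p div r) / real p \<le> 1"
      using ev
    proof eventually_elim
      case (elim p)
      have "real (r * (p div r)) \<le> real p" unfolding of_nat_le_iff by simp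
      then show ?case using elim by simp
    qed
    have "((\<lambda>p. 1 - real r * (1 / real p)) \<longlongrightarrow> 1 - real r * 0) F" by (intro tendsto_intros inv)
    then show "((\<lambda>p. 1 - real r * (1 / real p)) \<longlongrightarrow> 1) F" by simp
  qed simp
  have 2: "((\<lambda>p. ?z p / real ((p - 1) div 2) ^ d) \<longlongrightarrow> real (N_alt d 2 r) / (real r ^ d * fact d)) F"
  proof -
    have "((\<lambda>p. real (zigzag d ((p - 1) div 2) ((2 * ((p - 1) div 2) + 1) div r)) / real ((p - 1) div 2) ^ d) \<longlongrightarrow>
        real (N_alt d 2 r) / (real r ^ d * fact d)) F"
      using filterlim_compose[OF zigzag_floor_tendsto[OF d r] half] .
    moreover have "\<forall>\<^sub>F p in F. real (zigzag d ((p - 1) div 2) ((2 * ((p - 1) div 2) + 1) div r)) / real ((p - 1) div 2) ^ d =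
        ?z p / real ((p - 1) div 2) ^ d"
      using ev
    proof eventually_elim
      case (elim p)
      then have "2 * ((p - 1) div 2) + 1 = p" using prime_odd_nat[of p] by auto
      then show ?case by simp
    qed
    ultimately show ?thesis by (rule Lim_transform_eventually)
  qed
  have 3: "((\<lambda>p. (1 - 1 / real p) ^ d) \<longlongrightarrow> 1) F"
  proof -
    have "((\<lambda>p. (1 - 1 / real p) ^ d) \<longlongrightarrow> (1 - 0) ^ d) F" by (intro tendsto_intros inv)
    then show ?thesis by simp
  qed
  have lim: "((\<lambda>p. real r * real (p div r) / real p +
      real r / 2 * (?z p / real ((p - 1) div 2) ^ d * (1 - 1 / real p) ^ d)) \<longlongrightarrow>
      1 + real r / 2 * (real (N_alt d 2 r) / (real r ^ d * fact d) * 1)) F"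
    by (intro tendsto_add tendsto_mult tendsto_const 1 2 3)
  have "\<forall>\<^sub>F p in F. real r * real (p div r) / real p +
      real r / 2 * (?z p / real ((p - 1) div 2) ^ d * (1 - 1 / real p) ^ d) =
      real r * quad_log_ker p {1..d} p (p div r) / real p ^ d"
    using ev
  proof eventually_elim
    case (elim p)
    define a where "a = (p - 1) div 2"
    have pa: "p = 2 * a + 1" using elim prime_odd_nat[of p] by (auto simp: a_def)
    have a0: "a > 0" using elim pa by auto
    obtain n where n: "d = Suc n" using d by (cases d) auto
    have "p div r \<le> p div 2" using r by (intro div_le_mono2) auto
    then have j: "p div r \<le> a" using pa by simp
    have C: "quad_log_ker p {1..d} p (p div r) = real (p div r) * real p ^ n + 2 ^ n * ?z p"
      using quad_log_ker_eq_zigzag[OF _ pa _ _ j, of "{1..d}" n] elim n by (simp add: a_def)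
    have q: "1 - 1 / real p = 2 * real a / real p" using pa a0 by (simp add: field_simps)
    show ?case
      unfolding C q a_def[symmetric] using a0 elim
      by (simp add: n power_divide power_mult_distrib field_simps)
  qed
  with lim show ?thesis by (simp add: Lim_transform_eventually)
qed

section \<open>Power series over prime fields\<close>

definition adg :: "(nat \<Rightarrow>\<^sub>0 nat) \<Rightarrow> ((nat \<Rightarrow>\<^sub>0 nat) \<times> (nat \<Rightarrow>\<^sub>0 nat)) set" where
  "adg m = {(a, b). a + b = m}"

lemma finite_adg [simp]: "finite (adg m)"
proof -
  have "lookup ` fst ` adg m \<subseteq>
      (\<lambda>f i. if i \<in> Poly_Mapping.keys m then f i else 0) ` PiE (Poly_Mapping.keys m) (\<lambda>i. {..lookup m i})"
  proof clarify
    fix a b assume "(a, b) \<in> adg m"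
    then have m: "m = a + b" by (simp add: adg_def)
    show "lookup (fst (a, b)) \<in> (\<lambda>f i. if i \<in> Poly_Mapping.keys m then f i else 0) `
        PiE (Poly_Mapping.keys m) (\<lambda>i. {..lookup m i})"
      by (rule image_eqI[of _ _ "restrict (lookup a) (Poly_Mapping.keys m)"])
         (auto simp: m lookup_add fun_eq_iff in_keys_iff)
  qed
  then have "finite (lookup ` fst ` adg m)"
    by (rule finite_subset) (auto intro!: finite_PiE)
  then have "finite (fst ` adg m)"
    by (rule finite_imageD) (rule inj_onI, rule poly_mapping_eqI, simp)
  then show ?thesis
  proof (rule finite_imageD)
    show "inj_on fst (adg m)"
    proof (rule inj_onI)
      fix x y assume "x \<in> adg m" "y \<in> adg m" "fst x = fst y"
      then have "fst x + snd x = fst x + snd y" by (simp add: adg_def case_prod_beta)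
      then show "x = y" using \<open>fst x = fst y\<close> by (simp add: prod_eq_iff)
    qed
  qed
qed

text \<open>A separate type, because plain functions already carry the pointwise product that
  underlies \<open>pgroup\<close> for \<open>W\<close>; here the product is convolution.\<close>

typedef 'a mps = "UNIV :: ((nat \<Rightarrow>\<^sub>0 nat) \<Rightarrow> 'a) set" morphisms coef Mps ..

setup_lifting type_definition_mps

lemma sum_adg_single:
  fixes g :: "(nat \<Rightarrow>\<^sub>0 nat) \<Rightarrow> 'a::comm_ring_1"
  shows "(\<Sum>(a, b)\<in>adg m. (if a = \<alpha> then c else 0) * g b) = (if \<exists>\<gamma>. m = \<alpha> + \<gamma> then c * g (m - \<alpha>) else 0)"
proof (cases "\<exists>\<gamma>. m = \<alpha> + \<gamma>")
  case True
  then obtain \<gamma> where m: "m = \<alpha> + \<gamma>" by blast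
  have "(\<Sum>(a, b)\<in>adg m. (if a = \<alpha> then c else 0) * g b) = (\<Sum>(a, b)\<in>{(\<alpha>, \<gamma>)}. (if a = \<alpha> then c else 0) * g b)"
  proof (rule sum.mono_neutral_right)
    show "\<forall>x\<in>adg m - {(\<alpha>, \<gamma>)}. (case x of (a, b) \<Rightarrow> (if a = \<alpha> then c else 0) * g b) = 0"
    proof
      fix x assume x: "x \<in> adg m - {(\<alpha>, \<gamma>)}"
      have "fst x \<noteq> \<alpha>"
      proof
        assume "fst x = \<alpha>"
        with x have "x = (\<alpha>, \<gamma>)" by (cases x) (simp add: adg_def m)
        with x show False by simp
      qed
      then show "(case x of (a, b) \<Rightarrow> (if a = \<alpha> then c else 0) * g b) = 0" by (cases x) simp
    qed
  qed (simp, simp add: adg_def m)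
  then show ?thesis using True by (simp add: m)
next
  case False
  then have "(\<Sum>(a, b)\<in>adg m. (if a = \<alpha> then c else 0) * g b) = 0"
    by (intro sum.neutral) (auto simp: adg_def)
  then show ?thesis using False by simp
qed

instantiation mps :: (comm_ring_1) comm_ring_1
begin

lift_definition zero_mps :: "'a mps" is "\<lambda>_. 0" .
lift_definition one_mps :: "'a mps" is "\<lambda>m. if m = 0 then 1 else 0" .
lift_definition plus_mps :: "'a mps \<Rightarrow> 'a mps \<Rightarrow> 'a mps" is "\<lambda>f g m. f m + g m" .
lift_definition minus_mps :: "'a mps \<Rightarrow> 'a mps \<Rightarrow> 'a mps" is "\<lambda>f g m. f m - g m" .
lift_definition uminus_mps :: "'a mps \<Rightarrow> 'a mps" is "\<lambda>f m. - f m" .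
lift_definition times_mps :: "'a mps \<Rightarrow> 'a mps \<Rightarrow> 'a mps" is "\<lambda>f g m. \<Sum>(a, b)\<in>adg m. f a * g b" .

instance
proof
  fix f g h :: "'a mps"
  show "f * g * h = f * (g * h)"
  proof (transfer, rule ext)
    fix f g h :: "(nat \<Rightarrow>\<^sub>0 nat) \<Rightarrow> 'a" and m
    have "(\<Sum>(a, b)\<in>adg m. (\<Sum>(c, d)\<in>adg a. f c * g d) * h b) =
        (\<Sum>x\<in>adg m. \<Sum>y\<in>adg (fst x). f (fst y) * g (snd y) * h (snd x))"
      by (simp add: case_prod_beta sum_distrib_right)
    also have "\<dots> = (\<Sum>(x, y)\<in>Sigma (adg m) (\<lambda>x. adg (fst x)). f (fst y) * g (snd y) * h (snd x))"
      by (rule sum.Sigma) auto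
    also have "\<dots> = (\<Sum>(x, y)\<in>Sigma (adg m) (\<lambda>x. adg (snd x)). f (fst x) * (g (fst y) * h (snd y)))"
      by (rule sum.reindex_bij_witness[of _ "\<lambda>((a, b), (c, d)). ((a + c, d), (a, c))"
            "\<lambda>((a, b), (c, d)). ((c, d + b), (d, b))"])
         (auto simp: adg_def ac_simps)
    also have "\<dots> = (\<Sum>x\<in>adg m. \<Sum>y\<in>adg (snd x). f (fst x) * (g (fst y) * h (snd y)))"
      by (rule sum.Sigma[symmetric]) auto
    also have "\<dots> = (\<Sum>(a, b)\<in>adg m. f a * (\<Sum>(c, d)\<in>adg b. g c * h d))"
      by (simp add: case_prod_beta sum_distrib_left)
    finally show "(\<Sum>(a, b)\<in>adg m. (\<Sum>(c, d)\<in>adg a. f c * g d) * h b) =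
        (\<Sum>(a, b)\<in>adg m. f a * (\<Sum>(c, d)\<in>adg b. g c * h d))" .
  qed
  show "f * g = g * f"
  proof (transfer, rule ext)
    fix f g :: "(nat \<Rightarrow>\<^sub>0 nat) \<Rightarrow> 'a" and m
    show "(\<Sum>(a, b)\<in>adg m. f a * g b) = (\<Sum>(a, b)\<in>adg m. g a * f b)"
      by (rule sum.reindex_bij_witness[of _ "\<lambda>(a, b). (b, a)" "\<lambda>(a, b). (b, a)"])
         (auto simp: adg_def ac_simps)
  qed
  show "1 * f = f"
    by (transfer, rule ext, subst sum_adg_single) auto
  show "(f + g) * h = f * h + g * h"
    by transfer (simp add: fun_eq_iff case_prod_beta algebra_simps sum.distrib)
  show "(0::'a mps) \<noteq> 1" by transfer (auto simp: fun_eq_iff)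
qed (transfer; simp add: fun_eq_iff algebra_simps)+

end

definition mnm :: "(nat \<Rightarrow>\<^sub>0 nat) \<Rightarrow> 'a::zero \<Rightarrow> 'a mps" where
  "mnm \<alpha> c = Mps (\<lambda>m. if m = \<alpha> then c else 0)"

lemma mps_eqI: "(\<And>m. coef f m = coef g m) \<Longrightarrow> f = g"
  by transfer auto

lemma coef_simps [simp]:
  "coef 0 m = 0" "coef (f + g) m = coef f m + coef g m" "coef (f - g) m = coef f m - coef g m"
  "coef (- f) m = - coef f m" "coef (Mps v) m = v m"
  by (transfer, simp)+

lemma coef_mnm [simp]: "coef (mnm \<alpha> c) m = (if m = \<alpha> then c else 0)"
  by (simp add: mnm_def)

lemma coef_mult: "coef (f * g) m = (\<Sum>(a, b)\<in>adg m. coef f a * coef g b)"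
  by transfer simp

lemma coef_sum: "coef (sum f A) m = (\<Sum>i\<in>A. coef (f i) m)"
  by (induction A rule: infinite_finite_induct) auto

lemma coef_mnm_mult:
  "coef (mnm \<alpha> c * g) m = (if \<exists>\<gamma>. m = \<alpha> + \<gamma> then c * coef g (m - \<alpha>) else 0)"
  unfolding coef_mult coef_mnm by (rule sum_adg_single)

lemma mnm_mult_mnm: "mnm \<alpha> c * mnm \<beta> c' = mnm (\<alpha> + \<beta>) (c * c')"
  by (rule mps_eqI) (auto simp: coef_mnm_mult)

lemma adds_iff_lookup: "(\<exists>\<gamma>. m = \<alpha> + \<gamma>) \<longleftrightarrow> (\<forall>i. lookup \<alpha> i \<le> lookup m i)" for m :: "nat \<Rightarrow>\<^sub>0 nat"
proof
  assume "\<forall>i. lookup \<alpha> i \<le> lookup m i"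
  then have "m = \<alpha> + (m - \<alpha>)" by (intro poly_mapping_eqI) (auto simp: lookup_add lookup_minus)
  then show "\<exists>\<gamma>. m = \<alpha> + \<gamma>" by blast
qed (auto simp: lookup_add)

lemma adds_single_iff: "(\<exists>\<gamma>. m = single i q + \<gamma>) \<longleftrightarrow> q \<le> lookup m i" for m :: "nat \<Rightarrow>\<^sub>0 nat"
  unfolding adds_iff_lookup by (auto simp: lookup_single when_def)

definition mdeg :: "(nat \<Rightarrow>\<^sub>0 nat) \<Rightarrow> nat" where "mdeg m = sum (lookup m) (Poly_Mapping.keys m)"

lemma mdeg_eq: "finite I \<Longrightarrow> (\<And>i. i \<notin> I \<Longrightarrow> lookup m i = 0) \<Longrightarrow> mdeg m = sum (lookup m) I"
  unfolding mdeg_def by (rule sum.mono_neutral_left) (auto simp: in_keys_iff)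

lemma mdeg_add: "mdeg (a + b) = mdeg a + mdeg b"
proof -
  let ?I = "Poly_Mapping.keys a \<union> Poly_Mapping.keys b"
  have "mdeg a = sum (lookup a) ?I" "mdeg b = sum (lookup b) ?I" "mdeg (a + b) = sum (lookup (a + b)) ?I"
    by (rule mdeg_eq; auto simp: in_keys_iff lookup_add)+
  then show ?thesis by (simp add: lookup_add sum.distrib)
qed

lemma mdeg_0 [simp]: "mdeg 0 = 0" by (simp add: mdeg_def)

lemma mdeg_eq_0_iff: "mdeg m = 0 \<longleftrightarrow> m = 0"
  by (auto simp: mdeg_def in_keys_iff intro!: poly_mapping_eqI)

text \<open>\<open>F\<^sub>p[[x\<^sub>0, \<dots>, x\<^sub>d]]\<close>. Its unit element is \<open>E p\<close>; the element \<open>1\<close> of the ambient type, in particular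
  \<open>a ^ 0\<close>, does not belong to it.\<close>
definition Am :: "nat \<Rightarrow> nat \<Rightarrow> zprod mps set" where
  "Am p d = {a. \<forall>m. coef a m \<in> Fp p \<and> (coef a m \<noteq> 0 \<longrightarrow> (\<forall>i>d. lookup m i = 0))}"

abbreviation E :: "nat \<Rightarrow> zprod mps" where "E p \<equiv> mnm 0 (fpe p 1)"

lemma AmD: "a \<in> Am p d \<Longrightarrow> coef a m \<in> Fp p" "a \<in> Am p d \<Longrightarrow> coef a m \<noteq> 0 \<Longrightarrow> i > d \<Longrightarrow> lookup m i = 0"
  by (auto simp: Am_def)

lemma Fp_sum: "p > 0 \<Longrightarrow> (\<And>i. i \<in> A \<Longrightarrow> f i \<in> Fp p) \<Longrightarrow> sum f A \<in> Fp p"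
  by (induction A rule: infinite_finite_induct) (auto intro: pgroupD(3)[OF pgroup_Fp])

lemma fpe_one_neq_0: "prime p \<Longrightarrow> fpe p 1 \<noteq> 0"
  using fpe_eq_iff[of p 1 0] prime_gt_1_nat[of p] by auto

lemma Fp_no_zero_divisors:
  assumes "prime p" "x \<in> Fp p" "y \<in> Fp p" "x \<noteq> 0" "y \<noteq> 0" shows "x * y \<noteq> 0"
proof
  assume 0: "x * y = 0"
  obtain z where "z \<in> Fp p" "x * z = fpe p 1" using Fp_inverse[OF assms(1,2,4)] by blast
  then have "y = z * (x * y)" using Fp_one_mult(1)[OF assms(3)] by (metis mult.assoc mult.commute)
  then show False using 0 assms(5) by simp
qed

lemma Am_add: assumes "p > 0" "a \<in> Am p d" "b \<in> Am p d" shows "a + b \<in> Am p d"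
proof -
  have "lookup m i = 0" if "coef (a + b) m \<noteq> 0" "i > d" for m i
    using that AmD(2)[OF assms(2), of m i] AmD(2)[OF assms(3), of m i] by (cases "coef a m = 0") auto
  then show ?thesis using AmD(1)[OF assms(2)] AmD(1)[OF assms(3)] pgroupD(3)[OF pgroup_Fp[OF assms(1)]]
    unfolding Am_def by simp
qed

lemma Am_uminus: "p > 0 \<Longrightarrow> a \<in> Am p d \<Longrightarrow> - a \<in> Am p d"
  using pgroupD(4)[OF pgroup_Fp[of p]] by (auto simp: Am_def)

lemma Am_diff: "p > 0 \<Longrightarrow> a \<in> Am p d \<Longrightarrow> b \<in> Am p d \<Longrightarrow> a - b \<in> Am p d"
  using Am_add[of p a d "- b"] Am_uminus by simp

lemma Am_0 [simp]: "0 \<in> Am p d" by (simp add: Am_def)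

lemma Am_mult: assumes "p > 0" "a \<in> Am p d" "b \<in> Am p d" shows "a * b \<in> Am p d"
proof -
  have "coef (a * b) m \<in> Fp p" for m
    unfolding coef_mult case_prod_beta
    by (rule Fp_sum[OF assms(1)], rule Fp_mult) (use AmD(1) assms(2,3) in auto)
  moreover have "lookup m i = 0" if nz: "coef (a * b) m \<noteq> 0" and i: "i > d" for m i
  proof -
    obtain x where x: "x \<in> adg m" "coef a (fst x) * coef b (snd x) \<noteq> 0"
      using nz unfolding coef_mult case_prod_beta by (meson sum.neutral)
    then have "lookup (fst x) i = 0" "lookup (snd x) i = 0"
      using AmD(2)[OF assms(2) _ i] AmD(2)[OF assms(3) _ i] by (metis mult_zero_left, metis mult_zero_right)
    moreover have "m = fst x + snd x" using x(1) by (auto simp: adg_def)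
    ultimately show ?thesis by (simp add: lookup_add)
  qed
  ultimately show ?thesis by (auto simp: Am_def)
qed

lemma Am_sum: "p > 0 \<Longrightarrow> (\<And>i. i \<in> I \<Longrightarrow> f i \<in> Am p d) \<Longrightarrow> sum f I \<in> Am p d"
  by (induction I rule: infinite_finite_induct) (auto intro: Am_add)

lemma Am_power: "p > 0 \<Longrightarrow> a \<in> Am p d \<Longrightarrow> n > 0 \<Longrightarrow> a ^ n \<in> Am p d"
proof (induction n)
  case (Suc n)
  then show ?case by (cases "n = 0") (simp_all add: Am_mult)
qed simp

lemma mnm_in_Am: "c \<in> Fp p \<Longrightarrow> (\<And>i. i > d \<Longrightarrow> lookup \<alpha> i = 0) \<Longrightarrow> mnm \<alpha> c \<in> Am p d"
  by (auto simp: Am_def)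

lemma E_in_Am [simp]: "E p \<in> Am p d" by (rule mnm_in_Am) auto

lemma E_mult: "a \<in> Am p d \<Longrightarrow> E p * a = a"
  by (rule mps_eqI) (auto simp: coef_mnm_mult Fp_one_mult(1) AmD(1))

lemma mnm_single_in_Am: "i \<le> d \<Longrightarrow> mnm (single i q) (fpe p 1) \<in> Am p d"
  by (rule mnm_in_Am) (auto simp: lookup_single when_def)

lemma mnm_single_power:
  "n > 0 \<Longrightarrow> mnm (single i 1) (fpe p 1) ^ n = mnm (single i n) (fpe p 1)"
proof (induction n)
  case (Suc n)
  then show ?case
    by (cases "n = 0") (simp_all add: mnm_mult_mnm Fp_one_mult flip: single_add)
qed simp

text \<open>The ideal \<open>(x_0^q, ..., x_d^q)\<close> is monomial, so the coefficients inside the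
  box decide membership. For infinite series this relies on distributing all monomials outside the
  box among the finitely many generators.\<close>

lemma Am_decomp_iff:
  assumes p: "p > 0" and a: "a \<in> Am p d"
  shows "(\<exists>h. (\<forall>i\<le>d. h i \<in> Am p d) \<and> a = (\<Sum>i\<le>d. mnm (single i q) (fpe p 1) * h i)) \<longleftrightarrow>
    (\<forall>m. (\<forall>i\<le>d. lookup m i < q) \<longrightarrow> coef a m = 0)"
proof
  assume "\<exists>h. (\<forall>i\<le>d. h i \<in> Am p d) \<and> a = (\<Sum>i\<le>d. mnm (single i q) (fpe p 1) * h i)"
  then obtain h where h: "a = (\<Sum>i\<le>d. mnm (single i q) (fpe p 1) * h i)" by blast
  show "\<forall>m. (\<forall>i\<le>d. lookup m i < q) \<longrightarrow> coef a m = 0"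
  proof (intro allI impI)
    fix m :: "nat \<Rightarrow>\<^sub>0 nat" assume m: "\<forall>i\<le>d. lookup m i < q"
    have "\<not> q \<le> lookup m i" if "i \<le> d" for i using m that by (simp add: not_le)
    then have "coef (mnm (single i q) (fpe p 1) * h i) m = 0" if "i \<le> d" for i
      using that by (simp add: coef_mnm_mult adds_single_iff)
    then show "coef a m = 0" unfolding h coef_sum by (intro sum.neutral) simp
  qed
next
  assume van: "\<forall>m. (\<forall>i\<le>d. lookup m i < q) \<longrightarrow> coef a m = 0"
  \<comment> \<open>Each monomial outside the box is assigned to its first variable of exponent at
    least \<open>q\<close>, so that it is counted once.\<close>
  define fst' where "fst' = (\<lambda>m :: nat \<Rightarrow>\<^sub>0 nat. LEAST i. q \<le> lookup m i)"
  define h where "h = (\<lambda>i :: nat. Mps (\<lambda>\<gamma>. if fst' (single i q + \<gamma>) = i then coef a (single i q + \<gamma>) else 0))"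
  have hA: "h i \<in> Am p d" for i
  proof -
    have "lookup \<gamma> j = 0" if "coef a (single i q + \<gamma>) \<noteq> 0" "j > d" for \<gamma> j
      using AmD(2)[OF a that] by (simp add: lookup_add)
    then show ?thesis using AmD(1)[OF a] by (auto simp: Am_def h_def)
  qed
  have "coef a m = coef (\<Sum>i\<le>d. mnm (single i q) (fpe p 1) * h i) m" for m
  proof -
    have eq: "coef (mnm (single i q) (fpe p 1) * h i) m = (if q \<le> lookup m i \<and> fst' m = i then coef a m else 0)" for i
    proof (cases "q \<le> lookup m i")
      case True
      then obtain \<gamma> where m: "m = single i q + \<gamma>" using adds_single_iff[of m i q] by blast
      then show ?thesis using True Fp_one_mult(1)[OF AmD(1)[OF hA], of i \<gamma>]
        by (auto simp: coef_mnm_mult h_def)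
    qed (simp add: coef_mnm_mult adds_single_iff)
    show ?thesis
    proof (cases "\<exists>i\<le>d. q \<le> lookup m i")
      case True
      then obtain i where i: "i \<le> d" "q \<le> lookup m i" by blast
      have f: "fst' m \<le> d" "q \<le> lookup m (fst' m)"
        unfolding fst'_def using Least_le[of "\<lambda>i. q \<le> lookup m i", OF i(2)] i(1) LeastI[of "\<lambda>i. q \<le> lookup m i", OF i(2)] by auto
      have "(\<Sum>i\<le>d. if q \<le> lookup m i \<and> fst' m = i then coef a m else 0) = (\<Sum>i\<le>d. if i = fst' m then coef a m else 0)"
        by (rule sum.cong[OF refl]) (use f in auto)
      then show ?thesis unfolding coef_sum eq using f(1) by simp
    next
      case False
      then have "\<forall>i\<le>d. lookup m i < q" by (meson not_le)
      then have "coef a m = 0" using van by blast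
      then show ?thesis unfolding coef_sum eq by (simp cong: if_cong)
    qed
  qed
  then have A: "a = (\<Sum>i\<le>d. mnm (single i q) (fpe p 1) * h i)" by (rule mps_eqI)
  show "\<exists>h. (\<forall>i\<le>d. h i \<in> Am p d) \<and> a = (\<Sum>i\<le>d. mnm (single i q) (fpe p 1) * h i)"
    by (rule exI[of _ h], rule conjI[OF _ A]) (use hA in simp)
qed

lemma of_nat_mult_Am: "p > 0 \<Longrightarrow> a \<in> Am p d \<Longrightarrow> of_nat p * a = 0"
proof (rule mps_eqI)
  fix m assume p: "p > 0" and a: "a \<in> Am p d"
  have "coef (of_nat n * a) m = of_nat n * coef a m" for n
    by (induction n) (auto simp: algebra_simps)
  then show "coef (of_nat p * a) m = coef 0 m"
    using pgroupD(6)[OF pgroup_Fp[OF p] AmD(1)[OF a]] by simp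
qed

lemma Am_frobenius:
  assumes p: "prime p" and a: "a \<in> Am p d" and b: "b \<in> Am p d"
  shows "(a + b) ^ p = a ^ p + b ^ p"
proof -
  have p0: "p > 0" using p prime_gt_0_nat by blast
  have "of_nat (p choose k) * a ^ k * b ^ (p - k) = 0" if "k \<in> {1..<p}" for k
  proof -
    have "p dvd (p choose k)" using that p by (intro dvd_choose_prime) auto
    then obtain c where "p choose k = p * c" by (auto simp: dvd_def)
    then have "of_nat (p choose k) * a ^ k * b ^ (p - k) = of_nat c * (of_nat p * (a ^ k * b ^ (p - k)))"
      by (simp add: ac_simps)
    also have "\<dots> = 0"
      using of_nat_mult_Am[OF p0 Am_mult[OF p0 Am_power[OF p0 a] Am_power[OF p0 b]], of k "p - k"] that by simp
    finally show ?thesis .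
  qed
  then have "(\<Sum>k\<in>{1..<p}. of_nat (p choose k) * a ^ k * b ^ (p - k)) = 0" by simp
  moreover have "{..p} = insert 0 (insert p {1..<p})" using p0 by auto
  ultimately show ?thesis using p0 by (simp add: binomial_ring add.commute)
qed

lemma Am_frobenius_sum:
  assumes p: "prime p" and f: "\<And>i. i \<in> I \<Longrightarrow> f i \<in> Am p d" and I: "finite I"
  shows "(\<Sum>i\<in>I. f i) ^ p ^ k = (\<Sum>i\<in>I. f i ^ p ^ k)"
proof -
  have p0: "p > 0" using p prime_gt_0_nat by blast
  have 1: "(\<Sum>i\<in>I. g i) ^ p = (\<Sum>i\<in>I. g i ^ p)" if g: "\<And>i. i \<in> I \<Longrightarrow> g i \<in> Am p d" for g
    using I g
  proof (induction I)
    case (insert x I)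
    have "g x \<in> Am p d" using insert.prems by simp
    moreover have "sum g I \<in> Am p d" by (rule Am_sum[OF p0]) (simp add: insert.prems)
    ultimately show ?case using insert by (simp add: Am_frobenius[OF p, of _ d])
  qed (use p0 in \<open>simp add: zero_power\<close>)
  show ?thesis
  proof (induction k)
    case (Suc k)
    have "(\<Sum>i\<in>I. f i) ^ p ^ Suc k = ((\<Sum>i\<in>I. f i) ^ p ^ k) ^ p"
      by (simp add: mult.commute flip: power_mult)
    also have "\<dots> = (\<Sum>i\<in>I. (f i ^ p ^ k) ^ p)"
      unfolding Suc by (rule 1) (use f p0 in \<open>auto intro!: Am_power\<close>)
    finally show ?case by (simp add: mult.commute flip: power_mult)
  qed simp
qed

text \<open>Coefficients of the inverse of the series \<open>f\<close>, by recursion on total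
  degree: \<open>c\<close> inverts the constant term and \<open>e\<close> is the unit of the prime
  field.\<close>

function minv :: "((nat \<Rightarrow>\<^sub>0 nat) \<Rightarrow> zprod) \<Rightarrow> zprod \<Rightarrow> zprod \<Rightarrow> (nat \<Rightarrow>\<^sub>0 nat) \<Rightarrow> zprod" where
  "minv f c e m = c * ((if m = 0 then e else 0) - (\<Sum>x\<in>adg m - {(0, m)}. f (fst x) * minv f c e (snd x)))"
  by auto
termination
proof (relation "Wellfounded.measure (\<lambda>(f, c, e, m). mdeg m)")
  fix f :: "(nat \<Rightarrow>\<^sub>0 nat) \<Rightarrow> zprod" and c e :: zprod and m x assume "x \<in> adg m - {(0, m)}"
  then have x: "m = fst x + snd x" "fst x \<noteq> 0" by (auto simp: adg_def)
  then show "((f, c, e, snd x), f, c, e, m) \<in> Wellfounded.measure (\<lambda>(f, c, e, m). mdeg m)"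
    using mdeg_eq_0_iff[of "fst x"] by (simp add: mdeg_add)
qed simp

declare minv.simps [simp del]

lemma Am_unit:
  assumes p: "prime p" and a: "a \<in> Am p d" and u: "coef a 0 \<noteq> 0"
  shows "\<exists>b\<in>Am p d. a * b = E p"
proof -
  have p0: "p > 0" using p prime_gt_0_nat by blast
  obtain c where c: "c \<in> Fp p" "coef a 0 * c = fpe p 1" using Fp_inverse[OF p AmD(1)[OF a] u] by blast
  let ?b = "minv (coef a) c (fpe p 1)"
  have bF: "?b m \<in> Fp p \<and> (?b m \<noteq> 0 \<longrightarrow> (\<forall>i>d. lookup m i = 0))" for m
  proof (induction m rule: measure_induct_rule[of mdeg])
    case (less m)
    have IH: "?b (snd x) \<in> Fp p \<and> (?b (snd x) \<noteq> 0 \<longrightarrow> (\<forall>i>d. lookup (snd x) i = 0))" "m = fst x + snd x"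
      if "x \<in> adg m - {(0, m)}" for x
    proof -
      have x: "m = fst x + snd x" "fst x \<noteq> 0" using that by (auto simp: adg_def)
      then have "mdeg (snd x) < mdeg m" using mdeg_eq_0_iff[of "fst x"] by (simp add: mdeg_add)
      then show "?b (snd x) \<in> Fp p \<and> (?b (snd x) \<noteq> 0 \<longrightarrow> (\<forall>i>d. lookup (snd x) i = 0))" "m = fst x + snd x"
        using less x by auto
    qed
    let ?s = "\<Sum>x\<in>adg m - {(0, m)}. coef a (fst x) * ?b (snd x)"
    have "?s \<in> Fp p" by (rule Fp_sum[OF p0], rule Fp_mult) (use IH AmD(1)[OF a] in auto)
    then have "?b m \<in> Fp p"
      unfolding minv.simps[of _ _ _ m] using c(1)
      by (intro Fp_mult pgroupD(5)[OF pgroup_Fp[OF p0]]) auto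
    moreover have "?b m = 0" if i: "i > d" "lookup m i \<noteq> 0" for i
    proof -
      have "coef a (fst x) * ?b (snd x) = 0" if x: "x \<in> adg m - {(0, m)}" for x
      proof (rule ccontr)
        assume nz: "coef a (fst x) * ?b (snd x) \<noteq> 0"
        then have "lookup (fst x) i = 0" using AmD(2)[OF a _ i(1), of "fst x"] by (metis mult_zero_left)
        moreover have "lookup (snd x) i = 0" using IH(1)[OF x] i(1) nz by (metis mult_zero_right)
        ultimately show False using IH(2)[OF x] i(2) by (simp add: lookup_add)
      qed
      then have "?s = 0" by simp
      moreover have "m \<noteq> 0" using i(2) by auto
      ultimately show ?thesis unfolding minv.simps[of _ _ _ m] by simp
    qed
    ultimately show ?case by blast
  qed
  have "Mps ?b \<in> Am p d" using bF by (auto simp: Am_def)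
  moreover have "a * Mps ?b = E p"
  proof (rule mps_eqI)
    fix m
    let ?s = "\<Sum>x\<in>adg m - {(0, m)}. coef a (fst x) * ?b (snd x)"
    have sF: "(if m = 0 then fpe p 1 else 0) - ?s \<in> Fp p"
    proof -
      have "?s \<in> Fp p" by (rule Fp_sum[OF p0], rule Fp_mult) (use bF AmD(1)[OF a] in auto)
      then show ?thesis by (intro pgroupD(5)[OF pgroup_Fp[OF p0]]) auto
    qed
    have "coef (a * Mps ?b) m = coef a 0 * ?b m + ?s"
    proof -
      have "(0, m) \<in> adg m" by (simp add: adg_def)
      then show ?thesis
        unfolding coef_mult case_prod_beta coef_simps
        using sum.remove[OF finite_adg, of "(0, m)" m "\<lambda>x. coef a (fst x) * ?b (snd x)"] by simp
    qed
    also have "coef a 0 * ?b m = coef a 0 * c * ((if m = 0 then fpe p 1 else 0) - ?s)"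
      by (subst minv.simps) (simp only: mult.assoc)
    also have "\<dots> = (if m = 0 then fpe p 1 else 0) - ?s"
      unfolding c(2) by (rule Fp_one_mult(1)[OF sF])
    finally show "coef (a * Mps ?b) m = coef (E p) m" by simp
  qed
  ultimately show ?thesis by blast
qed

section \<open>Chains of prime ideals: upper bound\<close>

definition idl :: "nat \<Rightarrow> nat \<Rightarrow> zprod mps set \<Rightarrow> bool" where
  "idl p d J \<longleftrightarrow> J \<subseteq> Am p d \<and> 0 \<in> J \<and> (\<forall>x\<in>J. \<forall>y\<in>J. x + y \<in> J) \<and> (\<forall>a\<in>Am p d. \<forall>x\<in>J. a * x \<in> J)"

definition prm :: "nat \<Rightarrow> nat \<Rightarrow> zprod mps set \<Rightarrow> bool" where
  "prm p d P \<longleftrightarrow> idl p d P \<and> E p \<notin> P \<and> (\<forall>a\<in>Am p d. \<forall>b\<in>Am p d. a * b \<in> P \<longrightarrow> a \<in> P \<or> b \<in> P)"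

text \<open>The \<open>k\<close>-th power of the maximal ideal, described by order of
  vanishing.\<close>

definition Mk :: "nat \<Rightarrow> nat \<Rightarrow> nat \<Rightarrow> zprod mps set" where
  "Mk p d k = {a \<in> Am p d. \<forall>m. mdeg m < k \<longrightarrow> coef a m = 0}"

lemma idlD:
  assumes "idl p d J"
  shows "x \<in> J \<Longrightarrow> x \<in> Am p d" "0 \<in> J" "x \<in> J \<Longrightarrow> y \<in> J \<Longrightarrow> x + y \<in> J" "a \<in> Am p d \<Longrightarrow> x \<in> J \<Longrightarrow> a * x \<in> J"
  using assms by (auto simp: idl_def)

lemma idl_uminus:
  assumes "p > 0" "idl p d J" "x \<in> J" shows "- x \<in> J"
proof -
  have "- E p * x \<in> J" by (rule idlD(4)[OF assms(2) Am_uminus[OF assms(1) E_in_Am] assms(3)])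
  then show ?thesis using E_mult[OF idlD(1)[OF assms(2,3)]] by simp
qed

lemma idl_diff: "p > 0 \<Longrightarrow> idl p d J \<Longrightarrow> x \<in> J \<Longrightarrow> y \<in> J \<Longrightarrow> x - y \<in> J"
  using idlD(3)[of p d J x "- y"] idl_uminus by simp

lemma idl_sum: "idl p d J \<Longrightarrow> (\<And>i. i \<in> I \<Longrightarrow> f i \<in> J) \<Longrightarrow> sum f I \<in> J"
  by (induction I rule: infinite_finite_induct) (auto intro: idlD)

lemma prmD:
  assumes "prm p d P"
  shows "idl p d P" "E p \<notin> P" "a \<in> Am p d \<Longrightarrow> b \<in> Am p d \<Longrightarrow> a * b \<in> P \<Longrightarrow> a \<in> P \<or> b \<in> P"
  using assms by (auto simp: prm_def)

lemma prm_coef_0: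
  assumes "prime p" "prm p d P" "x \<in> P" shows "coef x 0 = 0"
proof (rule ccontr)
  assume "coef x 0 \<noteq> 0"
  then obtain b where "b \<in> Am p d" "x * b = E p"
    using Am_unit[OF assms(1) idlD(1)[OF prmD(1)[OF assms(2)] assms(3)]] by blast
  then show False using idlD(4)[OF prmD(1)[OF assms(2)], of b x] assms(3) prmD(2)[OF assms(2)]
    by (simp add: mult.commute)
qed

lemma idl_Mk: assumes "p > 0" shows "idl p d (Mk p d k)"
proof -
  have "a * x \<in> Mk p d k" if "a \<in> Am p d" "x \<in> Mk p d k" for a x
  proof -
    have "coef (a * x) m = 0" if "mdeg m < k" for m
    proof -
      have "coef x (snd y) = 0" if "y \<in> adg m" for y
        using that \<open>mdeg m < k\<close> \<open>x \<in> Mk p d k\<close> by (auto simp: adg_def Mk_def mdeg_add)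
      then show ?thesis unfolding coef_mult case_prod_beta by simp
    qed
    then show ?thesis using that Am_mult[OF assms] by (auto simp: Mk_def)
  qed
  then show ?thesis using Am_add[OF assms] by (auto simp: idl_def Mk_def)
qed

lemma Mk_antimono: "k \<le> l \<Longrightarrow> Mk p d l \<subseteq> Mk p d k"
  by (auto simp: Mk_def)

section \<open>Standard bases and the Artin--Rees property\<close>

lemma dickson:
  fixes D :: "(nat \<Rightarrow>\<^sub>0 nat) set"
  assumes "\<And>\<alpha> i. \<alpha> \<in> D \<Longrightarrow> i \<ge> n \<Longrightarrow> lookup \<alpha> i = 0"
  shows "\<exists>F\<subseteq>D. finite F \<and> (\<forall>\<alpha>\<in>D. \<exists>\<phi>\<in>F. \<forall>i. lookup \<phi> i \<le> lookup \<alpha> i)"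
  using assms
proof (induction n arbitrary: D)
  case 0
  then have "D \<subseteq> {0}" by (auto intro: poly_mapping_eqI)
  then show ?case by (intro exI[of _ D]) (auto intro: finite_subset)
next
  case (Suc n)
  \<comment> \<open>Dropping the last coordinate reduces to the induction hypothesis, but domination
    is lost in that coordinate. It is restored by treating finitely many levels of that coordinate
    separately.\<close>
  have proj: "\<exists>F\<subseteq>B. finite F \<and> (\<forall>\<alpha>\<in>B. \<exists>\<phi>\<in>F. \<forall>i. i \<noteq> n \<longrightarrow> lookup \<phi> i \<le> lookup \<alpha> i)" if B: "B \<subseteq> D" for B
  proof -
    let ?cut = "Poly_Mapping.update n (0::nat)"
    have "\<exists>F\<subseteq>?cut ` B. finite F \<and> (\<forall>\<alpha>\<in>?cut ` B. \<exists>\<phi>\<in>F. \<forall>i. lookup \<phi> i \<le> lookup \<alpha> i)"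
    proof (rule Suc.IH)
      fix \<alpha> i assume "\<alpha> \<in> ?cut ` B" "n \<le> i"
      then obtain \<beta> where \<beta>: "\<beta> \<in> B" "\<alpha> = ?cut \<beta>" by blast
      show "lookup \<alpha> i = 0"
      proof (cases "i = n")
        case False
        then show ?thesis using Suc.prems[of \<beta> i] \<beta> B \<open>n \<le> i\<close> by (auto simp: lookup_update)
      qed (simp add: \<beta>(2) lookup_update)
    qed
    then obtain F where F: "F \<subseteq> ?cut ` B" "finite F" "\<forall>\<alpha>\<in>?cut ` B. \<exists>\<phi>\<in>F. \<forall>i. lookup \<phi> i \<le> lookup \<alpha> i"
      by blast
    obtain G where G: "G \<subseteq> B" "finite G" "F = ?cut ` G"
      using finite_subset_image[OF F(2,1)] by blast
    have "\<exists>\<phi>\<in>G. \<forall>i. i \<noteq> n \<longrightarrow> lookup \<phi> i \<le> lookup \<alpha> i" if "\<alpha> \<in> B" for \<alpha>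
    proof -
      obtain \<psi> where \<psi>: "\<psi> \<in> F" "\<forall>i. lookup \<psi> i \<le> lookup (?cut \<alpha>) i"
        using bspec[OF F(3) imageI[OF \<open>\<alpha> \<in> B\<close>]] by blast
      then obtain \<phi> where \<phi>: "\<phi> \<in> G" "\<psi> = ?cut \<phi>" using G(3) by blast
      have "lookup \<phi> i \<le> lookup \<alpha> i" if "i \<noteq> n" for i
        using \<psi>(2)[rule_format, of i] that by (simp add: \<phi>(2) lookup_update)
      then show ?thesis using \<phi>(1) by blast
    qed
    then show ?thesis using G by blast
  qed
  obtain F where F: "F \<subseteq> D" "finite F" "\<forall>\<alpha>\<in>D. \<exists>\<phi>\<in>F. \<forall>i. i \<noteq> n \<longrightarrow> lookup \<phi> i \<le> lookup \<alpha> i"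
    using proj[of D] by blast
  have "\<forall>t. \<exists>G\<subseteq>{\<alpha>\<in>D. lookup \<alpha> n = t}. finite G \<and>
      (\<forall>\<alpha>\<in>{\<alpha>\<in>D. lookup \<alpha> n = t}. \<exists>\<phi>\<in>G. \<forall>i. i \<noteq> n \<longrightarrow> lookup \<phi> i \<le> lookup \<alpha> i)"
    by (intro allI proj) auto
  then obtain G where "\<forall>t. G t \<subseteq> {\<alpha>\<in>D. lookup \<alpha> n = t} \<and> finite (G t) \<and>
      (\<forall>\<alpha>\<in>{\<alpha>\<in>D. lookup \<alpha> n = t}. \<exists>\<phi>\<in>G t. \<forall>i. i \<noteq> n \<longrightarrow> lookup \<phi> i \<le> lookup \<alpha> i)"
    unfolding choice_iff by blast
  then have G: "\<And>t. G t \<subseteq> {\<alpha>\<in>D. lookup \<alpha> n = t}" "\<And>t. finite (G t)"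
    "\<And>t \<alpha>. \<alpha> \<in> D \<Longrightarrow> lookup \<alpha> n = t \<Longrightarrow> \<exists>\<phi>\<in>G t. \<forall>i. i \<noteq> n \<longrightarrow> lookup \<phi> i \<le> lookup \<alpha> i"
    by simp_all
  \<comment> \<open>\<open>b\<close> exceeds the last exponents occurring in \<open>F\<close>: from
    level \<open>b\<close> on, \<open>F\<close> itself dominates.\<close>
  define b where "b = Suc (\<Sum>\<phi>\<in>F. lookup \<phi> n)"
  have b: "lookup \<phi> n \<le> b" if "\<phi> \<in> F" for \<phi>
    using member_le_sum[OF that, of "\<lambda>\<phi>. lookup \<phi> n"] F(2) by (simp add: b_def)
  have "\<exists>\<phi>\<in>F \<union> (\<Union>t<b. G t). \<forall>i. lookup \<phi> i \<le> lookup \<alpha> i" if \<alpha>: "\<alpha> \<in> D" for \<alpha>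
  proof (cases "lookup \<alpha> n < b")
    case True
    obtain \<phi> where \<phi>: "\<phi> \<in> G (lookup \<alpha> n)" "\<forall>i. i \<noteq> n \<longrightarrow> lookup \<phi> i \<le> lookup \<alpha> i"
      using G(3)[OF \<alpha> refl] by blast
    then have "lookup \<phi> n = lookup \<alpha> n" using G(1) by blast
    then have "\<forall>i. lookup \<phi> i \<le> lookup \<alpha> i" using \<phi>(2) by (metis order_refl)
    then show ?thesis using \<phi>(1) True by blast
  next
    case False
    obtain \<phi> where \<phi>: "\<phi> \<in> F" "\<forall>i. i \<noteq> n \<longrightarrow> lookup \<phi> i \<le> lookup \<alpha> i" using F(3) \<alpha> by blast
    have "lookup \<phi> n \<le> lookup \<alpha> n" using b[OF \<phi>(1)] False by simp
    then have "\<forall>i. lookup \<phi> i \<le> lookup \<alpha> i" using \<phi>(2) by metis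
    then show ?thesis using \<phi>(1) by blast
  qed
  moreover have "F \<union> (\<Union>t<b. G t) \<subseteq> D" "finite (F \<union> (\<Union>t<b. G t))" using F G(1,2) by blast+
  ultimately show ?case by blast
qed

text \<open>The order is local: least total degree first, ties broken by the order on exponents. In
  \<open>Am\<close> each degree has finitely many exponents, so minima exist.\<close>

definition islead :: "zprod mps \<Rightarrow> (nat \<Rightarrow>\<^sub>0 nat) \<Rightarrow> bool" where
  "islead g \<alpha> \<longleftrightarrow> coef g \<alpha> \<noteq> 0 \<and> (\<forall>\<beta>. coef g \<beta> \<noteq> 0 \<longrightarrow> mdeg \<alpha> < mdeg \<beta> \<or> mdeg \<alpha> = mdeg \<beta> \<and> \<alpha> \<le> \<beta>)"

lemma lookup_le_mdeg: "lookup m i \<le> mdeg m"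
proof (cases "i \<in> Poly_Mapping.keys m")
  case True
  then show ?thesis unfolding mdeg_def by (rule member_le_sum) auto
qed (simp add: in_keys_iff)

lemma finite_mdeg_le: "finite {m. mdeg m \<le> k \<and> (\<forall>i>d. lookup m i = 0)}"
proof (rule finite_imageD)
  show "inj_on lookup {m :: nat \<Rightarrow>\<^sub>0 nat. mdeg m \<le> k \<and> (\<forall>i>d. lookup m i = 0)}"
    by (rule inj_onI, rule poly_mapping_eqI, simp)
  have "lookup ` {m. mdeg m \<le> k \<and> (\<forall>i>d. lookup m i = 0)} \<subseteq>
      (\<lambda>f i. if i \<le> d then f i else 0) ` PiE {..d} (\<lambda>_. {..k})"
  proof (rule image_subsetI)
    fix m :: "nat \<Rightarrow>\<^sub>0 nat" assume m: "m \<in> {m. mdeg m \<le> k \<and> (\<forall>i>d. lookup m i = 0)}"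
    then have "lookup m i \<le> k" for i using lookup_le_mdeg[of m i] by auto
    then show "lookup m \<in> (\<lambda>f i. if i \<le> d then f i else 0) ` PiE {..d} (\<lambda>_. {..k})"
      using m by (intro image_eqI[of _ _ "restrict (lookup m) {..d}"]) (auto simp: fun_eq_iff)
  qed
  then show "finite (lookup ` {m. mdeg m \<le> k \<and> (\<forall>i>d. lookup m i = 0)})"
    by (rule finite_subset) (intro finite_imageI finite_PiE; simp)
qed

text \<open>Meant for leading exponents \<open>\<alpha>\<close> and \<open>\<beta>\<close>:
  minimality leaves no other pair of exponents with the same sum.\<close>

lemma coef_mult_unique:
  assumes "\<And>x y. x + y = \<alpha> + \<beta> \<Longrightarrow> coef a x \<noteq> 0 \<Longrightarrow> coef b y \<noteq> 0 \<Longrightarrow> x = \<alpha> \<and> y = \<beta>"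
  shows "coef (a * b) (\<alpha> + \<beta>) = coef a \<alpha> * coef b \<beta>"
proof -
  have "coef (a * b) (\<alpha> + \<beta>) = (\<Sum>x\<in>{(\<alpha>, \<beta>)}. coef a (fst x) * coef b (snd x))"
    unfolding coef_mult case_prod_beta
  proof (rule sum.mono_neutral_right)
    show "{(\<alpha>, \<beta>)} \<subseteq> adg (\<alpha> + \<beta>)" by (simp add: adg_def)
    show "\<forall>x\<in>adg (\<alpha> + \<beta>) - {(\<alpha>, \<beta>)}. coef a (fst x) * coef b (snd x) = 0"
    proof
      fix x assume x: "x \<in> adg (\<alpha> + \<beta>) - {(\<alpha>, \<beta>)}"
      show "coef a (fst x) * coef b (snd x) = 0"
      proof (rule ccontr)
        assume "coef a (fst x) * coef b (snd x) \<noteq> 0"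
        then have "coef a (fst x) \<noteq> 0" "coef b (snd x) \<noteq> 0" by auto
        moreover have "fst x + snd x = \<alpha> + \<beta>" using x by (auto simp: adg_def)
        ultimately have "x = (\<alpha>, \<beta>)" using assms by (simp add: prod_eq_iff)
        then show False using x by simp
      qed
    qed
  qed simp
  then show ?thesis by simp
qed

lemma islead_exists:
  assumes "a \<in> Am p d" "a \<noteq> 0" shows "\<exists>\<alpha>. islead a \<alpha>"
proof -
  obtain \<gamma> where \<gamma>: "coef a \<gamma> \<noteq> 0" using assms(2) mps_eqI[of a 0] by auto
  define n where "n = (LEAST n. \<exists>\<beta>. coef a \<beta> \<noteq> 0 \<and> mdeg \<beta> = n)"
  have n: "\<exists>\<beta>. coef a \<beta> \<noteq> 0 \<and> mdeg \<beta> = n"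
    unfolding n_def by (rule LeastI) (use \<gamma> in blast)
  have nle: "n \<le> mdeg \<beta>" if "coef a \<beta> \<noteq> 0" for \<beta>
    unfolding n_def by (rule Least_le) (use that in blast)
  let ?T = "{\<beta>. coef a \<beta> \<noteq> 0 \<and> mdeg \<beta> = n}"
  have fin: "finite ?T"
    by (rule finite_subset[OF _ finite_mdeg_le[of n d]]) (use AmD(2)[OF assms(1)] in auto)
  have "Min ?T \<in> ?T" by (rule Min_in[OF fin]) (use n in blast)
  moreover have "mdeg (Min ?T) < mdeg \<beta> \<or> mdeg (Min ?T) = mdeg \<beta> \<and> Min ?T \<le> \<beta>" if "coef a \<beta> \<noteq> 0" for \<beta>
    using nle[OF that] \<open>Min ?T \<in> ?T\<close> Min_le[OF fin, of \<beta>] that by (cases "mdeg \<beta> = n") auto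
  ultimately show ?thesis unfolding islead_def by blast
qed

lemma Am_no_zero_divisors:
  assumes p: "prime p" and a: "a \<in> Am p d" "a \<noteq> 0" and b: "b \<in> Am p d" "b \<noteq> 0"
  shows "a * b \<noteq> 0"
proof -
  obtain \<alpha> \<beta> where \<alpha>: "islead a \<alpha>" and \<beta>: "islead b \<beta>" using islead_exists a b by metis
  have "coef (a * b) (\<alpha> + \<beta>) = coef a \<alpha> * coef b \<beta>"
  proof (rule coef_mult_unique)
    fix x y assume *: "x + y = \<alpha> + \<beta>" "coef a x \<noteq> 0" "coef b y \<noteq> 0"
    have "mdeg x + mdeg y = mdeg \<alpha> + mdeg \<beta>" using *(1) by (metis mdeg_add)
    then have le: "\<alpha> \<le> x" "\<beta> \<le> y" using \<alpha> \<beta> *(2,3) unfolding islead_def by force+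
    then show "x = \<alpha> \<and> y = \<beta>"
      using *(1) add_less_le_mono[of \<alpha> x \<beta> y] add_le_less_mono[of \<alpha> x \<beta> y] by (metis less_irrefl order_less_le)
  qed
  moreover have "coef a \<alpha> * coef b \<beta> \<noteq> 0"
    using Fp_no_zero_divisors[OF p AmD(1)[OF a(1)] AmD(1)[OF b(1)]] \<alpha> \<beta> by (auto simp: islead_def)
  ultimately show ?thesis by auto
qed

lemma prm_0: assumes "prime p" shows "prm p d {0}"
proof -
  have "E p \<noteq> 0"
  proof
    assume "E p = 0"
    then have "coef (E p) 0 = coef 0 0" by simp
    then show False using fpe_one_neq_0[OF assms] by simp
  qed
  then show ?thesis unfolding prm_def idl_def using Am_no_zero_divisors[OF assms] by auto
qed

text \<open>The generators are a standard basis for the degree-lexicographic order; division by it never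
  lowers the order, which gives the filtered form of generation.\<close>
lemma filtered_generators:
  assumes p: "prime p" and J: "idl p d J"
  obtains F :: "(nat \<Rightarrow>\<^sub>0 nat) set" and gen c where "finite F" "\<And>\<phi>. \<phi> \<in> F \<Longrightarrow> gen \<phi> \<in> J"
    "\<And>k v. v \<in> J \<Longrightarrow> v \<in> Mk p d k \<Longrightarrow>
      \<exists>a. (\<forall>\<phi>\<in>F. a \<phi> \<in> Mk p d (k - c)) \<and> v = (\<Sum>\<phi>\<in>F. a \<phi> * gen \<phi>)"
proof -
  have p0: "p > 0" using p prime_gt_0_nat by blast
  note JA = idlD(1)[OF J]
  define LE where "LE = {\<alpha>. \<exists>g\<in>J. islead g \<alpha>}"
  have "lookup \<alpha> i = 0" if "\<alpha> \<in> LE" "i \<ge> Suc d" for \<alpha> i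
    using that AmD(2)[OF JA, of _ \<alpha> i] by (auto simp: LE_def islead_def)
  then obtain F where F: "F \<subseteq> LE" "finite F" "\<forall>\<alpha>\<in>LE. \<exists>\<phi>\<in>F. \<forall>i. lookup \<phi> i \<le> lookup \<alpha> i"
    using dickson[of LE "Suc d"] by blast
  have "\<forall>\<phi>\<in>F. \<exists>g. g \<in> J \<and> islead g \<phi>" using F(1) by (auto simp: LE_def)
  then obtain gen where gen: "\<And>\<phi>. \<phi> \<in> F \<Longrightarrow> gen \<phi> \<in> J" "\<And>\<phi>. \<phi> \<in> F \<Longrightarrow> islead (gen \<phi>) \<phi>"
    by metis
  \<comment> \<open>Reducing by \<open>gen \<phi>\<close> multiplies it by a monomial of degree
    \<open>n - mdeg \<phi>\<close>; the sum bounds this loss of order for all generators at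
    once.\<close>
  define c where "c = (\<Sum>\<phi>\<in>F. mdeg \<phi>)"
  have c: "mdeg \<phi> \<le> c" if "\<phi> \<in> F" for \<phi>
    unfolding c_def by (rule member_le_sum) (use that F(2) in auto)
  note Mi = idl_Mk[OF p0]
  have step: "\<exists>a. (\<forall>\<phi>\<in>F. a \<phi> \<in> Mk p d (n - c)) \<and> v - (\<Sum>\<phi>\<in>F. a \<phi> * gen \<phi>) \<in> J \<inter> Mk p d (Suc n)"
    if "v \<in> J \<inter> Mk p d n" for n v
  proof -
    \<comment> \<open>Cancelling the lowest term may create higher terms of degree \<open>n\<close>,
      so the support need not shrink. Its upward closure in degree \<open>n\<close> does: it loses
      \<open>\<alpha>\<close>.\<close>
    let ?U = "\<lambda>v. {\<gamma>. mdeg \<gamma> = n \<and> (\<forall>i>d. lookup \<gamma> i = 0) \<and> (\<exists>\<delta>\<le>\<gamma>. mdeg \<delta> = n \<and> coef v \<delta> \<noteq> 0)}"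
    have finU: "finite (?U v)" for v by (rule finite_subset[OF _ finite_mdeg_le[of n d]]) auto
    show ?thesis using that
    proof (induction "card (?U v)" arbitrary: v rule: less_induct)
      case less
      have vA: "v \<in> Am p d" using less.prems JA by blast
      show ?case
      proof (cases "v \<in> Mk p d (Suc n)")
        case True
        then show ?thesis using less.prems idlD(2)[OF Mi] by (intro exI[of _ "\<lambda>_. 0"]) auto
      next
        case False
        let ?T = "{\<delta>. mdeg \<delta> = n \<and> coef v \<delta> \<noteq> 0}"
        have van: "coef v m = 0" if "mdeg m < n" for m using less.prems that by (auto simp: Mk_def)
        obtain \<delta> where "mdeg \<delta> < Suc n" "coef v \<delta> \<noteq> 0" using False vA by (auto simp: Mk_def)
        then have ne: "?T \<noteq> {}" using van[of \<delta>] by (auto simp: less_Suc_eq)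
        have fin: "finite ?T"
          by (rule finite_subset[OF _ finite_mdeg_le[of n d]]) (use AmD(2)[OF vA] in auto)
        define \<alpha> where "\<alpha> = Min ?T"
        have \<alpha>: "mdeg \<alpha> = n" "coef v \<alpha> \<noteq> 0" using Min_in[OF fin ne] by (auto simp: \<alpha>_def)
        have \<alpha>le: "\<alpha> \<le> \<delta>" if "mdeg \<delta> = n" "coef v \<delta> \<noteq> 0" for \<delta>
          unfolding \<alpha>_def by (rule Min_le[OF fin]) (use that in auto)
        have "islead v \<alpha>" unfolding islead_def using \<alpha> \<alpha>le van by (metis linorder_neqE_nat)
        then have "\<alpha> \<in> LE" using less.prems by (auto simp: LE_def)
        then obtain \<phi> where \<phi>: "\<phi> \<in> F" "\<exists>\<gamma>. \<alpha> = \<phi> + \<gamma>" using F(3) adds_iff_lookup by metis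
        then obtain \<gamma> where \<gamma>: "\<alpha> = \<phi> + \<gamma>" by blast
        have gA: "gen \<phi> \<in> Am p d" using JA gen(1)[OF \<phi>(1)] by blast
        have lead: "coef (gen \<phi>) \<phi> \<noteq> 0" "\<And>\<beta>. coef (gen \<phi>) \<beta> \<noteq> 0 \<Longrightarrow> mdeg \<phi> < mdeg \<beta> \<or> mdeg \<phi> = mdeg \<beta> \<and> \<phi> \<le> \<beta>"
          using gen(2)[OF \<phi>(1)] by (auto simp: islead_def)
        obtain y where y: "y \<in> Fp p" "coef (gen \<phi>) \<phi> * y = fpe p 1"
          using Fp_inverse[OF p AmD(1)[OF gA] lead(1)] by blast
        define t where "t = mnm \<gamma> (y * coef v \<alpha>)"
        have \<gamma>d: "lookup \<gamma> i = 0" if "i > d" for i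
          using AmD(2)[OF vA \<alpha>(2) that] by (simp add: \<gamma> lookup_add)
        have tA: "t \<in> Am p d" unfolding t_def by (rule mnm_in_Am) (use y AmD(1)[OF vA] \<gamma>d in \<open>auto intro: Fp_mult\<close>)
        have tM: "t \<in> Mk p d (n - c)"
          using tA c[OF \<phi>(1)] \<alpha>(1) \<gamma> by (auto simp: Mk_def t_def mdeg_add)
        have tg: "coef (t * gen \<phi>) m = 0 \<or> n < mdeg m \<or> (mdeg m = n \<and> \<alpha> \<le> m)" for m
        proof (cases "\<exists>\<beta>. m = \<gamma> + \<beta>")
          case True
          then obtain \<beta> where m: "m = \<gamma> + \<beta>" by blast
          show ?thesis
          proof (cases "coef (gen \<phi>) \<beta> = 0")
            case False
            then show ?thesis using lead(2)[OF False] \<alpha>(1) by (auto simp: m \<gamma> mdeg_add add.commute[of \<phi>] intro: add_left_mono)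
          qed (simp add: t_def coef_mnm_mult m)
        qed (simp add: t_def coef_mnm_mult)
        have t\<alpha>: "coef (t * gen \<phi>) \<alpha> = coef v \<alpha>"
        proof -
          have e: "\<gamma> + \<phi> = \<alpha>" by (simp add: \<gamma> add.commute)
          have "coef (t * gen \<phi>) (\<gamma> + \<phi>) = (y * coef v \<alpha>) * coef (gen \<phi>) \<phi>"
            unfolding t_def coef_mnm_mult by auto
          then have "coef (t * gen \<phi>) \<alpha> = (coef (gen \<phi>) \<phi> * y) * coef v \<alpha>"
            unfolding e by (simp only: ac_simps)
          then show ?thesis using y(2) Fp_one_mult(1)[OF AmD(1)[OF vA]] by simp
        qed
        define v' where "v' = v - t * gen \<phi>"
        have v': "v' \<in> J \<inter> Mk p d n"
        proof -
          have "v' \<in> J" unfolding v'_def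
            using less.prems idl_diff[OF p0 J] idlD(4)[OF J tA gen(1)[OF \<phi>(1)]] by blast
          moreover have "coef v' m = 0" if "mdeg m < n" for m
            using van[OF that] tg[of m] that by (auto simp: v'_def)
          ultimately show ?thesis using JA by (auto simp: Mk_def)
        qed
        have \<delta>\<alpha>: "\<alpha> \<le> \<delta>" "\<delta> \<noteq> \<alpha>" if "mdeg \<delta> = n" "coef v' \<delta> \<noteq> 0" for \<delta>
          using that \<alpha>le[of \<delta>] tg[of \<delta>] t\<alpha> by (auto simp: v'_def)
        have "?U v' \<subset> ?U v"
        proof
          show "?U v' \<subseteq> ?U v" using \<alpha> \<delta>\<alpha>(1) by (auto intro: order_trans)
          have "\<alpha> \<in> ?U v" using \<alpha> AmD(2)[OF vA \<alpha>(2)] by auto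
          moreover have "\<alpha> \<notin> ?U v'" using \<delta>\<alpha> by (auto dest: order_antisym)
          ultimately show "?U v' \<noteq> ?U v" by blast
        qed
        then have "card (?U v') < card (?U v)" by (rule psubset_card_mono[OF finU])
        from less.hyps[OF this v'] obtain a where a: "\<forall>\<phi>\<in>F. a \<phi> \<in> Mk p d (n - c)"
          "v' - (\<Sum>\<phi>\<in>F. a \<phi> * gen \<phi>) \<in> J \<inter> Mk p d (Suc n)" by blast
        let ?a = "a(\<phi> := a \<phi> + t)"
        have "(\<Sum>\<psi>\<in>F. ?a \<psi> * gen \<psi>) = (\<Sum>\<psi>\<in>F. a \<psi> * gen \<psi>) + t * gen \<phi>"
          using F(2) \<phi>(1) by (simp add: sum.remove[of F \<phi>] algebra_simps)
        then have "v - (\<Sum>\<psi>\<in>F. ?a \<psi> * gen \<psi>) = v' - (\<Sum>\<phi>\<in>F. a \<phi> * gen \<phi>)" by (simp add: v'_def)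
        moreover have "\<forall>\<psi>\<in>F. ?a \<psi> \<in> Mk p d (n - c)" using a(1) tM idlD(3)[OF Mi] \<phi>(1) by auto
        ultimately show ?thesis using a(2) by (intro exI[of _ ?a]) auto
      qed
    qed
  qed
  have "\<forall>n v. \<exists>a. v \<in> J \<inter> Mk p d n \<longrightarrow> (\<forall>\<phi>\<in>F. a \<phi> \<in> Mk p d (n - c)) \<and>
      v - (\<Sum>\<phi>\<in>F. a \<phi> * gen \<phi>) \<in> J \<inter> Mk p d (Suc n)"
    using step by blast
  then obtain st where st: "\<And>n v. v \<in> J \<inter> Mk p d n \<Longrightarrow> (\<forall>\<phi>\<in>F. st n v \<phi> \<in> Mk p d (n - c)) \<and>
      v - (\<Sum>\<phi>\<in>F. st n v \<phi> * gen \<phi>) \<in> J \<inter> Mk p d (Suc n)"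
    unfolding choice_iff by blast
  have main: "\<exists>a. (\<forall>\<phi>\<in>F. a \<phi> \<in> Mk p d (k - c)) \<and> v = (\<Sum>\<phi>\<in>F. a \<phi> * gen \<phi>)"
    if v: "v \<in> J" "v \<in> Mk p d k" for k v
  proof -
    \<comment> \<open>The remainders \<open>V n\<close> have order at least \<open>k + n\<close>, so
      repeated division leaves nothing in the limit.\<close>
    define V where "V = rec_nat v (\<lambda>n w. w - (\<Sum>\<phi>\<in>F. st (k + n) w \<phi> * gen \<phi>))"
    have V0: "V 0 = v" and VS: "\<And>n. V (Suc n) = V n - (\<Sum>\<phi>\<in>F. st (k + n) (V n) \<phi> * gen \<phi>)"
      by (simp_all add: V_def)
    have VJ: "V n \<in> J \<inter> Mk p d (k + n)" for n
    proof (induction n)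
      case (Suc n)
      then show ?case using st[OF Suc] by (simp add: VS)
    qed (use v V0 in simp)
    define s where "s = (\<lambda>n \<phi>. st (k + n) (V n) \<phi>)"
    have sM: "s n \<phi> \<in> Mk p d (k + n - c)" if "\<phi> \<in> F" for n \<phi> using st[OF VJ] that by (simp add: s_def)
    have sz: "coef (s n \<phi>) m = 0" if "\<phi> \<in> F" "mdeg m < k + n - c" for n \<phi> m
      using sM[OF that(1)] that(2) by (auto simp: Mk_def)
    have partial: "v - V N = (\<Sum>n<N. \<Sum>\<phi>\<in>F. s n \<phi> * gen \<phi>)" for N
      by (induction N) (simp_all add: V0 VS s_def algebra_simps)
    \<comment> \<open>The infinite sum of the quotients. As \<open>s n \<phi>\<close> has order at
      least \<open>k + n - c\<close>, only \<open>n \<le> mdeg m + c\<close> can contribute at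
      \<open>m\<close>.\<close>
    define a where "a = (\<lambda>\<phi>. Mps (\<lambda>m. \<Sum>n\<le>mdeg m + c. coef (s n \<phi>) m))"
    have acoef: "coef (a \<phi>) m = (\<Sum>n<N. coef (s n \<phi>) m)" if "\<phi> \<in> F" "mdeg m + c < N" for \<phi> m N
    proof -
      have "(\<Sum>n<N. coef (s n \<phi>) m) = (\<Sum>n\<le>mdeg m + c. coef (s n \<phi>) m)"
      proof (rule sum.mono_neutral_right)
        show "\<forall>i\<in>{..<N} - {..mdeg m + c}. coef (s i \<phi>) m = 0"
        proof
          fix i assume "i \<in> {..<N} - {..mdeg m + c}"
          then have "mdeg m < k + i - c" by auto
          then show "coef (s i \<phi>) m = 0" by (rule sz[OF that(1)])
        qed
      qed (use that(2) in auto)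
      then show ?thesis by (simp add: a_def)
    qed
    have aM: "a \<phi> \<in> Mk p d (k - c)" if \<phi>: "\<phi> \<in> F" for \<phi>
    proof -
      have sA: "s n \<phi> \<in> Am p d" for n using sM[OF \<phi>] by (auto simp: Mk_def)
      have "coef (a \<phi>) m \<in> Fp p" for m
        unfolding a_def coef_simps by (rule Fp_sum[OF p0]) (rule AmD(1)[OF sA])
      moreover have "lookup m i = 0" if "coef (a \<phi>) m \<noteq> 0" "i > d" for m i
      proof -
        obtain n where "coef (s n \<phi>) m \<noteq> 0" using \<open>coef (a \<phi>) m \<noteq> 0\<close> unfolding a_def coef_simps by (meson sum.neutral)
        then show ?thesis using AmD(2)[OF sA _ \<open>i > d\<close>] by blast
      qed
      moreover have "coef (a \<phi>) m = 0" if "mdeg m < k - c" for m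
        unfolding a_def coef_simps by (rule sum.neutral) (use sz[OF \<phi>] that in auto)
      ultimately show ?thesis by (auto simp: Mk_def Am_def)
    qed
    have "coef v m = coef (\<Sum>\<phi>\<in>F. a \<phi> * gen \<phi>) m" for m
    proof -
      define N where "N = Suc (mdeg m + c)"
      have "coef (V N) m = 0" using VJ[of N] by (auto simp: Mk_def N_def)
      then have "coef v m = coef (v - V N) m" by simp
      also have "v - V N = (\<Sum>\<phi>\<in>F. (\<Sum>n<N. s n \<phi>) * gen \<phi>)"
        unfolding partial by (subst sum.swap) (simp add: sum_distrib_right)
      also have "coef \<dots> m = (\<Sum>\<phi>\<in>F. coef (a \<phi> * gen \<phi>) m)"
        unfolding coef_sum
      proof (rule sum.cong[OF refl])
        fix \<phi> assume \<phi>: "\<phi> \<in> F"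
        show "coef ((\<Sum>n<N. s n \<phi>) * gen \<phi>) m = coef (a \<phi> * gen \<phi>) m"
          unfolding coef_mult case_prod_beta
        proof (rule sum.cong[OF refl])
          fix x assume "x \<in> adg m"
          then have "mdeg (fst x) + c < N" by (auto simp: adg_def N_def mdeg_add)
          then show "coef (\<Sum>n<N. s n \<phi>) (fst x) * coef (gen \<phi>) (snd x) = coef (a \<phi>) (fst x) * coef (gen \<phi>) (snd x)"
            by (simp add: acoef[OF \<phi>] coef_sum)
        qed
      qed
      finally show ?thesis by (simp add: coef_sum)
    qed
    then have "v = (\<Sum>\<phi>\<in>F. a \<phi> * gen \<phi>)" by (rule mps_eqI)
    then show ?thesis using aM by blast
  qed
  show thesis by (rule that[of F gen c, OF F(2) gen(1) main])
qed

text \<open>The filtered generators are applied to the ideal \<open>u A + P\<close>. Writing each of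
  them as \<open>u e + x\<close> with \<open>x\<close> in \<open>P\<close> turns the hypothesis into
  \<open>u (b - s)\<close> in \<open>P\<close>, where \<open>s\<close> has order at least
  \<open>k - c\<close>; primality then removes \<open>u\<close>, and \<open>b - s\<close> is the
  required \<open>y\<close>.\<close>

lemma artin_rees:
  assumes p: "prime p" and P: "prm p d P" and u: "u \<in> Am p d" "u \<notin> P"
  obtains c where "\<And>k b x. b \<in> Am p d \<Longrightarrow> x \<in> P \<Longrightarrow> u * b - x \<in> Mk p d k \<Longrightarrow> \<exists>y\<in>P. b - y \<in> Mk p d (k - c)"
proof -
  have p0: "p > 0" using p prime_gt_0_nat by blast
  note PI = prmD(1)[OF P]
  note PA = idlD(1)[OF PI]
  define J where "J = {u * a + x | a x. a \<in> Am p d \<and> x \<in> P}"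
  have J: "idl p d J"
    unfolding idl_def
  proof (intro conjI ballI)
    show "J \<subseteq> Am p d" using PA Am_add[OF p0 Am_mult[OF p0 u(1)]] by (auto simp: J_def)
    show "0 \<in> J" unfolding J_def using idlD(2)[OF PI] by (auto intro!: exI[of _ 0])
    fix v w assume "v \<in> J" "w \<in> J"
    then obtain a x b y where "v = u * a + x" "w = u * b + y" "a \<in> Am p d" "b \<in> Am p d" "x \<in> P" "y \<in> P"
      by (auto simp: J_def)
    then have "v + w = u * (a + b) + (x + y)" "a + b \<in> Am p d" "x + y \<in> P"
      using Am_add[OF p0] idlD(3)[OF PI] by (auto simp: algebra_simps)
    then show "v + w \<in> J" unfolding J_def by blast
  next
    fix b v assume b: "b \<in> Am p d" and "v \<in> J"
    then obtain a x where "v = u * a + x" "a \<in> Am p d" "x \<in> P" by (auto simp: J_def)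
    moreover from this have "b * a \<in> Am p d" "b * x \<in> P"
      using Am_mult[OF p0 b] idlD(4)[OF PI b] by blast+
    ultimately have "b * v = u * (b * a) + b * x" "b * a \<in> Am p d" "b * x \<in> P"
      by (simp_all add: algebra_simps)
    then show "b * v \<in> J" unfolding J_def by blast
  qed
  show thesis
  proof (rule filtered_generators[OF p J])
  fix F :: "(nat \<Rightarrow>\<^sub>0 nat) set" and gen c
  assume G: "finite F" "\<And>\<phi>. \<phi> \<in> F \<Longrightarrow> gen \<phi> \<in> J"
    "\<And>k v. v \<in> J \<Longrightarrow> v \<in> Mk p d k \<Longrightarrow> \<exists>a. (\<forall>\<phi>\<in>F. a \<phi> \<in> Mk p d (k - c)) \<and> v = (\<Sum>\<phi>\<in>F. a \<phi> * gen \<phi>)"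
  have "\<forall>\<phi>\<in>F. \<exists>ex. fst ex \<in> Am p d \<and> snd ex \<in> P \<and> gen \<phi> = u * fst ex + snd ex"
    using G(2) unfolding J_def by fastforce
  then obtain ex where ex: "\<And>\<phi>. \<phi> \<in> F \<Longrightarrow> fst (ex \<phi>) \<in> Am p d \<and> snd (ex \<phi>) \<in> P \<and> gen \<phi> = u * fst (ex \<phi>) + snd (ex \<phi>)"
    by metis
  show thesis
  proof (rule that[of c])
    fix k b x assume b: "b \<in> Am p d" and x: "x \<in> P" and M: "u * b - x \<in> Mk p d k"
    have "u * b - x = u * b + (- x)" "- x \<in> P" using idl_uminus[OF p0 PI x] by auto
    then have "u * b - x \<in> J" unfolding J_def using b by blast
    from G(3)[OF this M] obtain a where a: "\<forall>\<phi>\<in>F. a \<phi> \<in> Mk p d (k - c)" "u * b - x = (\<Sum>\<phi>\<in>F. a \<phi> * gen \<phi>)"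
      by blast
    have aA: "a \<phi> \<in> Am p d" if "\<phi> \<in> F" for \<phi> using a(1) that by (auto simp: Mk_def)
    let ?s = "\<Sum>\<phi>\<in>F. a \<phi> * fst (ex \<phi>)" and ?t = "\<Sum>\<phi>\<in>F. a \<phi> * snd (ex \<phi>)"
    have "(\<Sum>\<phi>\<in>F. a \<phi> * gen \<phi>) = u * ?s + ?t"
      unfolding sum_distrib_left sum.distrib[symmetric]
      by (rule sum.cong[OF refl]) (use ex in \<open>simp add: algebra_simps\<close>)
    then have "u * (b - ?s) = x + ?t" using a(2) by (simp add: algebra_simps)
    moreover have "x + ?t \<in> P"
      by (intro idlD(3)[OF PI x] idl_sum[OF PI] idlD(4)[OF PI]) (use aA ex in auto)
    moreover have "b - ?s \<in> Am p d"
      by (intro Am_diff[OF p0 b] Am_sum[OF p0] Am_mult[OF p0]) (use aA ex in auto)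
    ultimately have y: "b - ?s \<in> P" using prmD(3)[OF P u(1)] u(2) by metis
    have "?s \<in> Mk p d (k - c)"
    proof (rule idl_sum[OF idl_Mk[OF p0]])
      fix \<phi> assume "\<phi> \<in> F"
      then have "fst (ex \<phi>) * a \<phi> \<in> Mk p d (k - c)" using idlD(4)[OF idl_Mk[OF p0]] ex a(1) by blast
      then show "a \<phi> * fst (ex \<phi>) \<in> Mk p d (k - c)" by (simp add: mult.commute)
    qed
    then show "\<exists>y\<in>P. b - y \<in> Mk p d (k - c)" using y by (intro bexI[of _ "b - ?s"]) auto
  qed
qed
qed

section \<open>Growth of residue counts along a chain of primes\<close>

definition deg_trunc :: "nat \<Rightarrow> zprod mps \<Rightarrow> zprod mps" where
  "deg_trunc k a = Mps (\<lambda>m. if mdeg m < k then coef a m else 0)"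

lemma coef_deg_trunc [simp]: "coef (deg_trunc k a) m = (if mdeg m < k then coef a m else 0)"
  by (simp add: deg_trunc_def)

lemma deg_trunc_add: "deg_trunc k (a + b) = deg_trunc k a + deg_trunc k b" by (rule mps_eqI) simp
lemma deg_trunc_diff: "deg_trunc k (a - b) = deg_trunc k a - deg_trunc k b" by (rule mps_eqI) simp
lemma deg_trunc_deg_trunc: "deg_trunc k (deg_trunc k a) = deg_trunc k a" by (rule mps_eqI) simp
lemma deg_trunc_in_Am: "a \<in> Am p d \<Longrightarrow> deg_trunc k a \<in> Am p d" by (auto simp: Am_def)
lemma deg_trunc_eq_0_iff: "a \<in> Am p d \<Longrightarrow> deg_trunc k a = 0 \<longleftrightarrow> a \<in> Mk p d k"
proof -
  assume "a \<in> Am p d"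
  moreover have "deg_trunc k a = 0 \<longleftrightarrow> (\<forall>m. mdeg m < k \<longrightarrow> coef a m = 0)"
    using mps_eqI[of "deg_trunc k a" 0] by (metis coef_simps(1) coef_deg_trunc)
  ultimately show ?thesis by (simp add: Mk_def)
qed

text \<open>Truncations represent the residues modulo the \<open>k\<close>-th power of the maximal
  ideal. The exponents of degree below \<open>k\<close> are enclosed in a cube of side
  \<open>k\<close>; this is crude, but a polynomial of degree \<open>d + 1\<close> in
  \<open>k\<close> is enough for the chain bound.\<close>

lemma card_deg_trunc_Am:
  assumes "p > 0"
  shows "finite (deg_trunc k ` Am p d)" "card (deg_trunc k ` Am p d) \<le> p ^ (k ^ Suc d)"
proof -
  have inj: "inj_on coef (deg_trunc k ` Am p d)" by (rule inj_onI) (simp add: coef_inject)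
  have sub: "coef ` deg_trunc k ` Am p d \<subseteq> W p {..d} (\<lambda>_. k)"
  proof clarify
    fix a assume a: "a \<in> Am p d"
    show "coef (deg_trunc k a) \<in> W p {..d} (\<lambda>_. k)"
      unfolding W_def
    proof (clarsimp simp: AmD(1)[OF a], intro conjI impI)
      fix \<alpha> i assume *: "mdeg \<alpha> < k" "coef a \<alpha> \<noteq> 0"
      show "lookup \<alpha> i < k" using lookup_le_mdeg[of \<alpha> i] *(1) by simp
      show "\<not> i \<le> d \<Longrightarrow> lookup \<alpha> i = 0" using AmD(2)[OF a *(2)] by simp
    qed
  qed
  have fin: "finite (W p {..d} (\<lambda>_. k))" using pgroupD(1)[OF pgroup_W[OF assms]] by blast
  show "finite (deg_trunc k ` Am p d)" using finite_imageD[OF finite_subset[OF sub fin] inj] .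
  have "card (deg_trunc k ` Am p d) = card (coef ` deg_trunc k ` Am p d)" by (rule card_image[OF inj, symmetric])
  also have "\<dots> \<le> card (W p {..d} (\<lambda>_. k))" by (rule card_mono[OF fin sub])
  also have "\<dots> = p ^ (k ^ Suc d)" by (simp add: card_W assms)
  finally show "card (deg_trunc k ` Am p d) \<le> p ^ (k ^ Suc d)" .
qed

text \<open>The map \<open>(b, w) -> u b + w\<close> sends residues of the ring at level
  \<open>k - c\<close> and of \<open>P\<close> at level \<open>k\<close> to residues of
  \<open>Q\<close>. A kernel element is determined by \<open>b\<close>, and Artin--Rees places
  \<open>b\<close> in \<open>P\<close> at level \<open>k - c\<close>. For the logarithmic index
  \<open>H\<close> this means \<open>H_Q(k) + H_P(k - c) \<le> H_P(k)\<close>.\<close>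

lemma card_deg_trunc_step:
  assumes p: "prime p" and P: "prm p d P" and Q: "idl p d Q" "P \<subseteq> Q" "u \<in> Q"
    and c: "\<And>k b x. b \<in> Am p d \<Longrightarrow> x \<in> P \<Longrightarrow> u * b - x \<in> Mk p d k \<Longrightarrow> \<exists>y\<in>P. b - y \<in> Mk p d (k - c)"
  shows "card (deg_trunc (k - c) ` Am p d) * card (deg_trunc k ` P) \<le> card (deg_trunc k ` Q) * card (deg_trunc (k - c) ` P)"
proof -
  have p0: "p > 0" using p prime_gt_0_nat by blast
  note PI = prmD(1)[OF P]
  note PA = idlD(1)[OF PI] and QA = idlD(1)[OF Q(1)]
  have uA: "u \<in> Am p d" using QA Q(3) by blast
  define D where "D = deg_trunc (k - c) ` Am p d \<times> deg_trunc k ` P"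
  define h where "h = (\<lambda>bw. deg_trunc k (u * fst bw) + snd bw)"
  define K where "K = {z \<in> D. h z = 0}"
  have finI: "finite (deg_trunc l ` I)" if "I \<subseteq> Am p d" for I l
    using finite_subset[OF image_mono[OF that] card_deg_trunc_Am(1)[OF p0]] .
  have finD: "finite D" unfolding D_def using finI PA by blast
  have hd: "h (y - x) = h y - h x" for x y by (simp add: h_def deg_trunc_diff algebra_simps)
  have Ddiff: "y - x \<in> D" if "x \<in> D" "y \<in> D" for x y
    using that Am_diff[OF p0] idl_diff[OF p0 PI] by (auto simp: D_def simp flip: deg_trunc_diff)
  have Dadd: "x + y \<in> D" if "x \<in> D" "y \<in> D" for x y
    using that Am_add[OF p0] idlD(3)[OF PI] by (auto simp: D_def simp flip: deg_trunc_add)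
  have "card D = card (h ` D) * card K"
  proof (rule card_eq_card_image_mult_card_kernel[OF finD])
    show "K \<subseteq> D" by (auto simp: K_def)
    show "x + y \<in> D" if "x \<in> D" "y \<in> K" for x y using that Dadd by (auto simp: K_def)
    show "h x = h y \<longleftrightarrow> y - x \<in> K" if "x \<in> D" "y \<in> D" for x y
      using Ddiff[OF that] by (auto simp: K_def hd)
  qed
  moreover have "card (h ` D) \<le> card (deg_trunc k ` Q)"
  proof (rule card_mono)
    show "finite (deg_trunc k ` Q)" using finI QA by blast
    show "h ` D \<subseteq> deg_trunc k ` Q"
    proof (rule image_subsetI)
      fix z assume "z \<in> D"
      then obtain b x where z: "z = (deg_trunc (k - c) b, deg_trunc k x)" "b \<in> Am p d" "x \<in> P" by (auto simp: D_def)
      have "h z = deg_trunc k (u * deg_trunc (k - c) b + x)" by (simp add: z h_def deg_trunc_add)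
      moreover have "u * deg_trunc (k - c) b + x \<in> Q"
        using idlD(4)[OF Q(1) deg_trunc_in_Am[OF z(2)] Q(3)] Q(2) z(3) by (intro idlD(3)[OF Q(1)]) (auto simp: mult.commute)
      ultimately show "h z \<in> deg_trunc k ` Q" by blast
    qed
  qed
  moreover have "card K \<le> card (deg_trunc (k - c) ` P)"
  proof (rule card_inj_on_le[of fst])
    show "inj_on fst K"
      by (rule inj_onI) (auto simp: K_def h_def add_eq_0_iff prod_eq_iff)
    show "finite (deg_trunc (k - c) ` P)" using finI PA by blast
    show "fst ` K \<subseteq> deg_trunc (k - c) ` P"
    proof (rule image_subsetI)
      fix z assume z: "z \<in> K"
      then obtain b x where *: "z = (deg_trunc (k - c) b, deg_trunc k x)" "b \<in> Am p d" "x \<in> P" by (auto simp: K_def D_def)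
      let ?b = "deg_trunc (k - c) b"
      have bA: "?b \<in> Am p d" by (rule deg_trunc_in_Am[OF *(2)])
      have "deg_trunc k (u * ?b - (- x)) = 0" using z by (simp add: K_def h_def * deg_trunc_add)
      then have "u * ?b - (- x) \<in> Mk p d k"
        using deg_trunc_eq_0_iff[of "u * ?b - (- x)" p d k] Am_add[OF p0 Am_mult[OF p0 uA bA] PA[OF *(3)]] by simp
      then obtain y where y: "y \<in> P" "?b - y \<in> Mk p d (k - c)"
        using c[OF bA idl_uminus[OF p0 PI *(3)]] by blast
      then have "deg_trunc (k - c) (?b - y) = 0"
        using deg_trunc_eq_0_iff[of "?b - y" p d] Am_diff[OF p0 bA PA[OF y(1)]] by simp
      then have "?b = deg_trunc (k - c) y" by (simp add: deg_trunc_diff deg_trunc_deg_trunc)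
      then show "fst z \<in> deg_trunc (k - c) ` P" using y(1) * by simp
    qed
  qed
  ultimately show ?thesis
    by (simp add: D_def card_cartesian_product) (metis mult_le_mono)
qed

lemma card_deg_trunc_prm:
  assumes p: "prime p" and P: "prm p d P" and k: "k \<ge> 1"
  shows "p * card (deg_trunc k ` P) \<le> card (deg_trunc k ` Am p d)"
proof -
  have p0: "p > 0" using p prime_gt_0_nat by blast
  let ?V = "deg_trunc k ` Am p d"
  let ?K = "{a \<in> ?V. coef a 0 = 0}"
  have fin: "finite ?V" by (rule card_deg_trunc_Am[OF p0])
  have "card ?V = card ((\<lambda>a. coef a 0) ` ?V) * card ?K"
  proof (rule card_eq_card_image_mult_card_kernel[OF fin])
    show "x + y \<in> ?V" if "x \<in> ?V" "y \<in> ?K" for x y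
      using that Am_add[OF p0] by (auto simp flip: deg_trunc_add)
    show "coef x 0 = coef y 0 \<longleftrightarrow> y - x \<in> ?K" if "x \<in> ?V" "y \<in> ?V" for x y
    proof -
      have "y - x \<in> ?V" using that Am_diff[OF p0] by (auto simp flip: deg_trunc_diff)
      then show ?thesis by auto
    qed
  qed auto
  moreover have "(\<lambda>a. coef a 0) ` ?V = Fp p"
  proof
    show "(\<lambda>a. coef a 0) ` ?V \<subseteq> Fp p" using AmD(1) k by auto
    show "Fp p \<subseteq> (\<lambda>a. coef a 0) ` ?V"
    proof
      fix x assume "x \<in> Fp p"
      then have "mnm 0 x \<in> Am p d" by (intro mnm_in_Am) auto
      then have a: "deg_trunc k (mnm 0 x) \<in> ?V" by (rule imageI)
      have b: "x = coef (deg_trunc k (mnm 0 x)) 0" using k by simp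
      show "x \<in> (\<lambda>a. coef a 0) ` ?V" by (rule image_eqI[where f = "\<lambda>a. coef a 0", OF b a])
    qed
  qed
  moreover have "card (deg_trunc k ` P) \<le> card ?K"
    by (rule card_mono) (use fin prm_coef_0[OF p P] idlD(1)[OF prmD(1)[OF P]] in auto)
  ultimately show ?thesis by (simp add: card_Fp[OF p0])
qed

text \<open>Degree \<open>d + 1\<close> in \<open>k\<close> is overtaken by degree
  \<open>d + 2\<close>. For \<open>k = N M\<close> the bound
  \<open>(k / N)^N \<le> k choose N\<close> leaves a comparison of powers of \<open>M\<close>, won
  once \<open>M\<close> exceeds \<open>K\<close>.\<close>

lemma power_less_binomial: "\<exists>k. (C * (k + 1)) ^ Suc d < k choose Suc (Suc d)"
proof -
  define N where "N = Suc (Suc d)"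
  define K where "K = (C * (N + 1)) ^ Suc d"
  define M where "M = Suc K"
  have "M ^ N \<le> (N * M) choose N"
  proof -
    have "N \<le> N * M" by (simp add: M_def)
    then have "(real (N * M) / real N) ^ N \<le> real ((N * M) choose N)"
      by (rule binomial_ge_n_over_k_pow_k)
    moreover have "real (N * M) / real N = real M"
    proof -
      have "N > 0" by (simp add: N_def)
      then show ?thesis by simp
    qed
    ultimately have "real (M ^ N) \<le> real ((N * M) choose N)" by (simp only: of_nat_power)
    then show ?thesis by (simp only: of_nat_le_iff)
  qed
  moreover have "(C * (N * M + 1)) ^ Suc d < M ^ N"
  proof -
    have "N * M + 1 \<le> (N + 1) * M" by (simp add: M_def)
    then have "(C * (N * M + 1)) ^ Suc d \<le> (C * ((N + 1) * M)) ^ Suc d"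
      by (intro power_mono mult_le_mono) auto
    also have "\<dots> = K * M ^ Suc d" by (simp only: K_def power_mult_distrib mult.assoc)
    also have "\<dots> < M * M ^ Suc d" by (intro mult_strict_right_mono) (auto simp: M_def)
    also have "\<dots> = M ^ N" by (simp add: N_def)
    finally show ?thesis .
  qed
  ultimately show ?thesis unfolding N_def by (meson order_less_le_trans)
qed

text \<open>By \<open>card_deg_trunc_step\<close> the index function of \<open>P i\<close> grows,
  per step of length \<open>C\<close>, by at least that of \<open>P (Suc i)\<close>. Pascal's rule
  turns this into the lower bound \<open>k choose j\<close> for the \<open>j\<close>-th prime below
  the top, whereas the whole ring only allows degree \<open>d + 1\<close>. So
  \<open>j = d + 2\<close> cannot occur.\<close>

lemma prm_chain_length:
  assumes p: "prime p" and P: "\<And>i. i \<le> n \<Longrightarrow> prm p d (P i)" and sub: "\<And>i. i < n \<Longrightarrow> P i \<subset> P (Suc i)"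
  shows "n \<le> Suc d"
proof (rule ccontr)
  assume "\<not> n \<le> Suc d"
  have p1: "p > 1" "p > 0" using p prime_gt_1_nat prime_gt_0_nat by auto
  have AR: "\<forall>i. \<exists>c. i < n \<longrightarrow> (\<exists>u\<in>P (Suc i). \<forall>k b x. b \<in> Am p d \<longrightarrow> x \<in> P i \<longrightarrow> u * b - x \<in> Mk p d k \<longrightarrow>
      (\<exists>y\<in>P i. b - y \<in> Mk p d (k - c)))"
  proof
    fix i show "\<exists>c. i < n \<longrightarrow> (\<exists>u\<in>P (Suc i). \<forall>k b x. b \<in> Am p d \<longrightarrow> x \<in> P i \<longrightarrow> u * b - x \<in> Mk p d k \<longrightarrow>
      (\<exists>y\<in>P i. b - y \<in> Mk p d (k - c)))"
    proof (cases "i < n")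
      case True
      then obtain u where u: "u \<in> P (Suc i)" "u \<notin> P i" using sub by blast
      have uA: "u \<in> Am p d" using idlD(1)[OF prmD(1)[OF P]] u(1) True by (meson Suc_leI)
      from artin_rees[OF p P uA u(2)] True obtain c where
        "\<And>k b x. b \<in> Am p d \<Longrightarrow> x \<in> P i \<Longrightarrow> u * b - x \<in> Mk p d k \<Longrightarrow> \<exists>y\<in>P i. b - y \<in> Mk p d (k - c)"
        by (metis less_imp_le)
      then show ?thesis using u(1) by blast
    qed auto
  qed
  then obtain c where c: "\<And>i. i < n \<Longrightarrow> \<exists>u\<in>P (Suc i). \<forall>k b x. b \<in> Am p d \<longrightarrow> x \<in> P i \<longrightarrow> u * b - x \<in> Mk p d k \<longrightarrow>
      (\<exists>y\<in>P i. b - y \<in> Mk p d (k - c i))"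
    unfolding choice_iff by blast
  \<comment> \<open>One shift for all the Artin--Rees constants. The successor makes it positive, so
    that every level \<open>C * (k + 1)\<close> is at least 1.\<close>
  define C where "C = Suc (\<Sum>i<n. c i)"
  define L where "L = (\<lambda>i k. log p (card (deg_trunc k ` Am p d)) - log p (card (deg_trunc k ` P i)))"
  have pos: "card (deg_trunc k ` I) > 0" if "idl p d I" for k I
  proof -
    have "finite (deg_trunc k ` I)"
      using finite_subset[OF image_mono card_deg_trunc_Am(1)[OF p1(2), of k d]] idlD(1)[OF that] by blast
    then show ?thesis using idlD(2)[OF that] by (auto simp: card_gt_0_iff)
  qed
  have Apos: "card (deg_trunc k ` Am p d) > 0" for k
    using card_deg_trunc_Am(1)[OF p1(2), of k d] Am_0[of p d] by (metis card_gt_0_iff empty_iff image_is_empty)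
  have step: "L (Suc i) k + L i (k - C) \<le> L i k" if i: "i < n" for i k
  proof -
    obtain u where u: "u \<in> P (Suc i)" "\<And>k b x. b \<in> Am p d \<Longrightarrow> x \<in> P i \<Longrightarrow> u * b - x \<in> Mk p d k \<Longrightarrow>
      \<exists>y\<in>P i. b - y \<in> Mk p d (k - c i)" using c[OF i] by blast
    have "c i \<le> C" using member_le_sum[of i "{..<n}" c] i by (simp add: C_def)
    then have u': "\<exists>y\<in>P i. b - y \<in> Mk p d (k - C)" if "b \<in> Am p d" "x \<in> P i" "u * b - x \<in> Mk p d k" for k b x
      using u(2)[OF that] Mk_antimono[of "k - C" "k - c i" p d] by (meson diff_le_mono2 subsetD)
    have Pi: "prm p d (P i)" "prm p d (P (Suc i))" using P i by auto
    have *: "real (card (deg_trunc (k - C) ` Am p d)) * real (card (deg_trunc k ` P i)) \<le>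
        real (card (deg_trunc k ` P (Suc i))) * real (card (deg_trunc (k - C) ` P i))"
    proof -
      have "P i \<subseteq> P (Suc i)" using sub[OF i] by blast
      then have "card (deg_trunc (k - C) ` Am p d) * card (deg_trunc k ` P i) \<le>
          card (deg_trunc k ` P (Suc i)) * card (deg_trunc (k - C) ` P i)"
        by (rule card_deg_trunc_step[OF p Pi(1) prmD(1)[OF Pi(2)] _ u(1)]) (rule u')
      then show ?thesis by (simp only: of_nat_le_iff flip: of_nat_mult)
    qed
    have pr: "real (card (deg_trunc l ` P i)) > 0" "real (card (deg_trunc l ` P (Suc i))) > 0" "real (card (deg_trunc l ` Am p d)) > 0" for l
      using pos[OF prmD(1)[OF Pi(1)]] pos[OF prmD(1)[OF Pi(2)]] Apos by auto
    have "log p (real (card (deg_trunc (k - C) ` Am p d)) * real (card (deg_trunc k ` P i))) \<le>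
        log p (real (card (deg_trunc k ` P (Suc i))) * real (card (deg_trunc (k - C) ` P i)))"
      using * pr p1 by (subst log_le_cancel_iff) auto
    then show ?thesis unfolding L_def by (simp add: log_mult_pos[OF pr(3) pr(1)] log_mult_pos[OF pr(2) pr(1)])
  qed
  have L0: "L i k \<ge> 0" if i: "i \<le> n" for i k
  proof -
    have I: "idl p d (P i)" using prmD(1)[OF P[OF i]] .
    have "card (deg_trunc k ` P i) \<le> card (deg_trunc k ` Am p d)"
      by (rule card_mono[OF card_deg_trunc_Am(1)[OF p1(2)]]) (use idlD(1)[OF I] in auto)
    then show ?thesis using pos[OF I, of k] p1 by (simp add: L_def)
  qed
  have growth: "real (k choose j) \<le> L (n - j) (C * (k + 1))" if "j \<le> n" for j k
    using that
  proof (induction j arbitrary: k)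
    case 0
    have "p * card (deg_trunc (C * (k + 1)) ` P n) \<le> card (deg_trunc (C * (k + 1)) ` Am p d)"
      by (rule card_deg_trunc_prm[OF p P]) (auto simp: C_def)
    then have "real p * real (card (deg_trunc (C * (k + 1)) ` P n)) \<le> real (card (deg_trunc (C * (k + 1)) ` Am p d))"
      by (metis of_nat_le_iff of_nat_mult)
    moreover have pp: "real (card (deg_trunc (C * (k + 1)) ` P n)) > 0"
      using pos[OF prmD(1)[OF P]] by simp
    ultimately have "log p (real p * real (card (deg_trunc (C * (k + 1)) ` P n))) \<le> log p (real (card (deg_trunc (C * (k + 1)) ` Am p d)))"
      using p1 Apos[of "C * (k + 1)"] by (subst log_le_cancel_iff) auto
    moreover have "log p (real p * real (card (deg_trunc (C * (k + 1)) ` P n))) =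
        1 + log p (real (card (deg_trunc (C * (k + 1)) ` P n)))"
      using log_mult_pos[OF _ pp, of "real p" "real p"] p1 by simp
    ultimately show ?case unfolding L_def by simp
  next
    case (Suc j)
    then have nj: "n - j = Suc (n - Suc j)" "n - Suc j < n" by auto
    show ?case
    proof (induction k)
      case 0
      show ?case using L0 by simp
    next
      case (Suc k)
      have "C * (Suc k + 1) - C = C * (k + 1)" by (simp add: algebra_simps)
      then have "L (n - j) (C * (Suc k + 1)) + L (n - Suc j) (C * (k + 1)) \<le> L (n - Suc j) (C * (Suc k + 1))"
        using step[OF nj(2), of "C * (Suc k + 1)"] nj(1) by simp
      moreover have "real (k choose j) \<le> L (n - j) (C * (Suc k + 1))"
      proof -
        have "real (k choose j) \<le> real (Suc k choose j)" by (cases j) auto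
        then show ?thesis using \<open>Suc j \<le> n\<close> \<open>\<And>k. j \<le> n \<Longrightarrow> real (k choose j) \<le> L (n - j) (C * (k + 1))\<close>[of "Suc k"] by simp
      qed
      ultimately show ?case using Suc by simp
    qed
  qed
  obtain k where k: "(C * (k + 1)) ^ Suc d < k choose Suc (Suc d)" using power_less_binomial by blast
  define i where "i = n - Suc (Suc d)"
  have "Suc (Suc d) \<le> n" using \<open>\<not> n \<le> Suc d\<close> by simp
  then have "real (k choose Suc (Suc d)) \<le> L i (C * (k + 1))" unfolding i_def by (rule growth)
  also have "\<dots> \<le> log p (card (deg_trunc (C * (k + 1)) ` Am p d))"
  proof -
    have "1 \<le> card (deg_trunc (C * (k + 1)) ` P i)" using pos[OF prmD(1)[OF P], of i] by (simp add: i_def Suc_leI)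
    then have "0 \<le> log p (card (deg_trunc (C * (k + 1)) ` P i))" using p1 by simp
    then show ?thesis by (simp add: L_def)
  qed
  also have "\<dots> \<le> log p (real (p ^ ((C * (k + 1)) ^ Suc d)))"
    using card_deg_trunc_Am(2)[OF p1(2), of "C * (k + 1)" d] Apos[of "C * (k + 1)"] p1
    by (subst log_le_cancel_iff) (auto simp del: power_Suc of_nat_power)
  also have "\<dots> = real ((C * (k + 1)) ^ Suc d)"
    using p1 by (simp add: log_nat_power del: power_Suc)
  finally show False using k by (simp only: of_nat_le_iff)
qed

section \<open>Chains of prime ideals: existence\<close>

lemma prm_avoiding:
  assumes p0: "p > 0" and J: "idl p d J" and S: "S \<subseteq> Am p d" "E p \<in> S"
    and mult: "\<And>s t. s \<in> S \<Longrightarrow> t \<in> S \<Longrightarrow> s * t \<in> S" and disj: "J \<inter> S = {}"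
  obtains P where "prm p d P" "J \<subseteq> P" "P \<inter> S = {}"
proof -
  let ?A = "{I. idl p d I \<and> J \<subseteq> I \<and> I \<inter> S = {}}"
  have "\<exists>P\<in>?A. \<forall>I\<in>?A. P \<subseteq> I \<longrightarrow> I = P"
  proof (rule subset_Zorn_nonempty)
    show "?A \<noteq> {}" using J disj by blast
    fix \<C> assume ne: "\<C> \<noteq> {}" and ch: "subset.chain ?A \<C>"
    have sub: "\<C> \<subseteq> ?A" and lin: "\<And>I K. I \<in> \<C> \<Longrightarrow> K \<in> \<C> \<Longrightarrow> I \<subseteq> K \<or> K \<subseteq> I"
      using ch by (auto simp: subset_chain_def)
    have I: "idl p d I" if "I \<in> \<C>" for I using sub that by blast
    have "idl p d (\<Union>\<C>)"
      unfolding idl_def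
    proof (intro conjI ballI)
      show "\<Union>\<C> \<subseteq> Am p d" using idlD(1)[OF I] by blast
      show "0 \<in> \<Union>\<C>" using ne idlD(2)[OF I] by blast
      show "a * x \<in> \<Union>\<C>" if "a \<in> Am p d" "x \<in> \<Union>\<C>" for a x using that idlD(4)[OF I] by blast
      fix x y assume "x \<in> \<Union>\<C>" "y \<in> \<Union>\<C>"
      then obtain I1 I2 where *: "I1 \<in> \<C>" "I2 \<in> \<C>" "x \<in> I1" "y \<in> I2" by blast
      have "x + y \<in> I1 \<or> x + y \<in> I2"
        using lin[OF *(1,2)]
      proof
        assume "I1 \<subseteq> I2"
        then have "x \<in> I2" using *(3) by blast
        then show ?thesis using idlD(3)[OF I[OF *(2)] _ *(4)] by simp
      next
        assume "I2 \<subseteq> I1"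
        then have "y \<in> I1" using *(4) by blast
        then show ?thesis using idlD(3)[OF I[OF *(1)] *(3)] by simp
      qed
      then show "x + y \<in> \<Union>\<C>" using *(1,2) by blast
    qed
    moreover have "J \<subseteq> \<Union>\<C>" using ne sub by blast
    moreover have "\<Union>\<C> \<inter> S = {}" using sub by blast
    ultimately show "\<Union>\<C> \<in> ?A" by blast
  qed
  then obtain P where P': "P \<in> ?A" "\<forall>I\<in>?A. P \<subseteq> I \<longrightarrow> I = P" by (rule bexE)
  from P'(1) have P: "idl p d P" "J \<subseteq> P" "P \<inter> S = {}" by simp_all
  have max: "I = P" if "idl p d I" "J \<subseteq> I" "I \<inter> S = {}" "P \<subseteq> I" for I
    using P'(2) that by simp
  have meet: "\<exists>x\<in>P. \<exists>c\<in>Am p d. x + c * a \<in> S" if a: "a \<in> Am p d" "a \<notin> P" for a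
  proof (rule ccontr)
    assume no: "\<not> ?thesis"
    let ?I = "{x + c * a | x c. x \<in> P \<and> c \<in> Am p d}"
    have "idl p d ?I"
      unfolding idl_def
    proof (intro conjI ballI)
      show "?I \<subseteq> Am p d" using idlD(1)[OF P(1)] Am_add[OF p0 _ Am_mult[OF p0 _ a(1)]] by blast
      show "0 \<in> ?I" using idlD(2)[OF P(1)] by (auto intro!: exI[of _ 0])
      fix v w assume "v \<in> ?I" "w \<in> ?I"
      then obtain x c y e where "v = x + c * a" "w = y + e * a" "x \<in> P" "y \<in> P" "c \<in> Am p d" "e \<in> Am p d" by blast
      then have "v + w = (x + y) + (c + e) * a" "x + y \<in> P" "c + e \<in> Am p d"
        using Am_add[OF p0] idlD(3)[OF P(1)] by (simp_all add: algebra_simps)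
      then show "v + w \<in> ?I" by blast
    next
      fix b v assume b: "b \<in> Am p d" and "v \<in> ?I"
      then obtain x c where *: "v = x + c * a" "x \<in> P" "c \<in> Am p d" by blast
      then have "b * v = b * x + (b * c) * a" by (simp add: algebra_simps)
      moreover have "b * x \<in> P" "b * c \<in> Am p d" using idlD(4)[OF P(1) b *(2)] Am_mult[OF p0 b *(3)] by auto
      ultimately show "b * v \<in> ?I" by blast
    qed
    moreover have Psub: "P \<subseteq> ?I"
    proof
      fix x assume "x \<in> P"
      then show "x \<in> ?I" using Am_0 by (intro CollectI exI[of _ x] exI[of _ 0]) auto
    qed
    moreover have "?I \<inter> S = {}" using no by blast
    ultimately have "?I = P" using max P(2) by blast
    moreover have "0 + E p * a \<in> ?I" using idlD(2)[OF P(1)] E_in_Am by blast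
    ultimately show False using a(2) E_mult[OF a(1)] by simp
  qed
  have "prm p d P"
    unfolding prm_def
  proof (intro conjI ballI impI)
    show "E p \<notin> P" using P(3) S(2) by blast
    fix a b assume a: "a \<in> Am p d" and b: "b \<in> Am p d" and ab: "a * b \<in> P"
    show "a \<in> P \<or> b \<in> P"
    proof (rule ccontr)
      assume "\<not> (a \<in> P \<or> b \<in> P)"
      then obtain x c y e where *: "x \<in> P" "c \<in> Am p d" "x + c * a \<in> S" "y \<in> P" "e \<in> Am p d" "y + e * b \<in> S"
        using meet[OF a] meet[OF b] by blast
      have "(x + c * a) * (y + e * b) = (y + e * b) * x + (c * a) * y + (c * e) * (a * b)"
        by (simp add: algebra_simps)
      moreover have "(y + e * b) * x + (c * a) * y + (c * e) * (a * b) \<in> P"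
      proof -
        have "y + e * b \<in> Am p d" using *(6) S(1) by blast
        then show ?thesis
          by (intro idlD(3)[OF P(1)] idlD(4)[OF P(1) _ *(1)] idlD(4)[OF P(1) Am_mult[OF p0 *(2) a] *(4)]
              idlD(4)[OF P(1) Am_mult[OF p0 *(2,5)] ab])
      qed
      ultimately show False using mult[OF *(3,6)] P(3) by auto
    qed
  qed (rule P(1))
  then show thesis using that P(2,3) by blast
qed

abbreviation Xv :: "nat \<Rightarrow> nat \<Rightarrow> zprod mps" where "Xv p i \<equiv> mnm (single i 1) (fpe p 1)"

text \<open>The iterated boundary monoid of \<open>x\<^bsub>d-n\<^esub>, \<dots>, x\<^bsub>d-1\<^esub>\<close> in the elementary description of Krull
  dimension by Coquand and Lombardi.\<close>
primrec SG :: "nat \<Rightarrow> nat \<Rightarrow> nat \<Rightarrow> zprod mps set" where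
  "SG p d 0 = {E p}"
| "SG p d (Suc n) = {Xv p (d - Suc n) ^ m * (s + a * Xv p (d - Suc n)) | m s a. s \<in> SG p d n \<and> a \<in> Am p d}"

lemma Xv_in_Am: "i \<le> d \<Longrightarrow> Xv p i \<in> Am p d" by (rule mnm_single_in_Am)

lemma Xv_power_mult_in_Am:
  assumes "p > 0" "a \<in> Am p d" "i \<le> d" shows "Xv p i ^ m * a \<in> Am p d"
proof (cases "m = 0")
  case False
  then show ?thesis using Am_mult[OF assms(1) Am_power[OF assms(1) Xv_in_Am[OF assms(3)]] assms(2)] by simp
qed (simp add: assms(2))

lemma SG_subset: assumes "p > 0" shows "SG p d n \<subseteq> Am p d"
proof (induction n)
  case (Suc n)
  show ?case
  proof
    fix u assume "u \<in> SG p d (Suc n)"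
    then obtain m s a where "u = Xv p (d - Suc n) ^ m * (s + a * Xv p (d - Suc n))" "s \<in> SG p d n" "a \<in> Am p d" by auto
    note u = this
    have "a * Xv p (d - Suc n) \<in> Am p d" by (rule Am_mult[OF assms u(3) Xv_in_Am]) simp
    then have "s + a * Xv p (d - Suc n) \<in> Am p d" using Suc u(2) by (intro Am_add[OF assms]) auto
    then show "u \<in> Am p d" unfolding u(1) by (rule Xv_power_mult_in_Am[OF assms]) simp
  qed
qed simp

lemma SG_shift:
  assumes "s \<in> SG p d n" "a \<in> Am p d" shows "s + a * Xv p (d - Suc n) \<in> SG p d (Suc n)"
proof -
  have "Xv p (d - Suc n) ^ 0 * (s + a * Xv p (d - Suc n)) \<in> SG p d (Suc n)"
    unfolding SG.simps using assms by blast
  then show ?thesis by (simp only: power_0 mult_1_left)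
qed

lemma SG_mono: "SG p d n \<subseteq> SG p d (Suc n)"
proof
  fix s assume "s \<in> SG p d n"
  then have "s + 0 * Xv p (d - Suc n) \<in> SG p d (Suc n)" by (intro SG_shift) auto
  then show "s \<in> SG p d (Suc n)" by (simp only: mult_zero_left add_0_right)
qed

lemma E_in_SG: "E p \<in> SG p d n"
  by (induction n) (use SG_mono in \<open>auto simp del: SG.simps(2)\<close>)

lemma Xv_in_SG: "Xv p (d - Suc n) \<in> SG p d (Suc n)"
proof -
  have "Xv p (d - Suc n) ^ 1 * (E p + 0 * Xv p (d - Suc n)) \<in> SG p d (Suc n)"
    unfolding SG.simps using E_in_SG[of p d n] Am_0[of p d] by blast
  moreover have "Xv p (d - Suc n) * E p = Xv p (d - Suc n)"
    using E_mult[OF Xv_in_Am[of "d - Suc n" d p]] by (simp add: mult.commute)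
  ultimately show ?thesis by (simp only: mult_zero_left add_0_right power_one_right)
qed

lemma SG_mult:
  assumes p0: "p > 0" shows "s \<in> SG p d n \<Longrightarrow> t \<in> SG p d n \<Longrightarrow> s * t \<in> SG p d n"
proof (induction n arbitrary: s t)
  case 0
  then show ?case using E_mult[OF E_in_Am[of p d]] by simp
next
  case (Suc n)
  let ?X = "Xv p (d - Suc n)"
  obtain m u a where s: "s = ?X ^ m * (u + a * ?X)" "u \<in> SG p d n" "a \<in> Am p d" using Suc.prems(1) by auto
  obtain l v b where t: "t = ?X ^ l * (v + b * ?X)" "v \<in> SG p d n" "b \<in> Am p d" using Suc.prems(2) by auto
  let ?c = "u * b + a * v + a * b * ?X"
  have "s * t = ?X ^ (m + l) * (u * v + ?c * ?X)" by (simp add: s(1) t(1) power_add algebra_simps)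
  moreover have "u * v \<in> SG p d n" by (rule Suc.IH[OF s(2) t(2)])
  moreover have "?c \<in> Am p d"
    using SG_subset[OF p0, of d n] s(2,3) t(2,3) by (intro Am_add[OF p0] Am_mult[OF p0] Xv_in_Am) auto
  ultimately show ?case unfolding SG.simps by blast
qed

text \<open>Purely lexicographic, with \<open>x_0\<close> weighing most and the least exponent
  leading. Unlike the degree order of \<open>islead\<close>, it lets \<open>x_d^2\<close> lead in
  \<open>Fpol\<close> and keeps \<open>x_d\<close> out of the leading exponents of the boundary
  monoids.\<close>

definition islex :: "zprod mps \<Rightarrow> (nat \<Rightarrow>\<^sub>0 nat) \<Rightarrow> bool" where
  "islex a \<alpha> \<longleftrightarrow> coef a \<alpha> \<noteq> 0 \<and> (\<forall>\<beta>. coef a \<beta> \<noteq> 0 \<longrightarrow> \<alpha> \<le> \<beta>)"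

lemma pm_lessI:
  fixes \<alpha> \<beta> :: "nat \<Rightarrow>\<^sub>0 nat"
  assumes "lookup \<alpha> k < lookup \<beta> k" "\<And>i. i < k \<Longrightarrow> lookup \<alpha> i = lookup \<beta> i"
  shows "\<alpha> < \<beta>"
  using assms by (auto simp: less_poly_mapping.rep_eq less_fun_def)

text \<open>Infinitely many exponents may lie below a given one, so the minimum is built coordinate
  by coordinate; \<open>k\<close> counts the coordinates already minimised.\<close>

lemma islex_exists:
  assumes a: "a \<in> Am p d" "a \<noteq> 0" shows "\<exists>\<alpha>. islex a \<alpha>"
proof -
  let ?T = "{\<beta>. coef a \<beta> \<noteq> 0}"
  have "\<exists>\<alpha>\<in>?T. \<forall>\<beta>\<in>?T. (\<forall>i<k. lookup \<alpha> i = lookup \<beta> i) \<or>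
      (\<exists>j<k. lookup \<alpha> j < lookup \<beta> j \<and> (\<forall>i<j. lookup \<alpha> i = lookup \<beta> i))" for k
  proof (induction k)
    case 0
    show ?case using mps_eqI[of a 0] a(2) by auto
  next
    case (Suc k)
    then obtain \<alpha> where \<alpha>: "\<alpha> \<in> ?T" "\<And>\<beta>. \<beta> \<in> ?T \<Longrightarrow> (\<forall>i<k. lookup \<alpha> i = lookup \<beta> i) \<or>
      (\<exists>j<k. lookup \<alpha> j < lookup \<beta> j \<and> (\<forall>i<j. lookup \<alpha> i = lookup \<beta> i))" by blast
    define n where "n = (LEAST n. \<exists>\<beta>\<in>?T. (\<forall>i<k. lookup \<alpha> i = lookup \<beta> i) \<and> lookup \<beta> k = n)"
    have "\<exists>\<beta>\<in>?T. (\<forall>i<k. lookup \<alpha> i = lookup \<beta> i) \<and> lookup \<beta> k = n"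
      unfolding n_def by (rule LeastI_ex) (use \<alpha>(1) in blast)
    then obtain \<gamma> where \<gamma>: "\<gamma> \<in> ?T" "\<forall>i<k. lookup \<alpha> i = lookup \<gamma> i" "lookup \<gamma> k = n" by blast
    have least: "n \<le> lookup \<beta> k" if "\<beta> \<in> ?T" "\<forall>i<k. lookup \<alpha> i = lookup \<beta> i" for \<beta>
      unfolding n_def by (rule Least_le) (use that in blast)
    have "(\<forall>i<Suc k. lookup \<gamma> i = lookup \<beta> i) \<or> (\<exists>j<Suc k. lookup \<gamma> j < lookup \<beta> j \<and> (\<forall>i<j. lookup \<gamma> i = lookup \<beta> i))"
      if \<beta>: "\<beta> \<in> ?T" for \<beta>
      using \<alpha>(2)[OF \<beta>]
    proof
      assume eq: "\<forall>i<k. lookup \<alpha> i = lookup \<beta> i"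
      then have eq': "\<forall>i<k. lookup \<gamma> i = lookup \<beta> i" using \<gamma>(2) by simp
      show ?thesis
      proof (cases "lookup \<gamma> k = lookup \<beta> k")
        case True
        then show ?thesis using eq' by (auto simp: less_Suc_eq)
      next
        case False
        then have "lookup \<gamma> k < lookup \<beta> k" using least[OF \<beta> eq] \<gamma>(3) by simp
        then show ?thesis using eq' by blast
      qed
    next
      assume "\<exists>j<k. lookup \<alpha> j < lookup \<beta> j \<and> (\<forall>i<j. lookup \<alpha> i = lookup \<beta> i)"
      then obtain j where j: "j < k" "lookup \<alpha> j < lookup \<beta> j" "\<forall>i<j. lookup \<alpha> i = lookup \<beta> i" by blast
      then have "lookup \<gamma> j < lookup \<beta> j" "\<forall>i<j. lookup \<gamma> i = lookup \<beta> i" using \<gamma>(2) by auto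
      then show ?thesis using j(1) less_SucI by blast
    qed
    then show ?case using \<gamma>(1) by blast
  qed
  from this[of "Suc d"] obtain \<alpha> where \<alpha>: "\<alpha> \<in> ?T" "\<And>\<beta>. \<beta> \<in> ?T \<Longrightarrow> (\<forall>i<Suc d. lookup \<alpha> i = lookup \<beta> i) \<or>
      (\<exists>j<Suc d. lookup \<alpha> j < lookup \<beta> j \<and> (\<forall>i<j. lookup \<alpha> i = lookup \<beta> i))" by blast
  have "\<alpha> \<le> \<beta>" if \<beta>: "\<beta> \<in> ?T" for \<beta>
    using \<alpha>(2)[OF \<beta>]
  proof
    assume eq: "\<forall>i<Suc d. lookup \<alpha> i = lookup \<beta> i"
    have "\<alpha> = \<beta>"
    proof (rule poly_mapping_eqI)
      fix i show "lookup \<alpha> i = lookup \<beta> i"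
        using eq AmD(2)[OF a(1), of \<alpha> i] AmD(2)[OF a(1), of \<beta> i] \<alpha>(1) \<beta> by (cases "i < Suc d") auto
    qed
    then show ?thesis by simp
  next
    assume "\<exists>j<Suc d. lookup \<alpha> j < lookup \<beta> j \<and> (\<forall>i<j. lookup \<alpha> i = lookup \<beta> i)"
    then show ?thesis using pm_lessI[of \<alpha> _ \<beta>] by (auto intro: less_imp_le)
  qed
  then show ?thesis using \<alpha>(1) by (auto simp: islex_def)
qed

lemma islex_mult:
  assumes p: "prime p" and a: "a \<in> Am p d" "islex a \<alpha>" and b: "b \<in> Am p d" "islex b \<beta>"
  shows "islex (a * b) (\<alpha> + \<beta>)"
  unfolding islex_def
proof (intro conjI allI impI)
  have "coef (a * b) (\<alpha> + \<beta>) = coef a \<alpha> * coef b \<beta>"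
  proof (rule coef_mult_unique)
    fix x y assume *: "x + y = \<alpha> + \<beta>" "coef a x \<noteq> 0" "coef b y \<noteq> 0"
    then have le: "\<alpha> \<le> x" "\<beta> \<le> y" using a b unfolding islex_def by auto
    then show "x = \<alpha> \<and> y = \<beta>"
      using *(1) add_less_le_mono[of \<alpha> x \<beta> y] add_le_less_mono[of \<alpha> x \<beta> y] by (metis less_irrefl order_less_le)
  qed
  then show "coef (a * b) (\<alpha> + \<beta>) \<noteq> 0"
    using Fp_no_zero_divisors[OF p AmD(1)[OF a(1)] AmD(1)[OF b(1)]] a b by (auto simp: islex_def)
  fix \<gamma> assume "coef (a * b) \<gamma> \<noteq> 0"
  then obtain x where x: "x \<in> adg \<gamma>" "coef a (fst x) * coef b (snd x) \<noteq> 0"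
    unfolding coef_mult case_prod_beta by (meson sum.neutral)
  then have "coef a (fst x) \<noteq> 0" "coef b (snd x) \<noteq> 0" by auto
  then have "\<alpha> \<le> fst x" "\<beta> \<le> snd x" using a b by (auto simp: islex_def)
  then show "\<alpha> + \<beta> \<le> \<gamma>" using x(1) add_mono by (auto simp: adg_def)
qed

text \<open>In \<open>s + a x_j\<close> the leading exponent of \<open>s\<close> has no variable up
  to index \<open>j\<close>, so it precedes every exponent divisible by \<open>x_j\<close> and
  survives. The factor \<open>x_j^m\<close> only raises coordinate \<open>j\<close>, which is below
  \<open>d\<close>.\<close>

lemma SG_islex:
  assumes p: "prime p" and u: "u \<in> SG p d n" and n: "n \<le> d"
  shows "\<exists>\<mu>. islex u \<mu> \<and> lookup \<mu> d = 0 \<and> (\<forall>i<d - n. lookup \<mu> i = 0)"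
  using u n
proof (induction n arbitrary: u)
  case 0
  have "islex (E p) 0" using fpe_one_neq_0[OF p] by (auto simp: islex_def)
  then show ?case using 0 by (intro exI[of _ 0]) auto
next
  case (Suc n)
  have p0: "p > 0" using p prime_gt_0_nat by blast
  define j where "j = d - Suc n"
  have j: "j < d" "d - n = Suc j" using Suc.prems(2) by (auto simp: j_def)
  let ?X = "Xv p j"
  obtain m s a where s: "u = ?X ^ m * (s + a * ?X)" "s \<in> SG p d n" "a \<in> Am p d"
    using Suc.prems(1) by (auto simp: j_def)
  obtain \<mu> where \<mu>: "islex s \<mu>" "lookup \<mu> d = 0" "\<forall>i<Suc j. lookup \<mu> i = 0"
    using Suc.IH[OF s(2)] Suc.prems(2) j by auto
  have X: "coef (a * ?X) \<beta> = 0 \<or> \<mu> < \<beta>" for \<beta>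
  proof (cases "1 \<le> lookup \<beta> j")
    case True
    define k where "k = (LEAST k. lookup \<beta> k \<noteq> 0)"
    have k: "lookup \<beta> k \<noteq> 0" "k \<le> j" "\<And>i. i < k \<Longrightarrow> lookup \<beta> i = 0"
      unfolding k_def using LeastI[of "\<lambda>k. lookup \<beta> k \<noteq> 0" j] Least_le[of "\<lambda>k. lookup \<beta> k \<noteq> 0" j] not_less_Least True by auto
    have "\<mu> < \<beta>" by (rule pm_lessI[of _ k]) (use k \<mu>(3) in auto)
    then show ?thesis ..
  next
    case False
    then have "coef (?X * a) \<beta> = 0" by (simp add: coef_mnm_mult adds_single_iff)
    then show ?thesis by (simp add: mult.commute)
  qed
  have lex: "islex (s + a * ?X) \<mu>"
    unfolding islex_def
  proof (intro conjI allI impI)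
    have "coef (a * ?X) \<mu> = 0" using X[of \<mu>] by simp
    then show "coef (s + a * ?X) \<mu> \<noteq> 0" using \<mu>(1) by (simp add: islex_def)
    fix \<beta> assume "coef (s + a * ?X) \<beta> \<noteq> 0"
    then have "coef s \<beta> \<noteq> 0 \<or> coef (a * ?X) \<beta> \<noteq> 0" by auto
    then show "\<mu> \<le> \<beta>" using X[of \<beta>] \<mu>(1) by (auto simp: islex_def)
  qed
  show ?case
  proof (cases "m = 0")
    case True
    then show ?thesis using lex \<mu> s(1) by (intro exI[of _ \<mu>]) (auto simp: j_def)
  next
    case False
    have Xm: "?X ^ m = mnm (single j m) (fpe p 1)" using False by (intro mnm_single_power[of m]) auto
    have "islex (?X ^ m) (single j m)" unfolding Xm using fpe_one_neq_0[OF p] by (auto simp: islex_def)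
    moreover have "?X ^ m \<in> Am p d" unfolding Xm by (rule mnm_single_in_Am) (use j in simp)
    moreover have "s + a * ?X \<in> Am p d"
      using SG_subset[OF p0, of d n] s(2,3) j by (intro Am_add[OF p0] Am_mult[OF p0] Xv_in_Am) auto
    ultimately have "islex u (single j m + \<mu>)" unfolding s(1) by (intro islex_mult[OF p] lex)
    then show ?thesis using \<mu>(2,3) j by (intro exI[of _ "single j m + \<mu>"]) (auto simp: lookup_add lookup_single j_def[symmetric])
  qed
qed

definition Fpol :: "nat \<Rightarrow> nat \<Rightarrow> nat \<Rightarrow> zprod mps" where
  "Fpol p d r = mnm (single 0 r) (fpe p 1) + (\<Sum>i=1..d. mnm (single i 2) (fpe p 1))"

lemma Fpol_in_Am: "p > 0 \<Longrightarrow> Fpol p d r \<in> Am p d"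
  unfolding Fpol_def by (intro Am_add Am_sum mnm_single_in_Am) auto

lemma single_eq_iff: "n > 0 \<Longrightarrow> single i n = single j m \<longleftrightarrow> i = j \<and> n = m" for n m :: nat
  by (metis lookup_single_eq lookup_single_not_eq not_gr_zero)

lemma islex_Fpol:
  assumes p: "prime p" and d: "d \<ge> 1" and r: "r \<ge> 1"
  shows "islex (Fpol p d r) (single d 2)"
proof -
  have le: "single d 2 \<le> single i (2::nat)" if "i \<le> d" for i
  proof (cases "i = d")
    case False
    then have "single d 2 < single i (2::nat)"
      using that by (intro pm_lessI[of _ i]) (auto simp: lookup_single when_def)
    then show ?thesis by simp
  qed simp
  have le0: "single d 2 \<le> single 0 r"
    using d r by (intro less_imp_le pm_lessI[of _ 0]) (auto simp: lookup_single when_def)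
  have c: "coef (Fpol p d r) \<beta> = (if \<beta> = single 0 r then fpe p 1 else 0) + (\<Sum>i=1..d. if \<beta> = single i 2 then fpe p 1 else 0)" for \<beta>
    by (simp add: Fpol_def coef_sum)
  show ?thesis
    unfolding islex_def
  proof (intro conjI allI impI)
    have "(\<Sum>i=1..d. if single d (2::nat) = single i 2 then fpe p 1 else 0) = (\<Sum>i=1..d. if i = d then fpe p 1 else 0)"
      by (rule sum.cong[OF refl]) (auto simp: single_eq_iff)
    also have "\<dots> = fpe p 1" using d by simp
    finally show "coef (Fpol p d r) (single d 2) \<noteq> 0"
      unfolding c using d fpe_one_neq_0[OF p] by (simp add: single_eq_iff)
    fix \<beta> assume nz: "coef (Fpol p d r) \<beta> \<noteq> 0"
    have "\<beta> = single 0 r \<or> (\<exists>i\<in>{1..d}. \<beta> = single i 2)"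
    proof -
      have False if "\<beta> \<noteq> single 0 r" "\<And>i. i \<in> {1..d} \<Longrightarrow> \<beta> \<noteq> single i 2"
      proof -
        have "(\<Sum>i=1..d. if \<beta> = single i 2 then fpe p 1 else 0) = 0" by (rule sum.neutral) (use that(2) in auto)
        then show False using nz that(1) unfolding c by simp
      qed
      then show ?thesis by blast
    qed
    then show "single d 2 \<le> \<beta>" using le le0 by auto
  qed
qed

text \<open>Leading exponents separate \<open>(F)\<close> from \<open>SG p d d\<close>: those of
  multiples of \<open>F\<close> contain \<open>x_d\<close>. If \<open>P\<close> avoids level
  \<open>n + 1\<close>, then \<open>P\<close> and the new variable generate an ideal that avoids
  level \<open>n\<close>, for otherwise \<open>SG_shift\<close> would place an element of
  \<open>P\<close> in level \<open>n + 1\<close>. The variable itself belongs to that level, so the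
  inclusion is strict.\<close>

lemma prm_chain_exists:
  assumes p: "prime p" and d: "d \<ge> 1" and r: "r \<ge> 1"
  obtains P where "\<And>i. i \<le> d \<Longrightarrow> prm p d (P i)" "\<And>i. i < d \<Longrightarrow> P i \<subset> P (Suc i)" "Fpol p d r \<in> P 0"
proof -
  have p0: "p > 0" using p prime_gt_0_nat by blast
  let ?F = "Fpol p d r"
  note FA = Fpol_in_Am[OF p0, of d r]
  let ?J = "{h * ?F | h. h \<in> Am p d}"
  have J: "idl p d ?J"
    unfolding idl_def
  proof (intro conjI ballI)
    show "?J \<subseteq> Am p d" using Am_mult[OF p0 _ FA] by blast
    show "0 \<in> ?J" using Am_0[of p d] by (auto intro!: exI[of _ 0])
    fix v w assume "v \<in> ?J" "w \<in> ?J"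
    then obtain a b where "v = a * ?F" "w = b * ?F" "a \<in> Am p d" "b \<in> Am p d" by blast
    then have "v + w = (a + b) * ?F" "a + b \<in> Am p d" using Am_add[OF p0] by (auto simp: algebra_simps)
    then show "v + w \<in> ?J" by blast
  next
    fix b v assume b: "b \<in> Am p d" and "v \<in> ?J"
    then obtain a where *: "v = a * ?F" "a \<in> Am p d" by blast
    then have "b * v = (b * a) * ?F" by (simp add: mult.assoc)
    then show "b * v \<in> ?J" using Am_mult[OF p0 b *(2)] by blast
  qed
  have "?J \<inter> SG p d d = {}"
  proof (rule ccontr)
    assume "?J \<inter> SG p d d \<noteq> {}"
    then obtain h where h: "h \<in> Am p d" "h * ?F \<in> SG p d d" by blast
    obtain \<mu> where \<mu>: "islex (h * ?F) \<mu>" "lookup \<mu> d = 0" using SG_islex[OF p h(2)] by auto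
    have "h \<noteq> 0" using \<mu>(1) by (auto simp: islex_def)
    then obtain \<nu> where \<nu>: "islex h \<nu>" using islex_exists[OF h(1)] by blast
    have "islex (h * ?F) (\<nu> + single d 2)" by (rule islex_mult[OF p h(1) \<nu> FA islex_Fpol[OF p d r]])
    then have "\<mu> = \<nu> + single d 2" using \<mu>(1) by (auto simp: islex_def intro: order_antisym)
    then show False using \<mu>(2) by (simp add: lookup_add)
  qed
  from prm_avoiding[OF p0 J SG_subset[OF p0] E_in_SG SG_mult[OF p0] this]
  obtain P0 where P0: "prm p d P0" "?J \<subseteq> P0" "P0 \<inter> SG p d d = {}" .
  have step: "\<exists>Q. prm p d Q \<and> P \<subset> Q \<and> Q \<inter> SG p d n = {}"
    if P: "prm p d P" "P \<inter> SG p d (Suc n) = {}" for P n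
  proof -
    let ?X = "Xv p (d - Suc n)"
    have X: "?X \<in> Am p d" by (rule Xv_in_Am) simp
    note PI = prmD(1)[OF P(1)]
    let ?I = "{x + a * ?X | x a. x \<in> P \<and> a \<in> Am p d}"
    have I: "idl p d ?I"
      unfolding idl_def
    proof (intro conjI ballI)
      show "?I \<subseteq> Am p d" using idlD(1)[OF PI] Am_add[OF p0 _ Am_mult[OF p0 _ X]] by blast
      show "0 \<in> ?I" using idlD(2)[OF PI] Am_0[of p d] by (auto intro!: exI[of _ 0])
      fix v w assume "v \<in> ?I" "w \<in> ?I"
      then obtain x c y e where "v = x + c * ?X" "w = y + e * ?X" "x \<in> P" "y \<in> P" "c \<in> Am p d" "e \<in> Am p d" by blast
      then have "v + w = (x + y) + (c + e) * ?X" "x + y \<in> P" "c + e \<in> Am p d"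
        using Am_add[OF p0] idlD(3)[OF PI] by (simp_all add: algebra_simps)
      then show "v + w \<in> ?I" by blast
    next
      fix b v assume b: "b \<in> Am p d" and "v \<in> ?I"
      then obtain x c where *: "v = x + c * ?X" "x \<in> P" "c \<in> Am p d" by blast
      then have "b * v = b * x + (b * c) * ?X" by (simp add: algebra_simps)
      moreover have "b * x \<in> P" "b * c \<in> Am p d" using idlD(4)[OF PI b *(2)] Am_mult[OF p0 b *(3)] by auto
      ultimately show "b * v \<in> ?I" by blast
    qed
    have "?I \<inter> SG p d n = {}"
    proof (rule ccontr)
      assume "?I \<inter> SG p d n \<noteq> {}"
      then obtain x a where *: "x \<in> P" "a \<in> Am p d" "x + a * ?X \<in> SG p d n" by blast
      then have "x + a * ?X + (- a) * ?X \<in> SG p d (Suc n)" using Am_uminus[OF p0] by (intro SG_shift) auto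
      moreover have "x + a * ?X + (- a) * ?X = x" by (simp add: algebra_simps)
      ultimately show False using P(2) *(1) by auto
    qed
    from prm_avoiding[OF p0 I SG_subset[OF p0] E_in_SG SG_mult[OF p0] this]
    obtain Q where Q: "prm p d Q" "?I \<subseteq> Q" "Q \<inter> SG p d n = {}" .
    have PQ: "P \<subseteq> Q"
    proof
      fix x assume "x \<in> P"
      then have "x + 0 * ?X \<in> ?I" using Am_0[of p d] by blast
      then show "x \<in> Q" using Q(2) by auto
    qed
    have "0 + E p * ?X \<in> Q" using Q(2) idlD(2)[OF PI] E_in_Am by blast
    then have XQ: "?X \<in> Q" using E_mult[OF X] by simp
    have XP: "?X \<notin> P"
    proof
      assume "?X \<in> P"
      then have "?X \<in> P \<inter> SG p d (Suc n)" using Xv_in_SG by (rule IntI)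
      then show False unfolding P(2) by (rule emptyE)
    qed
    have "P \<noteq> Q" using XQ XP by metis
    then have "P \<subset> Q" using PQ by (simp add: psubset_eq)
    then show ?thesis using Q(1,3) by (intro exI[of _ Q] conjI)
  qed
  \<comment> \<open>The \<open>i\<close>-th prime avoids the monoid of level \<open>d - i\<close>,
    which leaves exactly \<open>d\<close> steps.\<close>
  have chain: "\<exists>P. (\<forall>i\<le>n. prm p d (P i) \<and> P i \<inter> SG p d (d - i) = {}) \<and> (\<forall>i<n. P i \<subset> P (Suc i)) \<and> ?F \<in> P 0"
    if "n \<le> d" for n
    using that
  proof (induction n)
    case 0
    have "E p * ?F \<in> P0" using P0(2) E_in_Am by blast
    then have "?F \<in> P0" using E_mult[OF FA] by simp
    then show ?case using P0 by (intro exI[of _ "\<lambda>_. P0"]) auto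
  next
    case (Suc n)
    then obtain P where P: "\<forall>i\<le>n. prm p d (P i) \<and> P i \<inter> SG p d (d - i) = {}" "\<forall>i<n. P i \<subset> P (Suc i)" "?F \<in> P 0"
      by auto
    have e: "d - n = Suc (d - Suc n)" using Suc.prems by simp
    have "prm p d (P n)" "P n \<inter> SG p d (Suc (d - Suc n)) = {}"
      unfolding e[symmetric] using P(1) by blast+
    from step[OF this] obtain Q where Q: "prm p d Q" "P n \<subset> Q" "Q \<inter> SG p d (d - Suc n) = {}" by blast
    show ?case
      using P Q by (intro exI[of _ "P(Suc n := Q)"]) (auto simp: le_Suc_eq less_Suc_eq)
  qed
  from chain[of d] obtain P where "\<forall>i\<le>d. prm p d (P i)" "\<forall>i<d. P i \<subset> P (Suc i)" "?F \<in> P 0" by auto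
  then show thesis using that by blast
qed

section \<open>Chains of ideals of finite colength\<close>

definition box :: "nat \<Rightarrow> nat \<Rightarrow> (nat \<Rightarrow>\<^sub>0 nat) \<Rightarrow> bool" where
  "box d q m \<longleftrightarrow> (\<forall>i. if i \<le> d then lookup m i < q else lookup m i = 0)"

text \<open>Normal form modulo \<open>(x_0^q, ..., x_d^q)\<close>. That an ideal contains this one
  is expressed by the hypothesis \<open>X\<close> of the counting lemmas: it contains every series
  that truncates to 0.\<close>

definition box_trunc :: "nat \<Rightarrow> nat \<Rightarrow> zprod mps \<Rightarrow> zprod mps" where
  "box_trunc d q a = Mps (\<lambda>m. if box d q m then coef a m else 0)"

lemma boxD: assumes "box d q m" shows "i \<le> d \<Longrightarrow> lookup m i < q" "\<not> i \<le> d \<Longrightarrow> lookup m i = 0"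
  using assms unfolding box_def by metis+

lemma coef_box_trunc [simp]: "coef (box_trunc d q a) m = (if box d q m then coef a m else 0)"
  by (simp add: box_trunc_def)

lemma box_trunc_add: "box_trunc d q (a + b) = box_trunc d q a + box_trunc d q b" by (rule mps_eqI) simp
lemma box_trunc_diff: "box_trunc d q (a - b) = box_trunc d q a - box_trunc d q b" by (rule mps_eqI) simp
lemma box_trunc_0 [simp]: "box_trunc d q 0 = 0" by (rule mps_eqI) simp
lemma box_trunc_box_trunc: "box_trunc d q (box_trunc d q a) = box_trunc d q a" by (rule mps_eqI) simp
lemma box_trunc_in_Am: "a \<in> Am p d \<Longrightarrow> box_trunc d q a \<in> Am p d" by (auto simp: Am_def)

lemma box_trunc_eq_0_iff: "box_trunc d q a = 0 \<longleftrightarrow> (\<forall>m. box d q m \<longrightarrow> coef a m = 0)"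
  using mps_eqI[of "box_trunc d q a" 0] by (metis coef_simps(1) coef_box_trunc)

lemma box_trunc_mult_eq_0: assumes "box_trunc d q x = 0" shows "box_trunc d q (a * x) = 0"
proof -
  have "coef (a * x) m = 0" if m: "box d q m" for m
  proof -
    have "coef x (snd y) = 0" if y: "y \<in> adg m" for y
    proof -
      have "lookup m i = lookup (fst y) i + lookup (snd y) i" for i using y by (auto simp: adg_def lookup_add)
      then have "box d q (snd y)" using m unfolding box_def by (metis add_eq_0_iff_both_eq_0 le_add2 le_less_trans)
      then show ?thesis using assms box_trunc_eq_0_iff by blast
    qed
    then show ?thesis unfolding coef_mult case_prod_beta by simp
  qed
  then show ?thesis by (simp add: box_trunc_eq_0_iff)
qed

lemma box_trunc_eq_0_iff_decomp:
  assumes "p > 0" "a \<in> Am p d"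
  shows "box_trunc d q a = 0 \<longleftrightarrow> (\<exists>h. (\<forall>i\<le>d. h i \<in> Am p d) \<and> a = (\<Sum>i\<le>d. mnm (single i q) (fpe p 1) * h i))"
proof -
  have "(\<forall>m. box d q m \<longrightarrow> coef a m = 0) \<longleftrightarrow> (\<forall>m. (\<forall>i\<le>d. lookup m i < q) \<longrightarrow> coef a m = 0)"
    using AmD(2)[OF assms(2)] unfolding box_def by (metis not_le)
  then show ?thesis unfolding box_trunc_eq_0_iff Am_decomp_iff[OF assms] .
qed

lemma bij_coef_W: "bij_betw coef (box_trunc d q ` Am p d) (W p {..d} (\<lambda>_. q))"
proof (rule bij_betw_byWitness[where f' = Mps])
  show "\<forall>a\<in>box_trunc d q ` Am p d. Mps (coef a) = a" by (simp add: coef_inverse)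
  show "\<forall>v\<in>W p {..d} (\<lambda>_. q). coef (Mps v) = v" by (simp add: fun_eq_iff)
  show "coef ` box_trunc d q ` Am p d \<subseteq> W p {..d} (\<lambda>_. q)"
    by (auto simp: W_def AmD(1) dest: boxD split: if_splits)
  show "Mps ` W p {..d} (\<lambda>_. q) \<subseteq> box_trunc d q ` Am p d"
  proof (rule image_subsetI)
    fix v assume v: "v \<in> W p {..d} (\<lambda>_. q)"
    have "Mps v \<in> Am p d" using WD(1)[OF v] WD(3)[OF v] by (auto simp: Am_def)
    moreover have "box_trunc d q (Mps v) = Mps v"
    proof (rule mps_eqI)
      fix m have "v m = 0" if "\<not> box d q m"
      proof (rule ccontr)
        assume "v m \<noteq> 0"
        then have "box d q m" unfolding box_def using WD(2,3)[OF v] by auto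
        then show False using that by simp
      qed
      then show "coef (box_trunc d q (Mps v)) m = coef (Mps v) m" by simp
    qed
    ultimately show "Mps v \<in> box_trunc d q ` Am p d" by (metis imageI)
  qed
qed

lemma finite_box_trunc: "p > 0 \<Longrightarrow> J \<subseteq> Am p d \<Longrightarrow> finite (box_trunc d q ` J)"
  using bij_betw_finite[OF bij_coef_W, of d q p] pgroupD(1)[OF pgroup_W[of p "{..d}"]]
  by (meson finite_atMost finite_subset image_mono)

lemma box_unit_scalar:
  assumes p: "prime p" and J: "idl p d J" and x: "x \<in> Am p d" "x \<notin> J" and c: "c \<in> Fp p" "mnm 0 c * x \<in> J"
  shows "c = 0"
proof (rule ccontr)
  assume "c \<noteq> 0"
  then obtain y where y: "y \<in> Fp p" "c * y = fpe p 1" using Fp_inverse[OF p c(1)] by blast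
  have "mnm 0 y * (mnm 0 c * x) \<in> J" by (rule idlD(4)[OF J _ c(2)]) (rule mnm_in_Am, use y in auto)
  moreover have "mnm 0 y * (mnm 0 c * x) = E p * x"
    using y(2) by (simp add: mnm_mult_mnm mult.commute[of y c] mult.assoc[symmetric])
  ultimately show False using E_mult[OF x(1)] x(2) by simp
qed

lemma mnm0_diff: "mnm 0 (a - b) = mnm 0 a - mnm 0 (b :: 'a::comm_ring_1)" by (rule mps_eqI) simp

text \<open>Under \<open>X\<close> the residue of a series decides whether it lies in
  \<open>J\<close>. Hence the scalar multiples of an \<open>x\<close> outside \<open>J\<close>
  translate the residues of \<open>J\<close> to \<open>p\<close> disjoint copies.\<close>

lemma card_box_trunc_adjoin:
  assumes p: "prime p" and J: "idl p d J" and X: "\<And>a. a \<in> Am p d \<Longrightarrow> box_trunc d q a = 0 \<Longrightarrow> a \<in> J"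
    and x: "x \<in> Am p d" "x \<notin> J"
  shows "card ((\<lambda>(c, w). box_trunc d q (mnm 0 c * x) + w) ` (Fp p \<times> box_trunc d q ` J)) = p * card (box_trunc d q ` J)"
proof -
  have p0: "p > 0" using p prime_gt_0_nat by blast
  note F = pgroupD[OF pgroup_Fp[OF p0]]
  let ?h = "\<lambda>(c, w). box_trunc d q (mnm 0 c * x) + w"
  have tJ: "box_trunc d q a \<in> J" if "a \<in> J" for a
  proof -
    have a: "a \<in> Am p d" using idlD(1)[OF J that] .
    have "box_trunc d q (a - box_trunc d q a) = 0" by (simp add: box_trunc_diff box_trunc_box_trunc)
    then have "a - box_trunc d q a \<in> J" using X[OF Am_diff[OF p0 a box_trunc_in_Am[OF a]]] by simp
    then have "a - (a - box_trunc d q a) \<in> J" by (rule idl_diff[OF p0 J that])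
    then show ?thesis by simp
  qed
  have "inj_on ?h (Fp p \<times> box_trunc d q ` J)"
  proof (rule inj_onI)
    fix z z' assume z: "z \<in> Fp p \<times> box_trunc d q ` J" and z': "z' \<in> Fp p \<times> box_trunc d q ` J" and eq: "?h z = ?h z'"
    obtain c a c' a' where *: "z = (c, box_trunc d q a)" "z' = (c', box_trunc d q a')" "c \<in> Fp p" "c' \<in> Fp p" "a \<in> J" "a' \<in> J"
      using z z' by auto
    have cA: "mnm 0 (c - c') \<in> Am p d" by (rule mnm_in_Am) (use F(5) * in auto)
    then have yA: "mnm 0 (c - c') * x \<in> Am p d" using Am_mult[OF p0 _ x(1)] by blast
    have "box_trunc d q (mnm 0 (c - c') * x) = box_trunc d q (a' - a)"
      using eq by (simp add: * mnm0_diff left_diff_distrib box_trunc_diff algebra_simps)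
    then have "box_trunc d q (mnm 0 (c - c') * x - (a' - a)) = 0" by (simp add: box_trunc_diff)
    moreover have a'a: "a' - a \<in> J" using idl_diff[OF p0 J *(6,5)] .
    ultimately have "mnm 0 (c - c') * x - (a' - a) \<in> J"
      using X Am_diff[OF p0 yA idlD(1)[OF J a'a]] by blast
    then have "(mnm 0 (c - c') * x - (a' - a)) + (a' - a) \<in> J" by (rule idlD(3)[OF J _ a'a])
    then have "mnm 0 (c - c') * x \<in> J" by simp
    then have "c - c' = 0" using box_unit_scalar[OF p J x F(5)[OF *(3,4)]] by blast
    then show "z = z'" using eq * by simp
  qed
  then have "card (?h ` (Fp p \<times> box_trunc d q ` J)) = card (Fp p \<times> box_trunc d q ` J)" by (rule card_image)
  then show ?thesis by (simp add: card_cartesian_product card_Fp[OF p0])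
qed

lemma card_box_trunc_strict:
  assumes p: "prime p" and J: "idl p d J" and X: "\<And>a. a \<in> Am p d \<Longrightarrow> box_trunc d q a = 0 \<Longrightarrow> a \<in> J"
    and K: "idl p d K" "J \<subset> K"
  shows "p * card (box_trunc d q ` J) \<le> card (box_trunc d q ` K)"
proof -
  have p0: "p > 0" using p prime_gt_0_nat by blast
  obtain x where x: "x \<in> K" "x \<notin> J" using K(2) by blast
  have xA: "x \<in> Am p d" using idlD(1)[OF K(1) x(1)] .
  have "(\<lambda>(c, w). box_trunc d q (mnm 0 c * x) + w) ` (Fp p \<times> box_trunc d q ` J) \<subseteq> box_trunc d q ` K"
  proof clarify
    fix c a assume c: "c \<in> Fp p" and a: "a \<in> J"
    have "mnm 0 c * x + a \<in> K"
      using K(2) a by (intro idlD(3)[OF K(1)] idlD(4)[OF K(1) _ x(1)] mnm_in_Am c) auto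
    then show "box_trunc d q (mnm 0 c * x) + box_trunc d q a \<in> box_trunc d q ` K" by (metis imageI box_trunc_add)
  qed
  then have "card ((\<lambda>(c, w). box_trunc d q (mnm 0 c * x) + w) ` (Fp p \<times> box_trunc d q ` J)) \<le> card (box_trunc d q ` K)"
    using card_mono[OF finite_box_trunc[OF p0, of K d q]] idlD(1)[OF K(1)] by blast
  also have "card ((\<lambda>(c, w). box_trunc d q (mnm 0 c * x) + w) ` (Fp p \<times> box_trunc d q ` J)) = p * card (box_trunc d q ` J)"
    by (rule card_box_trunc_adjoin[OF p J X xA x(2)])
  finally show ?thesis .
qed

lemma idl_Am: "p > 0 \<Longrightarrow> idl p d (Am p d)"
  by (auto simp: idl_def Am_add Am_mult)

lemma idl_adjoin:
  assumes p0: "p > 0" and J: "idl p d J" and I: "idl p d I" and x: "x \<in> Am p d"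
  shows "idl p d {y + a * x | y a. y \<in> J \<and> a \<in> I}"
  unfolding idl_def
proof (intro conjI ballI)
  let ?K = "{y + a * x | y a. y \<in> J \<and> a \<in> I}"
  show "?K \<subseteq> Am p d" using idlD(1)[OF J] idlD(1)[OF I] Am_add[OF p0 _ Am_mult[OF p0 _ x]] by blast
  show "0 \<in> ?K" using idlD(2)[OF J] idlD(2)[OF I] by (auto intro!: exI[of _ 0])
  fix v w assume "v \<in> ?K" "w \<in> ?K"
  then obtain y c z e where "v = y + c * x" "w = z + e * x" "y \<in> J" "z \<in> J" "c \<in> I" "e \<in> I" by blast
  then have "v + w = (y + z) + (c + e) * x" "y + z \<in> J" "c + e \<in> I"
    using idlD(3)[OF J] idlD(3)[OF I] by (simp_all add: algebra_simps)
  then show "v + w \<in> ?K" by blast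
next
  let ?K = "{y + a * x | y a. y \<in> J \<and> a \<in> I}"
  fix b v assume b: "b \<in> Am p d" and "v \<in> ?K"
  then obtain y c where *: "v = y + c * x" "y \<in> J" "c \<in> I" by blast
  then have "b * v = b * y + (b * c) * x" by (simp add: algebra_simps)
  moreover have "b * y \<in> J" "b * c \<in> I" using idlD(4)[OF J b *(2)] idlD(4)[OF I b *(3)] by auto
  ultimately show "b * v \<in> ?K" by blast
qed

text \<open>Take an ideal minimal among those strictly above \<open>J\<close>; it is generated over \<open>J\<close> by any \<open>x\<close> in it,
  and by Nakayama the maximal ideal sends \<open>x\<close> into \<open>J\<close>.\<close>
lemma idl_cover_exists:
  assumes p: "prime p" and J: "idl p d J" "J \<noteq> Am p d" and X: "\<And>a. a \<in> Am p d \<Longrightarrow> box_trunc d q a = 0 \<Longrightarrow> a \<in> J"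
  obtains K where "idl p d K" "J \<subset> K" "card (box_trunc d q ` K) = p * card (box_trunc d q ` J)"
proof -
  have p0: "p > 0" using p prime_gt_0_nat by blast
  let ?P = "\<lambda>K. idl p d K \<and> J \<subset> K"
  have "?P (Am p d)" using idl_Am[OF p0] J idlD(1)[OF J(1)] by blast
  \<comment> \<open>Minimality is measured by the number of residues, which a strict inclusion
    changes by a factor of at least \<open>p\<close>.\<close>
  from ex_has_least_nat[of ?P, OF this, of "\<lambda>K. card (box_trunc d q ` K)"]
  obtain K where K: "?P K" and min: "\<forall>L. ?P L \<longrightarrow> card (box_trunc d q ` K) \<le> card (box_trunc d q ` L)"
    by (elim exE conjE, intro that conjI)
  obtain x where x: "x \<in> K" "x \<notin> J" using K by blast
  have xA: "x \<in> Am p d" using idlD(1) K x(1) by blast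
  have JJ: "y \<in> {y + a * x | y a. y \<in> J \<and> a \<in> I}" if "y \<in> J" "idl p d I" for y I
    using that idlD(2)[OF that(2)] by (intro CollectI exI[of _ y] exI[of _ 0]) auto
  define M where "M = {y + a * x | y a. y \<in> J \<and> a \<in> Mk p d 1}"
  have M: "idl p d M" unfolding M_def by (rule idl_adjoin[OF p0 J(1) idl_Mk[OF p0] xA])
  have "x \<notin> M"
  proof
    assume "x \<in> M"
    then obtain y a where a: "x = y + a * x" "y \<in> J" "a \<in> Mk p d 1" by (auto simp: M_def)
    have aA: "a \<in> Am p d" "coef a 0 = 0" using a(3) by (auto simp: Mk_def)
    have "coef (E p - a) 0 \<noteq> 0" using aA(2) fpe_one_neq_0[OF p] by simp
    then obtain b where b: "b \<in> Am p d" "(E p - a) * b = E p"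
      using Am_unit[OF p Am_diff[OF p0 E_in_Am aA(1)]] by blast
    have "x - a * x = y" using a(1) by (simp add: algebra_simps)
    then have "(E p - a) * x = y" using E_mult[OF xA] by (simp add: left_diff_distrib)
    then have "b * y = ((E p - a) * b) * x" by (simp add: ac_simps)
    then have "x = b * y" using b(2) E_mult[OF xA] by simp
    then show False using idlD(4)[OF J(1) b(1) a(2)] x(2) by simp
  qed
  have MJ: "a * x \<in> J" if "a \<in> Mk p d 1" for a
  proof -
    have "M \<subset> K"
    proof
      show "M \<subseteq> K" unfolding M_def
        using K x(1) idlD(3)[of p d K] idlD(4)[of p d K _ x] by (auto simp: Mk_def)
      show "M \<noteq> K" using x(1) \<open>x \<notin> M\<close> by blast
    qed
    have "\<not> J \<subset> M"
    proof
      assume "J \<subset> M"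
      have "p * card (box_trunc d q ` M) \<le> card (box_trunc d q ` K)"
        using K \<open>J \<subset> M\<close> X by (intro card_box_trunc_strict[OF p M _ _ \<open>M \<subset> K\<close>]) auto
      moreover have "card (box_trunc d q ` K) \<le> card (box_trunc d q ` M)" using min M \<open>J \<subset> M\<close> by blast
      moreover have "card (box_trunc d q ` M) > 0"
        using finite_box_trunc[OF p0, of M d q] idlD(1,2)[OF M] by (auto simp: card_gt_0_iff)
      ultimately have "p * card (box_trunc d q ` M) \<le> 1 * card (box_trunc d q ` M)" "card (box_trunc d q ` M) > 0" by linarith+
      then show False using prime_gt_1_nat[OF p] by simp
    qed
    moreover have "J \<subseteq> M" unfolding M_def using JJ[OF _ idl_Mk[OF p0]] by blast
    ultimately have "M = J" by blast
    moreover have "0 + a * x \<in> M" unfolding M_def using that idlD(2)[OF J(1)] by blast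
    ultimately show ?thesis by simp
  qed
  define L where "L = {y + a * x | y a. y \<in> J \<and> a \<in> Am p d}"
  have L: "idl p d L" unfolding L_def by (rule idl_adjoin[OF p0 J(1) idl_Am[OF p0] xA])
  have "0 + E p * x \<in> L" unfolding L_def using idlD(2)[OF J(1)] E_in_Am by blast
  then have "x \<in> L" using E_mult[OF xA] by simp
  moreover have "J \<subseteq> L" unfolding L_def using JJ[OF _ idl_Am[OF p0]] by blast
  ultimately have JL: "J \<subset> L" using x(2) by blast
  have "box_trunc d q ` L \<subseteq> (\<lambda>(c, w). box_trunc d q (mnm 0 c * x) + w) ` (Fp p \<times> box_trunc d q ` J)"
  proof (rule image_subsetI)
    fix v assume "v \<in> L"
    then obtain y a where *: "v = y + a * x" "y \<in> J" "a \<in> Am p d" by (auto simp: L_def)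
    let ?c = "coef a 0"
    have cF: "?c \<in> Fp p" by (rule AmD(1)[OF *(3)])
    have cA: "mnm 0 ?c \<in> Am p d" by (rule mnm_in_Am[OF cF]) simp
    have "a - mnm 0 ?c \<in> Mk p d 1"
      using Am_diff[OF p0 *(3) cA] by (auto simp: Mk_def mdeg_eq_0_iff)
    then have "y + (a - mnm 0 ?c) * x \<in> J" using idlD(3)[OF J(1) *(2) MJ] by blast
    moreover have "box_trunc d q v = box_trunc d q (mnm 0 ?c * x) + box_trunc d q (y + (a - mnm 0 ?c) * x)"
      by (simp add: * algebra_simps flip: box_trunc_add)
    ultimately show "box_trunc d q v \<in> (\<lambda>(c, w). box_trunc d q (mnm 0 c * x) + w) ` (Fp p \<times> box_trunc d q ` J)"
      using cF by (intro image_eqI[of _ _ "(?c, box_trunc d q (y + (a - mnm 0 ?c) * x))"]) auto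
  qed
  then have "card (box_trunc d q ` L) \<le> card ((\<lambda>(c, w). box_trunc d q (mnm 0 c * x) + w) ` (Fp p \<times> box_trunc d q ` J))"
    using finite_Fp[OF p0] finite_box_trunc[OF p0 subsetI[OF idlD(1)[OF J(1)]]]
    by (intro card_mono[rotated] finite_imageI[of "Fp p \<times> _"] finite_cartesian_product)
  also have "card ((\<lambda>(c, w). box_trunc d q (mnm 0 c * x) + w) ` (Fp p \<times> box_trunc d q ` J)) = p * card (box_trunc d q ` J)"
    by (rule card_box_trunc_adjoin[OF p J(1) X xA x(2)])
  finally have "card (box_trunc d q ` L) \<le> p * card (box_trunc d q ` J)" .
  moreover have "p * card (box_trunc d q ` J) \<le> card (box_trunc d q ` L)" by (rule card_box_trunc_strict[OF p J(1) X L JL])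
  ultimately show thesis using that L JL by (metis le_antisym)
qed

text \<open>A cover multiplies the number of residues by exactly \<open>p\<close>, because the
  residue field is \<open>F_p\<close>. The length of a chain of covers is therefore the logarithm of
  the index of \<open>J\<close>, and \<open>idl_chain_length\<close> shows that no chain is
  longer.\<close>

lemma idl_chain_exists:
  assumes p: "prime p" and J: "idl p d J" and X: "\<And>a. a \<in> Am p d \<Longrightarrow> box_trunc d q a = 0 \<Longrightarrow> a \<in> J"
  shows "\<exists>n N. (\<forall>i\<le>n. idl p d (N i) \<and> J \<subseteq> N i) \<and> (\<forall>i<n. N i \<subset> N (Suc i)) \<and>
    p ^ n * card (box_trunc d q ` J) = card (box_trunc d q ` Am p d)"
  using J X
proof (induction "card (box_trunc d q ` Am p d) - card (box_trunc d q ` J)" arbitrary: J rule: less_induct)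
  case less
  have p0: "p > 0" and p1: "p > 1" using p prime_gt_0_nat prime_gt_1_nat by auto
  show ?case
  proof (cases "J = Am p d")
    case True
    then show ?thesis using less.prems(1) by (intro exI[of _ 0] exI[of _ "\<lambda>_. J"]) auto
  next
    case False
    from idl_cover_exists[OF p less.prems(1) False less.prems(2)]
    obtain K where K: "idl p d K" "J \<subset> K" "card (box_trunc d q ` K) = p * card (box_trunc d q ` J)" by metis
    have "card (box_trunc d q ` J) > 0"
      using finite_box_trunc[OF p0, of J d q] idlD(1,2)[OF less.prems(1)] by (auto simp: card_gt_0_iff)
    then have "card (box_trunc d q ` J) < card (box_trunc d q ` K)" using K(3) p1 by simp
    moreover have "card (box_trunc d q ` K) \<le> card (box_trunc d q ` Am p d)"
      by (rule card_mono[OF finite_box_trunc[OF p0 order_refl]]) (use idlD(1)[OF K(1)] in auto)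
    ultimately have "card (box_trunc d q ` Am p d) - card (box_trunc d q ` K) < card (box_trunc d q ` Am p d) - card (box_trunc d q ` J)"
      by linarith
    moreover have "\<And>a. a \<in> Am p d \<Longrightarrow> box_trunc d q a = 0 \<Longrightarrow> a \<in> K" using less.prems(2) K(2) by blast
    ultimately obtain n N where N: "\<forall>i\<le>n. idl p d (N i) \<and> K \<subseteq> N i" "\<forall>i<n. N i \<subset> N (Suc i)"
      "p ^ n * card (box_trunc d q ` K) = card (box_trunc d q ` Am p d)" using less.hyps[OF _ K(1)] by metis
    let ?N = "\<lambda>i. case i of 0 \<Rightarrow> J | Suc i \<Rightarrow> N i"
    have "idl p d (?N i) \<and> J \<subseteq> ?N i" if "i \<le> Suc n" for i
      using that N(1) K(2) less.prems(1) by (cases i) auto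
    moreover have "J \<subset> N 0" using N(1) K(2) by blast
    then have "?N i \<subset> ?N (Suc i)" if "i < Suc n" for i
      using that N(2) by (cases i) simp_all
    moreover have "p ^ Suc n * card (box_trunc d q ` J) = card (box_trunc d q ` Am p d)"
      using N(3) K(3) by (simp add: ac_simps)
    ultimately show ?thesis by (intro exI[of _ "Suc n"] exI[of _ ?N]) blast
  qed
qed

lemma idl_chain_length:
  assumes p: "prime p" and N: "\<And>i. i \<le> n \<Longrightarrow> idl p d (N i)" "\<And>i. i < n \<Longrightarrow> N i \<subset> N (Suc i)"
    and X: "\<And>a. a \<in> Am p d \<Longrightarrow> box_trunc d q a = 0 \<Longrightarrow> a \<in> N 0"
  shows "p ^ n * card (box_trunc d q ` N 0) \<le> card (box_trunc d q ` Am p d)"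
proof -
  have p0: "p > 0" using p prime_gt_0_nat by blast
  have "p ^ i * card (box_trunc d q ` N 0) \<le> card (box_trunc d q ` N i) \<and> N 0 \<subseteq> N i" if "i \<le> n" for i
    using that
  proof (induction i)
    case (Suc i)
    then have *: "p ^ i * card (box_trunc d q ` N 0) \<le> card (box_trunc d q ` N i)" "N 0 \<subseteq> N i" by auto
    have "p * card (box_trunc d q ` N i) \<le> card (box_trunc d q ` N (Suc i))"
      by (rule card_box_trunc_strict[OF p]) (use Suc.prems N X *(2) in auto)
    then have "p * (p ^ i * card (box_trunc d q ` N 0)) \<le> card (box_trunc d q ` N (Suc i))"
      using *(1) by (meson le_trans mult_le_mono2)
    then show ?case using *(2) N(2)[of i] Suc.prems by (auto simp: mult.assoc)
  qed simp
  from this[of n] have "p ^ n * card (box_trunc d q ` N 0) \<le> card (box_trunc d q ` N n)" by simp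
  also have "\<dots> \<le> card (box_trunc d q ` Am p d)"
    by (rule card_mono[OF finite_box_trunc[OF p0 order_refl]]) (use idlD(1)[OF N(1)[of n]] in auto)
  finally show ?thesis .
qed

text \<open>Reflecting the box turns multiplication by \<open>Fpol\<close> into the shift operator.\<close>
lemma card_ker_Fpol:
  assumes p0: "p > 0"
  shows "card {v \<in> box_trunc d q ` Am p d. box_trunc d q (v * Fpol p d r) = 0} =
    card {v \<in> W p {..d} (\<lambda>_. q). gop {..d} (\<lambda>i. if i = 0 then r else 2) v = 0}"
proof -
  let ?s = "\<lambda>i::nat. if i = 0 then r else 2"
  define \<kappa> where "\<kappa> = (\<Sum>i\<le>d. single i (q - 1))"
  have k: "lookup \<kappa> i = (if i \<le> d then q - 1 else 0)" for i
    by (simp add: \<kappa>_def lookup_sum lookup_single when_def)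
  have kb: "box d q (\<kappa> - m)" "\<kappa> - (\<kappa> - m) = m" if "box d q m" for m
  proof -
    have m: "if i \<le> d then lookup m i < q else lookup m i = 0" for i using that by (simp add: box_def)
    show "box d q (\<kappa> - m)" unfolding box_def
    proof
      fix i show "if i \<le> d then lookup (\<kappa> - m) i < q else lookup (\<kappa> - m) i = 0"
        using m[of i] k[of i] by (auto simp: lookup_minus)
    qed
    show "\<kappa> - (\<kappa> - m) = m"
    proof (rule poly_mapping_eqI)
      fix i show "lookup (\<kappa> - (\<kappa> - m)) i = lookup m i" using m[of i] k[of i] by (auto simp: lookup_minus)
    qed
  qed
  define R where "R = (\<lambda>(v :: zprod mps) m. if box d q m then coef v (\<kappa> - m) else 0)"
  define R' where "R' = (\<lambda>w. Mps (\<lambda>m. if box d q m then w (\<kappa> - m) else 0) :: zprod mps)"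
  have boxW: "box d q m" if "w \<in> W p {..d} (\<lambda>_. q)" "w m \<noteq> 0" for w m
    using WD(2,3)[OF that] by (auto simp: box_def)
  have FS: "Fpol p d r = (\<Sum>i\<le>d. mnm (single i (?s i)) (fpe p 1))"
  proof -
    have "{..d} = insert 0 {1..d}" by auto
    then show ?thesis by (simp add: Fpol_def)
  qed
  have cF: "coef (v * Fpol p d r) m = (\<Sum>i\<le>d. if ?s i \<le> lookup m i then coef v (m - single i (?s i)) else 0)"
    if v: "v \<in> Am p d" for v m
  proof -
    have "v * Fpol p d r = (\<Sum>i\<le>d. mnm (single i (?s i)) (fpe p 1) * v)"
      unfolding FS by (simp add: sum_distrib_left mult.commute)
    then show ?thesis
      using Fp_one_mult(1)[OF AmD(1)[OF v]] by (simp add: coef_sum coef_mnm_mult adds_single_iff cong: if_cong)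
  qed
  have gR: "gop {..d} ?s (R v) m = coef (v * Fpol p d r) (\<kappa> - m)" if v: "v \<in> Am p d" and m: "box d q m" for v m
  proof -
    have "R v (m + single i (?s i)) = (if ?s i \<le> lookup (\<kappa> - m) i then coef v (\<kappa> - m - single i (?s i)) else 0)"
      if i: "i \<le> d" for i
    proof -
      have mi: "lookup m i < q" using m i by (auto simp: box_def)
      have "box d q (m + single i (?s i)) \<longleftrightarrow> lookup m i + ?s i < q"
        using m i unfolding box_def by (auto simp: lookup_add lookup_single when_def split: if_splits)
      also have "\<dots> \<longleftrightarrow> ?s i \<le> lookup (\<kappa> - m) i" using mi i by (auto simp: lookup_minus k)
      finally have "box d q (m + single i (?s i)) \<longleftrightarrow> ?s i \<le> lookup (\<kappa> - m) i" .
      moreover have "\<kappa> - (m + single i (?s i)) = \<kappa> - m - single i (?s i)"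
        by (rule poly_mapping_eqI) (simp add: lookup_minus lookup_add)
      ultimately show ?thesis by (simp add: R_def)
    qed
    then show ?thesis unfolding cF[OF v] gop_def by (intro sum.cong) auto
  qed
  have "bij_betw R (box_trunc d q ` Am p d) (W p {..d} (\<lambda>_. q))"
  proof (rule bij_betw_byWitness[where f' = R'])
    show "\<forall>v\<in>box_trunc d q ` Am p d. R' (R v) = v"
      using kb by (auto simp: R_def R'_def intro!: mps_eqI)
    show "\<forall>w\<in>W p {..d} (\<lambda>_. q). R (R' w) = w"
      using kb boxW by (auto simp: R_def R'_def fun_eq_iff)
    show "R ` box_trunc d q ` Am p d \<subseteq> W p {..d} (\<lambda>_. q)"
      by (auto simp: W_def R_def AmD(1) dest: boxD split: if_splits)
    show "R' ` W p {..d} (\<lambda>_. q) \<subseteq> box_trunc d q ` Am p d"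
    proof (rule image_subsetI)
      fix w assume w: "w \<in> W p {..d} (\<lambda>_. q)"
      have "R' w \<in> Am p d" using WD(1)[OF w] boxD(2)[of d q] by (auto simp: Am_def R'_def) 
      moreover have "box_trunc d q (R' w) = R' w" by (rule mps_eqI) (simp add: R'_def)
      ultimately show "R' w \<in> box_trunc d q ` Am p d" by (metis imageI)
    qed
  qed
  moreover have "gop {..d} ?s (R v) = 0 \<longleftrightarrow> box_trunc d q (v * Fpol p d r) = 0" if v: "v \<in> box_trunc d q ` Am p d" for v
  proof -
    have vA: "v \<in> Am p d" using v box_trunc_in_Am by blast
    have RW: "R v \<in> W p {..d} (\<lambda>_. q)" using calculation v by (auto simp: bij_betw_def)
    have nb: "gop {..d} ?s (R v) m = 0" if "\<not> box d q m" for m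
      using boxW[OF endoD(2)[OF endo_gop[OF p0 finite_atMost finite_atMost] RW]] that by blast
    have "gop {..d} ?s (R v) = 0 \<longleftrightarrow> (\<forall>m. box d q m \<longrightarrow> gop {..d} ?s (R v) m = 0)"
      using nb by (auto simp: fun_eq_iff)
    also have "\<dots> \<longleftrightarrow> (\<forall>m. box d q m \<longrightarrow> coef (v * Fpol p d r) (\<kappa> - m) = 0)" using gR[OF vA] by simp
    also have "\<dots> \<longleftrightarrow> (\<forall>m. box d q m \<longrightarrow> coef (v * Fpol p d r) m = 0)" using kb by metis
    finally show ?thesis by (simp add: box_trunc_eq_0_iff)
  qed
  ultimately have "bij_betw R {v \<in> box_trunc d q ` Am p d. box_trunc d q (v * Fpol p d r) = 0}
      {v \<in> W p {..d} (\<lambda>_. q). gop {..d} ?s v = 0}"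
    by (rule bij_betw_Collect[where Q = "\<lambda>w. gop {..d} ?s w = 0"])
  then show ?thesis by (rule bij_betw_same_card)
qed

text \<open>Rank and nullity for multiplication by \<open>Fpol\<close> on the residues of the box.
  The image consists of the residues of the ideal \<open>(Fpol, x_0^q, ..., x_d^q)\<close>, so the
  index of this ideal equals the size of the kernel.\<close>

lemma card_box_quotient:
  fixes p d q r :: nat
  assumes p: "prime p" and q: "q > 0"
  defines "B \<equiv> {a \<in> Am p d. \<exists>h\<in>Am p d. box_trunc d q (a - h * Fpol p d r) = 0}"
  shows "card (box_trunc d q ` Am p d) = card (box_trunc d q ` B) *
    card {v \<in> W p {..d} (\<lambda>_. q). gop {..d} (\<lambda>i. if i = 0 then r else 2) v = 0}"
proof -
  have p0: "p > 0" using p prime_gt_0_nat by blast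
  let ?V = "box_trunc d q ` Am p d" and ?f = "\<lambda>v. box_trunc d q (v * Fpol p d r)"
  let ?K = "{v \<in> ?V. ?f v = 0}"
  note FA = Fpol_in_Am[OF p0, of d r]
  have "card ?V = card (?f ` ?V) * card ?K"
  proof (rule card_eq_card_image_mult_card_kernel[OF finite_box_trunc[OF p0 order_refl]])
    show "x + y \<in> ?V" if "x \<in> ?V" "y \<in> ?K" for x y using that Am_add[OF p0] by (auto simp flip: box_trunc_add)
    show "?f x = ?f y \<longleftrightarrow> y - x \<in> ?K" if "x \<in> ?V" "y \<in> ?V" for x y
    proof -
      have "y - x \<in> ?V" using that Am_diff[OF p0] by (auto simp flip: box_trunc_diff)
      moreover have "?f (y - x) = ?f y - ?f x" by (simp add: left_diff_distrib box_trunc_diff)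
      ultimately show ?thesis by auto
    qed
  qed auto
  moreover have "?f ` ?V = box_trunc d q ` B"
  proof
    have tbm: "box_trunc d q (box_trunc d q h * Fpol p d r) = box_trunc d q (h * Fpol p d r)" for h
    proof -
      have "box_trunc d q (Fpol p d r * (box_trunc d q h - h)) = 0" by (rule box_trunc_mult_eq_0) (simp add: box_trunc_diff box_trunc_box_trunc)
      then show ?thesis by (simp add: right_diff_distrib box_trunc_diff mult.commute)
    qed
    show "?f ` ?V \<subseteq> box_trunc d q ` B"
    proof clarify
      fix h assume h: "h \<in> Am p d"
      have "box_trunc d q (h * Fpol p d r - h * Fpol p d r) = 0" by (simp add: box_trunc_diff)
      then have "h * Fpol p d r \<in> B" unfolding B_def using h Am_mult[OF p0 h FA] by blast
      then show "box_trunc d q (box_trunc d q h * Fpol p d r) \<in> box_trunc d q ` B" unfolding tbm by blast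
    qed
    show "box_trunc d q ` B \<subseteq> ?f ` ?V"
    proof clarify
      fix a assume "a \<in> B"
      then obtain h where h: "h \<in> Am p d" "box_trunc d q (a - h * Fpol p d r) = 0" by (auto simp: B_def)
      then have "box_trunc d q a = box_trunc d q (box_trunc d q h * Fpol p d r)" by (simp add: tbm box_trunc_diff)
      then show "box_trunc d q a \<in> ?f ` ?V" using h(1) by (metis (no_types, lifting) image_eqI)
    qed
  qed
  ultimately show ?thesis unfolding card_ker_Fpol[OF p0] by simp
qed

section \<open>The hypersurface ring\<close>

text \<open>Everything about \<open>S\<close> is pulled back along \<open>\<psi>\<close> to the set
  \<open>Am\<close>, where ideals are plain sets. The homomorphism laws, surjectivity and the kernel
  \<open>(Fpol)\<close> are all that is recorded of \<open>S\<close>, so cosets appear only when the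
  locale is instantiated and in the quotient module.\<close>

locale series_quotient = cring S for S (structure) +
  fixes p d r :: nat and \<psi> :: "zprod mps \<Rightarrow> 'a"
  assumes p: "prime p" and d: "d \<ge> 1" and r: "r \<ge> 2"
    and psi_closed: "a \<in> Am p d \<Longrightarrow> \<psi> a \<in> carrier S"
    and psi_surj: "s \<in> carrier S \<Longrightarrow> \<exists>a\<in>Am p d. \<psi> a = s"
    and psi_add: "a \<in> Am p d \<Longrightarrow> b \<in> Am p d \<Longrightarrow> \<psi> (a + b) = \<psi> a \<oplus> \<psi> b"
    and psi_mult: "a \<in> Am p d \<Longrightarrow> b \<in> Am p d \<Longrightarrow> \<psi> (a * b) = \<psi> a \<otimes> \<psi> b"
    and psi_E: "\<psi> (E p) = \<one>"
    and psi_eq_0: "a \<in> Am p d \<Longrightarrow> \<psi> a = \<zero> \<longleftrightarrow> (\<exists>h\<in>Am p d. a = h * Fpol p d r)"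
begin

lemma p0: "p > 0" using p prime_gt_0_nat by blast

lemma FA: "Fpol p d r \<in> Am p d" by (rule Fpol_in_Am[OF p0])

lemma psi_F: "\<psi> (Fpol p d r) = \<zero>"
  using psi_eq_0[OF FA] E_mult[OF FA] E_in_Am by metis

lemma psi_0: "\<psi> 0 = \<zero>"
  using psi_eq_0[OF Am_0] by (metis Am_0 mult_zero_left)

lemma psi_diff: assumes "a \<in> Am p d" "b \<in> Am p d" shows "\<psi> (a - b) = \<psi> a \<ominus> \<psi> b"
proof -
  have ab: "a - b \<in> Am p d" by (rule Am_diff[OF p0 assms])
  have "\<psi> a = \<psi> (a - b) \<oplus> \<psi> b" using psi_add[OF ab assms(2)] by simp
  then have "\<psi> a \<ominus> \<psi> b = \<psi> (a - b) \<oplus> (\<psi> b \<oplus> \<ominus> \<psi> b)"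
    using psi_closed[OF ab] psi_closed[OF assms(2)] by (simp add: minus_eq a_assoc)
  then show ?thesis using psi_closed[OF ab] psi_closed[OF assms(2)] by (simp add: r_neg)
qed

lemma psi_uminus: "a \<in> Am p d \<Longrightarrow> \<psi> (- a) = \<ominus> \<psi> a"
  using psi_diff[OF Am_0, of a] psi_closed[of a] by (simp add: psi_0 minus_eq)

lemma psi_eq_iff:
  assumes "a \<in> Am p d" "b \<in> Am p d"
  shows "\<psi> a = \<psi> b \<longleftrightarrow> (\<exists>h\<in>Am p d. a - b = h * Fpol p d r)"
  using psi_eq_0[OF Am_diff[OF p0 assms]] psi_diff[OF assms] psi_closed assms
    r_right_minus_eq[of "\<psi> a" "\<psi> b"] by simp

lemma psi_power: "a \<in> Am p d \<Longrightarrow> n > 0 \<Longrightarrow> \<psi> (a ^ n) = \<psi> a [^] n"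
proof (induction n)
  case (Suc n)
  show ?case
  proof (cases "n = 0")
    case True
    then show ?thesis using psi_closed[OF Suc.prems(1)] by simp
  next
    case False
    then have "\<psi> (a ^ n) = \<psi> a [^] n" "a ^ n \<in> Am p d" using Suc Am_power[OF p0] by auto
    then show ?thesis using psi_mult[OF _ Suc.prems(1), of "a ^ n"] by (simp add: mult.commute[of a])
  qed
qed simp

definition pre :: "'a set \<Rightarrow> zprod mps set" where
  "pre I = {a \<in> Am p d. \<psi> a \<in> I}"

lemma F_in_pre: "ideal I S \<Longrightarrow> Fpol p d r \<in> pre I"
  using FA additive_subgroup.zero_closed[OF ideal.axioms(1), of I S] by (simp add: pre_def psi_F)

lemma idl_pre: assumes "ideal I S" shows "idl p d (pre I)"
proof -
  interpret I: ideal I S by fact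
  show ?thesis unfolding idl_def pre_def
    using Am_add[OF p0] Am_mult[OF p0]
    by (auto simp: psi_0 psi_add psi_mult intro: I.I_l_closed psi_closed)
qed

lemma ideal_image: assumes J: "idl p d J" shows "ideal (\<psi> ` J) S"
proof (rule idealI[OF ring_axioms])
  note JA = idlD(1)[OF J]
  show "subgroup (\<psi> ` J) (add_monoid S)"
  proof (rule add.subgroupI)
    show "\<psi> ` J \<subseteq> carrier S" using JA psi_closed by blast
    show "\<psi> ` J \<noteq> {}" using idlD(2)[OF J] by blast
    fix s assume "s \<in> \<psi> ` J"
    then obtain a where a: "a \<in> J" "s = \<psi> a" by blast
    have "\<ominus> s = \<psi> (- a)" using psi_uminus[OF JA[OF a(1)]] a(2) by simp
    then show "\<ominus> s \<in> \<psi> ` J" using idl_uminus[OF p0 J a(1)] by (rule image_eqI)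
    fix t assume "t \<in> \<psi> ` J"
    then obtain b where b: "b \<in> J" "t = \<psi> b" by blast
    have "s \<oplus> t = \<psi> (a + b)" using psi_add[OF JA[OF a(1)] JA[OF b(1)]] a(2) b(2) by simp
    then show "s \<oplus> t \<in> \<psi> ` J" using idlD(3)[OF J a(1) b(1)] by (rule image_eqI)
  qed
  show *: "x \<otimes> a \<in> \<psi> ` J" if "a \<in> \<psi> ` J" "x \<in> carrier S" for a x
  proof -
    obtain v where "v \<in> Am p d" "\<psi> v = x" using psi_surj[OF \<open>x \<in> carrier S\<close>] by blast
    moreover obtain u where "u \<in> J" "a = \<psi> u" using \<open>a \<in> \<psi> ` J\<close> by blast
    ultimately have "u \<in> J" "a = \<psi> u" "v \<in> Am p d" "x = \<psi> v" by simp_all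
    then show ?thesis using psi_mult[OF _ JA, of v u] idlD(4)[OF J] by (intro image_eqI[of _ _ "v * u"]) simp_all
  qed
  show "a \<otimes> x \<in> \<psi> ` J" if "a \<in> \<psi> ` J" "x \<in> carrier S" for a x
  proof -
    have "a \<in> carrier S" using that(1) JA psi_closed by blast
    then show ?thesis using *[OF that] that(2) by (simp add: m_comm)
  qed
qed

lemma pre_image: assumes J: "idl p d J" and F: "Fpol p d r \<in> J" shows "pre (\<psi> ` J) = J"
proof
  show "J \<subseteq> pre (\<psi> ` J)" using idlD(1)[OF J] by (auto simp: pre_def)
  show "pre (\<psi> ` J) \<subseteq> J"
  proof
    fix a assume "a \<in> pre (\<psi> ` J)"
    then obtain b where b: "a \<in> Am p d" "b \<in> J" "\<psi> a = \<psi> b" by (auto simp: pre_def)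
    then obtain h where "h \<in> Am p d" "a - b = h * Fpol p d r" using psi_eq_iff idlD(1)[OF J] by blast
    then have "a - b \<in> J" using idlD(4)[OF J _ F] by simp
    then show "a \<in> J" using idlD(3)[OF J _ b(2), of "a - b"] by simp
  qed
qed

lemma image_pre: assumes "I \<subseteq> carrier S" shows "\<psi> ` pre I = I"
proof
  show "\<psi> ` pre I \<subseteq> I" by (auto simp: pre_def)
  show "I \<subseteq> \<psi> ` pre I"
  proof
    fix s assume s: "s \<in> I"
    then obtain a where "a \<in> Am p d" "\<psi> a = s" using psi_surj assms by blast
    then show "s \<in> \<psi> ` pre I" using s by (auto simp: pre_def)
  qed
qed

lemma pre_strict_mono: assumes "I \<subset> I'" "I' \<subseteq> carrier S" shows "pre I \<subset> pre I'"
proof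
  show "pre I \<subseteq> pre I'" using assms(1) by (auto simp: pre_def)
  show "pre I \<noteq> pre I'"
  proof
    assume "pre I = pre I'"
    then have "\<psi> ` pre I = \<psi> ` pre I'" by (rule arg_cong)
    then show False using image_pre[of I] image_pre[of I'] assms by auto
  qed
qed

lemma image_strict_mono:
  assumes "idl p d J" "idl p d J'" "Fpol p d r \<in> J" "J \<subset> J'" shows "\<psi> ` J \<subset> \<psi> ` J'"
proof
  show "\<psi> ` J \<subseteq> \<psi> ` J'" using assms(4) by blast
  show "\<psi> ` J \<noteq> \<psi> ` J'"
  proof
    assume "\<psi> ` J = \<psi> ` J'"
    then have "pre (\<psi> ` J) = pre (\<psi> ` J')" by (rule arg_cong)
    then show False using pre_image[of J] pre_image[of J'] assms by auto
  qed
qed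

lemma coef_F_0: "coef (Fpol p d r) 0 = 0"
proof -
  have "single i k \<noteq> 0" if "k > 0" for i k :: nat using that by (metis lookup_single_eq lookup_zero less_irrefl)
  then have "(0 = single i k) = False" if "k > 0" for i k :: nat using that by metis
  then show ?thesis using r by (simp add: Fpol_def coef_sum)
qed

lemma F_neq_0: "Fpol p d r \<noteq> 0" 
  using islex_Fpol[OF p d, of r] r unfolding islex_def by force

lemma Mk1_iff: "a \<in> Mk p d (Suc 0) \<longleftrightarrow> a \<in> Am p d \<and> coef a 0 = 0"
  by (auto simp: Mk_def mdeg_eq_0_iff)

abbreviation "mm \<equiv> \<psi> ` Mk p d (Suc 0)"

lemma ideal_mm: "ideal mm S" by (rule ideal_image[OF idl_Mk[OF p0]])

lemma one_notin_mm: "\<one> \<notin> mm"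
proof
  assume "\<one> \<in> mm"
  then have "E p \<in> pre mm" by (simp add: pre_def psi_E)
  moreover have "Fpol p d r \<in> Mk p d (Suc 0)" using coef_F_0 FA by (simp add: Mk1_iff)
  ultimately have "E p \<in> Mk p d (Suc 0)" using pre_image[OF idl_Mk[OF p0]] by blast
  then show False using fpe_one_neq_0[OF p] by (simp add: Mk1_iff)
qed

lemma ideal_subset_mm: assumes I: "ideal I S" and 1: "\<one> \<notin> I" shows "I \<subseteq> mm"
proof
  interpret I: ideal I S by fact
  fix s assume s: "s \<in> I"
  then obtain a where a: "a \<in> Am p d" "\<psi> a = s" using psi_surj I.a_subset by blast
  have "coef a 0 = 0"
  proof (rule ccontr)
    assume "coef a 0 \<noteq> 0"
    then obtain b where b: "b \<in> Am p d" "a * b = E p" using Am_unit[OF p a(1)] by blast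
    then have "s \<otimes> \<psi> b = \<one>" using psi_mult[OF a(1) b(1)] a(2) psi_E by simp
    then show False using I.I_r_closed[OF s psi_closed[OF b(1)]] 1 by simp
  qed
  then show "s \<in> mm" using a by (auto simp: Mk1_iff)
qed

lemma maximalideal_iff: "maximalideal M S \<longleftrightarrow> M = mm"
proof
  interpret m: ideal mm S by (rule ideal_mm)
  have mc: "mm \<noteq> carrier S" using one_notin_mm by auto
  show "maximalideal M S" if "M = mm" unfolding that
  proof (rule maximalidealI[OF ideal_mm])
    show "carrier S \<noteq> mm" using mc by simp
    show "J = mm \<or> J = carrier S" if "ideal J S" "mm \<subseteq> J" "J \<subseteq> carrier S" for J
      using ideal_subset_mm[OF that(1)] ideal.one_imp_carrier[OF that(1)] that(2) by blast
  qed
  show "M = mm" if "maximalideal M S"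
  proof -
    interpret M: maximalideal M S by fact
    have "\<one> \<notin> M" using M.one_imp_carrier M.I_notcarr by auto
    then have "M \<subseteq> mm" by (rule ideal_subset_mm[OF M.ideal_axioms])
    then show ?thesis using M.I_maximal[OF ideal_mm _ m.a_subset] mc by blast
  qed
qed

lemma local_ring_S: "local_ring S" and max_ideal_S: "max_ideal S = mm"
  using is_cring by (auto simp: local_ring_def max_ideal_def maximalideal_iff)

lemma one_neq_zero: "\<one> \<noteq> \<zero>"
  using one_notin_mm additive_subgroup.zero_closed[OF ideal.axioms(1)[OF ideal_mm]] by metis

lemma has_prime_char_S: "has_prime_char S p"
proof -
  have "of_nat n * E p \<in> Am p d \<and> \<psi> (of_nat n * E p) = [n] \<cdot> \<one>" for n
  proof (induction n)
    case (Suc n)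
    have "of_nat (Suc n) * E p = of_nat n * E p + E p" by (simp add: algebra_simps)
    then show ?case using Suc Am_add[OF p0 _ E_in_Am] psi_add[OF _ E_in_Am] by (simp add: psi_E)
  qed (simp add: psi_0)
  moreover have "of_nat p * E p = 0" by (rule of_nat_mult_Am[OF p0 E_in_Am])
  ultimately have "[p] \<cdot> \<one> = \<zero>" using psi_0 by metis
  then show ?thesis using p one_neq_zero by (simp add: has_prime_char_def)
qed

lemma prm_pre: assumes "primeideal P S" shows "prm p d (pre P)"
proof -
  interpret P: primeideal P S by fact
  have "\<one> \<notin> P" using P.one_imp_carrier P.I_notcarr by auto
  moreover have "a \<in> pre P \<or> b \<in> pre P" if "a \<in> Am p d" "b \<in> Am p d" "a * b \<in> pre P" for a b
    using that P.I_prime[of "\<psi> a" "\<psi> b"] psi_closed by (auto simp: pre_def psi_mult)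
  ultimately show ?thesis unfolding prm_def using idl_pre[OF P.ideal_axioms]
    by (auto simp: psi_E pre_def)
qed

lemma primeideal_image: assumes P: "prm p d P" and F: "Fpol p d r \<in> P" shows "primeideal (\<psi> ` P) S"
proof (rule primeidealI)
  note pP = pre_image[OF prmD(1)[OF P] F]
  show "ideal (\<psi> ` P) S" by (rule ideal_image[OF prmD(1)[OF P]])
  show "cring S" by (rule is_cring)
  show "carrier S \<noteq> \<psi> ` P"
  proof
    assume "carrier S = \<psi> ` P"
    then have "E p \<in> pre (\<psi> ` P)" using one_closed by (simp add: pre_def psi_E)
    then show False unfolding pP using prmD(2)[OF P] by simp
  qed
  fix s t assume "s \<in> carrier S" "t \<in> carrier S" and st: "s \<otimes> t \<in> \<psi> ` P"
  then obtain a b where ab: "a \<in> Am p d" "b \<in> Am p d" "s = \<psi> a" "t = \<psi> b" using psi_surj by metis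
  then have "a * b \<in> pre (\<psi> ` P)" using st Am_mult[OF p0] by (simp add: pre_def psi_mult)
  then have "a \<in> P \<or> b \<in> P" unfolding pP by (rule prmD(3)[OF P ab(1,2)])
  then show "s \<in> \<psi> ` P \<or> t \<in> \<psi> ` P" using ab by blast
qed

text \<open>A chain of primes of \<open>S\<close> pulls back to primes containing
  \<open>Fpol\<close>, below which \<open>{0}\<close> can be inserted because \<open>Fpol\<close> is
  nonzero. The bound \<open>d + 1\<close> for the series ring therefore gives
  \<open>d\<close>.\<close>

lemma krull_dim_S: "krull_dim S = enat d"
  unfolding krull_dim_def
proof (rule antisym[OF Sup_least Sup_upper])
  fix x assume "x \<in> {enat n |n. \<exists>P. (\<forall>i\<le>n. primeideal (P i) S) \<and> (\<forall>i<n. P i \<subset> P (Suc i))}"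
  then obtain n P where x: "x = enat n" and P: "\<And>i. i \<le> n \<Longrightarrow> primeideal (P i) S" "\<And>i. i < n \<Longrightarrow> P i \<subset> P (Suc i)"
    by blast
  let ?N = "\<lambda>i. case i of 0 \<Rightarrow> {0} | Suc i \<Rightarrow> pre (P i)"
  have idP: "ideal (P i) S" if "i \<le> n" for i using P(1)[OF that] by (rule primeideal.axioms(1))
  have sub: "P i \<subseteq> carrier S" if "i \<le> n" for i
    using additive_subgroup.a_subset[OF ideal.axioms(1)[OF idP[OF that]]] .
  have "Suc n \<le> Suc d"
  proof (rule prm_chain_length[OF p, of "Suc n" d ?N])
    show "prm p d (?N i)" if "i \<le> Suc n" for i
      using that prm_0[OF p] prm_pre P(1) by (cases i) auto
    show "?N i \<subset> ?N (Suc i)" if "i < Suc n" for i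
    proof (cases i)
      case 0
      have "0 \<in> pre (P 0)" "Fpol p d r \<in> pre (P 0)"
        using idlD(2)[OF idl_pre[OF idP]] F_in_pre[OF idP] by auto
      then show ?thesis using F_neq_0 0 by auto
    next
      case (Suc j)
      then show ?thesis using that pre_strict_mono[OF P(2)[of j] sub[of "Suc j"]] by simp
    qed
  qed
  then show "x \<le> enat d" by (simp add: x)
next
  obtain P where P: "\<And>i. i \<le> d \<Longrightarrow> prm p d (P i)" "\<And>i. i < d \<Longrightarrow> P i \<subset> P (Suc i)" "Fpol p d r \<in> P 0"
    using prm_chain_exists[OF p d, of r] r by auto
  have F: "Fpol p d r \<in> P i" if "i \<le> d" for i
    using that
  proof (induction i)
    case (Suc i)
    then show ?case using P(2)[of i] by auto
  qed (rule P(3))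
  have "primeideal (\<psi> ` P i) S" if "i \<le> d" for i by (rule primeideal_image[OF P(1)[OF that] F[OF that]])
  moreover have "\<psi> ` P i \<subset> \<psi> ` P (Suc i)" if "i < d" for i
    using that by (intro image_strict_mono prmD(1)[OF P(1)] F P(2)) auto
  ultimately show "enat d \<in> {enat n |n. \<exists>P. (\<forall>i\<le>n. primeideal (P i) S) \<and> (\<forall>i<n. P i \<subset> P (Suc i))}"
    by (intro CollectI exI[of _ d] exI[of _ "\<lambda>i. \<psi> ` P i"] conjI allI impI refl)
qed

text \<open>The ideal \<open>(Fpol, x_0^q, ..., x_d^q)\<close>, with the congruence modulo the
  powers expressed by truncation. It will be the preimage of the bracket power.\<close>

definition BB :: "nat \<Rightarrow> zprod mps set" where
  "BB q = {a \<in> Am p d. \<exists>h\<in>Am p d. box_trunc d q (a - h * Fpol p d r) = 0}"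

lemma idl_BB: "idl p d (BB q)"
  unfolding idl_def
proof (intro conjI ballI)
  show "BB q \<subseteq> Am p d" by (auto simp: BB_def)
  have "box_trunc d q (0 - 0 * Fpol p d r) = 0" by simp
  then show "0 \<in> BB q" unfolding BB_def using Am_0 by blast
  fix x y assume "x \<in> BB q" "y \<in> BB q"
  then obtain h k where *: "x \<in> Am p d" "y \<in> Am p d" "h \<in> Am p d" "k \<in> Am p d"
    "box_trunc d q (x - h * Fpol p d r) = 0" "box_trunc d q (y - k * Fpol p d r) = 0" by (auto simp: BB_def)
  have "(x + y) - (h + k) * Fpol p d r = (x - h * Fpol p d r) + (y - k * Fpol p d r)"
    by (simp add: algebra_simps)
  then have "box_trunc d q ((x + y) - (h + k) * Fpol p d r) = 0" using *(5,6) by (simp only: box_trunc_add)  simp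
  then show "x + y \<in> BB q" unfolding BB_def using Am_add[OF p0 *(1,2)] Am_add[OF p0 *(3,4)] by blast
next
  fix a x assume a: "a \<in> Am p d" and "x \<in> BB q"
  then obtain h where *: "x \<in> Am p d" "h \<in> Am p d" "box_trunc d q (x - h * Fpol p d r) = 0" by (auto simp: BB_def)
  have "a * x - (a * h) * Fpol p d r = a * (x - h * Fpol p d r)" by (simp add: algebra_simps)
  then have "box_trunc d q (a * x - (a * h) * Fpol p d r) = 0" using box_trunc_mult_eq_0[OF *(3), of a] by simp
  then show "a * x \<in> BB q" unfolding BB_def using Am_mult[OF p0 a *(1)] Am_mult[OF p0 a *(2)] by blast
qed

lemma ker_box_trunc_subset_BB: assumes "a \<in> Am p d" "box_trunc d q a = 0" shows "a \<in> BB q"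
proof -
  have "box_trunc d q (a - 0 * Fpol p d r) = 0" using assms(2) by simp
  then show ?thesis unfolding BB_def using assms(1) Am_0 by blast
qed

lemma F_in_BB: "Fpol p d r \<in> BB q"
proof -
  have "box_trunc d q (Fpol p d r - E p * Fpol p d r) = 0" using E_mult[OF FA] by simp
  then show ?thesis unfolding BB_def using FA E_in_Am by blast
qed

abbreviation bp :: "nat \<Rightarrow> 'a set" where "bp k \<equiv> bracket_power S (max_ideal S) (p ^ k)"

lemma pow_mm_subset: "(\<lambda>x. x [^] (p ^ k)) ` mm \<subseteq> carrier S"
  using idlD(1)[OF idl_Mk[OF p0]] psi_closed by blast

lemma ideal_bp: "ideal (bp k) S"
  unfolding bracket_power_def max_ideal_S by (rule genideal_ideal[OF pow_mm_subset])

text \<open>Since the Frobenius is additive, the bracket power is generated by the powers of the variables.\<close>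
lemma pre_bp: "pre (bp k) = BB (p ^ k)"
proof
  let ?q = "p ^ k" and ?x = "\<lambda>i k. mnm (single i k) (fpe p 1)"
  have q: "?q > 0" using p0 by simp
  have xA: "?x i n \<in> Am p d" if "i \<le> d" for i n by (rule mnm_single_in_Am[OF that])
  have "(\<lambda>x. x [^] ?q) ` mm \<subseteq> \<psi> ` BB ?q"
  proof (intro subsetI)
    fix s assume "s \<in> (\<lambda>x. x [^] ?q) ` mm"
    then obtain g where g: "s = \<psi> g [^] ?q" "g \<in> Am p d" "coef g 0 = 0" by (auto simp: Mk1_iff)
    have "coef g m = 0" if "\<forall>i\<le>d. lookup m i < 1" for m
    proof (rule ccontr)
      assume nz: "coef g m \<noteq> 0"
      have "lookup m i = 0" for i using that AmD(2)[OF g(2) nz, of i] by (cases "i \<le> d") auto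
      then have "m = 0" by (intro poly_mapping_eqI) simp
      then show False using nz g(3) by simp
    qed
    \<comment> \<open>A series without constant term is a combination of the variables: the case
      \<open>q = 1\<close> of \<open>Am_decomp_iff\<close>.\<close>
    then obtain h where h: "\<And>i. i \<le> d \<Longrightarrow> h i \<in> Am p d" "g = (\<Sum>i\<le>d. ?x i 1 * h i)"
      using Am_decomp_iff[OF p0 g(2), of 1] by blast
    have "g ^ ?q = (\<Sum>i\<le>d. (?x i 1 * h i) ^ ?q)"
      unfolding h(2) by (intro Am_frobenius_sum[OF p, where d = d] Am_mult[OF p0] xA h(1)) auto
    also have "\<dots> = (\<Sum>i\<le>d. ?x i ?q * h i ^ ?q)"
      using mnm_single_power[OF q] by (simp add: power_mult_distrib)
    finally have gq: "g ^ ?q = (\<Sum>i\<le>d. ?x i ?q * h i ^ ?q)" .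
    have gA: "g ^ ?q \<in> Am p d" by (rule Am_power[OF p0 g(2) q])
    have "\<And>i. i \<le> d \<Longrightarrow> h i ^ ?q \<in> Am p d" by (rule Am_power[OF p0 h(1) q])
    then have "box_trunc d ?q (g ^ ?q) = 0"
      unfolding box_trunc_eq_0_iff_decomp[OF p0 gA] using gq by (intro exI[of _ "\<lambda>i. h i ^ ?q"] conjI allI impI) simp_all
    then have "g ^ ?q \<in> BB ?q" by (rule ker_box_trunc_subset_BB[OF gA])
    moreover have "s = \<psi> (g ^ ?q)" using g(1) psi_power[OF g(2) q] by simp
    ultimately show "s \<in> \<psi> ` BB ?q" by blast
  qed
  then have "bp k \<subseteq> \<psi> ` BB ?q"
    unfolding bracket_power_def max_ideal_S by (rule genideal_minimal[OF ideal_image[OF idl_BB]])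
  then have "pre (bp k) \<subseteq> pre (\<psi> ` BB ?q)" by (auto simp: pre_def)
  then show "pre (bp k) \<subseteq> BB ?q" unfolding pre_image[OF idl_BB F_in_BB] .
  note P = idl_pre[OF ideal_bp, of k]
  have x: "?x i ?q \<in> pre (bp k)" if i: "i \<le> d" for i
  proof -
    have "single i (1::nat) \<noteq> 0" by (metis lookup_single_eq lookup_zero zero_neq_one)
    then have "?x i 1 \<in> Mk p d (Suc 0)" using xA[OF i, of 1] by (simp add: Mk1_iff)
    then have "\<psi> (?x i 1) [^] ?q \<in> bp k"
      unfolding bracket_power_def max_ideal_S using genideal_self[OF pow_mm_subset] by blast
    moreover have "\<psi> (?x i ?q) = \<psi> (?x i 1) [^] ?q"
      using psi_power[OF xA[OF i, of 1] q] mnm_single_power[OF q] by simp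
    ultimately show ?thesis using xA[OF i] by (simp add: pre_def)
  qed
  show "BB ?q \<subseteq> pre (bp k)"
  proof
    fix a assume "a \<in> BB ?q"
    then obtain h where h: "a \<in> Am p d" "h \<in> Am p d" "box_trunc d ?q (a - h * Fpol p d r) = 0" by (auto simp: BB_def)
    have hF: "h * Fpol p d r \<in> pre (bp k)" by (rule idlD(4)[OF P h(2) F_in_pre[OF ideal_bp]])
    have "a - h * Fpol p d r \<in> Am p d" by (rule Am_diff[OF p0 h(1) idlD(1)[OF P hF]])
    from h(3)[unfolded box_trunc_eq_0_iff_decomp[OF p0 this]]
    obtain g where g: "\<And>i. i \<le> d \<Longrightarrow> g i \<in> Am p d" "a - h * Fpol p d r = (\<Sum>i\<le>d. ?x i ?q * g i)" by blast
    have "?x i ?q * g i \<in> pre (bp k)" if "i \<le> d" for i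
      using idlD(4)[OF P g(1)[OF that] x[OF that]] by (simp add: mult.commute)
    then have "a - h * Fpol p d r \<in> pre (bp k)" unfolding g(2) by (intro idl_sum[OF P]) simp
    from idlD(3)[OF P this hF] show "a \<in> pre (bp k)" by simp
  qed
qed

text \<open>Submodules of the quotient correspond to the ideals of the series ring that contain
  \<open>BB\<close>. The chain from \<open>idl_chain_exists\<close> gives the lower bound for the
  length and \<open>idl_chain_length\<close> the upper one; \<open>card_box_quotient\<close>
  identifies the index with the kernel size.\<close>

lemma module_length_bp:
  "\<exists>l. module_length S (quotient_module S (bp k)) = enat l \<and>
    p ^ l = card {v \<in> W p {..d} (\<lambda>_. p ^ k). gop {..d} (\<lambda>i. if i = 0 then r else 2) v = 0}"
proof -
  let ?q = "p ^ k" and ?Q = "S Quot (bp k)" and ?M = "quotient_module S (bp k)"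
  define \<Psi> where "\<Psi> = (\<lambda>a. bp k +> \<psi> a)"
  interpret b: ideal "bp k" S by (rule ideal_bp)
  interpret Q: cring ?Q by (rule b.quotient_is_cring[OF is_cring])
  interpret h: ring_hom_cring S ?Q "(+>) (bp k)" by (rule b.rcos_ring_hom_cring[OF is_cring])
  \<comment> \<open>The additive monoids of the module and of the quotient ring agree in carrier,
    addition and zero but have different record types. The equivalence lets subgroups be handled in
    the ring.\<close>
  have addM: "subgroup H (add_monoid ?M) \<longleftrightarrow> subgroup H (add_monoid ?Q)" for H
    by (simp add: subgroup_def m_inv_def quotient_module_def)
  have Psi_closed: "\<Psi> a \<in> carrier ?Q" if "a \<in> Am p d" for a using psi_closed[OF that] by (simp add: \<Psi>_def)
  have Psi_surj: "\<exists>a\<in>Am p d. \<Psi> a = X" if X: "X \<in> carrier ?Q" for X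
  proof -
    have "carrier ?Q = (\<Union>s\<in>carrier S. {bp k +> s})" unfolding FactRing_def A_RCOSETS_def' by simp
    then obtain s where "s \<in> carrier S" "X = bp k +> s" 
      using X by (metis (no_types, lifting) UN_E singletonD)
    then show ?thesis using psi_surj[of s] by (auto simp: \<Psi>_def)
  qed
  have Psi_add: "\<Psi> (a + c) = \<Psi> a \<oplus>\<^bsub>?Q\<^esub> \<Psi> c" if "a \<in> Am p d" "c \<in> Am p d" for a c
    using psi_add[OF that] psi_closed that by (simp add: \<Psi>_def)
  have Psi_uminus: "\<Psi> (- a) = \<ominus>\<^bsub>?Q\<^esub> \<Psi> a" if "a \<in> Am p d" for a
    using psi_uminus[OF that] psi_closed that by (simp add: \<Psi>_def)
  have Psi_smult: "\<psi> a \<odot>\<^bsub>?M\<^esub> \<Psi> c = \<Psi> (a * c)" if "a \<in> Am p d" "c \<in> Am p d" for a c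
    using psi_mult[OF that] psi_closed that by (simp add: \<Psi>_def quotient_module_def)
  have Psi_0: "\<Psi> 0 = \<zero>\<^bsub>?Q\<^esub>" by (simp add: \<Psi>_def psi_0)
  have Psi_eq: "\<Psi> a = \<Psi> c \<longleftrightarrow> a - c \<in> BB ?q" if "a \<in> Am p d" "c \<in> Am p d" for a c
    using quotient_eq_iff_same_a_r_cos[OF ideal_bp psi_closed psi_closed, OF that, of k] psi_diff[OF that]
      Am_diff[OF p0 that] unfolding \<Psi>_def pre_bp[symmetric] by (simp add: pre_def)
  define pr where "pr = (\<lambda>N. {a \<in> Am p d. \<Psi> a \<in> N})"
  have idl_pr: "idl p d (pr N)" and BB_pr: "BB ?q \<subseteq> pr N" and im_pr: "\<Psi> ` pr N = N" if "submodule N S ?M" for N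
  proof -
    interpret N: subgroup N "add_monoid ?Q" using submodule.axioms(1)[OF that] by (simp add: addM)
    have N1: "\<zero>\<^bsub>?Q\<^esub> \<in> N" "\<And>X Y. X \<in> N \<Longrightarrow> Y \<in> N \<Longrightarrow> X \<oplus>\<^bsub>?Q\<^esub> Y \<in> N" "N \<subseteq> carrier ?Q"
      using N.one_closed N.m_closed N.subset by simp_all
    have sm: "\<Psi> (a * c) \<in> N" if "a \<in> Am p d" "c \<in> Am p d" "\<Psi> c \<in> N" for a c
      using submodule.smult_closed[OF \<open>submodule N S ?M\<close> psi_closed[OF that(1)] that(3)] Psi_smult[OF that(1,2)] by simp
    show "idl p d (pr N)"
      unfolding idl_def pr_def
      using N1(1) N1(2) Psi_add Psi_0 sm Am_add[OF p0] Am_mult[OF p0] by auto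
    show "BB ?q \<subseteq> pr N"
    proof
      fix a assume a: "a \<in> BB ?q"
      have aA: "a \<in> Am p d" using idlD(1)[OF idl_BB a] .
      have "\<Psi> a = \<Psi> 0" using Psi_eq[OF aA Am_0] a by simp
      then show "a \<in> pr N" using aA N1(1) by (simp add: pr_def Psi_0)
    qed
    show "\<Psi> ` pr N = N"
    proof
      show "\<Psi> ` pr N \<subseteq> N" by (auto simp: pr_def)
      show "N \<subseteq> \<Psi> ` pr N"
      proof
        fix X assume X: "X \<in> N"
        then obtain a where "a \<in> Am p d" "\<Psi> a = X" using Psi_surj N1(3) by blast
        then show "X \<in> \<Psi> ` pr N" using X by (auto simp: pr_def)
      qed
    qed
  qed
  have sub_im: "submodule (\<Psi> ` J) S ?M" if J: "idl p d J" for J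
  proof (intro submodule.intro submodule_axioms.intro)
    note JA = idlD(1)[OF J]
    show "subgroup (\<Psi> ` J) (add_monoid ?M)" unfolding addM
    proof (rule Q.add.subgroupI)
      show "\<Psi> ` J \<subseteq> carrier ?Q" using JA Psi_closed by blast
      show "\<Psi> ` J \<noteq> {}" using idlD(2)[OF J] by blast
      fix X assume "X \<in> \<Psi> ` J"
      then obtain a where a: "a \<in> J" "X = \<Psi> a" by blast
      have "\<ominus>\<^bsub>?Q\<^esub> X = \<Psi> (- a)" using Psi_uminus[OF JA[OF a(1)]] a(2) by simp
      then show "\<ominus>\<^bsub>?Q\<^esub> X \<in> \<Psi> ` J" using idl_uminus[OF p0 J a(1)] by (rule image_eqI)
      fix Y assume "Y \<in> \<Psi> ` J"
      then obtain c where c: "c \<in> J" "Y = \<Psi> c" by blast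
      have "X \<oplus>\<^bsub>?Q\<^esub> Y = \<Psi> (a + c)" using Psi_add[OF JA[OF a(1)] JA[OF c(1)]] a(2) c(2) by simp
      then show "X \<oplus>\<^bsub>?Q\<^esub> Y \<in> \<Psi> ` J" using idlD(3)[OF J a(1) c(1)] by (rule image_eqI)
    qed
    fix s X assume "s \<in> carrier S" "X \<in> \<Psi> ` J"
    then obtain a c where ac: "a \<in> Am p d" "s = \<psi> a" "c \<in> J" "X = \<Psi> c" using psi_surj by blast
    have "s \<odot>\<^bsub>?M\<^esub> X = \<Psi> (a * c)" using Psi_smult[OF ac(1) JA[OF ac(3)]] ac(2,4) by simp
    then show "s \<odot>\<^bsub>?M\<^esub> X \<in> \<Psi> ` J" using idlD(4)[OF J ac(1,3)] by (rule image_eqI)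
  qed
  have pr_im: "pr (\<Psi> ` J) = J" if J: "idl p d J" "BB ?q \<subseteq> J" for J
  proof
    show "J \<subseteq> pr (\<Psi> ` J)" using idlD(1)[OF J(1)] by (auto simp: pr_def)
    show "pr (\<Psi> ` J) \<subseteq> J"
    proof
      fix a assume "a \<in> pr (\<Psi> ` J)"
      then obtain c where c: "a \<in> Am p d" "c \<in> J" "\<Psi> a = \<Psi> c" by (auto simp: pr_def)
      then have "a - c \<in> J" using Psi_eq[OF c(1) idlD(1)[OF J(1) c(2)]] J(2) by blast
      then show "a \<in> J" using idlD(3)[OF J(1) _ c(2), of "a - c"] by simp
    qed
  qed
  have "\<exists>n N. (\<forall>i\<le>n. idl p d (N i) \<and> BB ?q \<subseteq> N i) \<and> (\<forall>i<n. N i \<subset> N (Suc i)) \<and>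
      p ^ n * card (box_trunc d ?q ` BB ?q) = card (box_trunc d ?q ` Am p d)"
    by (rule idl_chain_exists[OF p idl_BB ker_box_trunc_subset_BB])
  then obtain n N where N': "\<forall>i\<le>n. idl p d (N i) \<and> BB ?q \<subseteq> N i" "\<forall>i<n. N i \<subset> N (Suc i)"
    and N4: "p ^ n * card (box_trunc d ?q ` BB ?q) = card (box_trunc d ?q ` Am p d)" by (elim exE conjE)
  have N: "i \<le> n \<Longrightarrow> idl p d (N i)" "i \<le> n \<Longrightarrow> BB ?q \<subseteq> N i" "i < n \<Longrightarrow> N i \<subset> N (Suc i)" for i
    using N' by simp_all
  have B0: "card (box_trunc d ?q ` BB ?q) > 0"
  proof -
    have "finite (box_trunc d ?q ` BB ?q)" by (rule finite_box_trunc[OF p0]) (use idlD(1)[OF idl_BB] in blast)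
    moreover have "BB ?q \<noteq> {}" using idlD(2)[OF idl_BB] by blast
    ultimately show ?thesis by (simp add: card_gt_0_iff)
  qed
  have "p ^ n = card {v \<in> W p {..d} (\<lambda>_. ?q). gop {..d} (\<lambda>i. if i = 0 then r else 2) v = 0}"
    using card_box_quotient[OF p, of ?q d r] N4 B0 p0 unfolding BB_def[symmetric] by (simp add: mult.commute)
  moreover have "module_length S ?M = enat n"
    unfolding module_length_def
  proof (rule antisym[OF Sup_least Sup_upper])
    fix x assume "x \<in> {enat n |n. \<exists>N. (\<forall>i\<le>n. submodule (N i) S ?M) \<and> (\<forall>i<n. N i \<subset> N (Suc i))}"
    then obtain n' N' where x: "x = enat n'" and N': "\<And>i. i \<le> n' \<Longrightarrow> submodule (N' i) S ?M"
      "\<And>i. i < n' \<Longrightarrow> N' i \<subset> N' (Suc i)" by blast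
    have strict: "pr (N' i) \<subset> pr (N' (Suc i))" if i: "i < n'" for i
    proof
      show "pr (N' i) \<subseteq> pr (N' (Suc i))" using N'(2)[OF i] by (auto simp: pr_def)
      show "pr (N' i) \<noteq> pr (N' (Suc i))"
      proof
        assume eq: "pr (N' i) = pr (N' (Suc i))"
        have "N' i = \<Psi> ` pr (N' i)" by (rule im_pr[OF N'(1), symmetric]) (use i in simp)
        also have "\<dots> = N' (Suc i)" unfolding eq by (rule im_pr[OF N'(1)]) (use i in simp)
        finally show False using N'(2)[OF i] by simp
      qed
    qed
    have "p ^ n' * card (box_trunc d ?q ` pr (N' 0)) \<le> card (box_trunc d ?q ` Am p d)"
    proof (rule idl_chain_length[OF p, where N = "\<lambda>i. pr (N' i)"])
      show "idl p d (pr (N' i))" if "i \<le> n'" for i by (rule idl_pr[OF N'(1)[OF that]])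
      show "a \<in> pr (N' 0)" if "a \<in> Am p d" "box_trunc d ?q a = 0" for a
        using ker_box_trunc_subset_BB[OF that] BB_pr[OF N'(1)[of 0]] by blast
    qed (rule strict)
    moreover have "card (box_trunc d ?q ` BB ?q) \<le> card (box_trunc d ?q ` pr (N' 0))"
      using BB_pr[OF N'(1)[of 0]] idlD(1)[OF idl_pr[OF N'(1)[of 0]]]
      by (intro card_mono finite_box_trunc[OF p0] image_mono) auto
    ultimately have "p ^ n' * card (box_trunc d ?q ` BB ?q) \<le> p ^ n * card (box_trunc d ?q ` BB ?q)"
      unfolding N4 by (meson le_trans mult_le_mono2)
    then have "p ^ n' \<le> p ^ n" using B0 by simp
    then show "x \<le> enat n" using prime_gt_1_nat[OF p] by (simp add: x)
  next
    have "\<Psi> ` N i \<subset> \<Psi> ` N (Suc i)" if i: "i < n" for i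
    proof
      show "\<Psi> ` N i \<subseteq> \<Psi> ` N (Suc i)" using N(3)[OF i] by blast
      show "\<Psi> ` N i \<noteq> \<Psi> ` N (Suc i)"
      proof
        assume eq: "\<Psi> ` N i = \<Psi> ` N (Suc i)"
        have "N i = pr (\<Psi> ` N i)" by (rule pr_im[OF N(1,2), symmetric]) (use i in simp_all)
        also have "\<dots> = N (Suc i)" unfolding eq by (rule pr_im[OF N(1,2)]) (use i in simp_all)
        finally show False using N(3)[OF i] by simp
      qed
    qed
    moreover have "submodule (\<Psi> ` N i) S ?M" if "i \<le> n" for i by (rule sub_im[OF N(1)[OF that]])
    ultimately show "enat n \<in> {enat n |n. \<exists>N. (\<forall>i\<le>n. submodule (N i) S ?M) \<and> (\<forall>i<n. N i \<subset> N (Suc i))}"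
      by (intro CollectI exI[of _ n] exI[of _ "\<lambda>i. \<Psi> ` N i"] conjI allI impI refl)
  qed
  ultimately show ?thesis by blast
qed

lemma has_hk_multiplicity_S:
  assumes h: "(\<lambda>e. hk_length p d r (p ^ e) / real p ^ (e * d)) \<longlonglongrightarrow> h"
  shows "has_hk_multiplicity S h"
proof -
  have "ereal_of_enat (module_length S (quotient_module S (bp e))) / ereal (real p ^ (e * d)) =
      ereal (hk_length p d r (p ^ e) / real p ^ (e * d))" for e
  proof -
    obtain l where l: "module_length S (quotient_module S (bp e)) = enat l"
      "p ^ l = card {v \<in> W p {..d} (\<lambda>_. p ^ e). gop {..d} (\<lambda>i. if i = 0 then r else 2) v = 0}"
      using module_length_bp by blast
    have "hk_length p d r (p ^ e) = log (real p) (real (p ^ l))" unfolding hk_length_def l(2)[symmetric] ..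
    also have "\<dots> = real l" using prime_gt_1_nat[OF p] by simp
    finally show ?thesis using l(1) p0 by simp
  qed
  then show ?thesis unfolding has_hk_multiplicity_def
    using local_ring_S has_prime_char_S krull_dim_S h by auto
qed

end

section \<open>Transport to the power series ring over the residue ring\<close>

definition Am_ring :: "nat \<Rightarrow> nat \<Rightarrow> zprod mps ring" where
  "Am_ring p d = \<lparr>carrier = Am p d, monoid.mult = (*), one = E p, zero = 0, add = (+)\<rparr>"

lemma E_mult_right: "a \<in> Am p d \<Longrightarrow> a * E p = a"
  using E_mult[of a p d] by (simp add: mult.commute)

lemma cring_Am_ring: assumes p0: "p > 0" shows "cring (Am_ring p d)"
proof (rule cringI)
  show "abelian_group (Am_ring p d)"
  proof (rule abelian_groupI)
    show "\<exists>y\<in>carrier (Am_ring p d). y \<oplus>\<^bsub>Am_ring p d\<^esub> x = \<zero>\<^bsub>Am_ring p d\<^esub>" if "x \<in> carrier (Am_ring p d)" for x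
      using that Am_uminus[OF p0, of x d] by (intro bexI[of _ "- x"]) (simp_all add: Am_ring_def)
  qed (simp_all add: Am_ring_def Am_add[OF p0] add_ac)
  show "comm_monoid (Am_ring p d)"
    by (rule comm_monoidI) (simp_all add: Am_ring_def Am_mult[OF p0] E_mult E_mult_right mult_ac)
qed (simp add: Am_ring_def distrib_right)

definition mps_of :: "nat \<Rightarrow> ((nat \<Rightarrow>\<^sub>0 nat) \<Rightarrow> int) \<Rightarrow> zprod mps" where
  "mps_of p g = Mps (\<lambda>m. fpe p (g m))"

lemma coef_mps_of [simp]: "coef (mps_of p g) m = fpe p (g m)"
  by (simp add: mps_of_def)

definition of_mps :: "nat \<Rightarrow> zprod mps \<Rightarrow> (nat \<Rightarrow>\<^sub>0 nat) \<Rightarrow> int" where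
  "of_mps p a = (\<lambda>m. inv_into {0..<int p} (fpe p) (coef a m))"

abbreviation psr :: "nat \<Rightarrow> nat \<Rightarrow> ((nat \<Rightarrow>\<^sub>0 nat) \<Rightarrow> int) ring" where
  "psr p d \<equiv> power_series_ring (residue_ring (int p)) {..d}"

lemma carrier_psr:
  assumes p0: "p > 0"
  shows "g \<in> carrier (psr p d) \<longleftrightarrow> (\<forall>m. g m \<in> {0..<int p}) \<and> mps_of p g \<in> Am p d"
proof -
  have *: "fpe p z = 0 \<longleftrightarrow> z = 0" if "z \<in> {0..<int p}" for z
    using fpe_eq_iff[of p z 0] that by simp
  have "g \<in> carrier (psr p d) \<longleftrightarrow>
      (\<forall>m. g m \<in> {0..<int p}) \<and> (\<forall>m. \<not> Poly_Mapping.keys m \<subseteq> {..d} \<longrightarrow> g m = 0)"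
    by (simp add: power_series_ring_def residue_ring_def)
  moreover have "\<not> Poly_Mapping.keys m \<subseteq> {..d} \<longleftrightarrow> (\<exists>i>d. lookup m i \<noteq> 0)" for m :: "nat \<Rightarrow>\<^sub>0 nat"
    by (auto simp: subset_iff in_keys_iff not_le)
  ultimately show ?thesis using * by (auto simp: Am_def)
qed

lemma mps_of_of_mps: "p > 0 \<Longrightarrow> a \<in> Am p d \<Longrightarrow> mps_of p (of_mps p a) = a"
  using bij_betw_imp_surj_on[OF bij_betw_fpe[of p]]
  by (intro mps_eqI) (simp add: of_mps_def f_inv_into_f AmD(1))

lemma of_mps_mps_of: "p > 0 \<Longrightarrow> g \<in> carrier (psr p d) \<Longrightarrow> of_mps p (mps_of p g) = g"
  using bij_betw_imp_inj_on[OF bij_betw_fpe[of p]]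
  by (simp add: fun_eq_iff of_mps_def carrier_psr inv_into_f_f)

lemma of_mps_closed: assumes "p > 0" "a \<in> Am p d" shows "of_mps p a \<in> carrier (psr p d)"
proof -
  have "of_mps p a m \<in> {0..<int p}" for m
    unfolding of_mps_def using bij_betw_imp_surj_on[OF bij_betw_fpe[OF assms(1)]] AmD(1)[OF assms(2)]
    by (intro inv_into_into) simp
  then show ?thesis using carrier_psr[OF assms(1)] mps_of_of_mps[OF assms] assms(2) by simp
qed

lemma fpe_finsum:
  assumes p: "p > 1" and f: "\<And>i. i \<in> B \<Longrightarrow> f i \<in> {0..<int p}" and B: "finite B"
  shows "fpe p (finsum (residue_ring (int p)) f B) = (\<Sum>i\<in>B. fpe p (f i)) \<and>
    finsum (residue_ring (int p)) f B \<in> {0..<int p}"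
proof -
  interpret residues "int p" "residue_ring (int p)" by unfold_locales (use p in auto)
  have c: "carrier (residue_ring (int p)) = {0..<int p}" by (auto simp: res_carrier_eq)
  show ?thesis using B f
  proof (induction B)
    case (insert x B)
    then show ?case
      using p by (subst finsum_insert) (auto simp: c Pi_def res_add_eq fpe_mod fpe_add)
  qed (use p in \<open>simp add: res_zero_eq\<close>)
qed

lemma psr_mult:
  assumes p: "p > 1" and g: "g \<in> carrier (psr p d)" and h: "h \<in> carrier (psr p d)"
  shows "g \<otimes>\<^bsub>psr p d\<^esub> h \<in> carrier (psr p d)" "mps_of p (g \<otimes>\<^bsub>psr p d\<^esub> h) = mps_of p g * mps_of p h"
proof -
  have p0: "p > 0" using p by simp
  note G = g[unfolded carrier_psr[OF p0]] and H = h[unfolded carrier_psr[OF p0]]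
  have m: "(g \<otimes>\<^bsub>psr p d\<^esub> h) m = finsum (residue_ring (int p)) (\<lambda>(a, b). g a * h b mod int p) (adg m)" for m
    by (simp add: power_series_ring_def residue_ring_def adg_def)
  have F: "fpe p ((g \<otimes>\<^bsub>psr p d\<^esub> h) m) = (\<Sum>i\<in>adg m. fpe p (case i of (a, b) \<Rightarrow> g a * h b mod int p)) \<and>
      (g \<otimes>\<^bsub>psr p d\<^esub> h) m \<in> {0..<int p}" for m
    unfolding m by (rule fpe_finsum[OF p]) (use p0 in auto)
  show eq: "mps_of p (g \<otimes>\<^bsub>psr p d\<^esub> h) = mps_of p g * mps_of p h"
    by (rule mps_eqI) (use F in \<open>simp add: coef_mult case_prod_beta fpe_mod fpe_mult\<close>)
  show "g \<otimes>\<^bsub>psr p d\<^esub> h \<in> carrier (psr p d)"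
    unfolding carrier_psr[OF p0] eq using F Am_mult[OF p0] G H by blast
qed

lemma psr_add:
  assumes p0: "p > 0" and g: "g \<in> carrier (psr p d)" and h: "h \<in> carrier (psr p d)"
  shows "g \<oplus>\<^bsub>psr p d\<^esub> h \<in> carrier (psr p d)" "mps_of p (g \<oplus>\<^bsub>psr p d\<^esub> h) = mps_of p g + mps_of p h"
proof -
  note G = g[unfolded carrier_psr[OF p0]] and H = h[unfolded carrier_psr[OF p0]]
  have m: "(g \<oplus>\<^bsub>psr p d\<^esub> h) m = (g m + h m) mod int p" for m
    by (simp add: power_series_ring_def residue_ring_def)
  show eq: "mps_of p (g \<oplus>\<^bsub>psr p d\<^esub> h) = mps_of p g + mps_of p h"
    by (rule mps_eqI) (simp add: m fpe_mod fpe_add)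
  show "g \<oplus>\<^bsub>psr p d\<^esub> h \<in> carrier (psr p d)"
    unfolding carrier_psr[OF p0] eq using Am_add[OF p0] G H p0 by (simp add: m)
qed

lemma ring_iso_of_mps: assumes p: "p > 1" shows "of_mps p \<in> ring_iso (Am_ring p d) (psr p d)"
proof -
  have p0: "p > 0" using p by simp
  note cl = of_mps_closed[OF p0, of _ d] and inv = mps_of_of_mps[OF p0, of _ d] of_mps_mps_of[OF p0, of _ d]
  have mult: "of_mps p (a * b) = of_mps p a \<otimes>\<^bsub>psr p d\<^esub> of_mps p b" if "a \<in> Am p d" "b \<in> Am p d" for a b
    using inv(2)[OF psr_mult(1)[OF p cl[OF that(1)] cl[OF that(2)]]]
    unfolding psr_mult(2)[OF p cl[OF that(1)] cl[OF that(2)]] inv(1)[OF that(1)] inv(1)[OF that(2)] .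
  have add: "of_mps p (a + b) = of_mps p a \<oplus>\<^bsub>psr p d\<^esub> of_mps p b" if "a \<in> Am p d" "b \<in> Am p d" for a b
    using inv(2)[OF psr_add(1)[OF p0 cl[OF that(1)] cl[OF that(2)]]]
    unfolding psr_add(2)[OF p0 cl[OF that(1)] cl[OF that(2)]] inv(1)[OF that(1)] inv(1)[OF that(2)] .
  have one: "of_mps p (E p) = \<one>\<^bsub>psr p d\<^esub>"
  proof -
    have 1: "mps_of p \<one>\<^bsub>psr p d\<^esub> = E p"
      by (rule mps_eqI) (simp add: power_series_ring_def residue_ring_def)
    moreover have "\<one>\<^bsub>psr p d\<^esub> \<in> carrier (psr p d)"
      unfolding carrier_psr[OF p0] 1 using p by (simp add: power_series_ring_def residue_ring_def)
    ultimately show ?thesis using inv(2) by metis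
  qed
  have "bij_betw (of_mps p) (Am p d) (carrier (psr p d))"
    using inv cl carrier_psr[OF p0] by (intro bij_betw_byWitness[where f' = "mps_of p"]) auto
  then show ?thesis
    using mult add one cl by (simp add: ring_iso_def ring_hom_def Am_ring_def Pi_def)
qed

lemma of_mps_0: assumes "p > 1" shows "of_mps p 0 = \<zero>\<^bsub>psr p d\<^esub>"
proof -
  have p0: "p > 0" using assms by simp
  have 1: "mps_of p \<zero>\<^bsub>psr p d\<^esub> = 0"
    by (rule mps_eqI) (simp add: power_series_ring_def residue_ring_def)
  moreover have "\<zero>\<^bsub>psr p d\<^esub> \<in> carrier (psr p d)"
    unfolding carrier_psr[OF p0] 1 using assms by (simp add: power_series_ring_def residue_ring_def)
  ultimately show ?thesis using of_mps_mps_of[OF p0] by metis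
qed

lemma cring_psr: assumes "p > 1" shows "cring (psr p d)"
proof -
  \<comment> \<open>Transport along an isomorphism yields the target ring with its zero replaced by
    the image of zero; \<open>of_mps_0\<close> identifies the two.\<close>
  have "cring (psr p d \<lparr>zero := of_mps p \<zero>\<^bsub>Am_ring p d\<^esub>\<rparr>)"
    using assms by (intro cring.ring_iso_imp_img_cring[OF cring_Am_ring ring_iso_of_mps]) auto
  moreover have "of_mps p \<zero>\<^bsub>Am_ring p d\<^esub> = \<zero>\<^bsub>psr p d\<^esub>"
    using of_mps_0[OF assms] by (simp add: Am_ring_def)
  ultimately show ?thesis by simp
qed

lemma X_power: "X i ^ k = single (single i k) 1"
proof (induction k)
  case (Suc k)
  then show ?case by (simp add: X_def mult_single flip: single_add)
qed (simp add: single_one)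

lemma mps_of_reduce_mod:
  "mps_of p (reduce_mod p (X 0 ^ r + (\<Sum>i = 1..d. X i ^ 2))) = Fpol p d r"
proof (rule mps_eqI)
  fix m
  have s: "fpe p (sum f B) = (\<Sum>i\<in>B. fpe p (f i))" for f :: "nat \<Rightarrow> int" and B
    by (induction B rule: infinite_finite_induct) (simp_all add: fpe_add)
  have l: "fpe p (lookup (X i ^ k) m) = coef (mnm (single i k) (fpe p 1)) m" for i k
    by (simp add: X_power lookup_single when_def)
  show "coef (mps_of p (reduce_mod p (X 0 ^ r + (\<Sum>i = 1..d. X i ^ 2)))) m = coef (Fpol p d r) m"
    by (simp add: reduce_mod_def fpe_mod lookup_add lookup_sum fpe_add s l Fpol_def coef_sum del: coef_mnm)
qed

lemma series_quotient_hypersurface_mod: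
  fixes d r :: nat
  assumes p: "prime p" and d: "d \<ge> 1" and r: "r \<ge> 2"
  defines "f \<equiv> X 0 ^ r + (\<Sum>i = 1..d. X i ^ 2)"
  shows "series_quotient (hypersurface_mod p d f) p d r
    (\<lambda>a. Idl\<^bsub>psr p d\<^esub> {reduce_mod p f} +>\<^bsub>psr p d\<^esub> of_mps p a)"
proof -
  have p1: "p > 1" and p0: "p > 0" using p prime_gt_1_nat prime_gt_0_nat by auto
  let ?A = "psr p d" and ?f = "reduce_mod p f"
  let ?I = "Idl\<^bsub>?A\<^esub> {?f}"
  interpret A: cring ?A by (rule cring_psr[OF p1])
  have S: "hypersurface_mod p d f = ?A Quot ?I" by (simp add: hypersurface_mod_def Let_def)
  have F: "mps_of p ?f = Fpol p d r" unfolding f_def by (rule mps_of_reduce_mod)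
  have fA: "?f \<in> carrier ?A"
    unfolding carrier_psr[OF p0] F using p0 Fpol_in_Am[OF p0] by (simp add: reduce_mod_def)
  have I: "ideal ?I ?A" by (rule A.genideal_ideal) (use fA in simp)
  interpret I: ideal ?I ?A by (rule I)
  interpret Q: cring "?A Quot ?I" by (rule I.quotient_is_cring[OF A.is_cring])
  interpret h: ring_hom_cring ?A "?A Quot ?I" "(+>\<^bsub>?A\<^esub>) ?I" by (rule I.rcos_ring_hom_cring[OF A.is_cring])
  note iso = ring_iso_of_mps[OF p1, of d, unfolded ring_iso_def ring_hom_def Am_ring_def, simplified]
  note cl = of_mps_closed[OF p0, of _ d]
  show ?thesis unfolding S
  proof (unfold_locales)
    fix a assume a: "a \<in> Am p d"
    show "?I +>\<^bsub>?A\<^esub> of_mps p a \<in> carrier (?A Quot ?I)" using cl[OF a] by simp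
    have "?I +>\<^bsub>?A\<^esub> of_mps p a = \<zero>\<^bsub>?A Quot ?I\<^esub> \<longleftrightarrow> ?I +>\<^bsub>?A\<^esub> of_mps p a = ?I +>\<^bsub>?A\<^esub> \<zero>\<^bsub>?A\<^esub>"
      by simp
    also have "\<dots> \<longleftrightarrow> of_mps p a \<in> ?I"
      using A.quotient_eq_iff_same_a_r_cos[OF I cl[OF a] A.zero_closed] cl[OF a] by (simp add: A.minus_eq)
    also have "\<dots> \<longleftrightarrow> (\<exists>g\<in>carrier ?A. of_mps p a = g \<otimes>\<^bsub>?A\<^esub> ?f)"
      unfolding A.cgenideal_eq_genideal[OF fA, symmetric] cgenideal_def by auto
    also have "\<dots> \<longleftrightarrow> (\<exists>h\<in>Am p d. a = h * Fpol p d r)"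
    proof
      assume "\<exists>g\<in>carrier ?A. of_mps p a = g \<otimes>\<^bsub>?A\<^esub> ?f"
      then obtain g where g: "g \<in> carrier ?A" "of_mps p a = g \<otimes>\<^bsub>?A\<^esub> ?f" by blast
      have "a = mps_of p g * Fpol p d r"
        using psr_mult(2)[OF p1 g(1) fA] mps_of_of_mps[OF p0 a] g(2) F by simp
      moreover have "mps_of p g \<in> Am p d" using g(1) carrier_psr[OF p0] by blast
      ultimately show "\<exists>h\<in>Am p d. a = h * Fpol p d r" by blast
    next
      assume "\<exists>h\<in>Am p d. a = h * Fpol p d r"
      then obtain h where h: "h \<in> Am p d" "a = h * Fpol p d r" by blast
      have "mps_of p (of_mps p h \<otimes>\<^bsub>?A\<^esub> ?f) = a"
        using psr_mult(2)[OF p1 cl[OF h(1)] fA] mps_of_of_mps[OF p0 h(1)] F h(2) by simp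
      then have "of_mps p a = of_mps p h \<otimes>\<^bsub>?A\<^esub> ?f"
        using of_mps_mps_of[OF p0 psr_mult(1)[OF p1 cl[OF h(1)] fA]] by simp
      then show "\<exists>g\<in>carrier ?A. of_mps p a = g \<otimes>\<^bsub>?A\<^esub> ?f" using cl[OF h(1)] by blast
    qed
    finally show "?I +>\<^bsub>?A\<^esub> of_mps p a = \<zero>\<^bsub>?A Quot ?I\<^esub> \<longleftrightarrow> (\<exists>h\<in>Am p d. a = h * Fpol p d r)" .
    fix b assume b: "b \<in> Am p d"
    show "?I +>\<^bsub>?A\<^esub> of_mps p (a + b) = (?I +>\<^bsub>?A\<^esub> of_mps p a) \<oplus>\<^bsub>?A Quot ?I\<^esub> (?I +>\<^bsub>?A\<^esub> of_mps p b)"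
      using iso a b h.hom_add[OF cl[OF a] cl[OF b]] by simp
    show "?I +>\<^bsub>?A\<^esub> of_mps p (a * b) = (?I +>\<^bsub>?A\<^esub> of_mps p a) \<otimes>\<^bsub>?A Quot ?I\<^esub> (?I +>\<^bsub>?A\<^esub> of_mps p b)"
      using iso a b h.hom_mult[OF cl[OF a] cl[OF b]] by simp
  next
    show "?I +>\<^bsub>?A\<^esub> of_mps p (E p) = \<one>\<^bsub>?A Quot ?I\<^esub>" using iso by simp
  next
    fix s assume s: "s \<in> carrier (?A Quot ?I)"
    have "carrier (?A Quot ?I) = (\<Union>g\<in>carrier ?A. {?I +>\<^bsub>?A\<^esub> g})" unfolding FactRing_def A_RCOSETS_def' by simp
    then obtain g where g: "g \<in> carrier ?A" "s = ?I +>\<^bsub>?A\<^esub> g"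
      using s by (metis (no_types, lifting) UN_E singletonD)
    show "\<exists>a\<in>Am p d. ?I +>\<^bsub>?A\<^esub> of_mps p a = s"
    proof
      show "mps_of p g \<in> Am p d" using g(1) carrier_psr[OF p0] by blast
      show "?I +>\<^bsub>?A\<^esub> of_mps p (mps_of p g) = s" using of_mps_mps_of[OF p0 g(1)] g(2) by simp
    qed
  qed (use p d r in auto)
qed

theorem corollary1p3:
  fixes d n :: nat
  assumes "d \<ge> 1" and "n \<ge> 1"
  shows "has_limit_hk_multiplicity d (X 0 ^ (n + 1) + (\<Sum>i = 1..d. X i ^ 2))
           (1 + (real (n + 1) / 2) * (real (N_alt d 2 (n + 1)) / (real (n + 1) ^ d * fact d)))"
proof -
  define r where "r = n + 1"
  have r: "r \<ge> 2" using assms(2) by (simp add: r_def)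
  let ?L = "1 + real r / 2 * (real (N_alt d 2 r) / (real r ^ d * fact d))"
  let ?F = "inf at_top (principal {p::nat. prime p})"
  define c where "c = (\<lambda>p. real r * quad_log_ker p {1..d} p (p div r) / real p ^ d)"
  \<comment> \<open>\<open>lim\<close> makes one function of \<open>p\<close> out of limits whose
    existence is established for primes. It is squeezed between \<open>c p\<close> and
    \<open>c p + 2 r / p\<close>.\<close>
  define h where "h = (\<lambda>p. lim (\<lambda>e. hk_length p d r (p ^ e) / real p ^ (e * d)))"
  have h: "(\<lambda>e. hk_length p d r (p ^ e) / real p ^ (e * d)) \<longlonglongrightarrow> h p"
    "c p \<le> h p" "h p \<le> c p + 2 * real r / real p" if p: "prime p" for p
  proof -
    have "r \<ge> 1" using r by simp
    then obtain l where l: "(\<lambda>e. hk_length p d r (p ^ e) / real p ^ (e * d)) \<longlonglongrightarrow> l"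
      "c p \<le> l" "l \<le> c p + 2 * real r / real p"
      unfolding c_def by (rule hk_length_tendsto[OF p assms(1)])
    have "h p = l" unfolding h_def by (rule limI[OF l(1)])
    with l show "(\<lambda>e. hk_length p d r (p ^ e) / real p ^ (e * d)) \<longlonglongrightarrow> h p"
      "c p \<le> h p" "h p \<le> c p + 2 * real r / real p" by simp_all
  qed
  have "has_hk_multiplicity (hypersurface_mod p d (X 0 ^ r + (\<Sum>i = 1..d. X i ^ 2))) (h p)" if "prime p" for p
    by (rule series_quotient.has_hk_multiplicity_S[OF series_quotient_hypersurface_mod[OF that assms(1) r] h(1)[OF that]])
  then have ev: "\<forall>\<^sub>F p in ?F. has_hk_multiplicity (hypersurface_mod p d (X 0 ^ r + (\<Sum>i = 1..d. X i ^ 2))) (h p)"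
    unfolding eventually_inf_principal by (intro always_eventually) simp
  have c: "(c \<longlongrightarrow> ?L) ?F" unfolding c_def by (rule quad_log_ker_prime_tendsto[OF assms(1) r])
  have "(\<lambda>p::nat. 2 * real r / real p) \<longlonglongrightarrow> 0" by real_asymp
  then have "((\<lambda>p::nat. 2 * real r / real p) \<longlongrightarrow> 0) ?F" by (rule tendsto_mono[OF inf_le1])
  then have c': "((\<lambda>p. c p + 2 * real r / real p) \<longlongrightarrow> ?L) ?F" using tendsto_add[OF c] by fastforce
  have "\<forall>\<^sub>F p in ?F. c p \<le> h p" "\<forall>\<^sub>F p in ?F. h p \<le> c p + 2 * real r / real p"
    unfolding eventually_inf_principal by (rule always_eventually, use h in blast)+
  from tendsto_sandwich[OF this c c'] have "(h \<longlongrightarrow> ?L) ?F" .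
  with ev show ?thesis
    unfolding has_limit_hk_multiplicity_def Let_def r_def[symmetric] by (intro exI[of _ h] conjI)
qed

end
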